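(* For every $\varepsilon>0$ there is a constant $C_\varepsilon$ such that the following holds. Let $P\subset[-1,1]^3$ be a finite set of points and $L\subset\mathcal A_{3,1}$ a finite set of lines, and let $\delta>0$. Then \[ |B(\delta)-B(2\delta)|^2\le C_\varepsilon\,\delta^{-6-\varepsilon}\,\frac{\operatorname{M}_P(\delta)}{|P|}\,\max_{u\in(\delta,1)}\left(\min\{|\theta(L)|_\delta^{1/2}\delta,\ u\}\; u\;\frac{\operatorname{M}_L(\delta\times\delta/u\times 1)}{|L|}\right), \] where $B(w)=B(w;P,L)$.
   Context: Fix $\chi:\mathbb R^3\to[0,1]$ a smooth compactly supported radial bump function with $\chi(x)\ge 1/2$ for $|x|\le 1/2$ and $\chi(x)=0$ for $|x|\ge 2$. For $w>0$ let $\chi_w(x)=w^{-3}\chi(x/w)$ and $\eta_w=\chi_w*\chi_{w/2}$. For finite sets $P$ of points and $L$ of lines in $\mathbb R^3$ define $I(w;P,L)=w^2\sum_{p\in P}\sum_{\ell\in L}\int_\ell \eta_w(x-p)\,dx$ (integration with respect to arc length on $\ell$) and $B(w;P,L)=\frac{I(w;P,L)}{w^2|P||L|}$. $\mathcal A_{3,1}$ is the set of lines in $\mathbb R^3$ meeting the unit ball $B(0,1)$. $\operatorname{M}_P(\delta)$ is the maximum of $|P\cap Q|$ over all cubes $Q$ of side $\delta$. For $u,w\in(0,1]$, $\operatorname{M}_L(u\times w\times 1)$ is the maximum over all boxes $\Pi$ with side lengths $u,w,1$ of the number of $\ell\in L$ with $|\ell\cap\Pi|\ge 1/2$ (length). $\theta(L)\subset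 S^2$ is the set of directions of lines in $L$ and $|\cdot|_\delta$ denotes the $\delta$-covering number. The constant $C_\varepsilon$ may depend on the fixed bump function $\chi$.
   Formalization: The inequality is proved for 0 < δ < 1 rather than all δ > 0, since for δ ≥ 1 the maximum over u in (δ,1) is over the empty set and so undefined (and the bound fails if that maximum is read as 0). *)

theory Defs
  imports "HOL-Analysis.Analysis"
begin

section \<open>The bump function and its dilates\<close>

fun times_cont_diff :: "nat \<Rightarrow> ('a::real_normed_vector \<Rightarrow> 'b::real_normed_vector) \<Rightarrow> bool" where
  "times_cont_diff 0 f \<longleftrightarrow> continuous_on UNIV f"
| "times_cont_diff (Suc k) f \<longleftrightarrow>
     (\<forall>x. f differentiable (at x)) \<and>
     (\<forall>v. times_cont_diff k (\<lambda>x. frechet_derivative f (at x) v))"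

definition smooth :: "('a::real_normed_vector \<Rightarrow> 'b::real_normed_vector) \<Rightarrow> bool" where
  "smooth f \<longleftrightarrow> (\<forall>k. times_cont_diff k f)"

text \<open>Compactness of the support is implied by the last conjunct.\<close>

definition bump :: "(real^3 \<Rightarrow> real) \<Rightarrow> bool" where
  "bump chi \<longleftrightarrow>
     smooth chi \<and>
     (\<forall>x. 0 \<le> chi x \<and> chi x \<le> 1) \<and>
     (\<forall>x y. norm x = norm y \<longrightarrow> chi x = chi y) \<and>
     (\<forall>x. norm x \<le> 1/2 \<longrightarrow> chi x \<ge> 1/2) \<and>
     (\<forall>x. norm x \<ge> 2 \<longrightarrow> chi x = 0)"

definition dilate :: "(real^3 \<Rightarrow> real) \<Rightarrow> real \<Rightarrow> real^3 \<Rightarrow> real" where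
  "dilate chi w x = chi (x /\<^sub>R w) / w ^ 3"

definition convolve :: "(real^3 \<Rightarrow> real) \<Rightarrow> (real^3 \<Rightarrow> real) \<Rightarrow> real^3 \<Rightarrow> real" where
  "convolve f g x = (LINT y|lborel. f y * g (x - y))"

definition eta :: "(real^3 \<Rightarrow> real) \<Rightarrow> real \<Rightarrow> real^3 \<Rightarrow> real" where
  "eta chi w = convolve (dilate chi w) (dilate chi (w/2))"


section \<open>Lines\<close>

definition line_at :: "real^3 \<Rightarrow> real^3 \<Rightarrow> (real^3) set" where
  "line_at a v = range (\<lambda>t. a + t *\<^sub>R v)"

definition lines :: "(real^3) set set" where
  "lines = {line_at a v | a v. norm v = 1}"

definition lines_meeting_unit_ball :: "(real^3) set set" where
  "lines_meeting_unit_ball = {l \<in> lines. l \<inter> cball 0 1 \<noteq> {}}"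

text \<open>Lines carry no orientation, so both unit direction vectors of a line are included.\<close>

definition directions :: "(real^3) set set \<Rightarrow> (real^3) set" where
  "directions L = {v. norm v = 1 \<and> (\<exists>a. line_at a v \<in> L)}"

text \<open>Arc length on a line, as a Borel measure on the whole space: the image of Lebesgue
  measure under a unit speed parametrization. The choice of the latter is immaterial, see
  \<open>arc_length_line_at\<close>.\<close>

definition arc_length :: "(real^3) set \<Rightarrow> (real^3) measure" where
  "arc_length l =
     (let (a, v) = (SOME (a, v). norm v = 1 \<and> l = line_at a v)
      in distr lborel borel (\<lambda>t. a + t *\<^sub>R v))"

lemma distr_line_at_unique:
  fixes a b u v :: "real^3"
  assumes v: "norm v = 1" and u: "norm u = 1" and eq: "line_at b u = line_at a v"
  shows "distr lborel borel (\<lambda>t. b + t *\<^sub>R u) = distr lborel borel (\<lambda>t. a + t *\<^sub>R v)"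
proof -
  have "b + t *\<^sub>R u \<in> line_at a v" for t
    using eq by (auto simp: line_at_def)
  then have ex: "\<exists>s. b + t *\<^sub>R u = a + s *\<^sub>R v" for t
    by (fastforce simp: line_at_def)
  obtain s where s: "b = a + s *\<^sub>R v"
    using ex[of 0] by auto
  obtain s' where s': "b + u = a + s' *\<^sub>R v"
    using ex[of 1] by auto
  define c where "c = s' - s"
  have uc: "u = c *\<^sub>R v"
    using s s' by (simp add: c_def algebra_simps)
  have c: "\<bar>c\<bar> = 1"
    using u v uc by simp
  have "distr lborel borel (\<lambda>t. b + t *\<^sub>R u)
      = distr lborel borel ((\<lambda>t. a + t *\<^sub>R v) \<circ> (\<lambda>t. s + c * t))"
    by (rule distr_cong) (auto simp: s uc algebra_simps)
  also have "\<dots> = distr (distr lborel borel (\<lambda>t. s + c * t)) borel (\<lambda>t. a + t *\<^sub>R v)"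
    by (rule distr_distr[symmetric]) auto
  also have "distr lborel borel (\<lambda>t. s + c * t) = lborel"
    using lborel_real_affine[of c s] c by (simp add: density_1 flip: one_ennreal_def)
  finally show ?thesis .
qed

lemma arc_length_line_at:
  assumes "norm v = 1"
  shows "arc_length (line_at a v) = distr lborel borel (\<lambda>t. a + t *\<^sub>R v)"
proof -
  obtain b u where bu: "(SOME (b, u). norm u = 1 \<and> line_at a v = line_at b u) = (b, u)"
    by fastforce
  have u: "norm u = 1 \<and> line_at a v = line_at b u"
    using someI[of "\<lambda>(b, u). norm u = 1 \<and> line_at a v = line_at b u" "(a, v)"] assms
    by (simp add: bu)
  then show ?thesis
    using distr_line_at_unique[OF assms, of u b] bu by (auto simp: arc_length_def)
qed


section \<open>Incidences and concentration\<close>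

definition incidences ::
    "(real^3 \<Rightarrow> real) \<Rightarrow> real \<Rightarrow> (real^3) set \<Rightarrow> (real^3) set set \<Rightarrow> real" where
  "incidences chi w P L =
     w\<^sup>2 * (\<Sum>p\<in>P. \<Sum>l\<in>L. LINT x|arc_length l. eta chi w (x - p))"

definition normalized_incidences ::
    "(real^3 \<Rightarrow> real) \<Rightarrow> real \<Rightarrow> (real^3) set \<Rightarrow> (real^3) set set \<Rightarrow> real" where
  "normalized_incidences chi w P L =
     incidences chi w P L / (w\<^sup>2 * real (card P) * real (card L))"

text \<open>Closed boxes with the given side lengths, in arbitrary position and orientation.\<close>

definition boxes :: "real \<Rightarrow> real \<Rightarrow> real \<Rightarrow> (real^3) set set" where
  "boxes a b c =
     {(\<lambda>x. p + f x) ` cbox 0 (vector [a, b, c] :: real^3) | p f. orthogonal_transformation f}"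

definition M_points :: "(real^3) set \<Rightarrow> real \<Rightarrow> nat" where
  "M_points P d = Max ((\<lambda>Q. card (P \<inter> Q)) ` boxes d d d)"

definition M_lines :: "(real^3) set set \<Rightarrow> real \<Rightarrow> real \<Rightarrow> nat" where
  "M_lines L u w =
     Max ((\<lambda>B. card {l \<in> L. measure (arc_length l) B \<ge> 1/2}) ` boxes u w 1)"

definition covering_number :: "real \<Rightarrow> 'a::metric_space set \<Rightarrow> nat" where
  "covering_number d A =
     (LEAST n. \<exists>C. finite C \<and> card C = n \<and> A \<subseteq> (\<Union>c\<in>C. cball c d))"

end

theory Submission
  imports Defs "HOL-Probability.Probability"
begin

text \<open>
  The difference of the two incidence counts is the pairing of a sum of bumps at the points with a
  function whose Fourier transform is the product of a frequency cut-off at scale 1/d and the sum X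
  of the Fourier transforms of the lines. By Cauchy-Schwarz the points contribute their
  concentration, and by Plancherel it remains to bound the energy of X on dyadic shells of radius
  r up to 1/d. There each line lives in the slab of frequencies orthogonal to its direction. At a
  frequency direction q only the line directions close to the great circle orthogonal to q matter.
  They are sorted according to the scale at which the set of frequencies incident to them, a
  great circle, stops being doubling along a tree of nested caps. Two caps at distance g force the
  common incident directions into a small set, so that for at least half of the caps q the number
  of relevant direction classes at each scale is at most the square root of the covering number,
  and always at most the length of the great circle in units of the class size. The remaining
  caps are treated by halving again. Within one class, a Gaussian-weighted Schur test reduces the
  energy to counting lines in a plank, which is the M-lines factor of the estimate.
\<close>

section \<open>Gaussians and Fubini\<close>

text \<open>The two smoothing kernels at d and 2 d share the convolution factor
  \<open>dilate chi d\<close>. What distinguishes them is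
  \<open>dilate chi (d / 2) - dilate chi (2 * d)\<close>, whose Fourier transform vanishes to first
  order at the origin, so on the shell of radius \<rho> its square gains (\<rho> d)^2. This pays
  exactly for counting the lines of a plank of thickness 1/\<rho> with boxes of thickness d. The
  exponent -6 splits evenly: d^-3 from the overlaps of the bumps at the points, d^-3 from the energy
  of the lines.

  The obstacle is to lose only the square root of the covering number. Cauchy-Schwarz over the
  direction classes at q costs their number, which can be large for exceptional q, and these cannot
  be discarded. They are handled as a family of their own; since each round at least halves the
  family, the price is a logarithm.

  The tree has a depth J depending on \<epsilon> alone and branching at most 4 d^(-\<epsilon>/18).
  Hence a factor 2 lost at every level amounts to a constant, and being off by one level amounts to
  a small power of 1/d.\<close>

lemma cis_measurable [measurable]: "cis \<in> borel_measurable borel"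
  by (intro borel_measurable_continuous_onI continuous_intros)

lemma lborel_product_integral:
  fixes g :: "'a::euclidean_space \<Rightarrow> real \<Rightarrow> complex"
  assumes g: "\<And>b. b \<in> Basis \<Longrightarrow> integrable lborel (g b)"
  shows "integrable lborel (\<lambda>x::'a. \<Prod>b\<in>Basis. g b (x \<bullet> b))"
    and "(LINT x|lborel. (\<Prod>b\<in>Basis. g b (x \<bullet> b))) = (\<Prod>b\<in>(Basis::'a set). (LINT s|lborel. g b s))"
proof -
  interpret product_sigma_finite "\<lambda>b::'a. lborel :: real measure" ..
  have [measurable]: "\<And>b. b \<in> Basis \<Longrightarrow> g b \<in> borel_measurable borel"
    using borel_measurable_integrable[OF g] by simp
  have sel: "(\<Sum>b\<in>Basis. f b *\<^sub>R b) \<bullet> c = f c" if "c \<in> Basis" for f and c :: 'a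
    using that by (simp add: inner_sum_left inner_Basis if_distrib sum.delta cong: if_cong)
  show "integrable lborel (\<lambda>x::'a. \<Prod>b\<in>Basis. g b (x \<bullet> b))"
    unfolding lborel_eq[where 'a='a]
    by (subst integrable_distr_eq)
       (auto simp: sel intro!: product_integrable_prod g)
  show "(LINT x|lborel. (\<Prod>b\<in>Basis. g b (x \<bullet> b))) = (\<Prod>b\<in>(Basis::'a set). (LINT s|lborel. g b s))"
    unfolding lborel_eq[where 'a='a]
    by (subst integral_distr) (auto simp: sel product_integral_prod g simp flip: lborel_eq)
qed

text \<open>This is the characteristic function of the standard normal law, freed of its normalising
  factor.\<close>

lemma gaussian_fourier_std:
  "integrable lborel (\<lambda>s::real. complex_of_real (exp (- s\<^sup>2 / 2)) * cis (s * y))"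
  "(LINT s|lborel. complex_of_real (exp (- s\<^sup>2 / 2)) * cis (s * y)) = sqrt (2 * pi) * exp (- y\<^sup>2 / 2)"
proof -
  have dens: "std_normal_density s = exp (- s\<^sup>2 / 2) / sqrt (2 * pi)" for s
    by (simp add: std_normal_density_def)
  have "integrable lborel std_normal_density" by simp
  then have "integrable lborel (\<lambda>s. sqrt (2 * pi) * std_normal_density s)" by (rule integrable_mult_right)
  then have int: "integrable lborel (\<lambda>s::real. exp (- s\<^sup>2 / 2))" by (simp add: dens)
  show "integrable lborel (\<lambda>s::real. complex_of_real (exp (- s\<^sup>2 / 2)) * cis (s * y))"
    by (rule Bochner_Integration.integrable_bound[OF int]) (auto simp: norm_mult)
  have "char std_normal_distribution y = (LINT s|lborel. std_normal_density s *\<^sub>R iexp (y * s))"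
    unfolding char_def by (subst integral_density) (auto simp: normal_density_nonneg)
  also have "\<dots> = (LINT s|lborel. (1 / sqrt (2 * pi)) *\<^sub>R (complex_of_real (exp (- s\<^sup>2 / 2)) * cis (s * y)))"
    by (simp add: dens cis_conv_exp scaleR_conv_of_real field_simps)
  also have "\<dots> = (1 / sqrt (2 * pi)) *\<^sub>R (LINT s|lborel. complex_of_real (exp (- s\<^sup>2 / 2)) * cis (s * y))"
    by (rule integral_scaleR_right)
  finally have "(1 / sqrt (2 * pi)) *\<^sub>R (LINT s|lborel. complex_of_real (exp (- s\<^sup>2 / 2)) * cis (s * y))
      = exp (- y\<^sup>2 / 2)"
    by (simp add: char_std_normal_distribution)
  then show "(LINT s|lborel. complex_of_real (exp (- s\<^sup>2 / 2)) * cis (s * y)) = sqrt (2 * pi) * exp (- y\<^sup>2 / 2)"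
    by (simp add: scaleR_conv_of_real field_simps)
qed

lemma gaussian_fourier_real:
  assumes "A > 0"
  shows "integrable lborel (\<lambda>s::real. complex_of_real (exp (- (s / A)\<^sup>2 / 2)) * cis (s * y))"
    and "(LINT s|lborel. complex_of_real (exp (- (s / A)\<^sup>2 / 2)) * cis (s * y))
      = sqrt (2 * pi) * A * exp (- (A * y)\<^sup>2 / 2)"
proof -
  define h where "h = (\<lambda>s::real. complex_of_real (exp (- (s / A)\<^sup>2 / 2)) * cis (s * y))"
  have h: "h (0 + A * s) = complex_of_real (exp (- s\<^sup>2 / 2)) * cis (s * (A * y))" for s
    using assms by (simp add: h_def algebra_simps)
  have "integrable lborel (\<lambda>s. h (0 + A * s))"
    unfolding h by (rule gaussian_fourier_std)
  then show "integrable lborel (\<lambda>s::real. complex_of_real (exp (- (s / A)\<^sup>2 / 2)) * cis (s * y))"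
    using lborel_integrable_real_affine_iff[of A h 0] assms by (simp add: h_def)
  have "(LINT s|lborel. h s) = \<bar>A\<bar> *\<^sub>R (LINT s|lborel. h (0 + A * s))"
    using assms by (intro lborel_integral_real_affine) auto
  also have "\<dots> = sqrt (2 * pi) * A * exp (- (A * y)\<^sup>2 / 2)"
    unfolding h gaussian_fourier_std using assms by (simp add: scaleR_conv_of_real)
  finally show "(LINT s|lborel. complex_of_real (exp (- (s / A)\<^sup>2 / 2)) * cis (s * y))
      = sqrt (2 * pi) * A * exp (- (A * y)\<^sup>2 / 2)"
    by (simp add: h_def)
qed

lemma cis_sum: "finite S \<Longrightarrow> cis (\<Sum>x\<in>S. f x) = (\<Prod>x\<in>S. cis (f x))"
  by (induction S rule: finite_induct) (auto simp flip: cis_mult)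

lemma gaussian_fourier_basis:
  fixes x :: "'a::euclidean_space"
  assumes A: "\<And>b. b \<in> Basis \<Longrightarrow> A b > 0"
  shows "integrable lborel (\<lambda>\<xi>::'a. complex_of_real (exp (- (\<Sum>b\<in>Basis. ((\<xi> \<bullet> b) / A b)\<^sup>2) / 2)) * cis (\<xi> \<bullet> x))"
    and "(LINT \<xi>|lborel. complex_of_real (exp (- (\<Sum>b\<in>Basis. ((\<xi> \<bullet> b) / A b)\<^sup>2) / 2)) * cis (\<xi> \<bullet> x))
      = sqrt (2 * pi) ^ DIM('a) * (\<Prod>b\<in>Basis. A b) * exp (- (\<Sum>b\<in>Basis. (A b * (x \<bullet> b))\<^sup>2) / 2)"
proof -
  have eq: "complex_of_real (exp (- (\<Sum>b\<in>Basis. ((\<xi> \<bullet> b) / A b)\<^sup>2) / 2)) * cis (\<xi> \<bullet> x)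
    = (\<Prod>b\<in>Basis. complex_of_real (exp (- ((\<xi> \<bullet> b) / A b)\<^sup>2 / 2)) * cis ((\<xi> \<bullet> b) * (x \<bullet> b)))" for \<xi> :: 'a
  proof -
    have "\<xi> \<bullet> x = (\<Sum>b\<in>Basis. (\<xi> \<bullet> b) * (x \<bullet> b))" by (rule euclidean_inner)
    moreover have "- (\<Sum>b\<in>Basis. ((\<xi> \<bullet> b) / A b)\<^sup>2) / 2 = (\<Sum>b\<in>Basis. - ((\<xi> \<bullet> b) / A b)\<^sup>2 / 2)"
      by (simp add: sum_negf sum_divide_distrib)
    ultimately show ?thesis
      by (simp add: exp_sum cis_sum prod.distrib)
  qed
  have eq2: "exp (- (\<Sum>b\<in>Basis. (A b * (x \<bullet> b))\<^sup>2) / 2) = (\<Prod>b\<in>Basis. exp (- (A b * (x \<bullet> b))\<^sup>2 / 2))"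
    by (simp add: exp_sum[symmetric] sum_negf sum_divide_distrib)
  show "integrable lborel (\<lambda>\<xi>::'a. complex_of_real (exp (- (\<Sum>b\<in>Basis. ((\<xi> \<bullet> b) / A b)\<^sup>2) / 2)) * cis (\<xi> \<bullet> x))"
    unfolding eq by (intro lborel_product_integral gaussian_fourier_real A)
  show "(LINT \<xi>|lborel. complex_of_real (exp (- (\<Sum>b\<in>Basis. ((\<xi> \<bullet> b) / A b)\<^sup>2) / 2)) * cis (\<xi> \<bullet> x))
      = sqrt (2 * pi) ^ DIM('a) * (\<Prod>b\<in>Basis. A b) * exp (- (\<Sum>b\<in>Basis. (A b * (x \<bullet> b))\<^sup>2) / 2)"
  proof -
    have "(LINT \<xi>|lborel. complex_of_real (exp (- (\<Sum>b\<in>Basis. ((\<xi> \<bullet> b) / A b)\<^sup>2) / 2)) * cis (\<xi> \<bullet> x))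
      = (\<Prod>b\<in>(Basis::'a set). (LINT s|lborel. complex_of_real (exp (- (s / A b)\<^sup>2 / 2)) * cis (s * (x \<bullet> b))))"
      unfolding eq by (intro lborel_product_integral gaussian_fourier_real A)
    also have "\<dots> = (\<Prod>b\<in>(Basis::'a set). complex_of_real (sqrt (2 * pi) * A b * exp (- (A b * (x \<bullet> b))\<^sup>2 / 2)))"
      by (intro prod.cong refl gaussian_fourier_real A)
    also have "\<dots> = complex_of_real (\<Prod>b\<in>(Basis::'a set). sqrt (2 * pi) * A b * exp (- (A b * (x \<bullet> b))\<^sup>2 / 2))"
      by (rule of_real_prod[symmetric])
    also have "(\<Prod>b\<in>(Basis::'a set). sqrt (2 * pi) * A b * exp (- (A b * (x \<bullet> b))\<^sup>2 / 2))
      = sqrt (2 * pi) ^ DIM('a) * (\<Prod>b\<in>Basis. A b) * exp (- (\<Sum>b\<in>Basis. (A b * (x \<bullet> b))\<^sup>2) / 2)"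
      unfolding eq2 by (simp only: prod.distrib prod_constant)
    finally show ?thesis .
  qed
qed

text \<open>Orthogonal images preserve the measure of sets in \<open>lmeasurable\<close>. The
  preimage of an open box is open, hence Borel, so passing to the completion does not change its
  measure, and the values on boxes determine \<open>lborel\<close>.\<close>

lemma lborel_distr_orthogonal:
  fixes f :: "real^3 \<Rightarrow> real^3"
  assumes f: "orthogonal_transformation f"
  shows "distr lborel borel f = lborel"
proof (rule lborel_eqI[symmetric])
  have cf: "continuous_on UNIV f"
    using f by (intro linear_continuous_on) (simp add: orthogonal_transformation_def linear_linear)
  have mf [measurable]: "f \<in> borel_measurable borel"
    by (rule borel_measurable_continuous_onI[OF cf])
  fix l u :: "real^3" assume le: "\<And>b. b \<in> Basis \<Longrightarrow> l \<bullet> b \<le> u \<bullet> b"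
  have bij: "bij f" by (rule orthogonal_transformation_bij[OF f])
  have inv: "orthogonal_transformation (inv f)" by (rule orthogonal_transformation_inv[OF f])
  have vim: "f -` box l u = inv f ` box l u"
    by (rule bij_vimage_eq_inv_image[OF bij])
  have op: "open (f -` box l u)"
    using cf by (intro open_vimage) auto
  have meas: "measure lebesgue (inv f ` box l u) = measure lebesgue (box l u)"
    by (rule measure_orthogonal_image[OF inv]) auto
  have lm: "inv f ` box l u \<in> lmeasurable"
    by (rule measurable_orthogonal_image[OF inv]) auto
  have "emeasure (distr lborel borel f) (box l u) = emeasure lborel (f -` box l u)"
    by (subst emeasure_distr) auto
  also have "\<dots> = emeasure lebesgue (inv f ` box l u)"
    using emeasure_completion[of "f -` box l u" lborel] op vim by simp
  also have "\<dots> = emeasure lebesgue (box l u)"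
    using emeasure_eq_measure2[OF lm] emeasure_eq_measure2[of "box l u" lebesgue] meas by simp
  also have "\<dots> = emeasure lborel (box l u)"
    by simp
  also have "\<dots> = (\<Prod>b\<in>Basis. (u - l) \<bullet> b)"
    by (rule emeasure_lborel_box[OF le])
  finally show "emeasure (distr lborel borel f) (box l u) = (\<Prod>b\<in>Basis. (u - l) \<bullet> b)" .
qed simp

lemma lborel_integral_orthogonal:
  fixes f :: "real^3 \<Rightarrow> real^3" and h :: "real^3 \<Rightarrow> 'b::{banach, second_countable_topology}"
  assumes f: "orthogonal_transformation f" and h: "h \<in> borel_measurable borel"
  shows "integrable lborel (\<lambda>x. h (f x)) \<longleftrightarrow> integrable lborel h"
    and "(LINT x|lborel. h (f x)) = (LINT x|lborel. h x)"
proof -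
  have "continuous_on UNIV f"
    using f by (intro linear_continuous_on) (simp add: orthogonal_transformation_def linear_linear)
  then have mf [measurable]: "f \<in> borel_measurable borel"
    by (rule borel_measurable_continuous_onI)
  show "integrable lborel (\<lambda>x. h (f x)) \<longleftrightarrow> integrable lborel h"
    using integrable_distr_eq[of f lborel borel h] h lborel_distr_orthogonal[OF f] by simp
  show "(LINT x|lborel. h (f x)) = (LINT x|lborel. h x)"
    using integral_distr[of f lborel borel h] h lborel_distr_orthogonal[OF f] by simp
qed

text \<open>The squared norm after scaling by A along the unit vector \<omega> and by B across it,
  written without choosing a frame. The Gaussian with weights 1/A and 1/B serves as a majorant, up
  to a constant, of a frequency region of length A along \<omega> and width B across; its transform
  is concentrated on the dual region.\<close>

definition axial_form :: "real^3 \<Rightarrow> real \<Rightarrow> real \<Rightarrow> real^3 \<Rightarrow> real" where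
  "axial_form \<omega> A B x = (A * (x \<bullet> \<omega>))\<^sup>2 + B\<^sup>2 * ((norm x)\<^sup>2 - (x \<bullet> \<omega>)\<^sup>2)"

lemma axial_gaussian_fourier:
  fixes \<omega> x :: "real^3"
  assumes \<omega>: "norm \<omega> = 1" and A: "A > 0" and B: "B > 0"
  shows "integrable lborel (\<lambda>\<xi>. complex_of_real (exp (- axial_form \<omega> (1 / A) (1 / B) \<xi> / 2)) * cis (\<xi> \<bullet> x))"
    and "(LINT \<xi>|lborel. complex_of_real (exp (- axial_form \<omega> (1 / A) (1 / B) \<xi> / 2)) * cis (\<xi> \<bullet> x))
      = sqrt (2 * pi) ^ 3 * (A * B\<^sup>2) * exp (- axial_form \<omega> A B x / 2)"
proof -
  define e where "e = (axis 1 1 :: real^3)"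
  have eB: "e \<in> Basis" by (auto simp: e_def Basis_vec_def)
  \<comment> \<open>A rotation taking e to \<omega> makes the form diagonal in the standard basis,
    where the product formula applies.\<close>
  obtain f where f: "orthogonal_transformation f" and fe: "f e = \<omega>"
    using orthogonal_transformation_exists_1[of e \<omega>] \<omega> by (auto simp: e_def norm_axis_1)
  define y where "y = inv f x"
  have fy: "f y = x"
    using orthogonal_transformation_surj[OF f] by (simp add: y_def surj_f_inv_f)
  have in_f: "f a \<bullet> f c = a \<bullet> c" for a c
    using f by (simp add: orthogonal_transformation_def)
  have no_f: "norm (f a) = norm a" for a
    using f by (simp add: orthogonal_transformation_norm)
  define R where "R = (\<lambda>b. if b = e then A else B)"
  have Rpos: "R b > 0" for b using A B by (simp add: R_def)
  have split: "(\<Sum>b\<in>Basis. (r b * (a \<bullet> b))\<^sup>2) = (p * (a \<bullet> e))\<^sup>2 + q\<^sup>2 * ((norm a)\<^sup>2 - (a \<bullet> e)\<^sup>2)"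
    if "r = (\<lambda>b. if b = e then p else q)" for r p q and a :: "real^3"
  proof -
    have "(norm a)\<^sup>2 = (\<Sum>b\<in>Basis. (a \<bullet> b)\<^sup>2)"
      by (subst norm_eq_sqrt_inner, subst euclidean_inner) (simp add: power2_eq_square sum_nonneg)
    also have "\<dots> = (a \<bullet> e)\<^sup>2 + (\<Sum>b\<in>Basis - {e}. (a \<bullet> b)\<^sup>2)"
      by (rule sum.remove[OF finite_Basis eB])
    finally have 1: "(\<Sum>b\<in>Basis - {e}. (a \<bullet> b)\<^sup>2) = (norm a)\<^sup>2 - (a \<bullet> e)\<^sup>2" by simp
    have "(\<Sum>b\<in>Basis. (r b * (a \<bullet> b))\<^sup>2) = (r e * (a \<bullet> e))\<^sup>2 + (\<Sum>b\<in>Basis - {e}. (r b * (a \<bullet> b))\<^sup>2)"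
      by (rule sum.remove[OF finite_Basis eB])
    also have "(\<Sum>b\<in>Basis - {e}. (r b * (a \<bullet> b))\<^sup>2) = (\<Sum>b\<in>Basis - {e}. q\<^sup>2 * (a \<bullet> b)\<^sup>2)"
      by (intro sum.cong) (auto simp: that power_mult_distrib)
    finally show ?thesis by (simp add: that 1 flip: sum_distrib_left)
  qed
  have inv_R: "(\<lambda>b. 1 / R b) = (\<lambda>b. if b = e then 1 / A else 1 / B)" by (auto simp: R_def)
  define h where "h = (\<lambda>\<xi>. complex_of_real (exp (- axial_form \<omega> (1 / A) (1 / B) \<xi> / 2)) * cis (\<xi> \<bullet> x))"
  have hm: "h \<in> borel_measurable borel"
    unfolding h_def axial_form_def
    by (intro borel_measurable_continuous_onI continuous_intros) auto
  have hf: "h (f \<zeta>) = complex_of_real (exp (- (\<Sum>b\<in>Basis. ((\<zeta> \<bullet> b) / R b)\<^sup>2) / 2)) * cis (\<zeta> \<bullet> y)" for \<zeta>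
  proof -
    have "axial_form \<omega> (1 / A) (1 / B) (f \<zeta>) = (\<Sum>b\<in>Basis. (1 / R b * (\<zeta> \<bullet> b))\<^sup>2)"
      unfolding split[OF inv_R] axial_form_def by (simp add: no_f in_f flip: fe)
    then show ?thesis by (simp add: h_def in_f flip: fy)
  qed
  have "integrable lborel (\<lambda>\<zeta>. h (f \<zeta>))"
    unfolding hf by (rule gaussian_fourier_basis) (rule Rpos)
  then show "integrable lborel (\<lambda>\<xi>. complex_of_real (exp (- axial_form \<omega> (1 / A) (1 / B) \<xi> / 2)) * cis (\<xi> \<bullet> x))"
    using lborel_integral_orthogonal(1)[OF f hm] by (simp add: h_def)
  have "(\<Prod>b\<in>Basis. R b) = R e * (\<Prod>b\<in>Basis - {e}. R b)"
    by (rule prod.remove[OF finite_Basis eB])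
  also have "(\<Prod>b\<in>Basis - {e}. R b) = (\<Prod>b\<in>Basis - {e}. B)"
    by (intro prod.cong) (auto simp: R_def)
  also have "\<dots> = B\<^sup>2" using eB by simp
  finally have prodR: "(\<Prod>b\<in>Basis. R b) = A * B\<^sup>2" by (simp add: R_def)
  have "axial_form \<omega> A B (f y) = (\<Sum>b\<in>Basis. (R b * (y \<bullet> b))\<^sup>2)"
    unfolding split[OF R_def] axial_form_def by (simp add: no_f in_f flip: fe)
  then have ax: "(\<Sum>b\<in>Basis. (R b * (y \<bullet> b))\<^sup>2) = axial_form \<omega> A B x" by (simp add: fy)
  have "(LINT \<xi>|lborel. h \<xi>) = (LINT \<zeta>|lborel. h (f \<zeta>))"
    by (rule lborel_integral_orthogonal(2)[OF f hm, symmetric])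
  also have "\<dots> = sqrt (2 * pi) ^ DIM(real^3) * (\<Prod>b\<in>Basis. R b) * exp (- (\<Sum>b\<in>Basis. (R b * (y \<bullet> b))\<^sup>2) / 2)"
    unfolding hf by (rule gaussian_fourier_basis) (rule Rpos)
  finally show "(LINT \<xi>|lborel. complex_of_real (exp (- axial_form \<omega> (1 / A) (1 / B) \<xi> / 2)) * cis (\<xi> \<bullet> x))
      = sqrt (2 * pi) ^ 3 * (A * B\<^sup>2) * exp (- axial_form \<omega> A B x / 2)"
    by (simp add: h_def prodR ax)
qed

lemma integrable_lborel_mult:
  fixes f :: "'a::euclidean_space \<Rightarrow> real" and g :: "'b::euclidean_space \<Rightarrow> real"
  assumes f: "integrable lborel f" and g: "integrable lborel g"
  shows "integrable (lborel \<Otimes>\<^sub>M lborel) (\<lambda>(x, y). f x * g y)"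
proof (rule lborel_pair.Fubini_integrable)
  have [measurable]: "f \<in> borel_measurable borel" "g \<in> borel_measurable borel"
    using assms by (auto dest: borel_measurable_integrable)
  show "(\<lambda>(x, y). f x * g y) \<in> borel_measurable (lborel \<Otimes>\<^sub>M lborel)" by measurable
  have "(\<lambda>x. LINT y|lborel. norm (case (x, y) of (x, y) \<Rightarrow> f x * g y)) = (\<lambda>x. norm (f x) * (LINT y|lborel. norm (g y)))"
    by (auto simp: abs_mult)
  then show "integrable lborel (\<lambda>x. LINT y|lborel. norm (case (x, y) of (x, y) \<Rightarrow> f x * g y))"
    using f by simp
  show "AE x in lborel. integrable lborel (\<lambda>y. case (x, y) of (x, y) \<Rightarrow> f x * g y)"
    using g by simp
qed

text \<open>Exchange of two absolutely convergent integrals. A complex g allows the lemma to be used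
  twice in \<open>fourier_bilinear\<close>; there \<gamma> will be the identity or the
  parametrization of a line.\<close>

lemma fourier_swap:
  fixes f :: "'a::euclidean_space \<Rightarrow> real" and \<gamma> :: "'a \<Rightarrow> 'c::euclidean_space" and g :: "'c \<Rightarrow> complex"
  assumes f: "integrable lborel f" and g: "integrable lborel g"
    and [measurable]: "\<gamma> \<in> borel_measurable borel"
  shows "(LINT \<xi>|lborel. g \<xi> * (LINT s|lborel. complex_of_real (f s) * cis (\<xi> \<bullet> \<gamma> s)))
    = (LINT s|lborel. complex_of_real (f s) * (LINT \<xi>|lborel. g \<xi> * cis (\<xi> \<bullet> \<gamma> s)))"
    and "integrable lborel (\<lambda>\<xi>. g \<xi> * (LINT s|lborel. complex_of_real (f s) * cis (\<xi> \<bullet> \<gamma> s)))"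
proof -
  have [measurable]: "f \<in> borel_measurable borel" "g \<in> borel_measurable borel"
    using assms by (auto dest: borel_measurable_integrable)
  have int: "integrable (lborel \<Otimes>\<^sub>M lborel) (\<lambda>(\<xi>, s). g \<xi> * (complex_of_real (f s) * cis (\<xi> \<bullet> \<gamma> s)))"
  proof (rule Bochner_Integration.integrable_bound)
    show "integrable (lborel \<Otimes>\<^sub>M lborel) (\<lambda>(\<xi>, s). norm (g \<xi>) * norm (f s))"
      using f g by (intro integrable_lborel_mult) auto
  qed (auto simp: norm_mult)
  have "(LINT \<xi>|lborel. g \<xi> * (LINT s|lborel. complex_of_real (f s) * cis (\<xi> \<bullet> \<gamma> s)))
    = (LINT \<xi>|lborel. (LINT s|lborel. g \<xi> * (complex_of_real (f s) * cis (\<xi> \<bullet> \<gamma> s))))"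
    by simp
  also have "\<dots> = (LINT s|lborel. (LINT \<xi>|lborel. g \<xi> * (complex_of_real (f s) * cis (\<xi> \<bullet> \<gamma> s))))"
    by (rule lborel_pair.Fubini_integral[OF int, symmetric])
  also have "\<dots> = (LINT s|lborel. (LINT \<xi>|lborel. complex_of_real (f s) * (g \<xi> * cis (\<xi> \<bullet> \<gamma> s))))"
    by (simp add: algebra_simps)
  finally show "(LINT \<xi>|lborel. g \<xi> * (LINT s|lborel. complex_of_real (f s) * cis (\<xi> \<bullet> \<gamma> s)))
    = (LINT s|lborel. complex_of_real (f s) * (LINT \<xi>|lborel. g \<xi> * cis (\<xi> \<bullet> \<gamma> s)))"
    by simp
  show "integrable lborel (\<lambda>\<xi>. g \<xi> * (LINT s|lborel. complex_of_real (f s) * cis (\<xi> \<bullet> \<gamma> s)))"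
    using lborel_pair.integrable_fst'[OF int] by simp
qed

text \<open>Turns a weighted inner product of two oscillatory integrals in frequency into a double
  integral in space against the transform of the weight, which is explicit for Gaussians. The
  conjugate is absorbed by changing the sign of \<kappa>.\<close>

lemma fourier_bilinear:
  fixes f :: "'a::euclidean_space \<Rightarrow> real" and h :: "'b::euclidean_space \<Rightarrow> real" and g :: "'c::euclidean_space \<Rightarrow> real"
  assumes f: "integrable lborel f" and h: "integrable lborel h" and g: "integrable lborel g"
    and [measurable]: "\<gamma> \<in> borel_measurable borel" "\<kappa> \<in> borel_measurable borel"
  shows "(LINT \<xi>|lborel. complex_of_real (g \<xi>) * (LINT s|lborel. complex_of_real (f s) * cis (\<xi> \<bullet> \<gamma> s))
        * cnj (LINT s|lborel. complex_of_real (h s) * cis (\<xi> \<bullet> \<kappa> s)))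
    = (LINT s|lborel. complex_of_real (f s) * (LINT t|lborel. complex_of_real (h t) *
        (LINT \<xi>|lborel. complex_of_real (g \<xi>) * cis (\<xi> \<bullet> (\<gamma> s - \<kappa> t)))))"
    and "integrable lborel (\<lambda>\<xi>. complex_of_real (g \<xi>) * (LINT s|lborel. complex_of_real (f s) * cis (\<xi> \<bullet> \<gamma> s))
        * cnj (LINT s|lborel. complex_of_real (h s) * cis (\<xi> \<bullet> \<kappa> s)))"
proof -
  have [measurable]: "f \<in> borel_measurable borel" "g \<in> borel_measurable borel" "h \<in> borel_measurable borel"
    using assms by (auto dest: borel_measurable_integrable)
  have cnjH: "cnj (LINT s|lborel. complex_of_real (h s) * cis (\<xi> \<bullet> \<kappa> s))
      = (LINT s|lborel. complex_of_real (h s) * cis (\<xi> \<bullet> (- \<kappa> s)))" for \<xi>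
    unfolding Bochner_Integration.integral_cnj[symmetric] by (simp add: cis_cnj)
  define gH where "gH = (\<lambda>\<xi>. complex_of_real (g \<xi>) * (LINT s|lborel. complex_of_real (h s) * cis (\<xi> \<bullet> (- \<kappa> s))))"
  have int_gH: "integrable lborel gH"
    unfolding gH_def by (rule fourier_swap(2)[OF h _]) (use g in auto)
  have eq: "complex_of_real (g \<xi>) * (LINT s|lborel. complex_of_real (f s) * cis (\<xi> \<bullet> \<gamma> s))
        * cnj (LINT s|lborel. complex_of_real (h s) * cis (\<xi> \<bullet> \<kappa> s))
     = gH \<xi> * (LINT s|lborel. complex_of_real (f s) * cis (\<xi> \<bullet> \<gamma> s))" for \<xi>
    unfolding gH_def cnjH by (simp only: mult_ac)
  show "integrable lborel (\<lambda>\<xi>. complex_of_real (g \<xi>) * (LINT s|lborel. complex_of_real (f s) * cis (\<xi> \<bullet> \<gamma> s))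
        * cnj (LINT s|lborel. complex_of_real (h s) * cis (\<xi> \<bullet> \<kappa> s)))"
    unfolding eq by (rule fourier_swap(2)[OF f int_gH]) measurable
  have inner: "(LINT \<xi>|lborel. gH \<xi> * cis (\<xi> \<bullet> \<gamma> s)) = (LINT t|lborel. complex_of_real (h t) *
        (LINT \<xi>|lborel. complex_of_real (g \<xi>) * cis (\<xi> \<bullet> (\<gamma> s - \<kappa> t))))" for s
  proof -
    have i: "integrable lborel (\<lambda>\<xi>. complex_of_real (g \<xi>) * cis (\<xi> \<bullet> \<gamma> s))"
      by (rule Bochner_Integration.integrable_bound[OF g]) (auto simp: norm_mult)
    have "(LINT \<xi>|lborel. gH \<xi> * cis (\<xi> \<bullet> \<gamma> s))
      = (LINT \<xi>|lborel. complex_of_real (g \<xi>) * cis (\<xi> \<bullet> \<gamma> s) * (LINT s|lborel. complex_of_real (h s) * cis (\<xi> \<bullet> (- \<kappa> s))))"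
      unfolding gH_def by (simp only: mult_ac)
    also have "\<dots> = (LINT t|lborel. complex_of_real (h t) * (LINT \<xi>|lborel. complex_of_real (g \<xi>) * cis (\<xi> \<bullet> \<gamma> s) * cis (\<xi> \<bullet> (- \<kappa> t))))"
      by (rule fourier_swap(1)[OF h i]) measurable
    also have "\<dots> = (LINT t|lborel. complex_of_real (h t) *
        (LINT \<xi>|lborel. complex_of_real (g \<xi>) * cis (\<xi> \<bullet> (\<gamma> s - \<kappa> t))))"
      by (simp add: mult.assoc cis_mult inner_diff_right)
    finally show ?thesis .
  qed
  have "(LINT \<xi>|lborel. gH \<xi> * (LINT s|lborel. complex_of_real (f s) * cis (\<xi> \<bullet> \<gamma> s)))
    = (LINT s|lborel. complex_of_real (f s) * (LINT \<xi>|lborel. gH \<xi> * cis (\<xi> \<bullet> \<gamma> s)))"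
    by (rule fourier_swap(1)[OF f int_gH]) measurable
  then show "(LINT \<xi>|lborel. complex_of_real (g \<xi>) * (LINT s|lborel. complex_of_real (f s) * cis (\<xi> \<bullet> \<gamma> s))
        * cnj (LINT s|lborel. complex_of_real (h s) * cis (\<xi> \<bullet> \<kappa> s)))
    = (LINT s|lborel. complex_of_real (f s) * (LINT t|lborel. complex_of_real (h t) *
        (LINT \<xi>|lborel. complex_of_real (g \<xi>) * cis (\<xi> \<bullet> (\<gamma> s - \<kappa> t)))))"
    unfolding eq by (simp only: inner)
qed

section \<open>A Plancherel inequality and affine substitution\<close>

lemma lborel_integral_affine:
  fixes f :: "'a::euclidean_space \<Rightarrow> 'b::{banach, second_countable_topology}"
  assumes [measurable]: "f \<in> borel_measurable borel" and c: "c \<noteq> 0"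
  shows "(LINT x|lborel. f x) = \<bar>c\<bar> ^ DIM('a) *\<^sub>R (LINT x|lborel. f (t + c *\<^sub>R x))"
    and "integrable lborel (\<lambda>x. f (t + c *\<^sub>R x)) \<longleftrightarrow> integrable lborel f"
proof -
  have L: "lborel = density (distr lborel borel (\<lambda>x. t + c *\<^sub>R x)) (\<lambda>_. ennreal (\<bar>c\<bar> ^ DIM('a)))"
    by (rule lborel_affine[OF c])
  have "(LINT x|lborel. f x) = (LINT x|density (distr lborel borel (\<lambda>x. t + c *\<^sub>R x)) (\<lambda>_. ennreal (\<bar>c\<bar> ^ DIM('a))). f x)"
    by (rule arg_cong[OF L, of "\<lambda>M. LINT x|M. f x"])
  also have "\<dots> = \<bar>c\<bar> ^ DIM('a) *\<^sub>R (LINT x|lborel. f (t + c *\<^sub>R x))"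
    by (subst integral_density) (auto simp: integral_distr)
  finally show "(LINT x|lborel. f x) = \<bar>c\<bar> ^ DIM('a) *\<^sub>R (LINT x|lborel. f (t + c *\<^sub>R x))" .
  have "integrable lborel f \<longleftrightarrow> integrable (density (distr lborel borel (\<lambda>x. t + c *\<^sub>R x)) (\<lambda>_. ennreal (\<bar>c\<bar> ^ DIM('a)))) f"
    by (rule arg_cong[OF L, of "\<lambda>M. integrable M f"])
  also have "\<dots> \<longleftrightarrow> integrable lborel (\<lambda>x. f (t + c *\<^sub>R x))"
  proof -
    let ?k = "\<bar>c\<bar> ^ DIM('a)" and ?g = "\<lambda>x. f (t + c *\<^sub>R x)"
    have "integrable lborel (\<lambda>x. ?k *\<^sub>R ?g x) \<longleftrightarrow> integrable lborel ?g"
      using integrable_scaleR_right[of "1 / ?k" lborel "\<lambda>x. ?k *\<^sub>R ?g x"] integrable_scaleR_right[of ?k lborel ?g] c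
      by auto
    then show ?thesis
      by (subst integrable_density) (auto simp: integrable_distr_eq)
  qed
  finally show "integrable lborel (\<lambda>x. f (t + c *\<^sub>R x)) \<longleftrightarrow> integrable lborel f" by simp
qed

lemma integrable_bounded_support:
  fixes f :: "'a::euclidean_space \<Rightarrow> 'b::{banach, second_countable_topology}"
  assumes [measurable]: "f \<in> borel_measurable borel"
    and b: "\<And>x. norm (f x) \<le> K" and s: "\<And>x. norm x > r \<Longrightarrow> f x = 0"
  shows "integrable lborel f"
    and "norm (LINT x|lborel. f x) \<le> K * measure lborel (cball 0 r :: 'a set)"
proof -
  have fin: "emeasure lborel (cball 0 r :: 'a set) < \<infinity>" by (rule emeasure_lborel_cball_finite)
  have i: "integrable lborel (\<lambda>x. K * indicator (cball 0 r :: 'a set) x)"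
    using fin by (intro integrable_mult_right integrable_real_indicator) auto
  have le: "norm (f x) \<le> K * indicator (cball 0 r) x" for x
    using b[of x] s[of x] by (auto simp: indicator_def not_le)
  have K: "K \<ge> 0" using b[of 0] norm_ge_zero order_trans by blast
  show f: "integrable lborel f"
    by (rule Bochner_Integration.integrable_bound[OF i]) (use le K in \<open>auto simp: abs_mult\<close>)
  have "norm (LINT x|lborel. f x) \<le> (LINT x|lborel. K * indicator (cball 0 r :: 'a set) x)"
    by (rule order_trans[OF integral_norm_bound]) (intro integral_mono i integrable_norm f le)
  also have "\<dots> = K * measure lborel (cball 0 r :: 'a set)" using fin by simp
  finally show "norm (LINT x|lborel. f x) \<le> K * measure lborel (cball 0 r :: 'a set)" .
qed

text \<open>An integrable majorant H of the squared transform is enough, so no L^2 theory enters.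
  The squared transform is weighted by Gaussians of growing width. In space this pairs G with its
  averages \<open>J n\<close> over Gaussians of width \<open>e n\<close>, and continuity of G lets
  these averages tend to a multiple of G.\<close>

lemma plancherel_le:
  fixes G :: "'a::euclidean_space \<Rightarrow> real"
  assumes cont: "continuous_on UNIV G" and bd: "\<And>x. \<bar>G x\<bar> \<le> K" and supp: "\<And>x. norm x > r \<Longrightarrow> G x = 0"
    and H: "integrable lborel H"
    and le: "\<And>\<xi>. (cmod (LINT x|lborel. complex_of_real (G x) * cis (\<xi> \<bullet> x)))\<^sup>2 \<le> H \<xi>"
  shows "(LINT x|lborel. (G x)\<^sup>2) \<le> (LINT \<xi>|lborel. H \<xi>) / (2 * pi) ^ DIM('a)"
proof -
  let ?d = "DIM('a)"
  have [measurable]: "G \<in> borel_measurable borel"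
    by (rule borel_measurable_continuous_onI[OF cont])
  have intG: "integrable lborel G"
    by (rule integrable_bounded_support[of G K r]) (auto simp: bd supp)
  define gs where "gs = (\<lambda>z::'a. exp (- (norm z)\<^sup>2 / 2))"
  have nsum: "(norm z)\<^sup>2 = (\<Sum>b\<in>Basis. (z \<bullet> b)\<^sup>2)" for z :: 'a
    by (subst norm_eq_sqrt_inner, subst euclidean_inner) (simp add: power2_eq_square sum_nonneg)
  have gs_eq: "complex_of_real (gs (c *\<^sub>R z)) = complex_of_real (exp (- (\<Sum>b\<in>Basis. ((z \<bullet> b) / (1 / c))\<^sup>2) / 2))" for c z
    unfolding gs_def nsum by (simp add: power_mult_distrib mult.commute)
  have gs_cis: "integrable lborel (\<lambda>\<xi>. complex_of_real (gs (c *\<^sub>R \<xi>)) * cis (\<xi> \<bullet> x))"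
     "(LINT \<xi>|lborel. complex_of_real (gs (c *\<^sub>R \<xi>)) * cis (\<xi> \<bullet> x)) = complex_of_real (sqrt (2 * pi) ^ ?d * ((1 / c) ^ ?d * gs ((1 / c) *\<^sub>R x)))"
    if "c > 0" for c x
  proof -
    show "integrable lborel (\<lambda>\<xi>. complex_of_real (gs (c *\<^sub>R \<xi>)) * cis (\<xi> \<bullet> x))"
      unfolding gs_eq by (rule gaussian_fourier_basis) (use that in auto)
    have "(LINT \<xi>|lborel. complex_of_real (gs (c *\<^sub>R \<xi>)) * cis (\<xi> \<bullet> x))
      = sqrt (2 * pi) ^ ?d * (\<Prod>b\<in>(Basis::'a set). 1 / c) * exp (- (\<Sum>b\<in>Basis. (1 / c * (x \<bullet> b))\<^sup>2) / 2)"
      unfolding gs_eq by (rule gaussian_fourier_basis) (use that in auto)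
    also have "exp (- (\<Sum>b\<in>Basis. (1 / c * (x \<bullet> b))\<^sup>2) / 2) = gs ((1 / c) *\<^sub>R x)"
      unfolding gs_def nsum by simp
    finally show "(LINT \<xi>|lborel. complex_of_real (gs (c *\<^sub>R \<xi>)) * cis (\<xi> \<bullet> x)) = complex_of_real (sqrt (2 * pi) ^ ?d * ((1 / c) ^ ?d * gs ((1 / c) *\<^sub>R x)))"
      by (simp add: mult.assoc)
  qed
  have gs_int: "integrable lborel (\<lambda>\<xi>. gs (c *\<^sub>R \<xi>))" if "c > 0" for c
    using gs_cis(1)[OF that, of 0] by (simp add: complex_of_real_integrable_eq)
  have gs_int1: "integrable lborel gs" using gs_int[of 1] by simp
  have gs_total: "(LINT \<xi>|lborel. gs \<xi>) = sqrt (2 * pi) ^ ?d"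
    using gs_cis(2)[of 1 0] by (simp add: gs_def flip: of_real_power)
  have [measurable]: "gs \<in> borel_measurable borel"
    using gs_int1 by (auto dest: borel_measurable_integrable)
  define F where "F = (\<lambda>\<xi>. LINT x|lborel. complex_of_real (G x) * cis (\<xi> \<bullet> x))"
  define e where "e = (\<lambda>n::nat. 1 / (real n + 1))"
  have e: "e n > 0" for n by (simp add: e_def)
  have e0: "e \<longlonglongrightarrow> 0" unfolding e_def using LIMSEQ_inverse_real_of_nat by (simp add: inverse_eq_divide add.commute)
  define J where "J = (\<lambda>n s. LINT z|lborel. G (s - e n *\<^sub>R z) * gs z)"
  have Kgs: "integrable lborel (\<lambda>z. K * gs z)"
    using gs_int1 by (rule integrable_mult_right)
  have J_le: "\<bar>J n s\<bar> \<le> K * sqrt (2 * pi) ^ ?d" for n s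
  proof -
    have "\<bar>J n s\<bar> \<le> (LINT z|lborel. K * gs z)"
      unfolding J_def real_norm_def[symmetric]
    proof (rule order_trans[OF integral_norm_bound], rule integral_mono)
      have *: "norm (G (s - e n *\<^sub>R z) * gs z) \<le> K * gs z" for z
        using bd by (auto simp: abs_mult gs_def intro!: mult_right_mono)
      show "norm (G (s - e n *\<^sub>R z) * gs z) \<le> K * gs z" for z by (rule *)
      have "norm (norm (G (s - e n *\<^sub>R z) * gs z)) \<le> norm (K * gs z)" for z
        using order_trans[OF *[of z] abs_ge_self] by (simp only: real_norm_def abs_abs)
      then show "integrable lborel (\<lambda>z. norm (G (s - e n *\<^sub>R z) * gs z))"
        by (intro Bochner_Integration.integrable_bound[OF Kgs] AE_I2) measurable
    qed (rule Kgs)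
    then show ?thesis by (simp add: gs_total)
  qed
  have J_lim: "(\<lambda>n. J n s) \<longlonglongrightarrow> (LINT z|lborel. G s * gs z)" for s
    unfolding J_def
  proof (rule integral_dominated_convergence[where w="\<lambda>z. K * gs z"])
    show "integrable lborel (\<lambda>z. K * gs z)" by (rule Kgs)
    show "AE z in lborel. (\<lambda>n. G (s - e n *\<^sub>R z) * gs z) \<longlonglongrightarrow> G s * gs z"
    proof (intro AE_I2 tendsto_mult tendsto_const)
      fix z
      have "(\<lambda>n. s - e n *\<^sub>R z) \<longlonglongrightarrow> s - 0 *\<^sub>R z" by (intro tendsto_intros e0)
      moreover have "isCont G s" using cont by (simp add: continuous_on_eq_continuous_at)
      ultimately show "(\<lambda>n. G (s - e n *\<^sub>R z)) \<longlonglongrightarrow> G s"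
        using isCont_tendsto_compose[of s G] by simp
    qed
    show "AE z in lborel. norm (G (s - e n *\<^sub>R z) * gs z) \<le> K * gs z" for n
      using bd by (auto simp: abs_mult gs_def intro!: mult_right_mono)
  qed auto
  have [measurable]: "J n \<in> borel_measurable borel" for n
    unfolding J_def by measurable
  have main: "(LINT s|lborel. G s * J n s) * sqrt (2 * pi) ^ ?d \<le> (LINT \<xi>|lborel. H \<xi>)" for n
  proof -
    have in1: "(LINT t|lborel. complex_of_real (G t) * (LINT \<xi>|lborel. complex_of_real (gs (e n *\<^sub>R \<xi>)) * cis (\<xi> \<bullet> (s - t))))
      = complex_of_real (sqrt (2 * pi) ^ ?d * J n s)" for s
    proof -
      have "J n s = (LINT z|lborel. (\<lambda>t. G t * gs ((1 / e n) *\<^sub>R (s - t))) (s + (- e n) *\<^sub>R z))"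
        using e[of n] by (simp add: J_def)
      also have "\<dots> = (1 / e n) ^ ?d * (LINT t|lborel. G t * gs ((1 / e n) *\<^sub>R (s - t)))"
        using lborel_integral_affine(1)[of "\<lambda>t. G t * gs ((1 / e n) *\<^sub>R (s - t))" "- e n" s] e[of n]
        by (simp add: power_one_over)
      finally have J1: "J n s = (1 / e n) ^ ?d * (LINT t|lborel. G t * gs ((1 / e n) *\<^sub>R (s - t)))" .
      have "(LINT t|lborel. complex_of_real (G t) * (LINT \<xi>|lborel. complex_of_real (gs (e n *\<^sub>R \<xi>)) * cis (\<xi> \<bullet> (s - t))))
        = (LINT t|lborel. complex_of_real (sqrt (2 * pi) ^ ?d * (1 / e n) ^ ?d * (G t * gs ((1 / e n) *\<^sub>R (s - t)))))"
        unfolding gs_cis(2)[OF e] by (intro Bochner_Integration.integral_cong) auto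
      also have "\<dots> = complex_of_real (sqrt (2 * pi) ^ ?d * (1 / e n) ^ ?d * (LINT t|lborel. (G t * gs ((1 / e n) *\<^sub>R (s - t)))))"
        unfolding integral_complex_of_real by simp
      finally show ?thesis unfolding J1 by (simp only: mult.assoc)
    qed
    have "(LINT \<xi>|lborel. complex_of_real (gs (e n *\<^sub>R \<xi>)) * F \<xi> * cnj (F \<xi>))
       = (LINT s|lborel. complex_of_real (G s) * complex_of_real (sqrt (2 * pi) ^ ?d * J n s))"
      unfolding F_def in1[symmetric]
      using fourier_bilinear(1)[OF intG intG gs_int[OF e[of n]], of "\<lambda>x. x" "\<lambda>x. x"] by simp
    also have "\<dots> = (LINT s|lborel. complex_of_real (sqrt (2 * pi) ^ ?d * (G s * J n s)))"
      by (intro Bochner_Integration.integral_cong) auto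
    also have "\<dots> = complex_of_real (sqrt (2 * pi) ^ ?d * (LINT s|lborel. G s * J n s))"
      unfolding integral_complex_of_real by simp
    finally have 1: "(LINT \<xi>|lborel. complex_of_real (gs (e n *\<^sub>R \<xi>)) * F \<xi> * cnj (F \<xi>))
      = complex_of_real (sqrt (2 * pi) ^ ?d * (LINT s|lborel. G s * J n s))" .
    have 2: "complex_of_real (gs (e n *\<^sub>R \<xi>)) * F \<xi> * cnj (F \<xi>) = complex_of_real (gs (e n *\<^sub>R \<xi>) * (cmod (F \<xi>))\<^sup>2)" for \<xi>
      by (simp only: mult.assoc of_real_mult complex_norm_square)
    have 3: "integrable lborel (\<lambda>\<xi>. gs (e n *\<^sub>R \<xi>) * (cmod (F \<xi>))\<^sup>2)"
    proof -
      have "integrable lborel (\<lambda>\<xi>. complex_of_real (gs (e n *\<^sub>R \<xi>)) * F \<xi> * cnj (F \<xi>))"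
        using fourier_bilinear(2)[OF intG intG gs_int[OF e[of n]], of "\<lambda>x. x" "\<lambda>x. x"] by (simp add: F_def)
      then show ?thesis unfolding 2 complex_of_real_integrable_eq .
    qed
    have "(LINT \<xi>|lborel. gs (e n *\<^sub>R \<xi>) * (cmod (F \<xi>))\<^sup>2) = sqrt (2 * pi) ^ ?d * (LINT s|lborel. G s * J n s)"
      using 1 unfolding 2 integral_complex_of_real of_real_eq_iff .
    moreover have "(LINT \<xi>|lborel. gs (e n *\<^sub>R \<xi>) * (cmod (F \<xi>))\<^sup>2) \<le> (LINT \<xi>|lborel. H \<xi>)"
    proof (rule integral_mono[OF 3 H])
      fix \<xi>
      have "gs (e n *\<^sub>R \<xi>) * (cmod (F \<xi>))\<^sup>2 \<le> 1 * (cmod (F \<xi>))\<^sup>2"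
        by (intro mult_right_mono) (auto simp: gs_def)
      also have "\<dots> \<le> H \<xi>" using le[of \<xi>] by (simp add: F_def)
      finally show "gs (e n *\<^sub>R \<xi>) * (cmod (F \<xi>))\<^sup>2 \<le> H \<xi>" .
    qed
    ultimately show ?thesis by (simp add: mult.commute)
  qed
  have "(\<lambda>n. LINT s|lborel. G s * J n s) \<longlonglongrightarrow> (LINT s|lborel. G s * (LINT z|lborel. G s * gs z))"
  proof (rule integral_dominated_convergence[where w="\<lambda>s. (K * sqrt (2 * pi) ^ ?d) * norm (G s)"])
    show "AE s in lborel. (\<lambda>n. G s * J n s) \<longlonglongrightarrow> G s * (LINT z|lborel. G s * gs z)"
      by (intro AE_I2 tendsto_mult tendsto_const J_lim)
    show "AE s in lborel. norm (G s * J n s) \<le> (K * sqrt (2 * pi) ^ ?d) * norm (G s)" for n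
      using mult_right_mono[OF J_le[of n], of "\<bar>G _\<bar>"] by (auto simp: abs_mult mult.commute)
  qed (use intG in auto)
  then have lim: "(\<lambda>n. (LINT s|lborel. G s * J n s) * sqrt (2 * pi) ^ ?d) \<longlonglongrightarrow> (LINT s|lborel. G s * (LINT z|lborel. G s * gs z)) * sqrt (2 * pi) ^ ?d"
    by (intro tendsto_mult tendsto_const)
  have X: "(LINT s|lborel. G s * (LINT z|lborel. G s * gs z)) * sqrt (2 * pi) ^ ?d \<le> (LINT \<xi>|lborel. H \<xi>)"
    by (rule LIMSEQ_le_const2[OF lim]) (use main in auto)
  have Y: "(LINT s|lborel. G s * (LINT z|lborel. G s * gs z)) = sqrt (2 * pi) ^ ?d * (LINT s|lborel. (G s)\<^sup>2)"
  proof -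
    have "G s * (LINT z|lborel. G s * gs z) = sqrt (2 * pi) ^ ?d * (G s)\<^sup>2" for s
      by (simp add: gs_total power2_eq_square mult_ac)
    then show ?thesis by simp
  qed
  have Z: "sqrt (2 * pi) ^ ?d * y * sqrt (2 * pi) ^ ?d = (2 * pi) ^ ?d * y" for y
  proof -
    have "sqrt (2 * pi) ^ ?d * sqrt (2 * pi) ^ ?d = (2 * pi) ^ ?d"
      by (simp only: power_mult_distrib[symmetric] real_sqrt_mult_self) (simp add: abs_of_nonneg)
    then show ?thesis by (metis mult.assoc mult.commute)
  qed
  show ?thesis
    using X unfolding Y Z by (subst pos_le_divide_eq) (simp_all add: mult.commute)
qed

section \<open>Finite differences and the decay of Fourier transforms\<close>

primrec fdiff :: "nat \<Rightarrow> 'a::real_vector \<Rightarrow> ('a \<Rightarrow> real) \<Rightarrow> 'a \<Rightarrow> real" where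
  "fdiff 0 h f x = f x"
| "fdiff (Suc m) h f x = fdiff m h f (x + h) - fdiff m h f x"

lemma fdiff_support:
  fixes f :: "'a::real_normed_vector \<Rightarrow> real"
  assumes "\<And>x. norm x > r \<Longrightarrow> f x = 0" and "norm x > r + real m * norm h"
  shows "fdiff m h f x = 0"
  using assms(2)
proof (induction m arbitrary: x)
  case (Suc m)
  have "norm x \<le> norm (x + h) + norm h"
    by (metis add_diff_cancel norm_triangle_ineq4)
  moreover have "norm h \<ge> 0" "real m * norm h \<ge> 0" by simp_all
  moreover have p: "r + norm h + real m * norm h < norm x"
    using Suc.prems by (simp add: algebra_simps)
  ultimately have "norm (x + h) > r + real m * norm h" "norm x > r + real m * norm h"
    using p by linarith+
  then show ?case by (simp add: Suc.IH)
qed (use assms(1) in auto)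

lemma fdiff_measurable [measurable]:
  fixes f :: "'a::euclidean_space \<Rightarrow> real"
  assumes [measurable]: "f \<in> borel_measurable borel"
  shows "fdiff m h f \<in> borel_measurable borel"
proof (induction m)
  case (Suc m)
  show ?case
    unfolding fdiff.simps(2)[abs_def]
    by (intro borel_measurable_diff measurable_compose[OF _ Suc.IH]) auto
qed (simp add: fdiff.simps(1)[abs_def])

lemma fdiff_fourier:
  fixes f :: "'a::euclidean_space \<Rightarrow> real"
  assumes f: "integrable lborel f"
  shows "integrable lborel (fdiff m h f)"
    and "(LINT x|lborel. complex_of_real (fdiff m h f x) * cis (\<zeta> \<bullet> x))
      = (cis (- (\<zeta> \<bullet> h)) - 1) ^ m * (LINT x|lborel. complex_of_real (f x) * cis (\<zeta> \<bullet> x))"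
proof -
  have [measurable]: "f \<in> borel_measurable borel"
    using f by (auto dest: borel_measurable_integrable)
  have cint: "integrable lborel (\<lambda>x. complex_of_real (g x) * cis (\<zeta> \<bullet> x))" if "integrable lborel g" for g :: "'a \<Rightarrow> real"
    using borel_measurable_integrable[OF that]
    by (intro Bochner_Integration.integrable_bound[OF that]) (auto simp: norm_mult)
  have shift: "integrable lborel (\<lambda>x. g (x + h))" if "integrable lborel g" for g :: "'a \<Rightarrow> real"
    using lborel_integral_affine(2)[of g 1 h] that borel_measurable_integrable[OF that] by (simp add: add.commute)
  have int: "integrable lborel (fdiff m h f)" for m
  proof (induction m)
    case (Suc m)
    then show ?case by (simp add: fdiff.simps(2)[abs_def] shift)
  qed (simp add: fdiff.simps(1)[abs_def] f)
  then show "integrable lborel (fdiff m h f)" .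
  show "(LINT x|lborel. complex_of_real (fdiff m h f x) * cis (\<zeta> \<bullet> x))
      = (cis (- (\<zeta> \<bullet> h)) - 1) ^ m * (LINT x|lborel. complex_of_real (f x) * cis (\<zeta> \<bullet> x))"
  proof (induction m)
    case (Suc m)
    let ?g = "fdiff m h f"
    let ?I = "LINT x|lborel. complex_of_real (?g x) * cis (\<zeta> \<bullet> x)"
    have "(LINT x|lborel. complex_of_real (?g (x + h)) * cis (\<zeta> \<bullet> x))
      = (LINT x|lborel. cis (- (\<zeta> \<bullet> h)) * (complex_of_real (?g (h + 1 *\<^sub>R x)) * cis (\<zeta> \<bullet> (h + 1 *\<^sub>R x))))"
      by (intro Bochner_Integration.integral_cong)
         (auto simp: add.commute inner_add_right mult.left_commute cis_mult)
    also have "\<dots> = cis (- (\<zeta> \<bullet> h)) * (LINT x|lborel. complex_of_real (?g (h + 1 *\<^sub>R x)) * cis (\<zeta> \<bullet> (h + 1 *\<^sub>R x)))"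
      by (rule integral_mult_right_zero)
    also have "(LINT x|lborel. complex_of_real (?g (h + 1 *\<^sub>R x)) * cis (\<zeta> \<bullet> (h + 1 *\<^sub>R x))) = ?I"
      using lborel_integral_affine(1)[of "\<lambda>x. complex_of_real (?g x) * cis (\<zeta> \<bullet> x)" 1 h] by simp
    finally have 1: "(LINT x|lborel. complex_of_real (?g (x + h)) * cis (\<zeta> \<bullet> x)) = cis (- (\<zeta> \<bullet> h)) * ?I" .
    have "(LINT x|lborel. complex_of_real (fdiff (Suc m) h f x) * cis (\<zeta> \<bullet> x))
      = (LINT x|lborel. complex_of_real (?g (x + h)) * cis (\<zeta> \<bullet> x) - complex_of_real (?g x) * cis (\<zeta> \<bullet> x))"
      by (simp add: algebra_simps)
    also have "\<dots> = cis (- (\<zeta> \<bullet> h)) * ?I - ?I"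
      by (subst Bochner_Integration.integral_diff) (auto simp: 1 intro!: cint shift int)
    finally have "(LINT x|lborel. complex_of_real (fdiff (Suc m) h f x) * cis (\<zeta> \<bullet> x)) = (cis (- (\<zeta> \<bullet> h)) - 1) * ?I"
      by (simp only: left_diff_distrib mult_1_left)
    then show ?case unfolding Suc.IH by (simp only: power_Suc mult.assoc)
  qed simp
qed

text \<open>Finite differences take the place of integration by parts. With the step pi / (\<zeta> .
  e) along e, each difference multiplies the transform by -2, so the transform is at most the
  integral of the m-th difference, which is of order |h|^m. The condition |\<zeta> . e| \<ge> 1
  keeps the step below pi and thus the support inside a fixed ball.\<close>

lemma fourier_decay_direction:
  fixes f :: "'a::euclidean_space \<Rightarrow> real"
  assumes [measurable]: "f \<in> borel_measurable borel" and f: "integrable lborel f" and e: "norm e = 1"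
    and supp: "\<And>x. norm x > r \<Longrightarrow> f x = 0"
    and D: "\<And>h x. \<bar>fdiff m (h *\<^sub>R e) f x\<bar> \<le> D * \<bar>h\<bar> ^ m"
  shows "\<exists>C\<ge>0. \<forall>\<zeta>. 1 \<le> \<bar>\<zeta> \<bullet> e\<bar> \<longrightarrow> cmod (LINT x|lborel. complex_of_real (f x) * cis (\<zeta> \<bullet> x)) * \<bar>\<zeta> \<bullet> e\<bar> ^ m \<le> C"
proof (intro exI conjI allI impI)
  let ?M = "measure lborel (cball 0 (r + real m * pi) :: 'a set)"
  have "D \<ge> 0" using D[of 1 0] by (simp add: order_trans[OF abs_ge_zero])
  then show "D * pi ^ m * ?M \<ge> 0" by simp
  fix \<zeta> assume \<zeta>: "1 \<le> \<bar>\<zeta> \<bullet> e\<bar>"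
  define c where "c = \<zeta> \<bullet> e"
  have c: "1 \<le> \<bar>c\<bar>" "c \<noteq> 0" using \<zeta> by (auto simp: c_def)
  define h where "h = pi / c"
  let ?I = "LINT x|lborel. complex_of_real (f x) * cis (\<zeta> \<bullet> x)"
  have hn: "norm (h *\<^sub>R e) \<le> pi"
    using c e by (simp add: h_def divide_le_eq pi_gt_zero)
  have "\<zeta> \<bullet> (h *\<^sub>R e) = pi" using c by (simp add: h_def c_def)
  then have cis: "cis (- (\<zeta> \<bullet> (h *\<^sub>R e))) - 1 = -2" by (simp add: complex_eq_iff)
  have "norm (LINT x|lborel. complex_of_real (fdiff m (h *\<^sub>R e) f x) * cis (\<zeta> \<bullet> x)) \<le> (D * \<bar>h\<bar> ^ m) * ?M"
  proof (rule integrable_bounded_support(2))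
    show "norm (complex_of_real (fdiff m (h *\<^sub>R e) f x) * cis (\<zeta> \<bullet> x)) \<le> D * \<bar>h\<bar> ^ m" for x
      using D[of h x] by (simp add: norm_mult)
    fix x :: 'a assume "norm x > r + real m * pi"
    moreover have "real m * norm (h *\<^sub>R e) \<le> real m * pi" by (intro mult_left_mono hn) auto
    ultimately have "norm x > r + real m * norm (h *\<^sub>R e)" by linarith
    from fdiff_support[OF supp this]
    show "complex_of_real (fdiff m (h *\<^sub>R e) f x) * cis (\<zeta> \<bullet> x) = 0" by simp
  qed measurable
  then have "2 ^ m * cmod ?I \<le> D * \<bar>h\<bar> ^ m * ?M"
    unfolding fdiff_fourier(2)[OF f] cis by (simp add: norm_mult norm_power)
  moreover have "1 * cmod ?I \<le> 2 ^ m * cmod ?I" by (intro mult_right_mono) auto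
  ultimately have "cmod ?I * \<bar>c\<bar> ^ m \<le> (D * \<bar>h\<bar> ^ m * ?M) * \<bar>c\<bar> ^ m"
    by (intro mult_right_mono) auto
  also have "\<dots> = D * (\<bar>h\<bar> * \<bar>c\<bar>) ^ m * ?M" by (simp add: power_mult_distrib)
  also have "\<bar>h\<bar> * \<bar>c\<bar> = pi" using c by (simp add: h_def flip: abs_mult)
  finally show "cmod ?I * \<bar>\<zeta> \<bullet> e\<bar> ^ m \<le> D * pi ^ m * ?M" by (simp add: c_def)
qed

abbreviation ddir :: "'a::real_normed_vector \<Rightarrow> ('a \<Rightarrow> real) \<Rightarrow> 'a \<Rightarrow> real" where
  "ddir e f \<equiv> \<lambda>x. frechet_derivative f (at x) e"

lemma times_cont_diff_continuous: "times_cont_diff m f \<Longrightarrow> continuous_on UNIV f"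
  by (cases m) (auto intro: differentiable_imp_continuous_on simp: differentiable_on_def differentiable_at_withinI)

lemma times_cont_diff_funpow:
  "times_cont_diff m f \<Longrightarrow> continuous_on UNIV ((ddir e ^^ m) f)"
  by (induction m arbitrary: f) (auto simp: funpow_swap1[symmetric] simp del: funpow.simps(2) simp add: funpow_Suc_right)

lemma has_field_derivative_fdiff:
  fixes f :: "'a::real_normed_vector \<Rightarrow> real"
  assumes "\<And>x. f differentiable (at x)"
  shows "((\<lambda>t. fdiff m h f (x + t *\<^sub>R e)) has_field_derivative fdiff m h (ddir e f) (x + t *\<^sub>R e)) (at t within S)"
proof (induction m arbitrary: x)
  case 0
  have D: "(f has_derivative frechet_derivative f (at (x + t *\<^sub>R e))) (at (x + t *\<^sub>R e))"
    using assms frechet_derivative_works by blast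
  have "((\<lambda>t. x + t *\<^sub>R e) has_derivative (\<lambda>s. s *\<^sub>R e)) (at t within S)"
    by (auto intro!: derivative_eq_intros)
  from has_derivative_compose[OF this D]
  have "((\<lambda>t. f (x + t *\<^sub>R e)) has_derivative (\<lambda>s. frechet_derivative f (at (x + t *\<^sub>R e)) (s *\<^sub>R e))) (at t within S)" .
  moreover have "frechet_derivative f (at (x + t *\<^sub>R e)) (s *\<^sub>R e) = frechet_derivative f (at (x + t *\<^sub>R e)) e * s" for s
    using linear_scale[OF has_derivative_linear[OF D]] by (simp add: mult.commute)
  ultimately show ?case by (simp add: has_field_derivative_def)
next
  case (Suc m)
  show ?case
    using DERIV_diff[OF Suc.IH[of "x + h"] Suc.IH[of x]] by (simp add: algebra_simps)
qed

text \<open>One mean value inequality along e per difference; the induction runs through the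
  derivative of f, whose remaining differences are already bounded.\<close>

lemma fdiff_bound:
  fixes f :: "'a::real_normed_vector \<Rightarrow> real"
  assumes "times_cont_diff m f" and "\<And>x. \<bar>(ddir e ^^ m) f x\<bar> \<le> D"
  shows "\<bar>fdiff m (h *\<^sub>R e) f x\<bar> \<le> D * \<bar>h\<bar> ^ m"
  using assms
proof (induction m arbitrary: f x)
  case (Suc m)
  have IH: "\<bar>fdiff m (h *\<^sub>R e) (ddir e f) x\<bar> \<le> D * \<bar>h\<bar> ^ m" for x
    using Suc.prems by (intro Suc.IH) (auto simp: funpow_Suc_right simp del: funpow.simps(2))
  have "norm (fdiff m (h *\<^sub>R e) f (x + h *\<^sub>R e) - fdiff m (h *\<^sub>R e) f (x + 0 *\<^sub>R e)) \<le> (D * \<bar>h\<bar> ^ m) * norm (h - 0)"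
    by (rule field_differentiable_bound[of UNIV "\<lambda>t. fdiff m (h *\<^sub>R e) f (x + t *\<^sub>R e)"])
       (use Suc.prems IH in \<open>auto intro!: has_field_derivative_fdiff\<close>)
  then show ?case by (simp add: mult_ac)
qed simp

lemma smooth_fdiff_bound:
  fixes f :: "'a::euclidean_space \<Rightarrow> real"
  assumes sm: "smooth f" and supp: "\<And>x. norm x > r \<Longrightarrow> f x = 0"
  shows "\<exists>D. \<forall>h x. \<bar>fdiff m (h *\<^sub>R e) f x\<bar> \<le> D * \<bar>h\<bar> ^ m"
proof -
  have cd: "times_cont_diff m f" using sm by (simp add: smooth_def)
  have s: "norm x > r \<Longrightarrow> (ddir e ^^ k) f x = 0" for k x
  proof (induction k arbitrary: x)
    case (Suc k)
    let ?g = "(ddir e ^^ k) f"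
    have "(?g has_derivative (\<lambda>_. 0)) (at x)"
    proof (rule has_derivative_transform_within_open[of "\<lambda>_. 0" "\<lambda>_. 0" x UNIV "{y. norm y > r}"])
      show "open {y::'a. norm y > r}" by (intro open_Collect_less continuous_intros)
    qed (use Suc in auto)
    then have "frechet_derivative ?g (at x) = (\<lambda>_. 0)"
      by (rule frechet_derivative_at[symmetric])
    then show ?case by simp
  qed (use supp in auto)
  have "continuous_on (cball 0 r) ((ddir e ^^ m) f)"
    using times_cont_diff_funpow[OF cd] continuous_on_subset by blast
  then have "bounded ((ddir e ^^ m) f ` cball 0 r)"
    by (intro compact_imp_bounded compact_continuous_image) auto
  then obtain D where D: "\<And>x. x \<in> cball 0 r \<Longrightarrow> \<bar>(ddir e ^^ m) f x\<bar> \<le> D"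
    unfolding bounded_iff real_norm_def by blast
  \<comment> \<open>D is only known on the ball and could be negative if the ball is empty; outside
    the ball the derivative vanishes.\<close>
  have "\<bar>(ddir e ^^ m) f x\<bar> \<le> max D 0" for x
    using D[of x] s[of x m] by (cases "norm x \<le> r") (auto simp: max_def)
  from fdiff_bound[OF cd this] show ?thesis by blast
qed

section \<open>Fourier decay of the bump function\<close>

locale bump_function =
  fixes chi :: "real^3 \<Rightarrow> real"
  assumes bump: "bump chi"
begin

lemma smooth_chi: "smooth chi"
  and chi_nonneg: "0 \<le> chi x"
  and chi_le_1: "chi x \<le> 1"
  and chi_radial: "norm x = norm y \<Longrightarrow> chi x = chi y"
  and chi_ge_half: "norm x \<le> 1/2 \<Longrightarrow> 1/2 \<le> chi x"
  and chi_eq_0: "2 \<le> norm x \<Longrightarrow> chi x = 0"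
  using bump unfolding bump_def by blast+

lemma continuous_chi: "continuous_on UNIV chi"
  using smooth_chi times_cont_diff_continuous by (auto simp: smooth_def)

lemma chi_measurable [measurable]: "chi \<in> borel_measurable borel"
  by (rule borel_measurable_continuous_onI[OF continuous_chi])

lemma integrable_chi: "integrable lborel chi"
  by (rule integrable_bounded_support[of chi 1 2]) (auto simp: chi_nonneg chi_le_1 chi_eq_0)

definition chihat :: "real^3 \<Rightarrow> complex" where
  "chihat \<zeta> = (LINT x|lborel. complex_of_real (chi x) * cis (\<zeta> \<bullet> x))"

lemma chihat_decay: "\<exists>C\<ge>0. \<forall>\<zeta>. cmod (chihat \<zeta>) * (1 + norm \<zeta>) ^ m \<le> C"
proof -
  have "\<exists>C\<ge>0. \<forall>\<zeta>. 1 \<le> \<bar>\<zeta> \<bullet> axis i 1\<bar> \<longrightarrow> cmod (chihat \<zeta>) * \<bar>\<zeta> \<bullet> axis i 1\<bar> ^ m \<le> C" for i :: 3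
  proof -
    obtain D where "\<And>h x. \<bar>fdiff m (h *\<^sub>R axis i 1) chi x\<bar> \<le> D * \<bar>h\<bar> ^ m"
      using smooth_fdiff_bound[OF smooth_chi, of 2 m "axis i 1"] chi_eq_0 by force
    then show ?thesis
      unfolding chihat_def
      by (intro fourier_decay_direction[of chi _ 2]) (auto simp: integrable_chi chi_eq_0 norm_axis_1)
  qed
  then obtain C where C: "\<And>i. C i \<ge> 0" "\<And>i \<zeta>. 1 \<le> \<bar>\<zeta> \<bullet> axis i 1\<bar> \<Longrightarrow> cmod (chihat \<zeta>) * \<bar>\<zeta> \<bullet> axis i (1::real)\<bar> ^ m \<le> C i"
    by metis
  define K where "K = 1 * measure lborel (cball 0 2 :: (real^3) set)"
  have b: "cmod (chihat \<zeta>) \<le> K" for \<zeta>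
    unfolding K_def chihat_def
    by (rule integrable_bounded_support(2)) (auto simp: norm_mult chi_nonneg chi_le_1 chi_eq_0)
  have K: "K \<ge> 0" by (simp add: K_def)
  show ?thesis
  proof (intro exI conjI allI)
    show "0 \<le> 3 ^ m * K + (\<Sum>i\<in>UNIV. 3 ^ m * C i)"
      using K C(1) by (intro add_nonneg_nonneg sum_nonneg) auto
    fix \<zeta> :: "real^3"
    show "cmod (chihat \<zeta>) * (1 + norm \<zeta>) ^ m \<le> 3 ^ m * K + (\<Sum>i\<in>UNIV. 3 ^ m * C i)"
    proof (cases "norm \<zeta> \<le> 2")
      case True
      have "cmod (chihat \<zeta>) * (1 + norm \<zeta>) ^ m \<le> K * 3 ^ m"
        using True by (intro mult_mono b power_mono K) auto
      then show ?thesis using C(1) by (simp add: mult.commute sum_nonneg add_increasing2)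
    next
      case False
      \<comment> \<open>If every coordinate were below half the norm, the squares would add up to
        less than three quarters of the squared norm.\<close>
      obtain i where i: "norm \<zeta> / 2 \<le> \<bar>\<zeta> $ i\<bar>"
      proof (rule ccontr)
        assume "\<not> thesis"
        then have "\<bar>\<zeta> $ i\<bar> < norm \<zeta> / 2" for i using that by (meson not_le)
        then have "(\<zeta> $ i)\<^sup>2 < (norm \<zeta> / 2)\<^sup>2" for i
          by (metis abs_ge_zero power2_abs power_strict_mono zero_less_numeral)
        then have "4 * (\<zeta> $ i)\<^sup>2 < (norm \<zeta>)\<^sup>2" for i
          by (simp add: power_divide mult.commute)
        from this[of 1] this[of 2] this[of 3] zero_le_power2[of "norm \<zeta>"]
        have "(\<zeta> $ 1)\<^sup>2 + (\<zeta> $ 2)\<^sup>2 + (\<zeta> $ 3)\<^sup>2 < (norm \<zeta>)\<^sup>2"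
          by linarith
        moreover have "(norm \<zeta>)\<^sup>2 = (\<zeta> $ 1)\<^sup>2 + (\<zeta> $ 2)\<^sup>2 + (\<zeta> $ 3)\<^sup>2"
          by (simp only: power2_norm_eq_inner inner_vec_def sum_3) (simp add: power2_eq_square)
        ultimately show False by simp
      qed
      have in_i: "\<zeta> \<bullet> axis i 1 = \<zeta> $ i" by (simp add: inner_axis)
      have "1 + norm \<zeta> \<le> 3 * \<bar>\<zeta> $ i\<bar>" using False i by linarith
      then have "cmod (chihat \<zeta>) * (1 + norm \<zeta>) ^ m \<le> cmod (chihat \<zeta>) * (3 * \<bar>\<zeta> $ i\<bar>) ^ m"
        by (intro mult_left_mono power_mono) auto
      also have "\<dots> = 3 ^ m * (cmod (chihat \<zeta>) * \<bar>\<zeta> $ i\<bar> ^ m)" by (simp add: power_mult_distrib)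
      also have "\<dots> \<le> 3 ^ m * C i"
        using C(2)[of \<zeta> i] False i by (intro mult_left_mono) (auto simp: in_i)
      also have "\<dots> \<le> (\<Sum>i\<in>UNIV. 3 ^ m * C i)"
        using C(1) by (intro member_le_sum) auto
      finally show ?thesis using K by (simp add: add_increasing)
    qed
  qed
qed


lemma cmod_cis_diff: "cmod (cis a - cis b) \<le> \<bar>a - b\<bar>"
proof -
  have "cis a - cis b = cis b * (cis (a - b) - 1)" by (simp add: algebra_simps cis_mult)
  then have "cmod (cis a - cis b) = cmod (cis (a - b) - 1)" by (simp add: norm_mult)
  also have "\<dots> \<le> \<bar>a - b\<bar>"
    using iexp_approx1[of "a - b" 0] by (simp add: cis_conv_exp)
  finally show ?thesis .
qed

text \<open>On the support of chi, which lies in the ball of radius 2, the phase moves by at most 2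
  |\<zeta> - \<zeta>'|. The estimate is what makes \<open>phihat\<close> vanish to first order at
  the origin.\<close>

lemma chihat_lipschitz: "\<exists>C\<ge>0. \<forall>\<zeta> \<zeta>'. cmod (chihat \<zeta> - chihat \<zeta>') \<le> C * norm (\<zeta> - \<zeta>')"
proof (intro exI conjI allI)
  let ?M = "measure lborel (cball 0 2 :: (real^3) set)"
  show "0 \<le> 2 * ?M" by simp
  fix \<zeta> \<zeta>' :: "real^3"
  have i: "integrable lborel (\<lambda>x. complex_of_real (chi x) * cis (\<xi> \<bullet> x))" for \<xi>
    by (rule Bochner_Integration.integrable_bound[OF integrable_chi]) (auto simp: norm_mult)
  have "chihat \<zeta> - chihat \<zeta>' = (LINT x|lborel. complex_of_real (chi x) * (cis (\<zeta> \<bullet> x) - cis (\<zeta>' \<bullet> x)))"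
    unfolding chihat_def by (subst Bochner_Integration.integral_diff[symmetric, OF i i]) (simp add: algebra_simps)
  also have "cmod \<dots> \<le> (2 * norm (\<zeta> - \<zeta>')) * ?M"
  proof (rule integrable_bounded_support(2))
    fix x :: "real^3"
    show "norm (complex_of_real (chi x) * (cis (\<zeta> \<bullet> x) - cis (\<zeta>' \<bullet> x))) \<le> 2 * norm (\<zeta> - \<zeta>')"
    proof (cases "norm x \<le> 2")
      case True
      have "norm (complex_of_real (chi x) * (cis (\<zeta> \<bullet> x) - cis (\<zeta>' \<bullet> x))) \<le> 1 * cmod (cis (\<zeta> \<bullet> x) - cis (\<zeta>' \<bullet> x))"
        unfolding norm_mult by (intro mult_right_mono) (auto simp: chi_nonneg chi_le_1)
      also have "\<dots> \<le> \<bar>(\<zeta> - \<zeta>') \<bullet> x\<bar>" using cmod_cis_diff by (simp add: inner_diff_left)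
      also have "\<dots> \<le> norm (\<zeta> - \<zeta>') * norm x" by (rule Cauchy_Schwarz_ineq2)
      also have "\<dots> \<le> norm (\<zeta> - \<zeta>') * 2" by (intro mult_left_mono True) auto
      finally show ?thesis by simp
    qed (simp add: chi_eq_0)
  qed (auto simp: chi_eq_0)
  finally show "cmod (chihat \<zeta> - chihat \<zeta>') \<le> 2 * ?M * norm (\<zeta> - \<zeta>')" by (simp add: mult_ac)
qed

section \<open>Dilates of the bump and the band-pass kernel \<open>phi\<close>\<close>

lemma dilate_measurable [measurable]: "dilate chi w \<in> borel_measurable borel"
  unfolding dilate_def[abs_def] by measurable

lemma dilate_nonneg: "w > 0 \<Longrightarrow> 0 \<le> dilate chi w x"
  and dilate_le: "w > 0 \<Longrightarrow> dilate chi w x \<le> 1 / w ^ 3"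
  and dilate_eq_0: "w > 0 \<Longrightarrow> 2 * w \<le> norm x \<Longrightarrow> dilate chi w x = 0"
  and dilate_minus: "dilate chi w (- x) = dilate chi w x"
  by (auto simp: dilate_def chi_nonneg chi_le_1 divide_simps intro!: chi_eq_0 chi_radial)

lemma continuous_dilate: "continuous_on UNIV (dilate chi w)"
  unfolding dilate_def[abs_def] divide_inverse
  by (intro continuous_intros continuous_on_compose2[OF continuous_chi]) auto

lemma integrable_dilate: "w > 0 \<Longrightarrow> integrable lborel (dilate chi w)"
  by (rule integrable_bounded_support[of _ "1 / w ^ 3" "2 * w"])
     (auto simp: dilate_nonneg dilate_le dilate_eq_0 abs_of_nonneg)

lemma dilate_fourier:
  assumes w: "w > 0"
  shows "(LINT x|lborel. complex_of_real (dilate chi w x) * cis (\<xi> \<bullet> x)) = chihat (w *\<^sub>R \<xi>)"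
proof -
  have "(LINT x|lborel. complex_of_real (dilate chi w x) * cis (\<xi> \<bullet> x))
    = w ^ 3 *\<^sub>R (LINT x|lborel. complex_of_real (dilate chi w (0 + w *\<^sub>R x)) * cis (\<xi> \<bullet> (0 + w *\<^sub>R x)))"
    using lborel_integral_affine(1)[of "\<lambda>x. complex_of_real (dilate chi w x) * cis (\<xi> \<bullet> x)" w 0] w by simp
  also have "\<dots> = (LINT x|lborel. w ^ 3 *\<^sub>R (complex_of_real (dilate chi w (0 + w *\<^sub>R x)) * cis (\<xi> \<bullet> (0 + w *\<^sub>R x))))"
    by (rule integral_scaleR_right[symmetric])
  also have "\<dots> = chihat (w *\<^sub>R \<xi>)"
  proof -
    have "w ^ 3 *\<^sub>R (complex_of_real (a / w ^ 3) * z) = complex_of_real a * z" for a z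
      using w by (simp add: scaleR_conv_of_real)
    then show ?thesis
      unfolding chihat_def using w by (intro Bochner_Integration.integral_cong) (auto simp: dilate_def)
  qed
  finally show ?thesis .
qed

text \<open>What remains of the difference of \<open>eta chi d\<close> and
  \<open>eta chi (2 * d)\<close> after the common factor \<open>dilate chi d\<close> has been split
  off, see \<open>eta_diff\<close>.\<close>

definition phi :: "real \<Rightarrow> real^3 \<Rightarrow> real" where
  "phi d x = dilate chi (d / 2) x - dilate chi (2 * d) x"

definition phihat :: "real \<Rightarrow> real^3 \<Rightarrow> complex" where
  "phihat d \<xi> = (LINT x|lborel. complex_of_real (phi d x) * cis (\<xi> \<bullet> x))"

lemma phi_measurable [measurable]: "phi d \<in> borel_measurable borel"
  unfolding phi_def[abs_def] by measurable

lemma continuous_phi: "continuous_on UNIV (phi d)"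
  unfolding phi_def[abs_def] by (intro continuous_intros continuous_dilate)

lemma phi_minus: "phi d (- x) = phi d x"
  by (simp add: phi_def dilate_minus)

lemma phi_bound: "d > 0 \<Longrightarrow> \<bar>phi d x\<bar> \<le> 8 / d ^ 3"
proof -
  assume d: "d > 0"
  have "0 \<le> dilate chi (d / 2) x" "dilate chi (d / 2) x \<le> 8 / d ^ 3"
    "0 \<le> dilate chi (2 * d) x" "dilate chi (2 * d) x \<le> 1 / (8 * d ^ 3)"
    using dilate_nonneg[of "d / 2" x] dilate_le[of "d / 2" x] dilate_nonneg[of "2 * d" x] dilate_le[of "2 * d" x] d
    by (auto simp: power_divide power_mult_distrib)
  moreover have "1 / (8 * d ^ 3) \<le> 8 / d ^ 3" using d by (simp add: field_simps)
  ultimately show ?thesis unfolding phi_def by linarith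
qed

lemma phi_eq_0: "d > 0 \<Longrightarrow> 4 * d \<le> norm x \<Longrightarrow> phi d x = 0"
  by (auto simp: phi_def dilate_eq_0)

lemma integrable_phi: "d > 0 \<Longrightarrow> integrable lborel (phi d)"
  unfolding phi_def[abs_def] by (intro Bochner_Integration.integrable_diff integrable_dilate) auto

lemma phihat_eq:
  assumes d: "d > 0"
  shows "phihat d \<xi> = chihat ((d / 2) *\<^sub>R \<xi>) - chihat ((2 * d) *\<^sub>R \<xi>)"
proof -
  have i: "integrable lborel (\<lambda>x. complex_of_real (dilate chi w x) * cis (\<xi> \<bullet> x))" if "w > 0" for w
    by (rule Bochner_Integration.integrable_bound[OF integrable_dilate[OF that]]) (auto simp: norm_mult)
  have "phihat d \<xi> = (LINT x|lborel. complex_of_real (dilate chi (d / 2) x) * cis (\<xi> \<bullet> x) - complex_of_real (dilate chi (2 * d) x) * cis (\<xi> \<bullet> x))"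
    unfolding phihat_def phi_def by (simp add: algebra_simps)
  also have "\<dots> = chihat ((d / 2) *\<^sub>R \<xi>) - chihat ((2 * d) *\<^sub>R \<xi>)"
    using d by (subst Bochner_Integration.integral_diff) (auto intro!: i simp: dilate_fourier)
  finally show ?thesis .
qed

text \<open>A band-pass filter around frequency 1/d. Near the origin the two transforms cancel, with
  the Lipschitz constant of \<open>chihat\<close>; far out each of them decays. The factor 2^m
  appears because 1 + d |\<xi>| is at most twice 1 + (d/2) |\<xi>|.\<close>

lemma phihat_bounds:
  "\<exists>C\<ge>0. \<forall>d>0. \<forall>\<xi>. cmod (phihat d \<xi>) \<le> C * (d * norm \<xi>) \<and> cmod (phihat d \<xi>) * (1 + d * norm \<xi>) ^ m \<le> C"
proof -
  obtain A where A: "A \<ge> 0" "\<And>\<zeta>. cmod (chihat \<zeta>) * (1 + norm \<zeta>) ^ m \<le> A"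
    using chihat_decay by blast
  obtain K where K: "K \<ge> 0" "\<And>\<zeta> \<zeta>'. cmod (chihat \<zeta> - chihat \<zeta>') \<le> K * norm (\<zeta> - \<zeta>')"
    using chihat_lipschitz by blast
  show ?thesis
  proof (intro exI conjI allI impI)
    show "0 \<le> 2 * K + (2 ^ m * A + A)" using A K by simp
    fix d :: real and \<xi> :: "real^3" assume d: "d > 0"
    have "cmod (phihat d \<xi>) \<le> K * norm ((d / 2) *\<^sub>R \<xi> - (2 * d) *\<^sub>R \<xi>)"
      unfolding phihat_eq[OF d] by (rule K)
    also have "norm ((d / 2) *\<^sub>R \<xi> - (2 * d) *\<^sub>R \<xi>) = 3 / 2 * (d * norm \<xi>)"
      using d by (simp flip: scaleR_left_diff_distrib)
    also have "K * (3 / 2 * (d * norm \<xi>)) \<le> (2 * K) * (d * norm \<xi>)"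
      using K d by (simp add: mult_right_mono mult.assoc[symmetric])
    also have "\<dots> \<le> (2 * K + (2 ^ m * A + A)) * (d * norm \<xi>)"
      using A d by (intro mult_right_mono) auto
    finally show "cmod (phihat d \<xi>) \<le> (2 * K + (2 ^ m * A + A)) * (d * norm \<xi>)" .
    have n: "0 \<le> d * norm \<xi>" using d by simp
    have 1: "cmod (chihat ((d / 2) *\<^sub>R \<xi>)) * (1 + d * norm \<xi>) ^ m \<le> 2 ^ m * A"
    proof -
      have "cmod (chihat ((d / 2) *\<^sub>R \<xi>)) * (1 + d * norm \<xi>) ^ m \<le> cmod (chihat ((d / 2) *\<^sub>R \<xi>)) * (2 * (1 + norm ((d / 2) *\<^sub>R \<xi>))) ^ m"
        using d n by (intro mult_left_mono power_mono) auto
      also have "\<dots> = 2 ^ m * (cmod (chihat ((d / 2) *\<^sub>R \<xi>)) * (1 + norm ((d / 2) *\<^sub>R \<xi>)) ^ m)"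
        by (simp only: power_mult_distrib mult_ac)
      also have "\<dots> \<le> 2 ^ m * A" by (intro mult_left_mono A) auto
      finally show ?thesis .
    qed
    have 2: "cmod (chihat ((2 * d) *\<^sub>R \<xi>)) * (1 + d * norm \<xi>) ^ m \<le> A"
    proof -
      have "cmod (chihat ((2 * d) *\<^sub>R \<xi>)) * (1 + d * norm \<xi>) ^ m \<le> cmod (chihat ((2 * d) *\<^sub>R \<xi>)) * (1 + norm ((2 * d) *\<^sub>R \<xi>)) ^ m"
        using d n by (intro mult_left_mono power_mono) auto
      also have "\<dots> \<le> A" by (rule A)
      finally show ?thesis .
    qed
    have "cmod (phihat d \<xi>) * (1 + d * norm \<xi>) ^ m \<le> (cmod (chihat ((d / 2) *\<^sub>R \<xi>)) + cmod (chihat ((2 * d) *\<^sub>R \<xi>))) * (1 + d * norm \<xi>) ^ m"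
      unfolding phihat_eq[OF d] using n by (intro mult_right_mono norm_triangle_ineq4) auto
    also have "\<dots> \<le> 2 ^ m * A + A" using 1 2 by (simp add: distrib_right)
    finally show "cmod (phihat d \<xi>) * (1 + d * norm \<xi>) ^ m \<le> 2 * K + (2 ^ m * A + A)"
      using K by linarith
  qed
qed

text \<open>The profile of chi along a line, normalised to integral 1, is convolved with the
  indicator of [-12, 12]. The profile lives in [-2, 2], whence 10 = 12 - 2 and 14 = 12 + 2. Finite
  differences of the convolution fall on the smooth profile, and this yields decay of every
  order.\<close>

lemma line_cutoff:
  "\<exists>\<beta>::real \<Rightarrow> real. \<beta> \<in> borel_measurable borel \<and> (\<forall>t. 0 \<le> \<beta> t \<and> \<beta> t \<le> 1) \<and> (\<forall>t. \<bar>t\<bar> > 14 \<longrightarrow> \<beta> t = 0) \<and>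
    (\<forall>t. \<bar>t\<bar> \<le> 10 \<longrightarrow> \<beta> t = 1) \<and>
    (\<forall>m. \<exists>C\<ge>0. \<forall>s. cmod (LINT t|lborel. complex_of_real (\<beta> t) * cis (s * t)) * \<bar>s\<bar> ^ m \<le> C)"
proof -
  define e where "e = (axis 1 1 :: real^3)"
  have e: "norm e = 1" by (simp add: e_def norm_axis_1)
  define k where "k = (\<lambda>s. chi (s *\<^sub>R e))"
  have [measurable]: "k \<in> borel_measurable borel" unfolding k_def by measurable
  have k: "0 \<le> k s" "k s \<le> 1" "\<bar>s\<bar> \<ge> 2 \<Longrightarrow> k s = 0" "\<bar>s\<bar> \<le> 1/2 \<Longrightarrow> 1/2 \<le> k s" for s
    using e chi_ge_half[of "s *\<^sub>R e"] by (auto simp: k_def chi_nonneg chi_le_1 intro!: chi_eq_0)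
  have ik: "integrable lborel k"
    by (rule integrable_bounded_support[of k 1 2]) (auto simp: k)
  define c where "c = (LINT s|lborel. k s)"
  have "(1 / 2 :: real) = (LINT s|lborel. (1 / 2) * indicator {-1/2..1/2::real} s)" by simp
  also have "\<dots> \<le> c" unfolding c_def
  proof (rule integral_mono[OF _ ik])
    show "integrable lborel (\<lambda>s. (1 / 2) * indicator {-1/2..1/2::real} s :: real)" by simp
    show "(1 / 2) * indicator {-1/2..1/2::real} s \<le> k s" for s
      using k(1)[of s] k(4)[of s] by (cases "\<bar>s\<bar> \<le> 1/2") (auto simp: indicator_def abs_le_iff)
  qed
  finally have c: "c \<ge> 1 / 2" .
  define ind where "ind = (indicator {-12..12} :: real \<Rightarrow> real)"
  have [measurable]: "ind \<in> borel_measurable borel" unfolding ind_def by measurable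
  define \<beta> where "\<beta> = (\<lambda>t. (LINT s|lborel. k (t - s) * ind s) / c)"
  have kshift: "integrable lborel (\<lambda>s. k (t - s))" "(LINT s|lborel. k (t - s)) = c" for t
    using lborel_integral_affine[of k "-1" t] ik by (auto simp: c_def)
  have int: "integrable lborel (\<lambda>s. k (t - s) * ind s)" for t
    by (rule Bochner_Integration.integrable_bound[OF kshift(1)[of t]]) (auto simp: ind_def indicator_def k)
  have 0: "0 \<le> \<beta> t" for t
    unfolding \<beta>_def using c by (intro divide_nonneg_nonneg integral_nonneg_AE) (auto simp: k ind_def)
  have 1: "\<beta> t \<le> 1" for t
  proof -
    have "(LINT s|lborel. k (t - s) * ind s) \<le> (LINT s|lborel. k (t - s))"
      by (rule integral_mono[OF int kshift(1)]) (auto simp: ind_def indicator_def k)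
    then show ?thesis using c by (simp add: \<beta>_def kshift)
  qed
  have 2: "\<beta> t = 0" if "\<bar>t\<bar> > 14" for t
  proof -
    have "k (t - s) * ind s = 0" for s
    proof (cases "2 \<le> \<bar>t - s\<bar>")
      case False
      then have "s \<notin> {-12..12}" using that by auto
      then show ?thesis by (simp add: ind_def)
    qed (simp add: k)
    then have "(\<lambda>s. k (t - s) * ind s) = (\<lambda>s. 0)" by blast
    then show ?thesis by (simp only: \<beta>_def) simp
  qed
  have 3: "\<beta> t = 1" if "\<bar>t\<bar> \<le> 10" for t
  proof -
    have "k (t - s) * ind s = k (t - s)" for s
    proof (cases "2 \<le> \<bar>t - s\<bar>")
      case False
      then have "s \<in> {-12..12}" using that by auto
      then show ?thesis by (simp add: ind_def)
    qed (simp add: k)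
    then show ?thesis using c by (simp only: \<beta>_def kshift) simp
  qed
  have [measurable]: "\<beta> \<in> borel_measurable borel" unfolding \<beta>_def by measurable
  have i\<beta>: "integrable lborel \<beta>"
    by (rule integrable_bounded_support[of \<beta> 1 14]) (auto simp: 0 1 2)
  have "\<exists>C\<ge>0. \<forall>s. cmod (LINT t|lborel. complex_of_real (\<beta> t) * cis (s * t)) * \<bar>s\<bar> ^ m \<le> C" for m
  proof -
    obtain D where D: "\<And>h x. \<bar>fdiff m (h *\<^sub>R e) chi x\<bar> \<le> D * \<bar>h\<bar> ^ m"
      using smooth_fdiff_bound[OF smooth_chi, of 2 m e] chi_eq_0 by force
    have fk: "fdiff j h k t = fdiff j (h *\<^sub>R e) chi (t *\<^sub>R e)" for j h t
      by (induction j arbitrary: t) (auto simp: k_def scaleR_add_left)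
    have fint: "integrable lborel (\<lambda>s. fdiff j h k (t - s) * ind s)" for j h t
    proof -
      have a: "integrable lborel (fdiff j h k)" by (rule fdiff_fourier(1)[OF ik])
      have "integrable lborel (\<lambda>s. fdiff j h k (t - s))"
        using lborel_integral_affine(2)[of "fdiff j h k" "-1" t] a by simp
      then show ?thesis
        by (rule Bochner_Integration.integrable_bound) (auto simp: ind_def indicator_def)
    qed
    have f\<beta>: "fdiff j h \<beta> t = (LINT s|lborel. fdiff j h k (t - s) * ind s) / c" for j h t
    proof (induction j arbitrary: t)
      case (Suc j)
      show ?case
        using fint[of j h t] fint[of j h "t + h"]
        by (simp add: Suc.IH left_diff_distrib diff_divide_distrib algebra_simps)
    qed (simp add: \<beta>_def)
    have b: "\<bar>fdiff m (h *\<^sub>R 1) \<beta> t\<bar> \<le> (24 * D / c) * \<bar>h\<bar> ^ m" for h t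
    proof -
      have "norm (LINT s|lborel. fdiff m h k (t - s) * ind s) \<le> (D * \<bar>h\<bar> ^ m) * measure lborel (cball 0 12 :: real set)"
      proof (rule integrable_bounded_support(2))
        show "norm (fdiff m h k (t - s) * ind s) \<le> D * \<bar>h\<bar> ^ m" for s
          using D[of h "(t - s) *\<^sub>R e"] by (auto simp: fk ind_def indicator_def intro: order_trans[OF abs_ge_zero])
      qed (auto simp: ind_def indicator_def)
      moreover have "measure lborel (cball 0 12 :: real set) = 24"
        by (simp add: cball_eq_atLeastAtMost)
      ultimately have "\<bar>LINT s|lborel. fdiff m h k (t - s) * ind s\<bar> / c \<le> (D * \<bar>h\<bar> ^ m * 24) / c"
        using c by (intro divide_right_mono) auto
      then show ?thesis using c by (simp add: f\<beta> mult_ac)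
    qed
    obtain C where C: "C \<ge> 0" "\<And>\<zeta>. 1 \<le> \<bar>\<zeta> \<bullet> (1::real)\<bar> \<Longrightarrow> cmod (LINT x|lborel. complex_of_real (\<beta> x) * cis (\<zeta> \<bullet> x)) * \<bar>\<zeta> \<bullet> 1\<bar> ^ m \<le> C"
      using fourier_decay_direction[of \<beta> 1 14 m "24 * D / c"] i\<beta> b 2 by auto
    show ?thesis
    proof (intro exI conjI allI)
      show "0 \<le> C + 28" using C by simp
      fix s :: real
      show "cmod (LINT t|lborel. complex_of_real (\<beta> t) * cis (s * t)) * \<bar>s\<bar> ^ m \<le> C + 28"
      proof (cases "1 \<le> \<bar>s\<bar>")
        case True
        then show ?thesis using C(2)[of s] by simp
      next
        case False
        have "cmod (LINT t|lborel. complex_of_real (\<beta> t) * cis (s * t)) \<le> 1 * measure lborel (cball 0 14 :: real set)"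
          by (rule integrable_bounded_support(2)) (auto simp: norm_mult 0 1 2)
        moreover have "measure lborel (cball 0 14 :: real set) = 28"
          by (simp add: cball_eq_atLeastAtMost)
        moreover have "\<bar>s\<bar> ^ m \<le> 1" using False by (intro power_le_one) auto
        ultimately have "cmod (LINT t|lborel. complex_of_real (\<beta> t) * cis (s * t)) * \<bar>s\<bar> ^ m \<le> 28 * 1"
          by (intro mult_mono) auto
        then show ?thesis using C by simp
      qed
    qed
  qed
  then show ?thesis using 0 1 2 3 by (intro exI[of _ \<beta>]) auto
qed

end

section \<open>Points and lines as functions\<close>

lemma card_le_fibres:
  assumes D: "finite D" and K: "finite K" and f: "f ` D \<subseteq> K"
    and M: "\<And>k. k \<in> K \<Longrightarrow> card {x \<in> D. f x = k} \<le> M"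
  shows "card D \<le> card K * M"
proof -
  have "D = (\<Union>k\<in>K. {x \<in> D. f x = k})" using f by auto
  then have "card D \<le> (\<Sum>k\<in>K. card {x \<in> D. f x = k})"
    using card_UN_le[OF K, of "\<lambda>k. {x \<in> D. f x = k}"] by simp
  also have "\<dots> \<le> (\<Sum>k\<in>K. M)" by (intro sum_mono M)
  finally show ?thesis by simp
qed

lemma M_points_ge:
  assumes "finite P" "Q \<in> boxes d d d"
  shows "card (P \<inter> Q) \<le> M_points P d"
proof -
  have "(\<lambda>Q. card (P \<inter> Q)) ` boxes d d d \<subseteq> {..card P}"
    using assms(1) by (auto intro: card_mono)
  then show ?thesis
    unfolding M_points_def using assms(2) by (intro Max_ge) (auto intro: finite_subset)
qed

text \<open>Cubes of side d on the grid with corner p: every coordinate of (q - p)/d has its floor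
  between -4 and 4, and 9^3 = 729.\<close>

lemma card_near_point_le:
  assumes P: "finite P" and d: "d > 0"
  shows "card {q \<in> P. norm (q - p) \<le> 4 * d} \<le> 729 * M_points P d"
proof -
  define fl where "fl = (\<lambda>(q::real^3) (i::3). \<lfloor>(q $ i - p $ i) / d\<rfloor>)"
  define f where "f = (\<lambda>q. (fl q 1, fl q 2, fl q 3))"
  let ?D = "{q \<in> P. norm (q - p) \<le> 4 * d}"
  let ?K = "{-4..4::int} \<times> {-4..4::int} \<times> {-4..4::int}"
  have "card ?D \<le> card ?K * M_points P d"
  proof (rule card_le_fibres)
    have "fl q i \<in> {-4..4}" if "norm (q - p) \<le> 4 * d" for q i
    proof -
      have "\<bar>q $ i - p $ i\<bar> \<le> 4 * d"
        using component_le_norm_cart[of "q - p" i] that by simp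
      then have "-4 \<le> (q $ i - p $ i) / d" "(q $ i - p $ i) / d \<le> 4"
        using d by (auto simp: field_simps abs_le_iff)
      then show ?thesis unfolding fl_def by (auto simp: le_floor_iff floor_le_iff)
    qed
    then show "f ` ?D \<subseteq> ?K" by (auto simp: f_def)
    fix k :: "int \<times> int \<times> int"
    obtain k1 k2 k3 where k: "k = (k1, k2, k3)" by (cases k)
    define c where "c = p + d *\<^sub>R (vector [real_of_int k1, real_of_int k2, real_of_int k3] :: real^3)"
    let ?B = "(\<lambda>x. c + x) ` cbox 0 (vector [d, d, d] :: real^3)"
    have "?B \<in> boxes d d d"
      unfolding boxes_def by (intro CollectI exI[of _ c] exI[of _ "\<lambda>x. x"]) simp
    moreover have "{q \<in> ?D. f q = k} \<subseteq> P \<inter> ?B"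
    proof (rule subsetI)
      fix q assume "q \<in> {q \<in> ?D. f q = k}"
      then have q: "q \<in> P" "f q = k" by auto
      have "q - c \<in> cbox 0 (vector [d, d, d])"
      proof -
        have *: "real_of_int \<lfloor>y / d\<rfloor> * d \<le> y \<and> y \<le> real_of_int \<lfloor>y / d\<rfloor> * d + d" for y
          using floor_correct[of "y / d"] pos_le_divide_eq[OF d, of "real_of_int \<lfloor>y / d\<rfloor>" y]
            pos_divide_less_eq[OF d, of y "real_of_int \<lfloor>y / d\<rfloor> + 1"]
          by (auto simp: distrib_right)
        show ?thesis
          using q(2) *[of "q $ 1 - p $ 1"] *[of "q $ 2 - p $ 2"] *[of "q $ 3 - p $ 3"]
          by (auto simp: f_def fl_def k c_def mem_box_cart forall_3 vector_3 mult.commute)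
      qed
      then have "q \<in> ?B" by (auto intro: image_eqI[of _ _ "q - c"])
      then show "q \<in> P \<inter> ?B" using q by simp
    qed
    ultimately show "card {q \<in> ?D. f q = k} \<le> M_points P d"
      using M_points_ge[OF P] card_mono[of "P \<inter> ?B"] P by (meson finite_Int le_trans)
  qed (use P in auto)
  then show ?thesis by simp
qed

text \<open>The quadratic s^2 A + 2 s B + C is non-negative for all s. For A > 0 it is evaluated at
  its minimum; for A = 0 a non-zero linear coefficient would push it to -1 somewhere.\<close>

lemma integral_Cauchy_Schwarz:
  fixes F G :: "'a \<Rightarrow> real"
  assumes F: "integrable M (\<lambda>x. (F x)\<^sup>2)" and G: "integrable M (\<lambda>x. (G x)\<^sup>2)" and FG: "integrable M (\<lambda>x. F x * G x)"
  shows "(LINT x|M. F x * G x)\<^sup>2 \<le> (LINT x|M. (F x)\<^sup>2) * (LINT x|M. (G x)\<^sup>2)"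
proof -
  define A where "A = (LINT x|M. (F x)\<^sup>2)"
  define B where "B = (LINT x|M. F x * G x)"
  define C where "C = (LINT x|M. (G x)\<^sup>2)"
  have q: "0 \<le> s\<^sup>2 * A + 2 * s * B + C" for s
  proof -
    have "0 \<le> (LINT x|M. (s * F x + G x)\<^sup>2)" by simp
    also have "\<dots> = (LINT x|M. s\<^sup>2 * (F x)\<^sup>2 + 2 * s * (F x * G x) + (G x)\<^sup>2)"
      by (simp add: power2_eq_square algebra_simps)
    also have "\<dots> = s\<^sup>2 * A + 2 * s * B + C"
      unfolding A_def B_def C_def using F G FG by simp
    finally show ?thesis .
  qed
  have "A \<ge> 0" unfolding A_def by simp
  show ?thesis
  proof (cases "A = 0")
    case True
    have "B = 0"
    proof (rule ccontr)
      assume "B \<noteq> 0"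
      then show False using q[of "- (C + 1) / (2 * B)"] True by (simp add: field_simps)
    qed
    then show ?thesis using True by (simp add: A_def B_def)
  next
    case False
    then have "A > 0" using \<open>A \<ge> 0\<close> by simp
    have "0 \<le> A * ((- B / A)\<^sup>2 * A + 2 * (- B / A) * B + C)"
      by (rule mult_nonneg_nonneg[OF less_imp_le[OF \<open>A > 0\<close>] q])
    also have "\<dots> = A * C - B\<^sup>2" using \<open>A > 0\<close> by (simp add: field_simps power2_eq_square)
    finally show ?thesis by (simp add: A_def B_def C_def)
  qed
qed

context bump_function
begin

lemma overlap_le:
  assumes d: "d > 0"
  shows "(LINT y|lborel. dilate chi d (y - p) * dilate chi d (y - q)) \<le>
    (if norm (q - p) \<le> 4 * d then 8 * unit_ball_vol 3 / d ^ 3 else 0)"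
proof (cases "norm (q - p) \<le> 4 * d")
  case True
  have "norm (LINT y|lborel. dilate chi d (p + 1 *\<^sub>R y - p) * dilate chi d (p + 1 *\<^sub>R y - q)) \<le> (1 / d ^ 3 * (1 / d ^ 3)) * measure lborel (cball 0 (2 * d) :: (real^3) set)"
  proof (rule integrable_bounded_support(2))
    show "norm (dilate chi d (p + 1 *\<^sub>R x - p) * dilate chi d (p + 1 *\<^sub>R x - q)) \<le> 1 / d ^ 3 * (1 / d ^ 3)" for x
      unfolding norm_mult using d by (intro mult_mono) (auto simp: dilate_nonneg dilate_le abs_of_nonneg)
  qed (use d in \<open>auto simp: dilate_eq_0\<close>)
  also have "measure lborel (cball 0 (2 * d) :: (real^3) set) = unit_ball_vol 3 * (2 * d) ^ 3"
    using d by (subst content_cball) auto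
  also have "1 / d ^ 3 * (1 / d ^ 3) * (unit_ball_vol 3 * (2 * d) ^ 3) = 8 * unit_ball_vol 3 / d ^ 3"
    using d by (simp add: power_mult_distrib field_simps eval_nat_numeral)
  finally have "norm (LINT y|lborel. dilate chi d (p + 1 *\<^sub>R y - p) * dilate chi d (p + 1 *\<^sub>R y - q)) \<le> 8 * unit_ball_vol 3 / d ^ 3"
    .
  moreover have "(LINT y|lborel. dilate chi d (y - p) * dilate chi d (y - q)) = (LINT y|lborel. dilate chi d (p + 1 *\<^sub>R y - p) * dilate chi d (p + 1 *\<^sub>R y - q))"
    using lborel_integral_affine(1)[of "\<lambda>y. dilate chi d (y - p) * dilate chi d (y - q)" 1 p] by simp
  ultimately show ?thesis using True by simp
next
  case False
  have "dilate chi d (y - p) * dilate chi d (y - q) = 0" for y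
  proof (rule ccontr)
    assume "\<not> ?thesis"
    then have "norm (y - p) < 2 * d" "norm (y - q) < 2 * d"
      using dilate_eq_0[OF d] by (auto simp: not_le[symmetric])
    then show False using False norm_triangle_sub[of "q - p" "y - p"] norm_minus_commute[of y q]
      by (auto simp: algebra_simps)
  qed
  then have "(\<lambda>y. dilate chi d (y - p) * dilate chi d (y - q)) = (\<lambda>y. 0)" by blast
  then show ?thesis using False by (simp only:) simp
qed

definition point_mass :: "(real^3) set \<Rightarrow> real \<Rightarrow> real^3 \<Rightarrow> real" where
  "point_mass P d y = (\<Sum>p\<in>P. dilate chi d (y - p))"

text \<open>After expanding the square only pairs of points at distance at most 4 d survive. Each
  such pair contributes at most a constant times d^-3, and each point has at most 729
  \<open>M_points P d\<close> partners, itself included.\<close>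

lemma point_mass_square:
  assumes P: "finite P" and d: "d > 0"
  shows "integrable lborel (\<lambda>y. (point_mass P d y)\<^sup>2)"
    and "(LINT y|lborel. (point_mass P d y)\<^sup>2) \<le> (729 * 8 * unit_ball_vol 3) / d ^ 3 * real (card P) * real (M_points P d)"
proof -
  have int: "integrable lborel (\<lambda>y. dilate chi d (y - p) * dilate chi d (y - q))" for p q
  proof -
    have "integrable lborel (\<lambda>y. dilate chi d (y - p))"
      using lborel_integral_affine(2)[of "dilate chi d" 1 "- p"] integrable_dilate[OF d] by (simp add: add.commute)
    then have "integrable lborel (\<lambda>y. dilate chi d (y - p) * (1 / d ^ 3))" by simp
    then show ?thesis
      by (rule Bochner_Integration.integrable_bound)
         (use d in \<open>auto simp: abs_mult dilate_nonneg intro!: AE_I2 divide_right_mono\<close>,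
          use d dilate_le[OF d] dilate_nonneg[OF d] in \<open>metis (no_types) mult_left_mono times_divide_eq_right mult_1_right abs_of_nonneg\<close>)
  qed
  have sq: "(point_mass P d y)\<^sup>2 = (\<Sum>p\<in>P. \<Sum>q\<in>P. dilate chi d (y - p) * dilate chi d (y - q))" for y
    unfolding point_mass_def power2_eq_square by (rule sum_product)
  show "integrable lborel (\<lambda>y. (point_mass P d y)\<^sup>2)"
    unfolding sq by (intro Bochner_Integration.integrable_sum int)
  let ?c = "8 * unit_ball_vol 3 / d ^ 3"
  have c: "?c \<ge> 0" using d by simp
  have "(LINT y|lborel. (point_mass P d y)\<^sup>2) = (\<Sum>p\<in>P. \<Sum>q\<in>P. (LINT y|lborel. dilate chi d (y - p) * dilate chi d (y - q)))"
    unfolding sq by (simp add: Bochner_Integration.integral_sum int)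
  also have "\<dots> \<le> (\<Sum>p\<in>P. \<Sum>q\<in>P. if norm (q - p) \<le> 4 * d then ?c else 0)"
    by (intro sum_mono overlap_le d)
  also have "\<dots> = (\<Sum>p\<in>P. real (card {q \<in> P. norm (q - p) \<le> 4 * d}) * ?c)"
    using P by (intro sum.cong refl) (simp add: sum.If_cases Int_def)
  also have "\<dots> \<le> (\<Sum>p\<in>P. real (729 * M_points P d) * ?c)"
    by (intro sum_mono mult_right_mono c) (use card_near_point_le[OF P d] in \<open>simp only: of_nat_le_iff\<close>)
  also have "\<dots> = (729 * 8 * unit_ball_vol 3) / d ^ 3 * real (card P) * real (M_points P d)"
    by simp
  finally show "(LINT y|lborel. (point_mass P d y)\<^sup>2) \<le> (729 * 8 * unit_ball_vol 3) / d ^ 3 * real (card P) * real (M_points P d)" .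
qed

section \<open>The kernel \<open>eta\<close> integrated along a line\<close>

lemma eta_support:
  assumes w: "w > 0" and x: "3 * w \<le> norm x"
  shows "eta chi w x = 0"
proof -
  have "dilate chi w y * dilate chi (w / 2) (x - y) = 0" for y
  proof (cases "2 * w \<le> norm y")
    case False
    have "norm x \<le> norm y + norm (x - y)" by (metis add.commute diff_add_cancel norm_triangle_ineq)
    then have "2 * (w / 2) \<le> norm (x - y)" using False x by simp
    then show ?thesis using w dilate_eq_0[of "w / 2"] by simp
  qed (use w in \<open>simp add: dilate_eq_0\<close>)
  then show ?thesis by (simp only: eta_def convolve_def) simp
qed

lemma integrable_dilate_mult:
  fixes g :: "real^3 \<Rightarrow> real"
  assumes w: "w > 0" and [measurable]: "g \<in> borel_measurable borel" and g: "\<And>y. \<bar>g y\<bar> \<le> K"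
  shows "integrable lborel (\<lambda>y. dilate chi w (y - p) * g y)"
    and "\<bar>LINT y|lborel. dilate chi w y * g y\<bar> \<le> 1 / w ^ 3 * K * measure lborel (cball 0 (2 * w) :: (real^3) set)"
proof -
  have K: "K \<ge> 0" using g[of 0] by linarith
  have b: "norm (dilate chi w (y - p) * g y) \<le> 1 / w ^ 3 * K" for y p :: "real^3"
    unfolding norm_mult using w g K by (intro mult_mono) (auto simp: dilate_nonneg dilate_le abs_of_nonneg)
  show "integrable lborel (\<lambda>y. dilate chi w (y - p) * g y)"
  proof (rule integrable_bounded_support(1)[where r = "norm p + 2 * w"])
    fix y :: "real^3" assume "norm y > norm p + 2 * w"
    then have "2 * w \<le> norm (y - p)" using norm_triangle_sub[of y p] by simp
    then show "dilate chi w (y - p) * g y = 0" using w by (simp add: dilate_eq_0)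
  qed (measurable, rule b)
  show "\<bar>LINT y|lborel. dilate chi w y * g y\<bar> \<le> 1 / w ^ 3 * K * measure lborel (cball 0 (2 * w) :: (real^3) set)"
    unfolding real_norm_def[symmetric]
    using b[of _ 0] w by (intro integrable_bounded_support(2)) (auto simp: dilate_eq_0)
qed

lemma eta_measurable [measurable]: "eta chi w \<in> borel_measurable borel"
  unfolding eta_def convolve_def[abs_def] by measurable

lemma eta_line_integrable:
  assumes w: "w > 0" and v: "norm v = 1"
  shows "integrable lborel (\<lambda>t. eta chi w (a + t *\<^sub>R v))"
proof (rule integrable_bounded_support(1)[where r = "norm a + 3 * w"])
  have "\<bar>dilate chi (w / 2) z\<bar> \<le> 8 / w ^ 3" for z
    using dilate_nonneg[of "w / 2" z] dilate_le[of "w / 2" z] w by (simp add: power_divide)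
  then show "norm (eta chi w (a + t *\<^sub>R v)) \<le> 1 / w ^ 3 * (8 / w ^ 3) * measure lborel (cball 0 (2 * w) :: (real^3) set)" for t
    unfolding eta_def convolve_def real_norm_def by (intro integrable_dilate_mult(2) w) auto
  fix t :: real assume t: "norm t > norm a + 3 * w"
  have "norm (t *\<^sub>R v) \<le> norm (a + t *\<^sub>R v) + norm a"
    by (metis add_diff_cancel_left' norm_triangle_ineq4)
  then have "3 * w \<le> norm (a + t *\<^sub>R v)" using t v by simp
  then show "eta chi w (a + t *\<^sub>R v) = 0" by (rule eta_support[OF w])
qed measurable

text \<open>\<open>dilate chi d\<close> is the first factor of the convolution
  \<open>eta chi d\<close> and the second factor of \<open>eta chi (2 * d)\<close>. One translation
  and one reflection bring it to the same variable in both, and the other factors subtract to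
  \<open>phi d\<close>.\<close>

lemma eta_diff:
  assumes d: "d > 0"
  shows "eta chi d (x - p) - eta chi (2 * d) (x - p) = (LINT y|lborel. dilate chi d (y - p) * phi d (x - y))"
proof -
  let ?f = "\<lambda>y. dilate chi d (y - p) * dilate chi (d / 2) (x - y)"
  let ?g = "\<lambda>y. dilate chi (2 * d) (x - y) * dilate chi d (y - p)"
  have b: "\<bar>dilate chi w z\<bar> \<le> 1 / w ^ 3" if "w > 0" for w z
    using that by (simp add: dilate_nonneg dilate_le)
  have 1: "eta chi d (x - p) = (LINT y|lborel. ?f y)"
    unfolding eta_def convolve_def
    using lborel_integral_affine(1)[of ?f 1 p] by (simp add: algebra_simps)
  have 2: "eta chi (2 * d) (x - p) = (LINT y|lborel. ?g y)"
    unfolding eta_def convolve_def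
    using lborel_integral_affine(1)[of ?g "-1" x] by (simp add: algebra_simps)
  have "integrable lborel ?f" "integrable lborel ?g"
    using integrable_dilate_mult(1)[OF d, of "\<lambda>y. dilate chi (d / 2) (x - y)" "1 / (d / 2) ^ 3" p]
      integrable_dilate_mult(1)[OF d, of "\<lambda>y. dilate chi (2 * d) (x - y)" "1 / (2 * d) ^ 3" p] b[of "d / 2"] b[of "2 * d"] d
    by (simp_all add: mult.commute)
  then show ?thesis
    unfolding 1 2 by (subst Bochner_Integration.integral_diff[symmetric]) (auto simp: phi_def algebra_simps)
qed

text \<open>The measure with density \<beta> along the line, convolved with the even function
  \<open>phi d\<close>.\<close>

definition line_wave :: "(real \<Rightarrow> real) \<Rightarrow> real \<Rightarrow> real^3 \<Rightarrow> real^3 \<Rightarrow> real^3 \<Rightarrow> real" where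
  "line_wave \<beta> d a v y = (LINT t|lborel. \<beta> t * phi d (a + t *\<^sub>R v - y))"

lemma eta_line_diff:
  assumes d: "0 < d" "d < 1" and v: "norm v = 1" and a: "norm a \<le> 1" and p: "norm p \<le> 2"
    and [measurable]: "\<beta> \<in> borel_measurable borel" and i\<beta>: "integrable lborel \<beta>" and \<beta>: "\<And>t. \<bar>t\<bar> \<le> 10 \<Longrightarrow> \<beta> t = 1"
  shows "(LINT x|arc_length (line_at a v). eta chi d (x - p)) - (LINT x|arc_length (line_at a v). eta chi (2 * d) (x - p))
    = (LINT y|lborel. dilate chi d (y - p) * line_wave \<beta> d a v y)"
    and "integrable lborel (\<lambda>y. dilate chi d (y - p) * line_wave \<beta> d a v y)"
proof -
  have arc: "(LINT x|arc_length (line_at a v). eta chi w (x - p)) = (LINT t|lborel. eta chi w (a + t *\<^sub>R v - p))" for w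
    unfolding arc_length_line_at[OF v] by (rule integral_distr) auto
  have int: "integrable lborel (\<lambda>t. eta chi w (a + t *\<^sub>R v - p))" if "w > 0" for w
    using eta_line_integrable[OF that v, of "a - p"] by (simp add: algebra_simps)
  \<comment> \<open>If both factors are non-zero then |t| < 4 d + 2 d + norm p + norm a < 9. So
    \<beta> equals 1 wherever the integrand does not vanish, and cutting the line off changes
    nothing.\<close>
  have zero: "dilate chi d (y - p) * phi d (a + t *\<^sub>R v - y) = 0" if "\<not> \<bar>t\<bar> \<le> 10" for t y
  proof (rule ccontr)
    assume "\<not> ?thesis"
    then have 1: "norm (y - p) < 2 * d" "norm (a + t *\<^sub>R v - y) < 4 * d"
      using dilate_eq_0 phi_eq_0 d by (auto simp: not_le[symmetric])
    have "\<bar>t\<bar> = norm ((a + t *\<^sub>R v - y) + (y - p) + p - a)" using v by simp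
    also have "\<dots> \<le> norm (a + t *\<^sub>R v - y) + norm (y - p) + norm p + norm a"
      by (rule order_trans[OF norm_triangle_ineq4]) (intro add_mono norm_triangle_le, auto)
    finally show False using that 1 d a p by simp
  qed
  have int2: "integrable (lborel \<Otimes>\<^sub>M lborel) (\<lambda>(t, y). \<beta> t * (dilate chi d (y - p) * phi d (a + t *\<^sub>R v - y)))"
  proof (rule Bochner_Integration.integrable_bound)
    have "integrable lborel (\<lambda>y. dilate chi d (y - p))"
      using lborel_integral_affine(2)[of "dilate chi d" 1 "- p"] integrable_dilate[of d] d by (simp add: add.commute)
    then show "integrable (lborel \<Otimes>\<^sub>M lborel) (\<lambda>(t, y). norm (\<beta> t) * (dilate chi d (y - p) * (8 / d ^ 3)))"
      using i\<beta> by (intro integrable_lborel_mult integrable_norm integrable_mult_left)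
    show "AE x in lborel \<Otimes>\<^sub>M lborel. norm (case x of (t, y) \<Rightarrow> \<beta> t * (dilate chi d (y - p) * phi d (a + t *\<^sub>R v - y)))
        \<le> norm (case x of (t, y) \<Rightarrow> norm (\<beta> t) * (dilate chi d (y - p) * (8 / d ^ 3)))"
    proof (rule AE_I2, clarify)
      fix t and y :: "real^3"
      have "norm (\<beta> t * (dilate chi d (y - p) * phi d (a + t *\<^sub>R v - y))) \<le> norm (\<beta> t) * (norm (dilate chi d (y - p)) * (8 / d ^ 3))"
        unfolding norm_mult using phi_bound[of d] d by (intro mult_left_mono) auto
      also have "\<dots> = norm (norm (\<beta> t) * (dilate chi d (y - p) * (8 / d ^ 3)))"
        using d by (simp add: abs_mult)
      finally show "norm (\<beta> t * (dilate chi d (y - p) * phi d (a + t *\<^sub>R v - y))) \<le> norm (norm (\<beta> t) * (dilate chi d (y - p) * (8 / d ^ 3)))" .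
    qed
  qed measurable
  have comm: "(LINT t|lborel. \<beta> t * (c * phi d (a + t *\<^sub>R v - y))) = c * (LINT t|lborel. \<beta> t * phi d (a + t *\<^sub>R v - y))" for c y
    unfolding integral_mult_right_zero[symmetric] by (simp only: mult.left_commute)
  have "(LINT x|arc_length (line_at a v). eta chi d (x - p)) - (LINT x|arc_length (line_at a v). eta chi (2 * d) (x - p))
    = (LINT t|lborel. eta chi d (a + t *\<^sub>R v - p) - eta chi (2 * d) (a + t *\<^sub>R v - p))"
    unfolding arc using d by (intro Bochner_Integration.integral_diff[symmetric] int) auto
  also have "\<dots> = (LINT t|lborel. (LINT y|lborel. \<beta> t * (dilate chi d (y - p) * phi d (a + t *\<^sub>R v - y))))"
  proof (intro Bochner_Integration.integral_cong refl)
    fix t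
    show "eta chi d (a + t *\<^sub>R v - p) - eta chi (2 * d) (a + t *\<^sub>R v - p)
      = (LINT y|lborel. \<beta> t * (dilate chi d (y - p) * phi d (a + t *\<^sub>R v - y)))"
      unfolding eta_diff[OF d(1)]
      by (intro Bochner_Integration.integral_cong refl) (use \<beta>[of t] zero[of t] in force)
  qed
  also have "\<dots> = (LINT y|lborel. (LINT t|lborel. \<beta> t * (dilate chi d (y - p) * phi d (a + t *\<^sub>R v - y))))"
    by (rule lborel_pair.Fubini_integral[OF int2, symmetric])
  also have "(\<lambda>y. (LINT t|lborel. \<beta> t * (dilate chi d (y - p) * phi d (a + t *\<^sub>R v - y))))
    = (\<lambda>y. dilate chi d (y - p) * line_wave \<beta> d a v y)"
    unfolding line_wave_def comm ..
  finally show "(LINT x|arc_length (line_at a v). eta chi d (x - p)) - (LINT x|arc_length (line_at a v). eta chi (2 * d) (x - p))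
    = (LINT y|lborel. dilate chi d (y - p) * line_wave \<beta> d a v y)" .
  have "integrable lborel (\<lambda>y. LINT t|lborel. \<beta> t * (dilate chi d (y - p) * phi d (a + t *\<^sub>R v - y)))"
    using lborel_pair.integrable_fst'[OF lborel_pair.integrable_product_swap[OF int2]] by simp
  then show "integrable lborel (\<lambda>y. dilate chi d (y - p) * line_wave \<beta> d a v y)"
    unfolding line_wave_def comm .
qed

definition line_fourier :: "(real \<Rightarrow> real) \<Rightarrow> real^3 \<Rightarrow> real^3 \<Rightarrow> real^3 \<Rightarrow> complex" where
  "line_fourier \<beta> a v \<xi> = (LINT t|lborel. complex_of_real (\<beta> t) * cis (\<xi> \<bullet> (a + t *\<^sub>R v)))"

lemma line_wave_fourier:
  assumes d: "0 < d" and [measurable]: "\<beta> \<in> borel_measurable borel" and i\<beta>: "integrable lborel \<beta>"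
  shows "(LINT y|lborel. complex_of_real (line_wave \<beta> d a v y) * cis (\<xi> \<bullet> y)) = phihat d \<xi> * line_fourier \<beta> a v \<xi>"
    and "integrable lborel (line_wave \<beta> d a v)"
proof -
  let ?\<gamma> = "\<lambda>t. a + t *\<^sub>R v"
  have i0: "integrable lborel (\<lambda>y. phi d (z - y))" for z
    using lborel_integral_affine(2)[of "phi d" "-1" z] integrable_phi[OF d] by simp
  have n0: "(LINT y|lborel. norm (phi d (z - y))) = (LINT y|lborel. norm (phi d y))" for z
    using lborel_integral_affine(1)[of "\<lambda>y. norm (phi d y)" "-1" z] by simp
  have int: "integrable (lborel \<Otimes>\<^sub>M lborel) (\<lambda>(t, y). complex_of_real (\<beta> t * phi d (?\<gamma> t - y)) * cis (\<xi> \<bullet> y))" for \<xi>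
  proof (rule lborel_pair.Fubini_integrable)
    show "integrable lborel (\<lambda>t. LINT y|lborel. norm (case (t, y) of (t, y) \<Rightarrow> complex_of_real (\<beta> t * phi d (?\<gamma> t - y)) * cis (\<xi> \<bullet> y)))"
      using i\<beta> by (simp add: norm_mult n0[unfolded real_norm_def])
    show "AE t in lborel. integrable lborel (\<lambda>y. case (t, y) of (t, y) \<Rightarrow> complex_of_real (\<beta> t * phi d (?\<gamma> t - y)) * cis (\<xi> \<bullet> y))"
    proof (rule AE_I2, simp only: case_prod_conv)
      fix t
      show "integrable lborel (\<lambda>y. complex_of_real (\<beta> t * phi d (?\<gamma> t - y)) * cis (\<xi> \<bullet> y))"
        by (rule Bochner_Integration.integrable_bound[OF integrable_mult_right[OF i0[of "?\<gamma> t"], of "\<beta> t"]]) (auto simp: norm_mult abs_mult)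
    qed
  qed measurable
  have wave: "complex_of_real (line_wave \<beta> d a v y) * cis (\<xi> \<bullet> y) = (LINT t|lborel. complex_of_real (\<beta> t * phi d (?\<gamma> t - y)) * cis (\<xi> \<bullet> y))" for y \<xi>
    unfolding line_wave_def integral_complex_of_real[symmetric] by simp
  have "(LINT y|lborel. complex_of_real (line_wave \<beta> d a v y) * cis (\<xi> \<bullet> y))
    = (LINT t|lborel. (LINT y|lborel. complex_of_real (\<beta> t * phi d (?\<gamma> t - y)) * cis (\<xi> \<bullet> y)))"
    unfolding wave by (rule lborel_pair.Fubini_integral[OF int])
  also have "\<dots> = (LINT t|lborel. phihat d \<xi> * (complex_of_real (\<beta> t) * cis (\<xi> \<bullet> ?\<gamma> t)))"
  proof (intro Bochner_Integration.integral_cong refl)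
    fix t
    have "(LINT y|lborel. complex_of_real (\<beta> t * phi d (?\<gamma> t - y)) * cis (\<xi> \<bullet> y))
      = (LINT z|lborel. complex_of_real (\<beta> t * phi d (?\<gamma> t - (?\<gamma> t + 1 *\<^sub>R z))) * cis (\<xi> \<bullet> (?\<gamma> t + 1 *\<^sub>R z)))"
      using lborel_integral_affine(1)[of "\<lambda>y. complex_of_real (\<beta> t * phi d (?\<gamma> t - y)) * cis (\<xi> \<bullet> y)" 1 "?\<gamma> t"] by simp
    also have "\<dots> = (LINT z|lborel. (complex_of_real (\<beta> t) * cis (\<xi> \<bullet> ?\<gamma> t)) * (complex_of_real (phi d z) * cis (\<xi> \<bullet> z)))"
      by (intro Bochner_Integration.integral_cong refl) (simp add: phi_minus inner_add_right cis_mult[symmetric])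
    also have "\<dots> = (complex_of_real (\<beta> t) * cis (\<xi> \<bullet> ?\<gamma> t)) * phihat d \<xi>"
      unfolding phihat_def by (rule integral_mult_right_zero)
    finally show "(LINT y|lborel. complex_of_real (\<beta> t * phi d (?\<gamma> t - y)) * cis (\<xi> \<bullet> y)) = phihat d \<xi> * (complex_of_real (\<beta> t) * cis (\<xi> \<bullet> ?\<gamma> t))"
      by (simp only: mult.commute)
  qed
  also have "\<dots> = phihat d \<xi> * line_fourier \<beta> a v \<xi>"
    unfolding line_fourier_def by (rule integral_mult_right_zero)
  finally show "(LINT y|lborel. complex_of_real (line_wave \<beta> d a v y) * cis (\<xi> \<bullet> y)) = phihat d \<xi> * line_fourier \<beta> a v \<xi>" .
  have "integrable lborel (\<lambda>y. LINT t|lborel. complex_of_real (\<beta> t * phi d (?\<gamma> t - y)) * cis (0 \<bullet> y))"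
    using lborel_pair.integrable_fst'[OF lborel_pair.integrable_product_swap[OF int[of 0]]] by simp
  then show "integrable lborel (line_wave \<beta> d a v)"
    unfolding wave[symmetric] by (simp add: complex_of_real_integrable_eq)
qed

text \<open>Supplies the hypotheses of \<open>plancherel_le\<close>. The radius 20 exceeds norm a +
  14 + 4 d.\<close>

lemma line_wave_regular:
  assumes d: "0 < d" "d < 1" and v: "norm v = 1" and a: "norm a \<le> 1"
    and [measurable]: "\<beta> \<in> borel_measurable borel" and \<beta>: "\<And>t. 0 \<le> \<beta> t" "\<And>t. \<beta> t \<le> 1" "\<And>t. \<bar>t\<bar> > 14 \<Longrightarrow> \<beta> t = 0"
  shows "continuous_on UNIV (line_wave \<beta> d a v)" and "\<bar>line_wave \<beta> d a v y\<bar> \<le> 8 / d ^ 3 * 28"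
    and "norm y > 20 \<Longrightarrow> line_wave \<beta> d a v y = 0"
proof -
  have ball: "measure lborel (cball 0 14 :: real set) = 28"
    by (simp add: cball_eq_atLeastAtMost)
  have b: "norm (\<beta> t * phi d z) \<le> 8 / d ^ 3" for t z
    using mult_mono[of "\<beta> t" 1 "\<bar>phi d z\<bar>" "8 / d ^ 3"] \<beta> phi_bound[OF d(1)] by (simp add: abs_mult)
  have b2: "norm (\<beta> t * phi d z) \<le> 8 / d ^ 3 * indicator {-14..14} t" for t z
    using b[of t z] \<beta>(3)[of t] by (cases "\<bar>t\<bar> > 14") (auto simp: indicator_def)
  show "\<bar>line_wave \<beta> d a v y\<bar> \<le> 8 / d ^ 3 * 28"
    unfolding line_wave_def real_norm_def[symmetric] ball[symmetric]
    using b \<beta>(3) by (intro integrable_bounded_support(2)) auto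
  show "line_wave \<beta> d a v y = 0" if "norm y > 20"
  proof -
    have "\<beta> t * phi d (a + t *\<^sub>R v - y) = 0" for t
    proof (cases "\<bar>t\<bar> > 14")
      case False
      have "norm y \<le> norm (a + t *\<^sub>R v - y) + (norm a + norm (t *\<^sub>R v))"
        using norm_triangle_ineq4[of "a + t *\<^sub>R v" "a + t *\<^sub>R v - y"] norm_triangle_ineq[of a "t *\<^sub>R v"] by simp
      then have "4 * d \<le> norm (a + t *\<^sub>R v - y)" using that False v a d by simp
      then show ?thesis using d by (simp add: phi_eq_0)
    qed (simp add: \<beta>)
    then have "(\<lambda>t. \<beta> t * phi d (a + t *\<^sub>R v - y)) = (\<lambda>t. 0)" by blast
    then show ?thesis by (simp only: line_wave_def) simp
  qed
  show "continuous_on UNIV (line_wave \<beta> d a v)"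
    unfolding continuous_on_sequentially comp_def
  proof (intro allI impI ballI)
    fix x :: "nat \<Rightarrow> real^3" and y
    assume "y \<in> UNIV" and "(\<forall>n. x n \<in> UNIV) \<and> x \<longlonglongrightarrow> y"
    then have x: "x \<longlonglongrightarrow> y" by simp
    show "(\<lambda>n. line_wave \<beta> d a v (x n)) \<longlonglongrightarrow> line_wave \<beta> d a v y"
      unfolding line_wave_def
    proof (rule integral_dominated_convergence[where w = "\<lambda>t. 8 / d ^ 3 * indicator {-14..14} t"])
      show "AE t in lborel. (\<lambda>n. \<beta> t * phi d (a + t *\<^sub>R v - x n)) \<longlonglongrightarrow> \<beta> t * phi d (a + t *\<^sub>R v - y)"
      proof (intro AE_I2 tendsto_mult tendsto_const)
        fix t
        have "(\<lambda>n. a + t *\<^sub>R v - x n) \<longlonglongrightarrow> a + t *\<^sub>R v - y" by (intro tendsto_intros x)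
        moreover have "isCont (phi d) (a + t *\<^sub>R v - y)" using continuous_phi by (simp add: continuous_on_eq_continuous_at)
        ultimately show "(\<lambda>n. phi d (a + t *\<^sub>R v - x n)) \<longlonglongrightarrow> phi d (a + t *\<^sub>R v - y)"
          by (rule isCont_tendsto_compose[rotated])
      qed
      show "integrable lborel (\<lambda>t. 8 / d ^ 3 * indicator {-14..14::real} t :: real)" by simp
      show "AE t in lborel. norm (\<beta> t * phi d (a + t *\<^sub>R v - x n)) \<le> 8 / d ^ 3 * indicator {-14..14} t" for n
        using b2 by simp
    qed measurable
  qed
qed

end

section \<open>Incidence trees\<close>

text \<open>Peeling: the sum over the good part of a set is at most K, and the hypothesis applies
  again to its bad part, which has at most half as many elements. After n rounds nothing is
  left.\<close>

lemma halving_sum_le: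
  fixes f :: "'q \<Rightarrow> real"
  assumes "finite Om" and "card Om < 2 ^ n"
    and step: "\<And>S. S \<subseteq> Om \<Longrightarrow> \<exists>Bad\<subseteq>S. 2 * card Bad \<le> card S \<and> (\<Sum>q\<in>S - Bad. f q) \<le> K"
    and K: "K \<ge> 0"
  shows "(\<Sum>q\<in>Om. f q) \<le> real n * K"
proof -
  have "(\<Sum>q\<in>S. f q) \<le> real n * K" if "S \<subseteq> Om" "card S < 2 ^ n" for S n
    using that
  proof (induction n arbitrary: S)
    case 0
    then have "S = {}" using assms(1) finite_subset by fastforce
    then show ?case by simp
  next
    case (Suc n)
    obtain Bad where B: "Bad \<subseteq> S" "2 * card Bad \<le> card S" "(\<Sum>q\<in>S - Bad. f q) \<le> K"
      using step[OF Suc.prems(1)] by blast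
    have fin: "finite S" using Suc.prems assms(1) finite_subset by blast
    have "(\<Sum>q\<in>Bad. f q) \<le> real n * K"
      using B Suc.prems by (intro Suc.IH) auto
    moreover have "(\<Sum>q\<in>S. f q) = (\<Sum>q\<in>S - Bad. f q) + (\<Sum>q\<in>Bad. f q)"
      by (rule sum.subset_diff[OF B(1) fin])
    ultimately show ?case using B(3) by (simp add: algebra_simps)
  qed
  then show ?thesis using assms by blast
qed

text \<open>The combinatorics in abstract form: \<open>Om\<close> stands for the frequency caps, V
  for the representatives of the line directions, \<open>cell k\<close> for the cell of a cap at
  level k of a tree of depth J, and \<open>near\<close> for adjacency of cells of one level. The
  number 27 counts a cell of a three-dimensional grid together with its neighbours.\<close>

locale incidence_tree =
  fixes Om :: "'q set" and V :: "'v set" and inc :: "'v \<Rightarrow> 'q \<Rightarrow> bool"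
    and cell :: "nat \<Rightarrow> 'q \<Rightarrow> 'c" and near :: "'c \<Rightarrow> 'c \<Rightarrow> bool" and J :: nat
  assumes fin_Om: "finite Om" and fin_V: "finite V"
    and near_0: "\<And>q q'. q \<in> Om \<Longrightarrow> q' \<in> Om \<Longrightarrow> near (cell 0 q) (cell 0 q')"
    and near_sym: "near c c' \<Longrightarrow> near c' c" and near_refl: "near c c"
    and near_card: "\<And>k c. card {c' \<in> cell k ` Om. near c' c} \<le> 27"
    and refine: "\<And>k q q'. k < J \<Longrightarrow> cell (Suc k) q = cell (Suc k) q' \<Longrightarrow> cell k q = cell k q'"
begin

definition inc_set :: "'v \<Rightarrow> 'q set" where
  "inc_set v = {q \<in> Om. inc v q}"

definition pop :: "nat \<Rightarrow> 'v \<Rightarrow> 'q \<Rightarrow> nat" where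
  "pop k v q = card {q' \<in> inc_set v. near (cell k q) (cell k q')}"

text \<open>The first level at which shrinking the neighbourhood of q by one step loses more than
  half of the caps incident to v in it; J if this never happens. It is defined for every q, incident
  to v or not, and so becomes a function of the cell of q (\<open>tp_cong\<close>).\<close>

definition tp :: "'v \<Rightarrow> 'q \<Rightarrow> nat" where
  "tp v q = (LEAST k. k = J \<or> 2 * pop (Suc k) v q < pop k v q)"

lemma fin_inc_set [simp]: "finite (inc_set v)"
  using fin_Om by (simp add: inc_set_def)

lemma tp_le: "tp v q \<le> J"
  unfolding tp_def by (rule Least_le) simp

lemma tp_prop: "tp v q = J \<or> 2 * pop (Suc (tp v q)) v q < pop (tp v q) v q"
  unfolding tp_def by (rule LeastI[of _ J]) simp

lemma pop_less_tp:
  assumes "j < tp v q" shows "pop j v q \<le> 2 * pop (Suc j) v q"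
  using not_less_Least[of j "\<lambda>k. k = J \<or> 2 * pop (Suc k) v q < pop k v q"] assms
  unfolding tp_def by auto

lemma tp_eq_iff:
  "tp v q = k \<longleftrightarrow> (k = J \<or> 2 * pop (Suc k) v q < pop k v q) \<and> k \<le> J \<and> (\<forall>j<k. pop j v q \<le> 2 * pop (Suc j) v q)"
proof
  assume "tp v q = k"
  then show "(k = J \<or> 2 * pop (Suc k) v q < pop k v q) \<and> k \<le> J \<and> (\<forall>j<k. pop j v q \<le> 2 * pop (Suc j) v q)"
    using tp_prop[of v q] tp_le[of v q] pop_less_tp[of _ v q] by auto
next
  assume R: "(k = J \<or> 2 * pop (Suc k) v q < pop k v q) \<and> k \<le> J \<and> (\<forall>j<k. pop j v q \<le> 2 * pop (Suc j) v q)"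
  show "tp v q = k"
    unfolding tp_def
  proof (rule Least_equality)
    fix y assume "y = J \<or> 2 * pop (Suc y) v q < pop y v q"
    then show "k \<le> y" using R by (meson leD le_trans linorder_le_less_linear not_less order_refl)
  qed (use R in auto)
qed

lemma pop_0: "q \<in> Om \<Longrightarrow> pop 0 v q = card (inc_set v)"
  unfolding pop_def using near_0 by (intro arg_cong[where f=card]) (auto simp: inc_set_def)

text \<open>At level 0 the neighbourhood of q contains all incident caps, and every level before the
  type keeps at least half.\<close>

lemma pop_tp:
  assumes "q \<in> Om" shows "card (inc_set v) \<le> 2 ^ tp v q * pop (tp v q) v q"
proof -
  have "k \<le> tp v q \<Longrightarrow> card (inc_set v) \<le> 2 ^ k * pop k v q" for k
  proof (induction k)
    case (Suc k)
    then have "card (inc_set v) \<le> 2 ^ k * pop k v q" by simp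
    also have "\<dots> \<le> 2 ^ k * (2 * pop (Suc k) v q)"
      using pop_less_tp[of k v q] Suc.prems by (intro mult_left_mono) auto
    finally show ?case by simp
  qed (use pop_0[OF assms] in simp)
  then show ?thesis by simp
qed

text \<open>The level that decides whether the type is k: the test compares the populations at
  levels k and k + 1, while for type J no level beyond J is consulted.\<close>

definition lam :: "nat \<Rightarrow> nat" where "lam k = min (Suc k) J"

lemma cell_mono:
  assumes "j \<le> k" "k \<le> J" "cell k q = cell k q'" shows "cell j q = cell j q'"
  using assms
proof (induction k)
  case (Suc k)
  show ?case
  proof (cases "j = Suc k")
    case False
    then show ?thesis using Suc refine[of k q q'] by auto
  qed (use Suc in simp)
qed auto

lemma tp_cong:
  assumes k: "k \<le> J" and c: "cell (lam k) q = cell (lam k) q'"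
  shows "tp v q = k \<longleftrightarrow> tp v q' = k"
proof -
  have "cell j q = cell j q'" if "j \<le> lam k" for j
    using cell_mono[OF that _ c] by (simp add: lam_def)
  then have p: "pop j v q = pop j v q'" if "j \<le> lam k" for j
    using that by (simp add: pop_def)
  show ?thesis
  proof (cases "k = J")
    case True
    then have "\<forall>j<k. pop j v q = pop j v q' \<and> pop (Suc j) v q = pop (Suc j) v q'"
      using p by (auto simp: lam_def)
    then show ?thesis using True by (auto simp: tp_eq_iff)
  next
    case False
    then have "\<forall>j\<le>k. pop j v q = pop j v q' \<and> pop (Suc j) v q = pop (Suc j) v q'"
      using p k by (auto simp: lam_def)
    then show ?thesis using False by (auto simp: tp_eq_iff)
  qed
qed

definition bad :: "(nat \<Rightarrow> 'v \<Rightarrow> 's) \<Rightarrow> real \<Rightarrow> nat \<Rightarrow> 'q set" where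
  "bad s \<Lambda> k = {q \<in> Om. real (card (s k ` {v \<in> V. inc v q \<and> tp v q = k})) > \<Lambda>}"

lemma inverse_weight_sum:
  "(\<Sum>q\<in>Om. \<Sum>v\<in>{v \<in> V. inc v q}. 1 / real (card (inc_set v))) \<le> real (card V)"
proof -
  have "(\<Sum>q\<in>Om. \<Sum>v\<in>{v \<in> V. inc v q}. 1 / real (card (inc_set v)))
    = (\<Sum>v\<in>V. \<Sum>q\<in>{q \<in> Om. inc v q}. 1 / real (card (inc_set v)))"
    by (rule sum.swap_restrict[OF fin_Om fin_V])
  also have "\<dots> \<le> (\<Sum>v\<in>V. 1)"
    by (intro sum_mono) (simp add: inc_set_def[symmetric])
  finally show ?thesis by simp
qed

text \<open>The weights 1 / card (inc_set v) make every direction v contribute at most 1 in total over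
  all its incidences, so no pigeonholing in the number of incidences per direction is needed.\<close>

lemma bad_card:
  fixes s :: "nat \<Rightarrow> 'v \<Rightarrow> 's"
  assumes k: "k < J" and \<Lambda>: "\<Lambda> \<ge> 0"
    and mult: "\<And>q q'. q \<in> Om \<Longrightarrow> q' \<in> Om \<Longrightarrow> \<not> near (cell (Suc k) q) (cell (Suc k) q') \<Longrightarrow>
       card (s k ` {v \<in> V. inc v q \<and> inc v q'}) \<le> m"
  shows "real (card (bad s \<Lambda> k)) * \<Lambda>\<^sup>2 \<le> 27 * real m * 2 ^ (k + 1) * real (card V) * real (card Om)"
proof -
  define T where "T = (\<lambda>q. {v \<in> V. inc v q \<and> tp v q = k})"
  define w where "w = (\<lambda>v. 1 / real (card (inc_set v)))"
  define A where "A = (\<lambda>q. \<Sum>v\<in>{v \<in> V. inc v q}. w v)"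
  define P where "P = (\<lambda>c. card {q' \<in> Om. near c (cell k q')})"
  have w0: "w v \<ge> 0" for v by (simp add: w_def)
  have A0: "A q \<ge> 0" for q unfolding A_def by (intro sum_nonneg w0)
  have one: "\<Lambda>\<^sup>2 \<le> 2 ^ (k + 1) * real m * real (P (cell k q)) * A q" if q: "q \<in> bad s \<Lambda> k" for q
  proof -
    have qO: "q \<in> Om" and gt: "real (card (s k ` T q)) > \<Lambda>"
      using q by (auto simp: bad_def T_def)
    define S where "S = s k ` T q"
    have finT: "finite (T q)" using fin_V by (simp add: T_def)
    have finS: "finite S" using finT by (simp add: S_def)
    have "\<forall>\<sigma>\<in>S. \<exists>v\<in>T q. s k v = \<sigma>" by (auto simp: S_def)
    then obtain r where r: "\<And>\<sigma>. \<sigma> \<in> S \<Longrightarrow> r \<sigma> \<in> T q" "\<And>\<sigma>. \<sigma> \<in> S \<Longrightarrow> s k (r \<sigma>) = \<sigma>"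
      by metis
    have rT: "r \<sigma> \<in> V" "inc (r \<sigma>) q" "tp (r \<sigma>) q = k" if "\<sigma> \<in> S" for \<sigma>
      using r(1)[OF that] by (auto simp: T_def)
    define p where "p = (\<lambda>\<sigma>. real (card (inc_set (r \<sigma>))))"
    have p_pos: "p \<sigma> > 0" if "\<sigma> \<in> S" for \<sigma>
      using rT(2)[OF that] qO by (auto simp: p_def card_gt_0_iff inc_set_def fin_Om)
    have inj: "inj_on r S" using r(2) by (metis inj_onI)
    \<comment> \<open>The annulus of caps that are neighbours of q at level k but no longer at level
      k + 1. A direction of type k has more than half of its population at level k there, whereas q
      and a cap of the annulus share at most m classes.\<close>
    define Q where "Q = {q' \<in> Om. near (cell k q) (cell k q') \<and> \<not> near (cell (Suc k) q) (cell (Suc k) q')}"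
    have finQ: "finite Q" using fin_Om by (simp add: Q_def)
    have half: "p \<sigma> \<le> 2 ^ (k + 1) * real (card {q' \<in> Q. inc (r \<sigma>) q'})" if \<sigma>: "\<sigma> \<in> S" for \<sigma>
    proof -
      let ?v = "r \<sigma>"
      let ?a = "{q' \<in> inc_set ?v. near (cell k q) (cell k q')}"
      let ?b = "{q' \<in> inc_set ?v. near (cell (Suc k) q) (cell (Suc k) q')}"
      have "2 * pop (Suc k) ?v q < pop k ?v q"
        using tp_prop[of ?v q] rT(3)[OF \<sigma>] k by auto
      moreover have "pop k ?v q - pop (Suc k) ?v q \<le> card (?a - ?b)"
        unfolding pop_def by (rule diff_card_le_card_Diff) simp
      moreover have "?a - ?b = {q' \<in> Q. inc ?v q'}"
        by (auto simp: Q_def inc_set_def)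
      ultimately have h: "pop k ?v q \<le> 2 * card {q' \<in> Q. inc ?v q'}" by simp
      have "card (inc_set ?v) \<le> 2 ^ k * pop k ?v q" using pop_tp[OF qO, of ?v] rT(3)[OF \<sigma>] by simp
      also have "\<dots> \<le> 2 ^ k * (2 * card {q' \<in> Q. inc ?v q'})" by (intro mult_left_mono h) simp
      finally have "card (inc_set ?v) \<le> 2 ^ (k + 1) * card {q' \<in> Q. inc ?v q'}" by simp
      then have "real (card (inc_set ?v)) \<le> real (2 ^ (k + 1) * card {q' \<in> Q. inc ?v q'})"
        by (simp only: of_nat_le_iff)
      then show ?thesis by (simp add: p_def)
    qed
    have mm: "card {\<sigma> \<in> S. inc (r \<sigma>) q'} \<le> m" if "q' \<in> Q" for q'
    proof -
      have "{\<sigma> \<in> S. inc (r \<sigma>) q'} \<subseteq> s k ` {v \<in> V. inc v q \<and> inc v q'}"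
      proof
        fix \<sigma> assume "\<sigma> \<in> {\<sigma> \<in> S. inc (r \<sigma>) q'}"
        then show "\<sigma> \<in> s k ` {v \<in> V. inc v q \<and> inc v q'}"
          using rT[of \<sigma>] r(2)[of \<sigma>] by (intro image_eqI[of _ _ "r \<sigma>"]) auto
      qed
      then have "card {\<sigma> \<in> S. inc (r \<sigma>) q'} \<le> card (s k ` {v \<in> V. inc v q \<and> inc v q'})"
        using fin_V by (intro card_mono) auto
      also have "\<dots> \<le> m" using that by (intro mult qO) (auto simp: Q_def)
      finally show ?thesis .
    qed
    \<comment> \<open>Pairs of a class and an incident cap of the annulus are counted in two ways;
      at each cap there are at most m classes.\<close>
    have "(\<Sum>\<sigma>\<in>S. p \<sigma>) \<le> (\<Sum>\<sigma>\<in>S. 2 ^ (k + 1) * real (card {q' \<in> Q. inc (r \<sigma>) q'}))"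
      by (intro sum_mono half)
    also have "\<dots> = 2 ^ (k + 1) * real (\<Sum>\<sigma>\<in>S. card {q' \<in> Q. inc (r \<sigma>) q'})"
      by (simp add: sum_distrib_left)
    also have "(\<Sum>\<sigma>\<in>S. card {q' \<in> Q. inc (r \<sigma>) q'}) = (\<Sum>q'\<in>Q. card {\<sigma> \<in> S. inc (r \<sigma>) q'})"
      using sum.swap_restrict[OF finS finQ, of "\<lambda>_ _. 1::nat" "\<lambda>\<sigma> q'. inc (r \<sigma>) q'"] by simp
    also have "2 ^ (k + 1) * real (\<Sum>q'\<in>Q. card {\<sigma> \<in> S. inc (r \<sigma>) q'}) \<le> 2 ^ (k + 1) * real (card Q * m)"
      using sum_mono[of Q "\<lambda>q'. card {\<sigma> \<in> S. inc (r \<sigma>) q'}" "\<lambda>_. m"] mm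
      by (intro mult_left_mono) (auto simp del: of_nat_mult of_nat_sum)
    also have "card Q \<le> P (cell k q)"
      unfolding P_def Q_def using fin_Om by (intro card_mono) auto
    then have "2 ^ (k + 1) * real (card Q * m) \<le> 2 ^ (k + 1) * (real m * real (P (cell k q)))"
      by (simp add: mult.commute mult_left_mono)
    finally have sp: "(\<Sum>\<sigma>\<in>S. p \<sigma>) \<le> 2 ^ (k + 1) * real m * real (P (cell k q))" by simp
    have sw: "(\<Sum>\<sigma>\<in>S. 1 / p \<sigma>) \<le> A q"
    proof -
      have "(\<Sum>\<sigma>\<in>S. 1 / p \<sigma>) = (\<Sum>v\<in>r ` S. w v)"
        by (subst sum.reindex[OF inj]) (simp add: p_def w_def)
      also have "\<dots> \<le> A q"
        unfolding A_def using rT fin_V by (intro sum_mono2) (auto simp: w0)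
      finally show ?thesis .
    qed
    \<comment> \<open>Cauchy-Schwarz with the weights p and 1/p. The sum of p has just been bounded
      through the annulus; the sum of 1/p is part of the inverse weight A at q.\<close>
    have "(real (card S))\<^sup>2 = (\<Sum>\<sigma>\<in>S. sqrt (p \<sigma>) * sqrt (1 / p \<sigma>))\<^sup>2"
    proof -
      have "(\<Sum>\<sigma>\<in>S. sqrt (p \<sigma>) * sqrt (1 / p \<sigma>)) = (\<Sum>\<sigma>\<in>S. 1)"
        by (intro sum.cong refl) (use p_pos in \<open>auto simp: real_sqrt_mult[symmetric] less_imp_neq[symmetric]\<close>)
      then show ?thesis by simp
    qed
    also have "\<dots> \<le> (\<Sum>\<sigma>\<in>S. (sqrt (p \<sigma>))\<^sup>2) * (\<Sum>\<sigma>\<in>S. (sqrt (1 / p \<sigma>))\<^sup>2)"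
      by (rule Cauchy_Schwarz_ineq_sum)
    also have "\<dots> = (\<Sum>\<sigma>\<in>S. p \<sigma>) * (\<Sum>\<sigma>\<in>S. 1 / p \<sigma>)"
      using p_pos by (simp add: less_imp_le)
    also have "\<dots> \<le> (2 ^ (k + 1) * real m * real (P (cell k q))) * A q"
      using p_pos by (intro mult_mono sp sw sum_nonneg) (auto intro: less_imp_le)
    finally have "(real (card S))\<^sup>2 \<le> 2 ^ (k + 1) * real m * real (P (cell k q)) * A q" .
    moreover have "\<Lambda>\<^sup>2 \<le> (real (card S))\<^sup>2" using gt \<Lambda> by (intro power_mono) (auto simp: S_def)
    ultimately show ?thesis by linarith
  qed
  let ?C = "cell k ` Om"
  have finC: "finite ?C" using fin_Om by simp
  have finB: "finite (bad s \<Lambda> k)" using fin_Om by (simp add: bad_def)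
  \<comment> \<open>On one cell of level k the factor P is constant, so only the A q are summed, and
    over all of \<open>Om\<close> these add up to at most \<open>card V\<close>. The sum of P over
    all cells then sees every cap at most 27 times.\<close>
  have per: "(\<Sum>q\<in>{q \<in> bad s \<Lambda> k. cell k q = c}. \<Lambda>\<^sup>2) \<le> 2 ^ (k + 1) * real m * real (card V) * real (P c)" for c
  proof -
    have "(\<Sum>q\<in>{q \<in> bad s \<Lambda> k. cell k q = c}. \<Lambda>\<^sup>2)
      \<le> (\<Sum>q\<in>{q \<in> bad s \<Lambda> k. cell k q = c}. 2 ^ (k + 1) * real m * real (P c) * A q)"
      by (intro sum_mono) (use one in auto)
    also have "\<dots> = 2 ^ (k + 1) * real m * real (P c) * (\<Sum>q\<in>{q \<in> bad s \<Lambda> k. cell k q = c}. A q)"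
      by (simp add: sum_distrib_left)
    also have "(\<Sum>q\<in>{q \<in> bad s \<Lambda> k. cell k q = c}. A q) \<le> (\<Sum>q\<in>Om. A q)"
      by (intro sum_mono2) (auto simp: fin_Om A0 bad_def)
    also have "(\<Sum>q\<in>Om. A q) \<le> real (card V)"
      unfolding A_def w_def by (rule inverse_weight_sum)
    finally have "(\<Sum>q\<in>{q \<in> bad s \<Lambda> k. cell k q = c}. \<Lambda>\<^sup>2) \<le> 2 ^ (k + 1) * real m * real (P c) * real (card V)"
      by (simp add: mult_left_mono)
    then show ?thesis by (simp only: mult_ac)
  qed
  have "real (card (bad s \<Lambda> k)) * \<Lambda>\<^sup>2 = (\<Sum>q\<in>bad s \<Lambda> k. \<Lambda>\<^sup>2)" by simp
  also have "\<dots> = (\<Sum>c\<in>?C. \<Sum>q\<in>{q \<in> bad s \<Lambda> k. cell k q = c}. \<Lambda>\<^sup>2)"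
    by (rule sum.group[symmetric, OF finB finC]) (auto simp: bad_def)
  also have "\<dots> \<le> (\<Sum>c\<in>?C. 2 ^ (k + 1) * real m * real (card V) * real (P c))"
    by (intro sum_mono per)
  also have "\<dots> = 2 ^ (k + 1) * real m * real (card V) * real (\<Sum>c\<in>?C. P c)"
    by (simp add: sum_distrib_left)
  also have "(\<Sum>c\<in>?C. P c) = (\<Sum>q'\<in>Om. card {c \<in> ?C. near c (cell k q')})"
    unfolding P_def using sum.swap_restrict[OF finC fin_Om, of "\<lambda>_ _. 1::nat" "\<lambda>c q'. near c (cell k q')"] by simp
  also have "\<dots> \<le> (\<Sum>q'\<in>Om. 27)" by (intro sum_mono near_card)
  then have "2 ^ (k + 1) * real m * real (card V) * real (\<Sum>q'\<in>Om. card {c \<in> ?C. near c (cell k q')})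
    \<le> 2 ^ (k + 1) * real m * real (card V) * real (27 * card Om)"
    by (intro mult_left_mono) (auto simp del: of_nat_sum of_nat_mult simp add: mult.commute)
  finally show ?thesis by (simp add: mult_ac)
qed

text \<open>By \<open>tp_cong\<close>, having type k is a property of the cell c of level
  \<open>lam k\<close>, so a direction can be a member without being incident to any cap of c.
  Incidence to a cap near c at level k is all that can be guaranteed, see
  \<open>members_near\<close>.\<close>

definition members :: "nat \<Rightarrow> 'c \<Rightarrow> 'v set" where
  "members k c = {v \<in> V. inc_set v \<noteq> {} \<and> (\<exists>q\<in>Om. cell (lam k) q = c \<and> tp v q = k)}"

lemma members_near:
  assumes "v \<in> members k c" "k \<le> J"
  obtains q q' where "q \<in> Om" "q' \<in> Om" "cell (lam k) q = c" "inc v q'" "near (cell k q) (cell k q')"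
proof -
  obtain q where q: "q \<in> Om" "cell (lam k) q = c" "tp v q = k" and ne: "inc_set v \<noteq> {}"
    using assms by (auto simp: members_def)
  have "card (inc_set v) > 0" using ne by (simp add: card_gt_0_iff)
  then have "pop k v q > 0" using pop_tp[OF q(1), of v] q(3) by (metis gr0I mult_0_right not_less)
  then obtain q' where "q' \<in> inc_set v" "near (cell k q) (cell k q')"
    unfolding pop_def card_gt_0_iff by auto
  then show ?thesis using that q by (auto simp: inc_set_def)
qed

text \<open>Each cell of level k containing a cap at which v has type k has in its neighbourhood at
  least the fraction 2^-k of all caps incident to v, and a cap lies in the neighbourhood of at most
  27 cells. Hence there are at most 27 * 2^k such cells, and each has at most \<open>ch\<close>
  subcells of level \<open>lam k\<close>.\<close>

lemma members_count:
  assumes v: "v \<in> V" and k: "k \<le> J"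
    and ch: "\<And>c0. card (cell (lam k) ` {q \<in> Om. cell k q = c0}) \<le> ch"
  shows "card {c \<in> cell (lam k) ` Om. v \<in> members k c} \<le> 27 * 2 ^ k * ch"
proof (cases "inc_set v = {}")
  case True
  then show ?thesis by (simp add: members_def)
next
  case False
  define W where "W = {q \<in> Om. tp v q = k}"
  define C0 where "C0 = cell k ` W"
  have finW: "finite W" using fin_Om by (simp add: W_def)
  have fin0: "finite C0" using finW by (simp add: C0_def)
  have sub: "{c \<in> cell (lam k) ` Om. v \<in> members k c} \<subseteq> (\<Union>c0\<in>C0. cell (lam k) ` {q \<in> Om. cell k q = c0})"
  proof
    fix c assume "c \<in> {c \<in> cell (lam k) ` Om. v \<in> members k c}"
    then obtain q where "q \<in> Om" "cell (lam k) q = c" "tp v q = k" by (auto simp: members_def)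
    then show "c \<in> (\<Union>c0\<in>C0. cell (lam k) ` {q \<in> Om. cell k q = c0})"
      by (auto simp: C0_def W_def)
  qed
  have "card {c \<in> cell (lam k) ` Om. v \<in> members k c} \<le> card (\<Union>c0\<in>C0. cell (lam k) ` {q \<in> Om. cell k q = c0})"
    using fin0 fin_Om by (intro card_mono[OF _ sub]) auto
  also have "\<dots> \<le> (\<Sum>c0\<in>C0. card (cell (lam k) ` {q \<in> Om. cell k q = c0}))" by (rule card_UN_le[OF fin0])
  also have "\<dots> \<le> card C0 * ch" using sum_mono[of C0 _ "\<lambda>_. ch"] ch by simp
  finally have 1: "card {c \<in> cell (lam k) ` Om. v \<in> members k c} \<le> card C0 * ch" .
  have "card C0 * card (inc_set v) = (\<Sum>c0\<in>C0. card (inc_set v))" by simp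
  also have "\<dots> \<le> (\<Sum>c0\<in>C0. 2 ^ k * card {q' \<in> inc_set v. near c0 (cell k q')})"
  proof (intro sum_mono)
    fix c0 assume "c0 \<in> C0"
    then obtain q where q: "q \<in> Om" "tp v q = k" "c0 = cell k q" by (auto simp: C0_def W_def)
    show "card (inc_set v) \<le> 2 ^ k * card {q' \<in> inc_set v. near c0 (cell k q')}"
      using pop_tp[OF q(1), of v] q by (simp add: pop_def)
  qed
  also have "\<dots> = 2 ^ k * (\<Sum>c0\<in>C0. card {q' \<in> inc_set v. near c0 (cell k q')})" by (simp add: sum_distrib_left)
  also have "(\<Sum>c0\<in>C0. card {q' \<in> inc_set v. near c0 (cell k q')}) = (\<Sum>q'\<in>inc_set v. card {c0 \<in> C0. near c0 (cell k q')})"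
    using sum.swap_restrict[OF fin0, of "inc_set v" "\<lambda>_ _. 1::nat" "\<lambda>c q'. near c (cell k q')"] by simp
  also have "\<dots> \<le> (\<Sum>q'\<in>inc_set v. 27)"
  proof (intro sum_mono)
    fix q'
    have "card {c0 \<in> C0. near c0 (cell k q')} \<le> card {c' \<in> cell k ` Om. near c' (cell k q')}"
      using fin_Om by (intro card_mono) (auto simp: C0_def W_def)
    then show "card {c0 \<in> C0. near c0 (cell k q')} \<le> 27" using near_card le_trans by blast
  qed
  finally have "card C0 * card (inc_set v) \<le> (27 * 2 ^ k) * card (inc_set v)" by (simp add: mult_ac)
  moreover have "card (inc_set v) > 0" using False by (simp add: card_gt_0_iff)
  ultimately have "card C0 \<le> 27 * 2 ^ k" using mult_le_cancel2 by blast
  then show ?thesis using 1 by (meson le_trans mult_le_mono1)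
qed

end

section \<open>Counting lines in planks\<close>

lemma M_lines_ge:
  assumes "finite L" "B \<in> boxes h1 h2 1"
  shows "card {l \<in> L. measure (arc_length l) B \<ge> 1/2} \<le> M_lines L h1 h2"
proof -
  have "(\<lambda>B. card {l \<in> L. measure (arc_length l) B \<ge> 1/2}) ` boxes h1 h2 1 \<subseteq> {..card L}"
    using assms(1) by (auto intro: card_mono)
  then show ?thesis
    unfolding M_lines_def using assms(2) by (intro Max_ge) (auto intro: finite_subset)
qed

lemma M_lines_le: "finite L \<Longrightarrow> M_lines L h1 h2 \<le> card L"
proof -
  assume L: "finite L"
  have sub: "(\<lambda>B. card {l \<in> L. measure (arc_length l) B \<ge> 1/2}) ` boxes h1 h2 1 \<subseteq> {..card L}"
    using L by (auto intro: card_mono)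
  have "boxes h1 h2 1 \<noteq> {}" unfolding boxes_def using orthogonal_transformation_id by blast
  then show ?thesis
    unfolding M_lines_def using sub finite_subset[OF sub] by (subst Max_le_iff) auto
qed

lemma measure_arc_length_ge:
  assumes v: "norm v = 1" and B: "compact B" and sub: "\<And>t. \<bar>t - \<tau>\<bar> \<le> 1/4 \<Longrightarrow> a + t *\<^sub>R v \<in> B"
  shows "measure (arc_length (line_at a v)) B \<ge> 1/2"
proof -
  let ?S = "(\<lambda>t. a + t *\<^sub>R v) -` B"
  have cl: "closed ?S"
    by (intro continuous_closed_vimage compact_imp_closed B continuous_intros)
  obtain K where K: "\<And>x. x \<in> B \<Longrightarrow> norm x \<le> K"
    using compact_imp_bounded[OF B] by (auto simp: bounded_iff)
  have "norm t \<le> K + norm a" if "t \<in> ?S" for t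
  proof -
    have "norm (t *\<^sub>R v) \<le> norm (a + t *\<^sub>R v) + norm a"
      by (metis add_diff_cancel_left' norm_triangle_ineq4)
    also have "\<dots> \<le> K + norm a" using K[of "a + t *\<^sub>R v"] that by auto
    finally show ?thesis using v by simp
  qed
  then have "bounded ?S" unfolding bounded_iff by blast
  then have "compact ?S" using cl by (simp add: compact_eq_bounded_closed)
  then have fin: "?S \<in> fmeasurable lborel"
    by (intro fmeasurableI emeasure_compact_finite borel_compact) (auto simp: borel_compact)
  have "1/2 = measure lborel {\<tau> - 1/4..\<tau> + 1/4}" by simp
  also have "\<dots> \<le> measure lborel ?S"
  proof (rule measure_mono_fmeasurable[OF _ _ fin])
    show "{\<tau> - 1/4..\<tau> + 1/4} \<subseteq> ?S"
    proof
      fix t assume "t \<in> {\<tau> - 1/4..\<tau> + 1/4}"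
      then have "\<bar>t - \<tau>\<bar> \<le> 1/4" unfolding atLeastAtMost_iff by linarith
      then show "t \<in> ?S" by (simp add: sub)
    qed
  qed simp
  also have "\<dots> = measure (arc_length (line_at a v)) B"
    unfolding arc_length_line_at[OF v] using B by (subst measure_distr) (auto simp: borel_compact)
  finally show ?thesis .
qed

lemma orthonormal_frame:
  fixes f1 f2 f3 :: "real^3"
  assumes n: "norm f1 = 1" "norm f2 = 1" "norm f3 = 1" and o: "f1 \<bullet> f2 = 0" "f1 \<bullet> f3 = 0" "f2 \<bullet> f3 = 0"
  defines "f \<equiv> (\<lambda>y::real^3. y $ 1 *\<^sub>R f1 + y $ 2 *\<^sub>R f2 + y $ 3 *\<^sub>R f3)"
  shows "orthogonal_transformation f" and "x = (x \<bullet> f1) *\<^sub>R f1 + (x \<bullet> f2) *\<^sub>R f2 + (x \<bullet> f3) *\<^sub>R f3"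
proof -
  have nn: "f1 \<bullet> f1 = 1" "f2 \<bullet> f2 = 1" "f3 \<bullet> f3 = 1" using n by (simp_all add: norm_eq_1)
  have oo: "f2 \<bullet> f1 = 0" "f3 \<bullet> f1 = 0" "f3 \<bullet> f2 = 0" using o by (simp_all add: inner_commute)
  have lin: "linear f" unfolding f_def by (intro linearI) (auto simp: algebra_simps)
  have "f y \<bullet> f z = y $ 1 * z $ 1 + y $ 2 * z $ 2 + y $ 3 * z $ 3" for y z
    by (simp add: f_def inner_add_left inner_add_right nn o oo)
  then have "f y \<bullet> f z = y \<bullet> z" for y z
    by (simp add: inner_vec_def sum_3)
  then show ort: "orthogonal_transformation f" using lin by (simp add: orthogonal_transformation_def)
  obtain y where y: "x = f y" using orthogonal_transformation_surj[OF ort] by (metis surjD)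
  show "x = (x \<bullet> f1) *\<^sub>R f1 + (x \<bullet> f2) *\<^sub>R f2 + (x \<bullet> f3) *\<^sub>R f3"
    unfolding y f_def by (simp add: inner_add_left nn o oo)
qed

lemma frame_box:
  fixes f1 f2 f3 :: "real^3"
  assumes fr: "norm f1 = 1" "norm f2 = 1" "norm f3 = 1" "f1 \<bullet> f2 = 0" "f1 \<bullet> f3 = 0" "f2 \<bullet> f3 = 0"
  obtains B where "B \<in> boxes h1 h2 h3" "compact B"
    "\<And>x. \<bar>(x - x0) \<bullet> f1\<bar> \<le> h1 / 2 \<Longrightarrow> \<bar>(x - x0) \<bullet> f2\<bar> \<le> h2 / 2 \<Longrightarrow> \<bar>(x - x0) \<bullet> f3\<bar> \<le> h3 / 2 \<Longrightarrow> x \<in> B"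
proof -
  define f where "f = (\<lambda>y::real^3. y $ 1 *\<^sub>R f1 + y $ 2 *\<^sub>R f2 + y $ 3 *\<^sub>R f3)"
  have ort: "orthogonal_transformation f" unfolding f_def by (rule orthonormal_frame(1)[OF fr])
  define h where "h = (vector [h1, h2, h3] :: real^3)"
  define p where "p = x0 - f ((1/2) *\<^sub>R h)"
  define B where "B = (\<lambda>x. p + f x) ` cbox 0 h"
  have lin: "linear f" using ort by (simp add: orthogonal_transformation_def)
  have "B \<in> boxes h1 h2 h3" unfolding boxes_def B_def h_def using ort by blast
  moreover have "compact B"
    unfolding B_def using lin
    by (intro compact_continuous_image continuous_intros linear_continuous_on) (auto simp: linear_linear)
  moreover have "x \<in> B" if "\<bar>(x - x0) \<bullet> f1\<bar> \<le> h1 / 2" "\<bar>(x - x0) \<bullet> f2\<bar> \<le> h2 / 2" "\<bar>(x - x0) \<bullet> f3\<bar> \<le> h3 / 2" for x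
  proof -
    define y where "y = (vector [(x - x0) \<bullet> f1 + h1 / 2, (x - x0) \<bullet> f2 + h2 / 2, (x - x0) \<bullet> f3 + h3 / 2] :: real^3)"
    have "f y = ((x - x0) \<bullet> f1) *\<^sub>R f1 + ((x - x0) \<bullet> f2) *\<^sub>R f2 + ((x - x0) \<bullet> f3) *\<^sub>R f3 + f ((1/2) *\<^sub>R h)"
      by (simp add: f_def y_def h_def vector_3 scaleR_add_left)
    also have "\<dots> = (x - x0) + f ((1/2) *\<^sub>R h)"
      using orthonormal_frame(2)[OF fr, of "x - x0"] by simp
    finally have "x = p + f y" by (simp add: p_def)
    moreover have "y \<in> cbox 0 h"
      using that by (auto simp: mem_box_cart forall_3 y_def h_def vector_3 abs_le_iff)
    ultimately show ?thesis by (auto simp: B_def)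
  qed
  ultimately show ?thesis using that by blast
qed

lemma third_axis:
  fixes n v :: "real^3"
  assumes "norm n = 1" "norm v = 1" "n \<bullet> v = 0"
  obtains e where "norm e = 1" "e \<bullet> n = 0" "e \<bullet> v = 0"
proof -
  have "(norm (cross3 n v))\<^sup>2 = 1" using norm_cross_dot[of n v] assms by simp
  then have "norm (cross3 n v) = 1" using norm_ge_zero[of "cross3 n v"] by (simp add: power2_eq_1_iff)
  then show ?thesis using that[of "cross3 n v"] by (simp add: dot_cross_self)
qed

text \<open>n is the normalised projection of \<omega> to the plane orthogonal to v. With r = sqrt
  (1 - c^2) \<ge> r^2 one has |n - \<omega>|^2 = 2 - 2 r \<le> 2 c^2. If \<omega> is parallel to v,
  the right-hand side is 2 and any unit normal will do.\<close>

lemma orthogonal_normal: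
  fixes v \<omega> :: "real^3"
  assumes v: "norm v = 1" and \<omega>: "norm \<omega> = 1"
  obtains n where "norm n = 1" "n \<bullet> v = 0" "norm (n - \<omega>) \<le> 2 * \<bar>v \<bullet> \<omega>\<bar>"
proof -
  define c where "c = v \<bullet> \<omega>"
  have vv: "v \<bullet> v = 1" "\<omega> \<bullet> \<omega> = 1" using v \<omega> by (simp_all add: norm_eq_1)
  have c1: "\<bar>c\<bar> \<le> 1" using Cauchy_Schwarz_ineq2[of v \<omega>] v \<omega> by (simp add: c_def)
  show ?thesis
  proof (cases "c\<^sup>2 = 1")
    case True
    then have c: "\<bar>c\<bar> = 1" by (simp add: power2_eq_1_iff abs_if split: if_splits) linarith
    define e1 where "e1 = (axis 1 1 :: real^3)"
    define e2 where "e2 = (axis 2 1 :: real^3)"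
    have e: "norm e1 = 1" "norm e2 = 1" "e2 \<bullet> e1 = 0"
      by (auto simp: e1_def e2_def norm_axis_1 inner_axis_axis)
    obtain f where f: "orthogonal_transformation f" "f e1 = v"
      using orthogonal_transformation_exists_1[OF e(1) v] by auto
    let ?n = "f e2"
    have "norm ?n = 1" using f(1) e by (simp add: orthogonal_transformation_norm)
    moreover have "?n \<bullet> v = 0"
      using f(1) e(3) by (simp add: orthogonal_transformation_def flip: f(2))
    moreover have "norm (?n - \<omega>) \<le> 2 * \<bar>v \<bullet> \<omega>\<bar>"
      using norm_triangle_ineq4[of ?n \<omega>] \<open>norm ?n = 1\<close> \<omega> c by (simp add: c_def)
    ultimately show ?thesis by (rule that)
  next
    case False
    moreover have "c\<^sup>2 \<le> 1" using power_mono[OF c1, of 2] by simp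
    ultimately have c: "1 - c\<^sup>2 > 0" by linarith
    define r where "r = sqrt (1 - c\<^sup>2)"
    have r: "r > 0" "r\<^sup>2 = 1 - c\<^sup>2" using c by (auto simp: r_def)
    define m where "m = \<omega> - c *\<^sub>R v"
    have mm: "m \<bullet> m = r\<^sup>2"
      unfolding m_def r(2) by (simp add: inner_diff_left inner_diff_right vv c_def[symmetric] inner_commute[of \<omega> v] power2_eq_square)
    have mv: "m \<bullet> v = 0" by (simp add: m_def inner_diff_left vv c_def inner_commute[of v \<omega>])
    have mo: "m \<bullet> \<omega> = r\<^sup>2" unfolding m_def r(2) by (simp add: inner_diff_left vv c_def[symmetric] power2_eq_square)
    define n where "n = (1 / r) *\<^sub>R m"
    have nm: "norm m = r" using mm r(1) by (simp only: norm_eq_sqrt_inner real_sqrt_abs abs_of_pos)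
    then have n1: "norm n = 1" using r by (simp add: n_def)
    have "(norm (n - \<omega>))\<^sup>2 = n \<bullet> n + \<omega> \<bullet> \<omega> - 2 * (n \<bullet> \<omega>)"
      by (simp add: power2_norm_eq_inner inner_diff_left inner_diff_right inner_commute)
    also have "n \<bullet> \<omega> = r" using r(1) by (simp add: n_def mo power2_eq_square)
    finally have e: "(norm (n - \<omega>))\<^sup>2 = 2 - 2 * r" using n1 vv by (simp add: norm_eq_1)
    have "r \<le> 1" using r by (simp add: r_def)
    then have "r\<^sup>2 \<le> r" using r(1) by (simp add: power2_eq_square mult_left_le)
    moreover have "(2 * \<bar>c\<bar>)\<^sup>2 = 4 * c\<^sup>2" by (simp add: power_mult_distrib)
    ultimately have "(norm (n - \<omega>))\<^sup>2 \<le> (2 * \<bar>c\<bar>)\<^sup>2"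
      unfolding e using r(2) zero_le_power2[of c] by linarith
    then have "norm (n - \<omega>) \<le> 2 * \<bar>c\<bar>" by (rule power2_le_imp_le) simp
    moreover have "n \<bullet> v = 0" by (simp add: n_def mv)
    ultimately show ?thesis using that n1 by (simp add: c_def)
  qed
qed

lemma norm_perp_le:
  fixes x v :: "'a::real_inner"
  assumes v: "norm v = 1" shows "norm (x - (x \<bullet> v) *\<^sub>R v) \<le> norm x"
proof -
  have "v \<bullet> v = 1" using v by (simp add: norm_eq_1)
  then have "(norm (x - (x \<bullet> v) *\<^sub>R v))\<^sup>2 = (norm x)\<^sup>2 - (x \<bullet> v)\<^sup>2"
    unfolding power2_norm_eq_inner
    by (simp add: inner_diff_left inner_diff_right inner_commute[of v x] power2_eq_square algebra_simps)
  then have "(norm (x - (x \<bullet> v) *\<^sub>R v))\<^sup>2 \<le> (norm x)\<^sup>2" by simp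
  then show ?thesis by (rule power2_le_imp_le) simp
qed

lemma card_floor_le:
  assumes "R \<ge> 0" shows "real (card {\<lfloor>-R\<rfloor>..\<lfloor>R\<rfloor>}) \<le> 2 * R + 2"
  using assms by (simp add: nat_le_iff) linarith

lemma floor_close: "\<lfloor>x\<rfloor> = \<lfloor>y\<rfloor> \<Longrightarrow> \<bar>x - y\<bar> \<le> (1::real)"
  by linarith

text \<open>Lines of the plank are written as graphs over the direction v1: at parameter s the line has
  coordinates p + s q in the two directions orthogonal to v1. Lines whose four coordinates agree up
  to a fraction of the side lengths fit into one box, whose axes are those of the sheared plank.\<close>

lemma plank_count:
  fixes a v :: "'l \<Rightarrow> real^3" and \<L> :: "(real^3) set set" and D :: "'l set" and ln :: "'l \<Rightarrow> (real^3) set"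
  assumes L: "finite \<L>" and inj: "inj_on ln D" and D: "finite D" "ln ` D \<subseteq> \<L>"
    and ln: "\<And>l. l \<in> D \<Longrightarrow> ln l = line_at (a l) (v l)" and v: "\<And>l. l \<in> D \<Longrightarrow> norm (v l) = 1"
    and v1: "norm v1 = 1" and n: "norm n = 1" "n \<bullet> v1 = 0"
    and vv: "\<And>l. l \<in> D \<Longrightarrow> v l \<bullet> v1 \<ge> 1/2"
    and an: "\<And>l. l \<in> D \<Longrightarrow> \<bar>(a l - a1) \<bullet> n\<bar> \<le> H1"
    and ap: "\<And>l. l \<in> D \<Longrightarrow> norm ((a l - a1) - ((a l - a1) \<bullet> v1) *\<^sub>R v1) \<le> H2"
    and av: "\<And>l. l \<in> D \<Longrightarrow> \<bar>(a l - a1) \<bullet> v1\<bar> \<le> 2"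
    and vn: "\<And>l. l \<in> D \<Longrightarrow> \<bar>v l \<bullet> n\<bar> \<le> H1"
    and vp: "\<And>l. l \<in> D \<Longrightarrow> norm (v l - (v l \<bullet> v1) *\<^sub>R v1) \<le> H2"
    and h: "0 < h1" "h1 \<le> h2" "h2 \<le> 1" and H: "0 \<le> H1" "0 \<le> H2"
  shows "real (card D) \<le> (320 * H1 / h1 + 2)\<^sup>2 * (320 * H2 / h2 + 2)\<^sup>2 * real (M_lines \<L> h1 h2)"
proof -
  obtain e where e: "norm e = 1" "e \<bullet> n = 0" "e \<bullet> v1 = 0"
    using third_axis[OF n(1) v1 n(2)] .
  have fr: "norm n = 1" "norm e = 1" "norm v1 = 1" "n \<bullet> e = 0" "n \<bullet> v1 = 0" "e \<bullet> v1 = 0"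
    using n e v1 by (simp_all add: inner_commute)
  have ii: "n \<bullet> n = 1" "e \<bullet> e = 1" "v1 \<bullet> v1 = 1" "e \<bullet> n = 0" "v1 \<bullet> n = 0" "v1 \<bullet> e = 0"
    using fr by (simp_all add: norm_eq_1 inner_commute)
  define \<kappa> where "\<kappa> = (\<lambda>l. v l \<bullet> v1)"
  \<comment> \<open>The parameter at which the line crosses the plane through a1 orthogonal to v1.
    There its coordinates are \<open>pn\<close> and \<open>pe\<close>, and \<open>qn\<close> and
    \<open>qe\<close> are its slopes per unit length along v1.\<close>
  define \<tau> where "\<tau> = (\<lambda>l. - ((a l - a1) \<bullet> v1) / \<kappa> l)"
  define qn where "qn = (\<lambda>l. (v l \<bullet> n) / \<kappa> l)"
  define qe where "qe = (\<lambda>l. (v l \<bullet> e) / \<kappa> l)"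
  define pn where "pn = (\<lambda>l. (a l - a1) \<bullet> n + \<tau> l * (v l \<bullet> n))"
  define pe where "pe = (\<lambda>l. (a l - a1) \<bullet> e + \<tau> l * (v l \<bullet> e))"
  \<comment> \<open>Deviations 5/4 c1 and 5/4 c2 have to fit into the box below. Together with the
    bounds 5 H for the four coordinates, 1/32 produces the number 320 = 2 * 5 * 32 of the
    statement.\<close>
  define c1 where "c1 = h1 / 32"
  define c2 where "c2 = h2 / 32"
  have c: "c1 > 0" "c2 > 0" using h by (simp_all add: c1_def c2_def)
  define key where "key = (\<lambda>l. (\<lfloor>pn l / c1\<rfloor>, \<lfloor>qn l / c1\<rfloor>, \<lfloor>pe l / c2\<rfloor>, \<lfloor>qe l / c2\<rfloor>))"
  define I where "I = (\<lambda>R::real. {\<lfloor>-R\<rfloor>..\<lfloor>R\<rfloor>})"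
  define K where "K = I (5 * H1 / c1) \<times> I (5 * H1 / c1) \<times> I (5 * H2 / c2) \<times> I (5 * H2 / c2)"
  have kap: "\<kappa> l \<ge> 1/2" "\<kappa> l \<le> 1" if "l \<in> D" for l
    using vv[OF that] Cauchy_Schwarz_ineq2[of "v l" v1] v[OF that] v1 by (auto simp: \<kappa>_def)
  have div2: "\<bar>x / \<kappa> l\<bar> \<le> 2 * \<bar>x\<bar>" if "l \<in> D" for x l
  proof -
    have "\<bar>x / \<kappa> l\<bar> = \<bar>x\<bar> / \<kappa> l" using kap[OF that] by (simp add: abs_divide)
    also have "\<dots> \<le> \<bar>x\<bar> / (1/2)" using kap[OF that] by (intro divide_left_mono) auto
    finally show ?thesis by simp
  qed
  have perp_e: "\<bar>x \<bullet> e\<bar> \<le> norm (x - (x \<bullet> v1) *\<^sub>R v1)" for x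
    using Cauchy_Schwarz_ineq2[of "x - (x \<bullet> v1) *\<^sub>R v1" e] fr ii by (simp add: inner_diff_left)
  have tau: "\<bar>\<tau> l\<bar> \<le> 4" if "l \<in> D" for l
    using div2[OF that, of "- ((a l - a1) \<bullet> v1)"] av[OF that] by (simp add: \<tau>_def)
  have bnds: "\<bar>pn l\<bar> \<le> 5 * H1" "\<bar>qn l\<bar> \<le> 5 * H1" "\<bar>pe l\<bar> \<le> 5 * H2" "\<bar>qe l\<bar> \<le> 5 * H2" if l: "l \<in> D" for l
  proof -
    have ve: "\<bar>v l \<bullet> e\<bar> \<le> H2" using perp_e[of "v l"] vp[OF l] by linarith
    have ae: "\<bar>(a l - a1) \<bullet> e\<bar> \<le> H2" using perp_e[of "a l - a1"] ap[OF l] by linarith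
    show "\<bar>qn l\<bar> \<le> 5 * H1" using div2[OF l, of "v l \<bullet> n"] vn[OF l] H by (simp add: qn_def)
    show "\<bar>qe l\<bar> \<le> 5 * H2" using div2[OF l, of "v l \<bullet> e"] ve H by (simp add: qe_def)
    have "\<bar>\<tau> l * (v l \<bullet> n)\<bar> \<le> 4 * H1" unfolding abs_mult using tau[OF l] vn[OF l] by (intro mult_mono) auto
    then show "\<bar>pn l\<bar> \<le> 5 * H1" unfolding pn_def using an[OF l] by linarith
    have "\<bar>\<tau> l * (v l \<bullet> e)\<bar> \<le> 4 * H2" unfolding abs_mult using tau[OF l] ve by (intro mult_mono) auto
    then show "\<bar>pe l\<bar> \<le> 5 * H2" unfolding pe_def using ae by linarith
  qed
  have inI: "\<lfloor>x / w\<rfloor> \<in> I (R / w)" if "\<bar>x\<bar> \<le> R" "w > 0" for x w R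
  proof -
    have "- (R / w) \<le> x / w" "x / w \<le> R / w" using that by (auto simp: field_simps abs_le_iff)
    then show ?thesis unfolding I_def by (auto intro: floor_mono)
  qed
  have sub: "key ` D \<subseteq> K"
    using inI[OF bnds(1) c(1)] inI[OF bnds(2) c(1)] inI[OF bnds(3) c(2)] inI[OF bnds(4) c(2)]
    by (auto simp: key_def K_def)
  have point: "a l + t *\<^sub>R v l = a1 + ((t - \<tau> l) * \<kappa> l) *\<^sub>R v1 + (pn l + (t - \<tau> l) * \<kappa> l * qn l) *\<^sub>R n + (pe l + (t - \<tau> l) * \<kappa> l * qe l) *\<^sub>R e"
    if l: "l \<in> D" for l t
  proof -
    have k0: "\<kappa> l \<noteq> 0" using kap[OF l] by linarith
    let ?x = "a l + t *\<^sub>R v l - a1"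
    have "?x \<bullet> v1 = (t - \<tau> l) * \<kappa> l"
    proof -
      have "v l \<bullet> v1 = \<kappa> l" by (simp add: \<kappa>_def)
      then show ?thesis using k0 by (simp add: \<tau>_def inner_diff_left inner_add_left field_simps)
    qed
    moreover have "?x \<bullet> n = pn l + (t - \<tau> l) * \<kappa> l * qn l"
      using k0 by (simp add: pn_def qn_def inner_diff_left inner_add_left algebra_simps)
    moreover have "?x \<bullet> e = pe l + (t - \<tau> l) * \<kappa> l * qe l"
      using k0 by (simp add: pe_def qe_def inner_diff_left inner_add_left algebra_simps)
    ultimately have "?x = (pn l + (t - \<tau> l) * \<kappa> l * qn l) *\<^sub>R n + (pe l + (t - \<tau> l) * \<kappa> l * qe l) *\<^sub>R e + ((t - \<tau> l) * \<kappa> l) *\<^sub>R v1"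
      using orthonormal_frame(2)[OF fr, of ?x] by (simp only:)
    then have "a1 + ?x = a1 + ((pn l + (t - \<tau> l) * \<kappa> l * qn l) *\<^sub>R n + (pe l + (t - \<tau> l) * \<kappa> l * qe l) *\<^sub>R e + ((t - \<tau> l) * \<kappa> l) *\<^sub>R v1)"
      by (simp only:)
    then show ?thesis by (simp only: add_diff_cancel_left' diff_add_cancel add_diff_eq add_ac)
  qed
  have vrep: "v l = \<kappa> l *\<^sub>R (v1 + qn l *\<^sub>R n + qe l *\<^sub>R e)" if l: "l \<in> D" for l
  proof -
    have k0: "\<kappa> l \<noteq> 0" using kap[OF l] by linarith
    show ?thesis
      using orthonormal_frame(2)[OF fr, of "v l"] k0 by (simp add: qn_def qe_def \<kappa>_def algebra_simps)
  qed
  have fibre: "card {l \<in> D. key l = k} \<le> M_lines \<L> h1 h2" for k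
  proof (cases "{l \<in> D. key l = k} = {}")
    case False
    then obtain l0 where l0: "l0 \<in> D" "key l0 = k" by auto
    define w where "w = v1 + qn l0 *\<^sub>R n + qe l0 *\<^sub>R e"
    have w0: "v l0 = \<kappa> l0 *\<^sub>R w" using vrep[OF l0(1)] by (simp add: w_def)
    have nw: "norm w \<ge> 1"
    proof -
      have "w \<bullet> v1 = 1" by (simp add: w_def inner_add_left ii fr)
      then show ?thesis using Cauchy_Schwarz_ineq2[of w v1] v1 by simp
    qed
    define f3 where "f3 = (1 / norm w) *\<^sub>R w"
    \<comment> \<open>The normal n sheared so as to be orthogonal to the reference line w. It
      remains orthogonal to e; therefore the deviation along e, which is of size h2, does not enter
      the thin direction \<open>f1\<close>.\<close>
    define g where "g = n - qn l0 *\<^sub>R v1"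
    have ng: "norm g \<ge> 1"
    proof -
      have "g \<bullet> n = 1" by (simp add: g_def inner_diff_left ii)
      then show ?thesis using Cauchy_Schwarz_ineq2[of g n] n by simp
    qed
    define f1 where "f1 = (1 / norm g) *\<^sub>R g"
    have "g \<noteq> 0" "w \<noteq> 0" using ng nw by auto
    then have n13: "norm f1 = 1" "norm f3 = 1" by (simp_all add: f1_def f3_def)
    have "g \<bullet> w = 0" by (simp add: g_def w_def inner_diff_left inner_add_right ii fr)
    then have o13: "f1 \<bullet> f3 = 0" by (simp add: f1_def f3_def)
    obtain f2 where f2: "norm f2 = 1" "f2 \<bullet> f1 = 0" "f2 \<bullet> f3 = 0"
      using third_axis[OF n13 o13] .
    have o12: "f1 \<bullet> f2 = 0" using f2 by (simp add: inner_commute)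
    obtain B where B: "B \<in> boxes h1 h2 1" "compact B"
      "\<And>x. \<bar>(x - (a1 + pn l0 *\<^sub>R n + pe l0 *\<^sub>R e)) \<bullet> f1\<bar> \<le> h1 / 2 \<Longrightarrow> \<bar>(x - (a1 + pn l0 *\<^sub>R n + pe l0 *\<^sub>R e)) \<bullet> f2\<bar> \<le> h2 / 2 \<Longrightarrow>
        \<bar>(x - (a1 + pn l0 *\<^sub>R n + pe l0 *\<^sub>R e)) \<bullet> f3\<bar> \<le> 1 / 2 \<Longrightarrow> x \<in> B"
      using frame_box[OF n13(1) f2(1) n13(2) o12 o13 f2(3), of h1 h2 1 "a1 + pn l0 *\<^sub>R n + pe l0 *\<^sub>R e"] by blast
    have "measure (arc_length (ln l)) B \<ge> 1/2" if l: "l \<in> D" "key l = k" for l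
      unfolding ln[OF l(1)]
    proof (rule measure_arc_length_ge[OF v[OF l(1)] B(2)])
      fix t assume t: "\<bar>t - \<tau> l\<bar> \<le> 1/4"
      define s where "s = (t - \<tau> l) * \<kappa> l"
      define y where "y = (pn l - pn l0) + s * (qn l - qn l0)"
      define z where "z = (pe l - pe l0) + s * (qe l - qe l0)"
      have s: "\<bar>s\<bar> \<le> 1/4"
        using mult_mono[OF t, of "\<bar>\<kappa> l\<bar>" 1] kap[OF l(1)] by (simp add: s_def abs_mult)
      have cl: "\<bar>x - y\<bar> \<le> w" if "\<lfloor>x / w\<rfloor> = \<lfloor>y / w\<rfloor>" "w > 0" for x y w :: real
      proof -
        have "\<bar>x / w - y / w\<bar> \<le> 1" by (rule floor_close[OF that(1)])
        then have "\<bar>x - y\<bar> / w \<le> 1" using that(2) by (simp add: diff_divide_distrib[symmetric] abs_divide)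
        then show ?thesis using that(2) by simp
      qed
      have keyeq: "key l = key l0" using l l0 by simp
      have d: "\<bar>pn l - pn l0\<bar> \<le> c1" "\<bar>qn l - qn l0\<bar> \<le> c1" "\<bar>pe l - pe l0\<bar> \<le> c2" "\<bar>qe l - qe l0\<bar> \<le> c2"
        using keyeq c by (auto simp: key_def intro!: cl)
      have y: "\<bar>y\<bar> \<le> 5/4 * c1"
      proof -
        have "\<bar>s * (qn l - qn l0)\<bar> \<le> 1/4 * c1" unfolding abs_mult using s d c by (intro mult_mono) auto
        then show ?thesis unfolding y_def using d by linarith
      qed
      have z: "\<bar>z\<bar> \<le> 5/4 * c2"
      proof -
        have "\<bar>s * (qe l - qe l0)\<bar> \<le> 1/4 * c2" unfolding abs_mult using s d c by (intro mult_mono) auto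
        then show ?thesis unfolding z_def using d by linarith
      qed
      have pt: "a l + t *\<^sub>R v l - (a1 + pn l0 *\<^sub>R n + pe l0 *\<^sub>R e) = s *\<^sub>R w + y *\<^sub>R n + z *\<^sub>R e"
        unfolding point[OF l(1)] s_def[symmetric] y_def z_def w_def by (simp add: algebra_simps)
      have le1: "\<bar>n \<bullet> f\<bar> \<le> 1" "\<bar>e \<bullet> f\<bar> \<le> 1" if "norm f = 1" for f
        using Cauchy_Schwarz_ineq2[of n f] Cauchy_Schwarz_ineq2[of e f] that fr by auto
      have yz: "\<bar>y * (n \<bullet> f) + z * (e \<bullet> f)\<bar> \<le> 5/4 * c1 + 5/4 * c2" if "norm f = 1" for f
      proof -
        have "\<bar>y * (n \<bullet> f)\<bar> \<le> 5/4 * c1 * 1" "\<bar>z * (e \<bullet> f)\<bar> \<le> 5/4 * c2 * 1"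
          unfolding abs_mult using y z le1[OF that] c by (intro mult_mono; simp)+
        then show ?thesis by linarith
      qed
      have wf: "w \<bullet> f1 = 0" "w \<bullet> f2 = 0"
      proof -
        show "w \<bullet> f1 = 0" using \<open>g \<bullet> w = 0\<close> by (simp add: f1_def inner_commute)
        have "f2 \<bullet> w = norm w * (f2 \<bullet> f3)" using \<open>w \<noteq> 0\<close> by (simp add: f3_def)
        then show "w \<bullet> f2 = 0" using f2 by (simp add: inner_commute)
      qed
      show "a l + t *\<^sub>R v l \<in> B"
      proof (rule B(3); unfold pt)
        have "e \<bullet> f1 = 0" by (simp add: f1_def g_def inner_diff_right ii fr)
        moreover have "\<bar>y * (n \<bullet> f1)\<bar> \<le> 5/4 * c1 * 1"
          unfolding abs_mult using y le1[OF n13(1)] c by (intro mult_mono) auto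
        ultimately show "\<bar>(s *\<^sub>R w + y *\<^sub>R n + z *\<^sub>R e) \<bullet> f1\<bar> \<le> h1 / 2"
          using wf h by (simp add: inner_add_left c1_def)
        show "\<bar>(s *\<^sub>R w + y *\<^sub>R n + z *\<^sub>R e) \<bullet> f2\<bar> \<le> h2 / 2"
          using yz[OF f2(1)] wf h by (simp add: inner_add_left c1_def c2_def)
        \<comment> \<open>The long side: parameters within 1/4 of \<open>\<tau> l\<close> have to
          stay within 1/2 of the centre. As the slopes of l and l0 agree up to c1 and c2, the
          displacement along \<open>f3\<close> is at most (1 + 1/16)/4 + 5/64 < 1/2.\<close>
        have wl: "norm (v1 + qn l *\<^sub>R n + qe l *\<^sub>R e) * \<kappa> l = 1"
          using arg_cong[OF vrep[OF l(1)], of norm] v[OF l(1)] kap[OF l(1)] by (simp add: mult.commute)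
        have "norm w \<le> norm (v1 + qn l *\<^sub>R n + qe l *\<^sub>R e) + norm ((qn l0 - qn l) *\<^sub>R n + (qe l0 - qe l) *\<^sub>R e)"
        proof -
          have "w = (v1 + qn l *\<^sub>R n + qe l *\<^sub>R e) + ((qn l0 - qn l) *\<^sub>R n + (qe l0 - qe l) *\<^sub>R e)"
            by (simp add: w_def algebra_simps)
          then show ?thesis by (metis norm_triangle_ineq)
        qed
        also have "norm ((qn l0 - qn l) *\<^sub>R n + (qe l0 - qe l) *\<^sub>R e) \<le> c1 + c2"
          using d fr by (intro norm_triangle_le) (simp add: abs_minus_commute)
        finally have "norm w * \<kappa> l \<le> (norm (v1 + qn l *\<^sub>R n + qe l *\<^sub>R e) + (c1 + c2)) * \<kappa> l"
          using kap[OF l(1)] by (intro mult_right_mono) auto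
        also have "\<dots> \<le> 1 + (c1 + c2) * 1"
          using wl mult_left_mono[OF kap(2)[OF l(1)], of "c1 + c2"] c by (simp add: distrib_right)
        finally have nwk: "norm w * \<kappa> l \<le> 1 + (c1 + c2)" by simp
        have "w \<bullet> f3 = norm w" using \<open>w \<noteq> 0\<close> by (simp add: f3_def power2_norm_eq_inner[symmetric] power2_eq_square)
        then have "\<bar>s * (w \<bullet> f3)\<bar> = \<bar>t - \<tau> l\<bar> * (norm w * \<kappa> l)"
          using kap[OF l(1)] by (simp add: s_def abs_mult)
        also have "\<dots> \<le> 1/4 * (1 + (c1 + c2))"
          using t nwk kap[OF l(1)] by (intro mult_mono) auto
        finally have "\<bar>s * (w \<bullet> f3)\<bar> \<le> 1/4 * (1 + (c1 + c2))" .
        moreover have "c1 \<le> 1/32" "c2 \<le> 1/32" using h by (simp_all add: c1_def c2_def)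
        ultimately show "\<bar>(s *\<^sub>R w + y *\<^sub>R n + z *\<^sub>R e) \<bullet> f3\<bar> \<le> 1 / 2"
          using yz[OF n13(2)] abs_triangle_ineq[of "s * (w \<bullet> f3)" "y * (n \<bullet> f3) + z * (e \<bullet> f3)"]
          unfolding inner_add_left inner_scaleR_left add.assoc by argo
      qed
    qed
    then have "ln ` {l \<in> D. key l = k} \<subseteq> {l \<in> \<L>. measure (arc_length l) B \<ge> 1/2}"
      using D(2) by auto
    then have "card (ln ` {l \<in> D. key l = k}) \<le> card {l \<in> \<L>. measure (arc_length l) B \<ge> 1/2}"
      using L by (intro card_mono) auto
    moreover have "card (ln ` {l \<in> D. key l = k}) = card {l \<in> D. key l = k}"
      using inj by (intro card_image) (auto simp: inj_on_def)
    ultimately show ?thesis using M_lines_ge[OF L B(1)] by linarith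
  next
    case True
    show ?thesis unfolding True by simp
  qed
  have finK: "finite K" by (simp add: K_def I_def)
  have "card D \<le> card K * M_lines \<L> h1 h2"
    by (rule card_le_fibres[OF D(1) finK sub fibre])
  then have "real (card D) \<le> real (card K) * real (M_lines \<L> h1 h2)"
    by (metis of_nat_le_iff of_nat_mult)
  also have "real (card K) = (real (card (I (5 * H1 / c1))))\<^sup>2 * (real (card (I (5 * H2 / c2))))\<^sup>2"
    by (simp add: K_def card_cartesian_product power2_eq_square)
  also have "\<dots> \<le> (320 * H1 / h1 + 2)\<^sup>2 * (320 * H2 / h2 + 2)\<^sup>2"
  proof (intro mult_mono power_mono)
    show "real (card (I (5 * H1 / c1))) \<le> 320 * H1 / h1 + 2"
      using card_floor_le[of "5 * H1 / c1"] H c by (simp add: I_def c1_def)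
    show "real (card (I (5 * H2 / c2))) \<le> 320 * H2 / h2 + 2"
      using card_floor_le[of "5 * H2 / c2"] H c by (simp add: I_def c2_def)
  qed (use H h in auto)
  finally show ?thesis by (simp add: mult_right_mono)
qed

text \<open>The lines of D pass close to points of k in directions close to \<open>v k\<close>, so
  they lie in a plank around k. The vector \<omega> is only almost orthogonal to \<open>v k\<close>;
  replacing it by a true normal costs at most a multiple of \<zeta> \<theta> \<le> \<eta>. Since
  \<theta> may exceed 1, the directions in D may still be far from \<open>v k\<close>. They are
  therefore sorted into 5^3 = 125 grid cells, and in each cell one of the lines becomes the axis of
  a plank.\<close>

lemma near_lines_count:
  fixes a v :: "(real^3) set \<Rightarrow> real^3" and \<L> D :: "(real^3) set set"
  assumes L: "finite \<L>" and D: "D \<subseteq> \<L>"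
    and ln: "\<And>l. l \<in> \<L> \<Longrightarrow> l = line_at (a l) (v l)" and v: "\<And>l. l \<in> \<L> \<Longrightarrow> norm (v l) = 1"
    and a: "\<And>l. l \<in> \<L> \<Longrightarrow> norm (a l) \<le> 1"
    and k: "k \<in> \<L>" and \<omega>: "norm \<omega> = 1" and vk: "\<bar>v k \<bullet> \<omega>\<bar> \<le> \<zeta>"
    and pos: "0 \<le> \<eta>" "0 \<le> \<theta>" "\<zeta> * \<theta> \<le> \<eta>"
    and v\<theta>: "\<And>l. l \<in> D \<Longrightarrow> norm (v l - v k) \<le> \<theta>" and v\<eta>: "\<And>l. l \<in> D \<Longrightarrow> \<bar>(v l - v k) \<bullet> \<omega>\<bar> \<le> \<eta>"
    and near: "\<And>l. l \<in> D \<Longrightarrow> \<exists>t t'. \<bar>t\<bar> \<le> 14 \<and> \<bar>t'\<bar> \<le> 14 \<and> norm (a k + t *\<^sub>R v k - a l - t' *\<^sub>R v l) \<le> \<theta>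
        \<and> \<bar>(a k + t *\<^sub>R v k - a l - t' *\<^sub>R v l) \<bullet> \<omega>\<bar> \<le> \<eta>"
    and h: "0 < h1" "h1 \<le> h2" "h2 \<le> 1"
  shows "real (card D) \<le> 125 * ((40000 * \<eta> / h1 + 2)\<^sup>2 * (40000 * \<theta> / h2 + 2)\<^sup>2) * real (M_lines \<L> h1 h2)"
proof -
  have finD: "finite D" using D L finite_subset by blast
  obtain n where n: "norm n = 1" "n \<bullet> v k = 0" "norm (n - \<omega>) \<le> 2 * \<bar>v k \<bullet> \<omega>\<bar>"
    using orthogonal_normal[OF v[OF k] \<omega>] .
  have n\<omega>: "norm (n - \<omega>) \<le> 2 * \<zeta>" using n(3) vk by linarith
  have to_n: "\<bar>x \<bullet> n\<bar> \<le> 3 * \<eta>" if "norm x \<le> \<theta>" "\<bar>x \<bullet> \<omega>\<bar> \<le> \<eta>" for x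
  proof -
    have "\<bar>x \<bullet> (n - \<omega>)\<bar> \<le> norm x * norm (n - \<omega>)" by (rule Cauchy_Schwarz_ineq2)
    also have "\<dots> \<le> \<theta> * (2 * \<zeta>)" using that n\<omega> pos by (intro mult_mono) auto
    also have "\<dots> \<le> 2 * \<eta>" using pos by (simp add: mult_ac)
    finally have "\<bar>x \<bullet> (n - \<omega>)\<bar> \<le> 2 * \<eta>" .
    then show ?thesis using that(2) unfolding inner_diff_right by linarith
  qed
  have vn: "\<bar>(v l - v k) \<bullet> n\<bar> \<le> 3 * \<eta>" if "l \<in> D" for l
    using to_n[OF v\<theta>[OF that] v\<eta>[OF that]] .
  have aa: "\<exists>c r. \<bar>c\<bar> \<le> 28 \<and> norm r \<le> 15 * \<theta> \<and> \<bar>r \<bullet> n\<bar> \<le> 45 * \<eta> \<and> a l - a k = c *\<^sub>R v k + r" if l: "l \<in> D" for l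
  proof -
    obtain t t' where t: "\<bar>t\<bar> \<le> 14" "\<bar>t'\<bar> \<le> 14" and x: "norm (a k + t *\<^sub>R v k - a l - t' *\<^sub>R v l) \<le> \<theta>"
        "\<bar>(a k + t *\<^sub>R v k - a l - t' *\<^sub>R v l) \<bullet> \<omega>\<bar> \<le> \<eta>"
      using near[OF l] by blast
    let ?x = "a k + t *\<^sub>R v k - a l - t' *\<^sub>R v l"
    let ?r = "- (t' *\<^sub>R (v l - v k)) - ?x"
    have 1: "a l - a k = (t - t') *\<^sub>R v k + ?r" by (simp add: algebra_simps)
    have "norm (t' *\<^sub>R (v l - v k)) \<le> 14 * \<theta>" using mult_mono[OF t(2) v\<theta>[OF l]] pos by simp
    then have 2: "norm ?r \<le> 15 * \<theta>"
      using norm_triangle_ineq4[of "- (t' *\<^sub>R (v l - v k))" ?x] x(1) by simp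
    have "\<bar>t' * ((v l - v k) \<bullet> n)\<bar> \<le> 14 * (3 * \<eta>)" unfolding abs_mult using t(2) vn[OF l] by (intro mult_mono) auto
    moreover have "?r \<bullet> n = - (t' * ((v l - v k) \<bullet> n)) - ?x \<bullet> n" by (simp only: inner_diff_left inner_minus_left inner_scaleR_left)
    ultimately have 3: "\<bar>?r \<bullet> n\<bar> \<le> 45 * \<eta>" using to_n[OF x] by linarith
    have "\<bar>t - t'\<bar> \<le> 28" using t by linarith
    then show ?thesis using 1 2 3 by blast
  qed
  define key where "key = (\<lambda>l. (\<lfloor>2 * v l $ 1\<rfloor>, \<lfloor>2 * v l $ 2\<rfloor>, \<lfloor>2 * v l $ 3\<rfloor>))"
  let ?K = "{-2..2::int} \<times> {-2..2::int} \<times> {-2..2::int}"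
  define M where "M = ((40000 * \<eta> / h1 + 2)\<^sup>2 * (40000 * \<theta> / h2 + 2)\<^sup>2) * real (M_lines \<L> h1 h2)"
  have fib: "real (card {l \<in> D. key l = c}) \<le> M" for c
  proof (cases "{l \<in> D. key l = c} = {}")
    case True
    have "M \<ge> 0" by (simp add: M_def)
    then show ?thesis unfolding True by simp
  next
    case False
    define E where "E = {l \<in> D. key l = c}"
    obtain j where j: "j \<in> E" using False by (auto simp: E_def)
    have jD: "j \<in> D" "key j = c" and EL: "\<And>l. l \<in> E \<Longrightarrow> l \<in> \<L>" and ED: "\<And>l. l \<in> E \<Longrightarrow> l \<in> D"
      using j D by (auto simp: E_def)
    have jL: "j \<in> \<L>" using jD D by auto
    have close: "norm (v l - v j) \<le> 1" if l: "l \<in> E" for l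
    proof -
      have "key l = key j" using l j by (simp add: E_def)
      then have "\<bar>2 * v l $ i - 2 * v j $ i\<bar> \<le> 1" for i
        using exhaust_3[of i] by (auto simp: key_def intro!: floor_close)
      then have "\<bar>2 * (v l $ i - v j $ i)\<bar> \<le> 1" for i
        by (simp only: right_diff_distrib)
      then have "\<bar>(v l - v j) $ i\<bar> \<le> 1/2" for i
        unfolding abs_mult vector_minus_component by (metis abs_numeral le_divide_eq_numeral1(1) mult.commute)
      then have sq: "((v l - v j) $ i)\<^sup>2 \<le> 1/4" for i
        using power_mono[of "\<bar>(v l - v j) $ i\<bar>" "1/2" 2] by (simp add: power_divide)
      have "(norm (v l - v j))\<^sup>2 = ((v l - v j) $ 1)\<^sup>2 + ((v l - v j) $ 2)\<^sup>2 + ((v l - v j) $ 3)\<^sup>2"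
        by (simp only: power2_norm_eq_inner inner_vec_def sum_3) (simp add: power2_eq_square)
      also have "\<dots> \<le> 1\<^sup>2" using sq[of 1] sq[of 2] sq[of 3] by simp
      finally show ?thesis by (rule power2_le_imp_le) simp
    qed
    \<comment> \<open>A second change of normal, now to the axis \<open>v j\<close>. Its inner
      product with n is at most 3 \<eta>, so m differs from n by at most 6 \<eta>, which amounts to
      12 \<eta> on vectors of norm at most 2.\<close>
    obtain m where m: "norm m = 1" "m \<bullet> v j = 0" "norm (m - n) \<le> 2 * \<bar>v j \<bullet> n\<bar>"
      using orthogonal_normal[OF v[OF jL] n(1)] .
    have "v j \<bullet> n = (v j - v k) \<bullet> n" using n(2) by (simp add: inner_diff_left inner_commute[of "v k" n])
    then have mn: "norm (m - n) \<le> 6 * \<eta>" using m(3) vn[OF jD(1)] by linarith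
    have to_m: "\<bar>x \<bullet> m\<bar> \<le> \<bar>x \<bullet> n\<bar> + 12 * \<eta>" if "norm x \<le> 2" for x
    proof -
      have "\<bar>x \<bullet> (m - n)\<bar> \<le> norm x * norm (m - n)" by (rule Cauchy_Schwarz_ineq2)
      also have "\<dots> \<le> 2 * (6 * \<eta>)" using that mn by (intro mult_mono) auto
      finally show ?thesis unfolding inner_diff_right by linarith
    qed
    have vk_vn: "v k \<bullet> n = 0" using n(2) by (simp add: inner_commute)
    \<comment> \<open>102 = 2 * 45 + 12 bounds the offset of two base points in the direction m. 86
      = 2 * 28 + 2 * 15 bounds it orthogonally to \<open>v j\<close>, where the displacement along
      \<open>v k\<close> only counts through \<open>v k - v j\<close>.\<close>
    have "real (card E) \<le> (320 * (102 * \<eta>) / h1 + 2)\<^sup>2 * (320 * (86 * \<theta>) / h2 + 2)\<^sup>2 * real (M_lines \<L> h1 h2)"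
    proof (rule plank_count[where ln = "\<lambda>l. l" and a = a and v = v and n = m and ?v1.0 = "v j" and ?a1.0 = "a j"])
      show "finite E" using finD by (simp add: E_def)
      show "l = line_at (a l) (v l)" if "l \<in> E" for l by (rule ln[OF EL[OF that]])
      show "norm (v l) = 1" if "l \<in> E" for l by (rule v[OF EL[OF that]])
      show "norm (v j) = 1" by (rule v[OF jL])
      show "1/2 \<le> v l \<bullet> v j" if l: "l \<in> E" for l
      proof -
        have "(norm (v l - v j))\<^sup>2 \<le> 1\<^sup>2" using close[OF l] by (intro power_mono) auto
        moreover have "(norm (v l - v j))\<^sup>2 = (norm (v l))\<^sup>2 + (norm (v j))\<^sup>2 - 2 * (v l \<bullet> v j)"
          unfolding power2_norm_eq_inner inner_diff_left inner_diff_right inner_commute[of "v j" "v l"] by simp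
        moreover have "norm (v l) = 1" "norm (v j) = 1" by (rule v[OF EL[OF l]], rule v[OF jL])
        ultimately show ?thesis by simp
      qed
      fix l assume l: "l \<in> E"
      obtain c r where cr: "\<bar>c\<bar> \<le> 28" "norm r \<le> 15 * \<theta>" "\<bar>r \<bullet> n\<bar> \<le> 45 * \<eta>" "a l - a k = c *\<^sub>R v k + r"
        using aa[OF ED[OF l]] by blast
      obtain c' r' where cr': "\<bar>c'\<bar> \<le> 28" "norm r' \<le> 15 * \<theta>" "\<bar>r' \<bullet> n\<bar> \<le> 45 * \<eta>" "a j - a k = c' *\<^sub>R v k + r'"
        using aa[OF jD(1)] by blast
      have "a l - a j = (a l - a k) - (a j - a k)" by simp
      then have dif: "a l - a j = (c - c') *\<^sub>R v k + (r - r')"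
        unfolding cr(4) cr'(4) by (simp add: algebra_simps)
      have n2: "norm (a l - a j) \<le> 2"
        using norm_triangle_ineq4[of "a l" "a j"] a[OF EL[OF l]] a[OF jL] by linarith
      have "(a l - a j) \<bullet> n = r \<bullet> n - r' \<bullet> n" unfolding dif by (simp add: inner_add_left inner_diff_left vk_vn)
      then have "\<bar>(a l - a j) \<bullet> n\<bar> \<le> 90 * \<eta>" using cr cr' by linarith
      then show "\<bar>(a l - a j) \<bullet> m\<bar> \<le> 102 * \<eta>" using to_m[OF n2] by linarith
      show "\<bar>(a l - a j) \<bullet> v j\<bar> \<le> 2"
        using Cauchy_Schwarz_ineq2[of "a l - a j" "v j"] n2 v[OF jL] by simp
      have nv2: "norm (v l - v j) \<le> 2" using close[OF l] by simp
      have "(v l - v j) \<bullet> n = (v l - v k) \<bullet> n - (v j - v k) \<bullet> n" by (simp add: inner_diff_left)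
      then have "\<bar>(v l - v j) \<bullet> n\<bar> \<le> 6 * \<eta>" using vn[OF ED[OF l]] vn[OF jD(1)] by linarith
      moreover have "v l \<bullet> m = (v l - v j) \<bullet> m" using m(2) by (simp add: inner_diff_left inner_commute[of "v j" m])
      ultimately show "\<bar>v l \<bullet> m\<bar> \<le> 102 * \<eta>" using to_m[OF nv2] pos by linarith
      let ?P = "\<lambda>x. x - (x \<bullet> v j) *\<^sub>R v j"
      have vjj: "v j \<bullet> v j = 1" using v[OF jL] by (simp add: norm_eq_1)
      have vkl: "norm (v l - v j) \<le> 2 * \<theta>"
        using norm_triangle_ineq4[of "v l - v k" "v j - v k"] v\<theta>[OF ED[OF l]] v\<theta>[OF jD(1)] by simp
      have "?P (v l) = ?P (v l - v j)" by (simp add: inner_diff_left vjj algebra_simps)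
      then have "norm (?P (v l)) \<le> norm (v l - v j)" using norm_perp_le[OF v[OF jL]] by metis
      then show "norm (v l - (v l \<bullet> v j) *\<^sub>R v j) \<le> 86 * \<theta>" using vkl pos by linarith
      have "?P (a l - a j) = ?P ((c - c') *\<^sub>R (v k - v j) + (r - r'))"
        unfolding dif by (simp add: inner_add_left inner_diff_left vjj algebra_simps)
      then have "norm (?P (a l - a j)) \<le> norm ((c - c') *\<^sub>R (v k - v j) + (r - r'))"
        using norm_perp_le[OF v[OF jL]] by metis
      also have "\<dots> \<le> \<bar>c - c'\<bar> * norm (v k - v j) + (norm r + norm r')"
        by (intro norm_triangle_le add_mono norm_triangle_ineq4) simp
      also have "\<dots> \<le> 56 * \<theta> + (15 * \<theta> + 15 * \<theta>)"
        using cr cr' v\<theta>[OF jD(1)] pos by (intro add_mono mult_mono) (auto simp: norm_minus_commute)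
      finally show "norm ((a l - a j) - ((a l - a j) \<bullet> v j) *\<^sub>R v j) \<le> 86 * \<theta>" by simp
    qed (use L m h pos EL in auto)
    also have "\<dots> \<le> M"
    proof -
      have "320 * (102 * \<eta>) / h1 + 2 \<le> 40000 * \<eta> / h1 + 2" "320 * (86 * \<theta>) / h2 + 2 \<le> 40000 * \<theta> / h2 + 2"
        using pos h by (simp_all add: divide_right_mono)
      moreover have "0 \<le> 320 * (102 * \<eta>) / h1 + 2" "0 \<le> 320 * (86 * \<theta>) / h2 + 2"
        using pos h by (simp_all add: add_nonneg_nonneg)
      ultimately show ?thesis
        unfolding M_def by (intro mult_right_mono mult_mono power_mono) auto
    qed
    finally show ?thesis by (simp add: E_def)
  qed
  have sub: "key ` D \<subseteq> ?K"
  proof -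
    have "\<lfloor>2 * v l $ i\<rfloor> \<in> {-2..2}" if "l \<in> D" for l i
    proof -
      have "\<bar>v l $ i\<bar> \<le> 1" using component_le_norm_cart[of "v l" i] v[of l] that D by auto
      then show ?thesis by (auto simp: le_floor_iff floor_le_iff abs_le_iff)
    qed
    then show ?thesis by (auto simp: key_def)
  qed
  have "real (card D) = (\<Sum>c\<in>?K. real (card {l \<in> D. key l = c}))"
  proof -
    have "card D = (\<Sum>c\<in>?K. card {l \<in> D. key l = c})"
      using sum.group[OF finD _ sub, of "\<lambda>_. 1::nat"] by simp
    then show ?thesis by simp
  qed
  also have "\<dots> \<le> (\<Sum>c\<in>?K. M)" by (intro sum_mono fib)
  also have "\<dots> = 125 * M" by (simp add: card_cartesian_product)
  finally show ?thesis by (simp add: M_def)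
qed

text \<open>Any two of these lines are close in the sense of \<open>near_lines_count\<close> with
  \<eta> = \<theta> = 2 and \<zeta> = 1. The lemma bounds \<open>M_lines\<close> from below by a
  power of h1 times the number of lines, so that rapidly decaying errors proportional to the number
  of lines can be absorbed.\<close>

lemma all_lines_count:
  fixes a v :: "(real^3) set \<Rightarrow> real^3" and \<L> :: "(real^3) set set"
  assumes L: "finite \<L>"
    and ln: "\<And>l. l \<in> \<L> \<Longrightarrow> l = line_at (a l) (v l)" and v: "\<And>l. l \<in> \<L> \<Longrightarrow> norm (v l) = 1"
    and a: "\<And>l. l \<in> \<L> \<Longrightarrow> norm (a l) \<le> 1"
    and h: "0 < h1" "h1 \<le> h2" "h2 \<le> 1"
  shows "real (card \<L>) * h1 ^ 4 \<le> 125 * 80002 ^ 4 * real (M_lines \<L> h1 h2)"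
proof (cases "\<L> = {}")
  case False
  then obtain k where k: "k \<in> \<L>" by auto
  define \<omega> where "\<omega> = (axis 1 1 :: real^3)"
  have \<omega>: "norm \<omega> = 1" by (simp add: \<omega>_def norm_axis_1)
  have vd: "norm (v l - v k) \<le> 2" if "l \<in> \<L>" for l
    using norm_triangle_ineq4[of "v l" "v k"] v[OF that] v[OF k] by simp
  have ad: "norm (a k - a l) \<le> 2" if "l \<in> \<L>" for l
    using norm_triangle_ineq4[of "a k" "a l"] a[OF that] a[OF k] by simp
  have in1: "\<bar>x \<bullet> \<omega>\<bar> \<le> norm x" for x using Cauchy_Schwarz_ineq2[of x \<omega>] \<omega> by simp
  have "real (card \<L>) \<le> 125 * ((40000 * 2 / h1 + 2)\<^sup>2 * (40000 * 2 / h2 + 2)\<^sup>2) * real (M_lines \<L> h1 h2)"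
  proof (rule near_lines_count[where a = a and v = v and k = k and \<omega> = \<omega> and \<zeta> = 1])
    fix l assume l: "l \<in> \<L>"
    show "\<exists>t t'. \<bar>t\<bar> \<le> 14 \<and> \<bar>t'\<bar> \<le> 14 \<and> norm (a k + t *\<^sub>R v k - a l - t' *\<^sub>R v l) \<le> 2
        \<and> \<bar>(a k + t *\<^sub>R v k - a l - t' *\<^sub>R v l) \<bullet> \<omega>\<bar> \<le> 2"
      using ad[OF l] in1[of "a k - a l"] by (intro exI[of _ 0]) auto
    show "\<bar>(v l - v k) \<bullet> \<omega>\<bar> \<le> 2" using vd[OF l] in1[of "v l - v k"] by linarith
  qed (use L ln v a k \<omega> vd h in1[of "v k"] in auto)
  also have "\<dots> \<le> 125 * ((80002 / h1)\<^sup>2 * (80002 / h1)\<^sup>2) * real (M_lines \<L> h1 h2)"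
  proof -
    have "40000 * 2 / h1 + 2 \<le> 80002 / h1" using h by (simp add: field_simps)
    moreover have "40000 * 2 / h2 \<le> 40000 * 2 / h1" using h by (intro divide_left_mono) auto
    ultimately have "40000 * 2 / h1 + 2 \<le> 80002 / h1" "40000 * 2 / h2 + 2 \<le> 80002 / h1" by linarith+
    then show ?thesis using h by (intro mult_right_mono mult_left_mono mult_mono power_mono) auto
  qed
  also have "\<dots> = 125 * 80002 ^ 4 * real (M_lines \<L> h1 h2) / h1 ^ 4"
    by (simp add: power_divide flip: power_add)
  finally show ?thesis using h by (simp add: pos_le_divide_eq)
qed simp

section \<open>Local energy of a bundle of lines\<close>

context bump_function
begin

text \<open>Moving the base point only contributes a phase.\<close>

lemma line_fourier_cmod:
  "cmod (line_fourier \<beta> a v \<xi>) = cmod (LINT t|lborel. complex_of_real (\<beta> t) * cis ((\<xi> \<bullet> v) * t))"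
proof -
  have "line_fourier \<beta> a v \<xi> = (LINT t|lborel. cis (\<xi> \<bullet> a) * (complex_of_real (\<beta> t) * cis ((\<xi> \<bullet> v) * t)))"
    unfolding line_fourier_def
    by (intro Bochner_Integration.integral_cong refl) (simp add: inner_add_right cis_mult[symmetric] mult_ac)
  also have "\<dots> = cis (\<xi> \<bullet> a) * (LINT t|lborel. complex_of_real (\<beta> t) * cis ((\<xi> \<bullet> v) * t))"
    by (rule integral_mult_right_zero)
  finally show ?thesis by (simp add: norm_mult)
qed

lemma line_fourier_bound:
  assumes [measurable]: "\<beta> \<in> borel_measurable borel" and \<beta>: "\<And>t. 0 \<le> \<beta> t" "\<And>t. \<beta> t \<le> 1" "\<And>t. \<bar>t\<bar> > 14 \<Longrightarrow> \<beta> t = 0"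
  shows "cmod (line_fourier \<beta> a v \<xi>) \<le> 28"
proof -
  have "norm (LINT t|lborel. complex_of_real (\<beta> t) * cis ((\<xi> \<bullet> v) * t)) \<le> 1 * measure lborel (cball 0 14 :: real set)"
    by (rule integrable_bounded_support(2)) (auto simp: norm_mult \<beta>)
  then show ?thesis unfolding line_fourier_cmod by (simp add: cball_eq_atLeastAtMost)
qed

lemma line_fourier_measurable [measurable]:
  assumes [measurable]: "\<beta> \<in> borel_measurable borel"
  shows "line_fourier \<beta> a v \<in> borel_measurable borel"
  unfolding line_fourier_def[abs_def] by measurable

end

lemma axial_form_ge:
  assumes \<omega>: "norm \<omega> = 1" and AB: "0 \<le> B" "B \<le> A"
  shows "axial_form \<omega> A B x \<ge> (A * (x \<bullet> \<omega>))\<^sup>2" "axial_form \<omega> A B x \<ge> (B * norm x)\<^sup>2"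
proof -
  have "(x \<bullet> \<omega>)\<^sup>2 \<le> (norm x)\<^sup>2"
    using Cauchy_Schwarz_ineq2[of x \<omega>] \<omega> power_mono[of "\<bar>x \<bullet> \<omega>\<bar>" "norm x" 2] by simp
  then show "axial_form \<omega> A B x \<ge> (A * (x \<bullet> \<omega>))\<^sup>2" by (simp add: axial_form_def)
  have "B\<^sup>2 * (x \<bullet> \<omega>)\<^sup>2 \<le> A\<^sup>2 * (x \<bullet> \<omega>)\<^sup>2" using AB by (intro mult_right_mono power_mono) auto
  then show "axial_form \<omega> A B x \<ge> (B * norm x)\<^sup>2"
    by (simp add: axial_form_def power_mult_distrib right_diff_distrib)
qed

text \<open>The form is at least B^2 unless the two points are within B/r' of each other and within
  B/r along \<omega>. For given s this exception confines t to an interval of length 4 B/r', because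
  v' is a unit vector, and it occurs only if \<open>near\<close> holds. All other t contribute at
  most 28 exp (- B^2 / 2), where 28 is the length of [-14, 14].\<close>

lemma gaussian_overlap:
  fixes a a' v v' \<omega> :: "real^3"
  assumes [measurable]: "\<beta> \<in> borel_measurable borel" and \<beta>: "\<And>t. 0 \<le> \<beta> t" "\<And>t. \<beta> t \<le> 1" "\<And>t. \<bar>t\<bar> > 14 \<Longrightarrow> \<beta> t = 0"
    and \<omega>: "norm \<omega> = 1" and v': "norm v' = 1" and r: "0 < r'" "r' \<le> r" and B: "0 \<le> B"
    and near: "\<not> near \<Longrightarrow> \<not> (\<exists>s t. \<bar>s\<bar> \<le> 14 \<and> \<bar>t\<bar> \<le> 14 \<and> norm (a + s *\<^sub>R v - a' - t *\<^sub>R v') \<le> B / r' \<and> \<bar>(a + s *\<^sub>R v - a' - t *\<^sub>R v') \<bullet> \<omega>\<bar> \<le> B / r)"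
  shows "(LINT s|lborel. \<beta> s * (LINT t|lborel. \<beta> t * exp (- axial_form \<omega> r r' (a + s *\<^sub>R v - (a' + t *\<^sub>R v')) / 2)))
    \<le> 28 * ((if near then 4 * (B / r') else 0) + 28 * exp (- B\<^sup>2 / 2))"
proof -
  let ?x = "\<lambda>s t. a + s *\<^sub>R v - (a' + t *\<^sub>R v')"
  let ?E = "\<lambda>s t. exp (- axial_form \<omega> r r' (?x s t) / 2)"
  let ?e = "exp (- B\<^sup>2 / 2)"
  let ?R = "B / r'"
  define c where "c = (if near then 4 * ?R else 0) + 28 * ?e"
  have R0: "?R \<ge> 0" using r B by simp
  have c0: "c \<ge> 0" using R0 by (simp add: c_def)
  have i\<beta>: "integrable lborel \<beta>" by (rule integrable_bounded_support[of \<beta> 1 14]) (auto simp: \<beta>)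
  have ball: "(LINT t|lborel. indicator {-14..14::real} t :: real) = 28" by simp
  have form0: "0 \<le> axial_form \<omega> r r' x" for x
    using axial_form_ge(1)[OF \<omega>, of r' r x] r by (intro order_trans[OF zero_le_power2]) auto
  have \<beta>le: "\<beta> t \<le> indicator {-14..14} t" for t using \<beta>(2)[of t] \<beta>(3)[of t] by (cases "\<bar>t\<bar> > 14") (auto simp: indicator_def)
  have ii: "integrable lborel (\<lambda>t. indicator {x..y} t :: real)" for x y :: real
    by (rule integrable_real_indicator) (auto simp: emeasure_lborel_Icc_eq)
  have Em [measurable]: "(\<lambda>x. exp (- axial_form \<omega> r r' x / 2)) \<in> borel_measurable borel"
    unfolding axial_form_def by (intro borel_measurable_continuous_onI continuous_intros) auto
  have far: "?E s t \<le> ?e" if "\<not> (norm (?x s t) \<le> ?R \<and> \<bar>?x s t \<bullet> \<omega>\<bar> \<le> B / r)" for s t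
  proof -
    have "B\<^sup>2 \<le> axial_form \<omega> r r' (?x s t)"
    proof (cases "norm (?x s t) \<le> ?R")
      case False
      then have "B \<le> r' * norm (?x s t)" using r by (simp add: field_simps)
      then have "B\<^sup>2 \<le> (r' * norm (?x s t))\<^sup>2" using B by (intro power_mono) auto
      then show ?thesis using axial_form_ge(2)[OF \<omega>, of r' r "?x s t"] r by simp
    next
      case True
      then have "B \<le> \<bar>r * (?x s t \<bullet> \<omega>)\<bar>" using that r by (simp add: field_simps abs_mult)
      then have "B\<^sup>2 \<le> \<bar>r * (?x s t \<bullet> \<omega>)\<bar>\<^sup>2" using B by (intro power_mono) auto
      then show ?thesis using axial_form_ge(1)[OF \<omega>, of r' r "?x s t"] r by simp
    qed
    then show ?thesis by simp
  qed
  have inner: "(LINT t|lborel. \<beta> t * ?E s t) \<le> c" if s: "\<bar>s\<bar> \<le> 14" for s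
  proof -
    obtain t0 where t0: "\<And>t. \<bar>t\<bar> \<le> 14 \<Longrightarrow> norm (?x s t) \<le> ?R \<Longrightarrow> \<bar>?x s t \<bullet> \<omega>\<bar> \<le> B / r \<Longrightarrow> near \<and> t \<in> {t0 - 2 * ?R..t0 + 2 * ?R}"
    proof (cases "\<exists>t. \<bar>t\<bar> \<le> 14 \<and> norm (?x s t) \<le> ?R \<and> \<bar>?x s t \<bullet> \<omega>\<bar> \<le> B / r")
      case True
      then obtain t0 where t0: "\<bar>t0\<bar> \<le> 14" "norm (?x s t0) \<le> ?R" "\<bar>?x s t0 \<bullet> \<omega>\<bar> \<le> B / r" by blast
      have nr: near
      proof (rule ccontr)
        assume "\<not> near"
        from near[OF this] t0 s show False by (auto simp: diff_diff_eq)
      qed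
      have "t \<in> {t0 - 2 * ?R..t0 + 2 * ?R}" if "norm (?x s t) \<le> ?R" for t
      proof -
        have "(t - t0) *\<^sub>R v' = ?x s t0 - ?x s t" by (simp add: algebra_simps)
        then have "\<bar>t - t0\<bar> = norm (?x s t0 - ?x s t)" using v' by (metis norm_scaleR mult.right_neutral)
        also have "\<dots> \<le> 2 * ?R" using norm_triangle_ineq4[of "?x s t0" "?x s t"] t0 that by linarith
        finally show ?thesis unfolding atLeastAtMost_iff by linarith
      qed
      then show ?thesis using that[of t0] nr by blast
    qed (use that in blast)
    have "\<beta> t * ?E s t \<le> (if near then 1 else 0) * indicator {t0 - 2 * ?R..t0 + 2 * ?R} t + ?e * indicator {-14..14} t" for t
    proof (cases "\<bar>t\<bar> \<le> 14")
      case t: True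
      show ?thesis
      proof (cases "norm (?x s t) \<le> ?R \<and> \<bar>?x s t \<bullet> \<omega>\<bar> \<le> B / r")
        case True
        have "\<beta> t * ?E s t \<le> 1 * 1" using \<beta> form0 by (intro mult_mono) auto
        also have "\<dots> \<le> (if near then 1 else 0) * indicator {t0 - 2 * ?R..t0 + 2 * ?R} t"
          using t0[OF t] True by simp
        finally show ?thesis by (rule add_increasing2[rotated]) simp
      next
        case False
        have "\<beta> t * ?E s t \<le> 1 * ?e" using \<beta> far[OF False] by (intro mult_mono) auto
        also have "\<dots> = ?e * indicator {-14..14} t" using t by (simp add: abs_le_iff)
        finally show ?thesis by (rule add_increasing[rotated]) simp
      qed
    qed (simp add: \<beta>)
    moreover have "integrable lborel (\<lambda>t. \<beta> t * ?E s t)"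
    proof (rule Bochner_Integration.integrable_bound[OF i\<beta>])
      show "AE t in lborel. norm (\<beta> t * ?E s t) \<le> norm (\<beta> t)"
        using form0 by (auto simp: abs_mult mult_left_le)
    qed measurable
    ultimately have "(LINT t|lborel. \<beta> t * ?E s t)
      \<le> (LINT t|lborel. (if near then 1 else 0) * indicator {t0 - 2 * ?R..t0 + 2 * ?R} t + ?e * indicator {-14..14} t)"
      by (intro integral_mono Bochner_Integration.integrable_add integrable_mult_right ii) auto
    also have "\<dots> = (LINT t|lborel. (if near then 1 else 0) * indicator {t0 - 2 * ?R..t0 + 2 * ?R} t) + (LINT t|lborel. ?e * indicator {-14..14::real} t)"
      by (intro Bochner_Integration.integral_add integrable_mult_right ii)
    also have "\<dots> = c" using R0 by (simp add: c_def)
    finally show ?thesis .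
  qed
  have nn: "0 \<le> (LINT t|lborel. \<beta> t * ?E s t)" for s by (intro integral_nonneg_AE) (auto simp: \<beta>)
  define Q where "Q = (\<lambda>s. LINT t|lborel. \<beta> t * ?E s t)"
  have Q: "0 \<le> Q s" "\<bar>s\<bar> \<le> 14 \<Longrightarrow> Q s \<le> c" for s
    using nn inner by (simp_all only: Q_def)
  have le: "\<beta> s * Q s \<le> c * indicator {-14..14} s" for s
  proof (cases "\<bar>s\<bar> \<le> 14")
    case True
    have "\<beta> s * Q s \<le> 1 * c" using Q(1)[of s] Q(2)[OF True] \<beta>(1,2)[of s] by (intro mult_mono) auto
    then show ?thesis using True by (simp add: abs_le_iff)
  qed (simp add: \<beta> c0)
  have "(LINT s|lborel. \<beta> s * Q s) \<le> (LINT s|lborel. c * indicator {-14..14::real} s)"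
    by (rule integral_mono') (use le c0 in \<open>auto intro: integrable_mult_right ii\<close>)
  also have "\<dots> = 28 * c" by simp
  finally have "(LINT s|lborel. \<beta> s * (LINT t|lborel. \<beta> t * ?E s t)) \<le> 28 * c" by (simp only: Q_def)
  then show ?thesis by (simp only: c_def)
qed

context bump_function
begin

text \<open>The Gaussian g is at least exp (-1) on U, so the indicator of U is replaced by exp 1
  times g. Expanding the square gives one overlap integral for each pair of lines; a bound on the
  row sums, uniform in the row, is multiplied by the number of rows. The factor r r'^2 is, up to a
  constant, the volume of the frequency region.\<close>

lemma local_energy:
  fixes a v :: "(real^3) set \<Rightarrow> real^3" and \<L> D :: "(real^3) set set"
  assumes [measurable]: "\<beta> \<in> borel_measurable borel" and \<beta>: "\<And>t. 0 \<le> \<beta> t" "\<And>t. \<beta> t \<le> 1" "\<And>t. \<bar>t\<bar> > 14 \<Longrightarrow> \<beta> t = 0"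
    and L: "finite \<L>" and D: "D \<subseteq> \<L>"
    and ln: "\<And>l. l \<in> \<L> \<Longrightarrow> l = line_at (a l) (v l)" and v: "\<And>l. l \<in> \<L> \<Longrightarrow> norm (v l) = 1"
    and a: "\<And>l. l \<in> \<L> \<Longrightarrow> norm (a l) \<le> 1"
    and \<omega>: "norm \<omega> = 1" and vk: "\<And>k. k \<in> D \<Longrightarrow> \<bar>v k \<bullet> \<omega>\<bar> \<le> \<zeta>"
    and r: "0 < r'" "r' \<le> r" and B: "0 \<le> B"
    and pos: "B / r \<le> \<eta>" "B / r' \<le> \<theta>" "\<zeta> * \<theta> \<le> \<eta>"
    and v\<theta>: "\<And>k l. k \<in> D \<Longrightarrow> l \<in> D \<Longrightarrow> norm (v l - v k) \<le> \<theta>"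
    and v\<eta>: "\<And>k l. k \<in> D \<Longrightarrow> l \<in> D \<Longrightarrow> \<bar>(v l - v k) \<bullet> \<omega>\<bar> \<le> \<eta>"
    and h: "0 < h1" "h1 \<le> h2" "h2 \<le> 1"
    and U [measurable]: "U \<in> sets borel" and U1: "\<And>\<xi>. \<xi> \<in> U \<Longrightarrow> axial_form \<omega> (1 / r) (1 / r') \<xi> \<le> 2"
  shows "(LINT \<xi>|lborel. indicator U \<xi> * (cmod (\<Sum>l\<in>D. line_fourier \<beta> (a l) (v l) \<xi>))\<^sup>2)
    \<le> exp 1 * (sqrt (2 * pi) ^ 3 * (r * r'\<^sup>2)) * (real (card D) * (28 * (4 * (B / r') *
        (125 * ((40000 * \<eta> / h1 + 2)\<^sup>2 * (40000 * \<theta> / h2 + 2)\<^sup>2) * real (M_lines \<L> h1 h2))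
        + real (card D) * (28 * exp (- B\<^sup>2 / 2)))))"
    and "integrable lborel (\<lambda>\<xi>. indicator U \<xi> * (cmod (\<Sum>l\<in>D. line_fourier \<beta> (a l) (v l) \<xi>))\<^sup>2)"
proof -
  have finD: "finite D" using D L finite_subset by blast
  have rr: "0 < r" using r by linarith
  have i\<beta>: "integrable lborel \<beta>" by (rule integrable_bounded_support[of \<beta> 1 14]) (auto simp: \<beta>)
  define g where "g = (\<lambda>\<xi>. exp (- axial_form \<omega> (1 / r) (1 / r') \<xi> / 2))"
  define X where "X = (\<lambda>l \<xi>. line_fourier \<beta> (a l) (v l) \<xi>)"
  define \<gamma> where "\<gamma> = (\<lambda>l t. a l + t *\<^sub>R v l)"
  define K where "K = sqrt (2 * pi) ^ 3 * (r * r'\<^sup>2)"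
  define Nr where "Nr = 125 * ((40000 * \<eta> / h1 + 2)\<^sup>2 * (40000 * \<theta> / h2 + 2)\<^sup>2) * real (M_lines \<L> h1 h2)"
  define e where "e = exp (- B\<^sup>2 / 2)"
  define nr where "nr = (\<lambda>k l. \<exists>s t. \<bar>s\<bar> \<le> 14 \<and> \<bar>t\<bar> \<le> 14 \<and> norm (a k + s *\<^sub>R v k - a l - t *\<^sub>R v l) \<le> B / r' \<and> \<bar>(a k + s *\<^sub>R v k - a l - t *\<^sub>R v l) \<bullet> \<omega>\<bar> \<le> B / r)"
  define EE where "EE = (\<lambda>k l. LINT s|lborel. \<beta> s * (LINT t|lborel. \<beta> t * exp (- axial_form \<omega> r r' (\<gamma> k s - \<gamma> l t) / 2)))"
  have K0: "K \<ge> 0" using rr by (simp add: K_def)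
  have ig: "integrable lborel g"
    using axial_gaussian_fourier(1)[OF \<omega> rr r(1), of 0] unfolding g_def by (simp add: complex_of_real_integrable_eq)
  have X_eq: "X l \<xi> = (LINT t|lborel. complex_of_real (\<beta> t) * cis (\<xi> \<bullet> \<gamma> l t))" for l \<xi>
    by (simp add: X_def line_fourier_def \<gamma>_def)
  have [measurable]: "\<gamma> l \<in> borel_measurable borel" for l unfolding \<gamma>_def by measurable
  have [measurable]: "X l \<in> borel_measurable borel" for l unfolding X_def by measurable
  have bil: "integrable lborel (\<lambda>\<xi>. complex_of_real (g \<xi>) * X k \<xi> * cnj (X l \<xi>))"
     "(LINT \<xi>|lborel. complex_of_real (g \<xi>) * X k \<xi> * cnj (X l \<xi>)) = complex_of_real (K * EE k l)" for k l
  proof -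
    show "integrable lborel (\<lambda>\<xi>. complex_of_real (g \<xi>) * X k \<xi> * cnj (X l \<xi>))"
      unfolding X_eq by (rule fourier_bilinear(2)[OF i\<beta> i\<beta> ig]) measurable
    have "(LINT \<xi>|lborel. complex_of_real (g \<xi>) * X k \<xi> * cnj (X l \<xi>))
      = (LINT s|lborel. complex_of_real (\<beta> s) * (LINT t|lborel. complex_of_real (\<beta> t) *
          (LINT \<xi>|lborel. complex_of_real (g \<xi>) * cis (\<xi> \<bullet> (\<gamma> k s - \<gamma> l t)))))"
      unfolding X_eq by (rule fourier_bilinear(1)[OF i\<beta> i\<beta> ig]) measurable
    also have "\<dots> = (LINT s|lborel. complex_of_real (\<beta> s) * (LINT t|lborel. complex_of_real (\<beta> t) *
          (complex_of_real (K * exp (- axial_form \<omega> r r' (\<gamma> k s - \<gamma> l t) / 2)))))"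
      unfolding g_def axial_gaussian_fourier(2)[OF \<omega> rr r(1)] K_def by (simp only: of_real_mult)
    also have "\<dots> = (LINT s|lborel. complex_of_real (\<beta> s) * (LINT t|lborel. complex_of_real (K * (\<beta> t *
          exp (- axial_form \<omega> r r' (\<gamma> k s - \<gamma> l t) / 2)))))"
      by (simp only: of_real_mult mult.left_commute)
    also have "(\<lambda>s. complex_of_real (\<beta> s) * (LINT t|lborel. complex_of_real (K * (\<beta> t *
          exp (- axial_form \<omega> r r' (\<gamma> k s - \<gamma> l t) / 2)))))
       = (\<lambda>s. complex_of_real (\<beta> s) * complex_of_real (K * (LINT t|lborel. \<beta> t * exp (- axial_form \<omega> r r' (\<gamma> k s - \<gamma> l t) / 2))))"
      by (simp only: integral_complex_of_real integral_mult_right_zero)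
    also have "\<dots> = (\<lambda>s. complex_of_real (K * (\<beta> s * (LINT t|lborel. \<beta> t *
          exp (- axial_form \<omega> r r' (\<gamma> k s - \<gamma> l t) / 2)))))"
      by (simp only: of_real_mult mult.left_commute)
    also have "(LINT s|lborel. complex_of_real (K * (\<beta> s * (LINT t|lborel. \<beta> t *
          exp (- axial_form \<omega> r r' (\<gamma> k s - \<gamma> l t) / 2))))) = complex_of_real (K * EE k l)"
      unfolding EE_def by (simp only: integral_complex_of_real integral_mult_right_zero)
    finally show "(LINT \<xi>|lborel. complex_of_real (g \<xi>) * X k \<xi> * cnj (X l \<xi>)) = complex_of_real (K * EE k l)" .
  qed
  have sq: "complex_of_real (g \<xi> * (cmod (\<Sum>l\<in>D. X l \<xi>))\<^sup>2) = (\<Sum>k\<in>D. \<Sum>l\<in>D. complex_of_real (g \<xi>) * X k \<xi> * cnj (X l \<xi>))" for \<xi>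
  proof -
    have "(\<Sum>l\<in>D. X l \<xi>) * cnj (\<Sum>l\<in>D. X l \<xi>) = (\<Sum>k\<in>D. \<Sum>l\<in>D. X k \<xi> * cnj (X l \<xi>))"
      unfolding cnj_sum by (rule sum_product)
    then have "complex_of_real (g \<xi>) * ((\<Sum>l\<in>D. X l \<xi>) * cnj (\<Sum>l\<in>D. X l \<xi>))
      = (\<Sum>k\<in>D. \<Sum>l\<in>D. complex_of_real (g \<xi>) * (X k \<xi> * cnj (X l \<xi>)))"
      by (simp only: sum_distrib_left)
    then show ?thesis by (simp only: of_real_mult complex_norm_square mult.assoc)
  qed
  have int1: "integrable lborel (\<lambda>\<xi>. g \<xi> * (cmod (\<Sum>l\<in>D. X l \<xi>))\<^sup>2)"
    unfolding complex_of_real_integrable_eq[symmetric] sq by (intro Bochner_Integration.integrable_sum bil)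
  have "complex_of_real (LINT \<xi>|lborel. g \<xi> * (cmod (\<Sum>l\<in>D. X l \<xi>))\<^sup>2) = (\<Sum>k\<in>D. \<Sum>l\<in>D. complex_of_real (K * EE k l))"
    unfolding integral_complex_of_real[symmetric] sq by (simp only: Bochner_Integration.integral_sum Bochner_Integration.integrable_sum bil)
  then have total: "(LINT \<xi>|lborel. g \<xi> * (cmod (\<Sum>l\<in>D. X l \<xi>))\<^sup>2) = (\<Sum>k\<in>D. \<Sum>l\<in>D. K * EE k l)"
    unfolding of_real_sum[symmetric] of_real_eq_iff .
  have g_ge: "1 \<le> exp 1 * g \<xi>" if "\<xi> \<in> U" for \<xi>
    using U1[OF that] by (simp add: g_def exp_add[symmetric] mult_exp_exp)
  have le: "indicator U \<xi> * (cmod (\<Sum>l\<in>D. X l \<xi>))\<^sup>2 \<le> exp 1 * (g \<xi> * (cmod (\<Sum>l\<in>D. X l \<xi>))\<^sup>2)" for \<xi>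
  proof (cases "\<xi> \<in> U")
    case True
    then show ?thesis using mult_right_mono[OF g_ge[OF True], of "(cmod (\<Sum>l\<in>D. X l \<xi>))\<^sup>2"] by (simp add: mult.assoc)
  qed (simp add: g_def)
  have iU: "integrable lborel (\<lambda>\<xi>. indicator U \<xi> * (cmod (\<Sum>l\<in>D. X l \<xi>))\<^sup>2)"
  proof (rule Bochner_Integration.integrable_bound[OF integrable_mult_right[OF int1, of "exp 1"]])
    show "AE \<xi> in lborel. norm (indicator U \<xi> * (cmod (\<Sum>l\<in>D. X l \<xi>))\<^sup>2) \<le> norm (exp 1 * (g \<xi> * (cmod (\<Sum>l\<in>D. X l \<xi>))\<^sup>2))"
      using order_trans[OF le abs_ge_self] by (intro AE_I2) (simp only: real_norm_def abs_mult abs_indicator abs_power2)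
  qed measurable
  then show "integrable lborel (\<lambda>\<xi>. indicator U \<xi> * (cmod (\<Sum>l\<in>D. line_fourier \<beta> (a l) (v l) \<xi>))\<^sup>2)"
    by (simp add: X_def)
  have row: "(\<Sum>l\<in>D. EE k l) \<le> 28 * (4 * (B / r') * Nr + real (card D) * (28 * e))" if k: "k \<in> D" for k
  proof -
    have kL: "k \<in> \<L>" using k D by auto
    have "(\<Sum>l\<in>D. EE k l) \<le> (\<Sum>l\<in>D. 28 * ((if nr k l then 4 * (B / r') else 0) + 28 * e))"
    proof (rule sum_mono)
      fix l assume "l \<in> D"
      then have "norm (v l) = 1" using D v by auto
      then show "EE k l \<le> 28 * ((if nr k l then 4 * (B / r') else 0) + 28 * e)"
        unfolding EE_def \<gamma>_def e_def
        by (intro gaussian_overlap \<beta> \<omega> r B) (auto simp: nr_def)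
    qed
    also have "\<dots> = 28 * (4 * (B / r') * real (card {l \<in> D. nr k l}) + real (card D) * (28 * e))"
      using finD by (simp add: sum_distrib_left[symmetric] sum.distrib sum.If_cases Int_def mult.commute)
    finally have S: "(\<Sum>l\<in>D. EE k l) \<le> 28 * (4 * (B / r') * real (card {l \<in> D. nr k l}) + real (card D) * (28 * e))" .
    have cN: "real (card {l \<in> D. nr k l}) \<le> Nr"
      unfolding Nr_def
    proof (rule near_lines_count[where a = a and v = v and k = k and \<omega> = \<omega> and \<zeta> = \<zeta>])
      have "0 \<le> B / r" "0 \<le> B / r'" using B r rr by auto
      then show "0 \<le> \<eta>" "0 \<le> \<theta>" using pos by linarith+
      fix l assume l: "l \<in> {l \<in> D. nr k l}"
      then obtain s t where "\<bar>s\<bar> \<le> 14" "\<bar>t\<bar> \<le> 14" "norm (a k + s *\<^sub>R v k - a l - t *\<^sub>R v l) \<le> B / r'" "\<bar>(a k + s *\<^sub>R v k - a l - t *\<^sub>R v l) \<bullet> \<omega>\<bar> \<le> B / r"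
        by (auto simp: nr_def)
      then show "\<exists>t t'. \<bar>t\<bar> \<le> 14 \<and> \<bar>t'\<bar> \<le> 14 \<and> norm (a k + t *\<^sub>R v k - a l - t' *\<^sub>R v l) \<le> \<theta> \<and> \<bar>(a k + t *\<^sub>R v k - a l - t' *\<^sub>R v l) \<bullet> \<omega>\<bar> \<le> \<eta>"
        using pos order_trans by blast
      show "norm (v l - v k) \<le> \<theta>" "\<bar>(v l - v k) \<bullet> \<omega>\<bar> \<le> \<eta>" using l k v\<theta> v\<eta> by auto
    qed (use L D ln v a kL \<omega> vk[OF k] pos h in auto)
    have "4 * (B / r') * real (card {l \<in> D. nr k l}) \<le> 4 * (B / r') * Nr"
      using B r by (intro mult_left_mono cN) auto
    then have "28 * (4 * (B / r') * real (card {l \<in> D. nr k l}) + real (card D) * (28 * e))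
      \<le> 28 * (4 * (B / r') * Nr + real (card D) * (28 * e))"
      by simp
    with S show ?thesis by (rule order_trans)
  qed
  have "(LINT \<xi>|lborel. indicator U \<xi> * (cmod (\<Sum>l\<in>D. X l \<xi>))\<^sup>2) \<le> (LINT \<xi>|lborel. exp 1 * (g \<xi> * (cmod (\<Sum>l\<in>D. X l \<xi>))\<^sup>2))"
    by (rule integral_mono[OF iU integrable_mult_right[OF int1]]) (rule le)
  also have "\<dots> = exp 1 * (\<Sum>k\<in>D. K * (\<Sum>l\<in>D. EE k l))" by (simp add: total sum_distrib_left)
  also have "\<dots> \<le> exp 1 * (\<Sum>k\<in>D. K * (28 * (4 * (B / r') * Nr + real (card D) * (28 * e))))"
    by (intro mult_left_mono sum_mono row K0) auto
  also have "\<dots> = exp 1 * K * (real (card D) * (28 * (4 * (B / r') * Nr + real (card D) * (28 * e))))"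
    by simp
  finally show "(LINT \<xi>|lborel. indicator U \<xi> * (cmod (\<Sum>l\<in>D. line_fourier \<beta> (a l) (v l) \<xi>))\<^sup>2)
    \<le> exp 1 * (sqrt (2 * pi) ^ 3 * (r * r'\<^sup>2)) * (real (card D) * (28 * (4 * (B / r') *
        (125 * ((40000 * \<eta> / h1 + 2)\<^sup>2 * (40000 * \<theta> / h2 + 2)\<^sup>2) * real (M_lines \<L> h1 h2))
        + real (card D) * (28 * exp (- B\<^sup>2 / 2)))))"
    unfolding X_def K_def Nr_def e_def .
qed

end

section \<open>Counting directions\<close>

definition floor3 :: "real^3 \<Rightarrow> int \<times> int \<times> int" where
  "floor3 x = (\<lfloor>x $ 1\<rfloor>, \<lfloor>x $ 2\<rfloor>, \<lfloor>x $ 3\<rfloor>)"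

definition near3 :: "int \<times> int \<times> int \<Rightarrow> int \<times> int \<times> int \<Rightarrow> bool" where
  "near3 c c' \<longleftrightarrow> \<bar>fst c - fst c'\<bar> \<le> 1 \<and> \<bar>fst (snd c) - fst (snd c')\<bar> \<le> 1 \<and> \<bar>snd (snd c) - snd (snd c')\<bar> \<le> 1"

lemma norm_le_coords:
  fixes x :: "real^3"
  assumes "\<And>i. \<bar>x $ i\<bar> \<le> t" and t: "t \<ge> 0"
  shows "norm x \<le> 2 * t"
proof -
  have sq: "(x $ i)\<^sup>2 \<le> t\<^sup>2" for i using power_mono[OF assms(1)[of i], of 2] by simp
  have "(norm x)\<^sup>2 = (x $ 1)\<^sup>2 + (x $ 2)\<^sup>2 + (x $ 3)\<^sup>2"
    by (simp only: power2_norm_eq_inner inner_vec_def sum_3) (simp add: power2_eq_square)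
  also have "\<dots> \<le> (2 * t)\<^sup>2" 
  proof -
    have "(2 * t)\<^sup>2 = 4 * t\<^sup>2" by (simp add: power_mult_distrib)
    then show ?thesis using sq[of 1] sq[of 2] sq[of 3] zero_le_power2[of t] by linarith
  qed
  finally show ?thesis by (rule power2_le_imp_le) (use t in simp)
qed

lemma floor3_eq_imp_close: "floor3 x = floor3 y \<Longrightarrow> norm (x - y) \<le> 2"
proof -
  assume e: "floor3 x = floor3 y"
  have "\<bar>(x - y) $ i\<bar> \<le> 1" for i
    using e exhaust_3[of i] by (auto simp: floor3_def intro: floor_close)
  from norm_le_coords[OF this] show ?thesis by simp
qed

lemma near3_imp_close: "near3 (floor3 x) (floor3 y) \<Longrightarrow> norm (x - y) \<le> 4"
proof -
  assume e: "near3 (floor3 x) (floor3 y)"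
  have f: "\<bar>s - t\<bar> \<le> 2" if "\<bar>\<lfloor>s\<rfloor> - \<lfloor>t\<rfloor>\<bar> \<le> 1" for s t :: real using that by linarith
  have "\<bar>(x - y) $ i\<bar> \<le> 2" for i
    using e exhaust_3[of i] by (auto simp: floor3_def near3_def intro!: f)
  from norm_le_coords[OF this] show ?thesis by simp
qed

lemma not_near3_imp_far: "\<not> near3 (floor3 x) (floor3 y) \<Longrightarrow> norm (x - y) \<ge> 1"
proof -
  assume e: "\<not> near3 (floor3 x) (floor3 y)"
  have f: "\<bar>s - t\<bar> \<ge> 1" if "\<not> \<bar>\<lfloor>s\<rfloor> - \<lfloor>t\<rfloor>\<bar> \<le> 1" for s t :: real using that by linarith
  obtain i where "\<bar>x $ i - y $ i\<bar> \<ge> 1" using e f by (auto simp: floor3_def near3_def)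
  then show ?thesis using component_le_norm_cart[of "x - y" i] by simp
qed

lemma near3_refl: "near3 c c" and near3_sym: "near3 c c' \<Longrightarrow> near3 c' c"
  by (auto simp: near3_def)

lemma card_near3: "card {c' \<in> S. near3 c' c} \<le> 27"
proof -
  obtain c1 c2 c3 where c: "c = (c1, c2, c3)" by (cases c)
  have "{c' \<in> S. near3 c' c} \<subseteq> {c1 - 1..c1 + 1} \<times> {c2 - 1..c2 + 1} \<times> {c3 - 1..c3 + 1}"
    by (auto simp: near3_def c)
  from card_mono[OF _ this] show ?thesis by (simp add: card_cartesian_product)
qed

text \<open>The grid of mesh 1/(b y) refines the grid of mesh 1/y, because rounding down is
  compatible with division by a positive integer. This is what turns the cells into a tree.\<close>

lemma floor3_div: 
  assumes "b > 0"
  shows "floor3 (y *\<^sub>R x) = (\<lambda>(i, j, k). (i div int b, j div int b, k div int b)) (floor3 ((real b * y) *\<^sub>R x))"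
proof -
  have d: "\<lfloor>t\<rfloor> = \<lfloor>real b * t\<rfloor> div int b" for t
  proof -
    have "\<lfloor>t\<rfloor> = \<lfloor>real b * t / real_of_int (int b)\<rfloor>" using assms by simp
    also have "\<dots> = \<lfloor>real b * t\<rfloor> div int b" by (rule floor_divide_real_eq_div) simp
    finally show ?thesis .
  qed
  show ?thesis
    unfolding floor3_def vector_scaleR_component real_scaleR_def case_prod_conv mult.assoc
    using d[of "y * x $ 1"] d[of "y * x $ 2"] d[of "y * x $ 3"] by blast
qed

lemma card_children3:
  assumes b: "b > 0"
  shows "card {c' \<in> S. (\<lambda>(i, j, k). (i div int b, j div int b, k div int b)) c' = c} \<le> b ^ 3"
proof -
  obtain c1 c2 c3 where c: "c = (c1, c2, c3)" by (cases c)
  have d: "i \<in> {j * int b..<j * int b + int b}" if "i div int b = j" for i j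
  proof -
    have "0 < int b" using b by simp
    then have "0 \<le> i mod int b" "i mod int b < int b" by simp_all
    then show ?thesis
      unfolding atLeastLessThan_iff that[symmetric] using div_mult_mod_eq[of i "int b"] by linarith
  qed
  have "{c' \<in> S. (\<lambda>(i, j, k). (i div int b, j div int b, k div int b)) c' = c}
    \<subseteq> {c1 * int b..<c1 * int b + int b} \<times> {c2 * int b..<c2 * int b + int b} \<times> {c3 * int b..<c3 * int b + int b}"
    using d by (auto simp: c)
  from card_mono[OF _ this] show ?thesis by (simp add: card_cartesian_product power3_eq_cube)
qed

lemma card_floor_ivl:
  assumes "R \<ge> 0"
  shows "real (card {\<lfloor>c - R\<rfloor>..\<lfloor>c + R\<rfloor>}) \<le> 2 * R + 2"
proof -
  have "real_of_int (\<lfloor>c + R\<rfloor> - \<lfloor>c - R\<rfloor> + 1) \<le> 2 * R + 2" by linarith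
  then show ?thesis using assms by simp
qed

lemma card_floor3_ball:
  assumes R: "R \<ge> 0" and S: "\<And>x. x \<in> S \<Longrightarrow> norm (f x - c) \<le> R"
  shows "real (card ((\<lambda>x. floor3 (f x)) ` S)) \<le> (2 * R + 2) ^ 3" and "finite ((\<lambda>x. floor3 (f x)) ` S)"
proof -
  let ?I = "\<lambda>i. {\<lfloor>c $ i - R\<rfloor>..\<lfloor>c $ i + R\<rfloor>}"
  have in1: "\<lfloor>f x $ i\<rfloor> \<in> ?I i" if "x \<in> S" for x i
  proof -
    have "\<bar>f x $ i - c $ i\<bar> \<le> R" using component_le_norm_cart[of "f x - c" i] S[OF that] by simp
    then show ?thesis by (auto intro!: floor_mono)
  qed
  then have sub: "(\<lambda>x. floor3 (f x)) ` S \<subseteq> ?I 1 \<times> ?I 2 \<times> ?I 3"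
    unfolding floor3_def by blast
  then show "finite ((\<lambda>x. floor3 (f x)) ` S)" by (rule finite_subset) simp
  have "real (card ((\<lambda>x. floor3 (f x)) ` S)) \<le> real (card (?I 1 \<times> ?I 2 \<times> ?I 3))"
    using card_mono[OF _ sub] unfolding of_nat_le_iff by (simp only: finite_SigmaI finite_atLeastAtMost_int)
  also have "\<dots> = real (card (?I 1)) * (real (card (?I 2)) * real (card (?I 3)))"
    by (simp only: card_cartesian_product of_nat_mult)
  also have "\<dots> \<le> (2 * R + 2) * ((2 * R + 2) * (2 * R + 2))"
    using R by (intro mult_mono card_floor_ivl) auto
  finally show "real (card ((\<lambda>x. floor3 (f x)) ` S)) \<le> (2 * R + 2) ^ 3" by (simp add: power3_eq_cube mult.assoc)
qed

text \<open>A direction almost orthogonal to both q and q' is within 10 w / g of n or -n for the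
  common normal n; the factor 2 counts the signs. Since q and q' are at distance at most 1, the part
  of q' orthogonal to q has at least half the length of q' - q.\<close>

lemma crossing_count:
  fixes q q' :: "real^3"
  assumes q: "norm q = 1" "norm q' = 1" and g: "0 < g" "g \<le> norm (q' - q)" "norm (q' - q) \<le> 1"
    and W: "\<And>v. v \<in> W \<Longrightarrow> norm v = 1" "\<And>v. v \<in> W \<Longrightarrow> \<bar>v \<bullet> q\<bar> \<le> w" "\<And>v. v \<in> W \<Longrightarrow> \<bar>v \<bullet> q'\<bar> \<le> w"
    and w: "0 \<le> w" and K: "K > 0"
  shows "real (card ((\<lambda>v. floor3 (K *\<^sub>R v)) ` W)) \<le> 2 * (2 * (K * (10 * w / g)) + 2) ^ 3"
proof -
  define d where "d = norm (q' - q)"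
  have d: "g \<le> d" "0 < d" "d \<le> 1" using g by (auto simp: d_def)
  have qq: "q \<bullet> q = 1" "q' \<bullet> q' = 1" using q by (simp_all add: norm_eq_1)
  define c where "c = q \<bullet> q'"
  have dc: "d\<^sup>2 = 2 - 2 * c"
    unfolding d_def power2_norm_eq_inner inner_diff_left inner_diff_right c_def inner_commute[of q' q] qq by simp
  define f where "f = q' - c *\<^sub>R q"
  have ff: "f \<bullet> f = 1 - c\<^sup>2"
    unfolding f_def inner_diff_left inner_diff_right
    by (simp add: inner_commute[of q' q] c_def[symmetric] qq power2_eq_square)
  have fq: "f \<bullet> q = 0" by (simp add: f_def inner_diff_left qq inner_commute[of q' q] c_def[symmetric])
  have "d\<^sup>2 \<le> 1" using d by (simp add: power_le_one)
  then have "c \<ge> 1/2" using dc by linarith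
  moreover have "1 - c \<ge> 0" using dc zero_le_power2[of d] by linarith
  ultimately have "(1 - c) * 1 \<le> (1 - c) * (1 + c)" by (intro mult_left_mono) auto
  also have "\<dots> = 1 - c\<^sup>2" by (simp add: power2_eq_square algebra_simps)
  finally have "1 - c\<^sup>2 \<ge> (1 - c) * 1" .
  then have fd: "(norm f)\<^sup>2 \<ge> (d / 2)\<^sup>2" 
  proof -
    have e: "(d / 2)\<^sup>2 = d\<^sup>2 / 4" by (simp add: power_divide)
    have "1 - c = d\<^sup>2 / 2" using dc by linarith
    then have "d\<^sup>2 / 2 \<le> 1 - c\<^sup>2" using \<open>1 - c\<^sup>2 \<ge> (1 - c) * 1\<close> by (simp only: mult_1_right)
    then have "d\<^sup>2 / 4 \<le> 1 - c\<^sup>2" using zero_le_power2[of d] by argo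
    then show ?thesis unfolding e power2_norm_eq_inner ff .
  qed
  then have nf: "norm f \<ge> d / 2" by (rule power2_le_imp_le) simp
  then have nf0: "norm f > 0" using d by linarith
  define e where "e = (1 / norm f) *\<^sub>R f"
  have e: "norm e = 1" "q \<bullet> e = 0" using nf0 fq by (simp_all add: e_def inner_commute)
  obtain n where n: "norm n = 1" "n \<bullet> q = 0" "n \<bullet> e = 0" using third_axis[OF q(1) e(1) e(2)] .
  have fr: "norm q = 1" "norm e = 1" "norm n = 1" "q \<bullet> e = 0" "q \<bullet> n = 0" "e \<bullet> n = 0"
    using q e n by (simp_all add: inner_commute)
  have c1: "\<bar>c\<bar> \<le> 1" using Cauchy_Schwarz_ineq2[of q q'] q by (simp add: c_def)
  \<comment> \<open>The distance of v from the line spanned by n is at most w + 4 w / g \<le> 5 w /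
    g, as g \<le> 1. Comparing lengths adds the same amount once more, hence the radius 2 \<tau>
    below.\<close>
  define \<tau> where "\<tau> = 5 * w / g"
  have ve: "\<bar>v \<bullet> e\<bar> \<le> 4 * w / g" if v: "v \<in> W" for v
  proof -
    have "\<bar>c * (v \<bullet> q)\<bar> \<le> 1 * w" unfolding abs_mult using c1 W(2)[OF v] by (intro mult_mono) auto
    moreover have "v \<bullet> f = v \<bullet> q' - c * (v \<bullet> q)" by (simp add: f_def inner_diff_right)
    ultimately have "\<bar>v \<bullet> f\<bar> \<le> 2 * w" using W(3)[OF v] by linarith
    then have "\<bar>v \<bullet> f\<bar> / norm f \<le> 2 * w / (g / 2)"
      using nf d g w by (intro frac_le) auto
    then show ?thesis by (simp add: e_def abs_divide)
  qed
  have near_n: "norm (v - n) \<le> 2 * \<tau> \<or> norm (v - (- n)) \<le> 2 * \<tau>" if v: "v \<in> W" for v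
  proof -
    have "v - (v \<bullet> n) *\<^sub>R n = (v \<bullet> q) *\<^sub>R q + (v \<bullet> e) *\<^sub>R e"
      using orthonormal_frame(2)[OF fr, of v] by (metis add_diff_cancel_right')
    then have "norm (v - (v \<bullet> n) *\<^sub>R n) \<le> \<bar>v \<bullet> q\<bar> + \<bar>v \<bullet> e\<bar>"
      using norm_triangle_ineq[of "(v \<bullet> q) *\<^sub>R q" "(v \<bullet> e) *\<^sub>R e"] q e by simp
    also have "\<dots> \<le> w + 4 * w / g" using W(2)[OF v] ve[OF v] by linarith
    also have "\<dots> \<le> w / g + 4 * w / g"
    proof -
      have "w * g \<le> w" by (rule mult_left_le) (use w d in auto)
      then have "w \<le> w / g" using g by (simp add: pos_le_divide_eq)
      then show ?thesis by (rule add_right_mono)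
    qed
    finally have perp: "norm (v - (v \<bullet> n) *\<^sub>R n) \<le> \<tau>" by (simp add: \<tau>_def)
    have "norm v \<le> norm (v - (v \<bullet> n) *\<^sub>R n) + norm ((v \<bullet> n) *\<^sub>R n)" by (metis diff_add_cancel norm_triangle_ineq)
    then have ge: "\<bar>v \<bullet> n\<bar> \<ge> 1 - \<tau>" using perp W(1)[OF v] n by simp
    have le: "\<bar>v \<bullet> n\<bar> \<le> 1" using Cauchy_Schwarz_ineq2[of v n] W(1)[OF v] n by simp
    show ?thesis
    proof (cases "v \<bullet> n \<ge> 0")
      case True
      have "norm (v - n) \<le> norm (v - (v \<bullet> n) *\<^sub>R n) + norm ((v \<bullet> n - 1) *\<^sub>R n)"
        by (rule order_trans[OF _ norm_triangle_ineq]) (simp add: algebra_simps)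
      then show ?thesis using perp ge le True n by simp
    next
      case False
      have "norm (v - (- n)) \<le> norm (v - (v \<bullet> n) *\<^sub>R n) + norm ((v \<bullet> n + 1) *\<^sub>R n)"
        by (rule order_trans[OF _ norm_triangle_ineq]) (simp add: algebra_simps)
      then show ?thesis using perp ge le False n by simp
    qed
  qed
  have \<tau>0: "\<tau> \<ge> 0" using w g by (simp add: \<tau>_def)
  define W1 where "W1 = {v \<in> W. norm (v - n) \<le> 2 * \<tau>}"
  define W2 where "W2 = {v \<in> W. norm (v - (- n)) \<le> 2 * \<tau>}"
  let ?F = "\<lambda>v. floor3 (K *\<^sub>R v)"
  have b: "real (card (?F ` S)) \<le> (2 * (K * (2 * \<tau>)) + 2) ^ 3 \<and> finite (?F ` S)" if S: "\<And>v. v \<in> S \<Longrightarrow> norm (v - m) \<le> 2 * \<tau>" for S m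
  proof -
    have "norm (K *\<^sub>R v - K *\<^sub>R m) \<le> K * (2 * \<tau>)" if "v \<in> S" for v
      using mult_left_mono[OF S[OF that], of K] K by (simp flip: scaleR_right_diff_distrib)
    from card_floor3_ball[OF _ this, of S] show ?thesis using K \<tau>0 by simp
  qed
  have "?F ` W = ?F ` W1 \<union> ?F ` W2" using near_n by (auto simp: W1_def W2_def)
  then have "real (card (?F ` W)) \<le> real (card (?F ` W1)) + real (card (?F ` W2))"
    using card_Un_le[of "?F ` W1" "?F ` W2"] by simp
  also have "\<dots> \<le> (2 * (K * (2 * \<tau>)) + 2) ^ 3 + (2 * (K * (2 * \<tau>)) + 2) ^ 3"
    using b[of W1 n] b[of W2 "- n"] by (intro add_mono) (auto simp: W1_def W2_def)
  finally show ?thesis by (simp add: \<tau>_def)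
qed

text \<open>Polar coordinates around q: the angle is rounded to multiples of 1/K, and the remaining two
  coordinates are determined up to a multiple of w.\<close>

lemma great_circle_count:
  fixes q :: "real^3"
  assumes q: "norm q = 1" and W: "\<And>v. v \<in> W \<Longrightarrow> norm v = 1" "\<And>v. v \<in> W \<Longrightarrow> \<bar>v \<bullet> q\<bar> \<le> w" and finW: "finite W"
    and K: "K \<ge> 1" and R: "K * w \<le> R" "1 \<le> R"
  shows "real (card ((\<lambda>v. floor3 (K *\<^sub>R v)) ` W)) \<le> 9 * K * (10 * R) ^ 3"
proof -
  obtain e where e: "norm e = 1" "e \<bullet> q = 0" "norm (e - e) \<le> 2 * \<bar>q \<bullet> e\<bar>"
  proof -
    obtain n where "norm n = 1" "n \<bullet> q = 0" using orthogonal_normal[OF q q] .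
    then show ?thesis using that[of n] by simp
  qed
  obtain n where n: "norm n = 1" "n \<bullet> q = 0" "n \<bullet> e = 0"
    using third_axis[OF q e(1)] e(2) by (auto simp: inner_commute)
  have fr: "norm q = 1" "norm e = 1" "norm n = 1" "q \<bullet> e = 0" "q \<bullet> n = 0" "e \<bullet> n = 0"
    using q e n by (simp_all add: inner_commute)
  define z where "z = (\<lambda>v. Complex (v \<bullet> e) (v \<bullet> n))"
  define key where "key = (\<lambda>v. \<lfloor>K * Arg (z v)\<rfloor>)"
  let ?F = "\<lambda>v. floor3 (K *\<^sub>R v)"
  let ?I = "{\<lfloor>- (K * pi)\<rfloor>..\<lfloor>K * pi\<rfloor>}"
  have w0: "w \<ge> 0" if "v \<in> W" for v using W(2)[OF that] by linarith
  have cm: "(cmod (z v))\<^sup>2 = 1 - (v \<bullet> q)\<^sup>2" if "v \<in> W" for v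
  proof -
    have "1 = v \<bullet> v" using W(1)[OF that] by (simp add: norm_eq_1)
    also have "\<dots> = v \<bullet> ((v \<bullet> q) *\<^sub>R q + (v \<bullet> e) *\<^sub>R e + (v \<bullet> n) *\<^sub>R n)"
      using orthonormal_frame(2)[OF fr, of v] by simp
    also have "\<dots> = (v \<bullet> q)\<^sup>2 + (v \<bullet> e)\<^sup>2 + (v \<bullet> n)\<^sup>2" by (simp add: inner_add_right power2_eq_square)
    finally show ?thesis by (simp add: z_def cmod_power2)
  qed
  have cm2: "1 - w \<le> cmod (z v)" "cmod (z v) \<le> 1" if v: "v \<in> W" for v
  proof -
    have "(cmod (z v))\<^sup>2 \<le> 1\<^sup>2" using cm[OF v] by simp
    then show "cmod (z v) \<le> 1" by (rule power2_le_imp_le) simp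
    have q1: "\<bar>v \<bullet> q\<bar> \<le> 1" using Cauchy_Schwarz_ineq2[of v q] W(1)[OF v] q by simp
    have "(1 - \<bar>v \<bullet> q\<bar>)\<^sup>2 = 1 - 2 * \<bar>v \<bullet> q\<bar> + \<bar>v \<bullet> q\<bar>\<^sup>2" by (simp add: power2_eq_square algebra_simps)
    moreover have "\<bar>v \<bullet> q\<bar>\<^sup>2 \<le> \<bar>v \<bullet> q\<bar>" unfolding power2_eq_square by (rule mult_left_le[OF q1 abs_ge_zero])
    ultimately have "(1 - \<bar>v \<bullet> q\<bar>)\<^sup>2 \<le> (cmod (z v))\<^sup>2" unfolding cm[OF v] by simp
    then have "1 - \<bar>v \<bullet> q\<bar> \<le> cmod (z v)" by (rule power2_le_imp_le) simp
    then show "1 - w \<le> cmod (z v)" using W(2)[OF v] by linarith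
  qed
  have fib: "real (card (?F ` {v \<in> W. key v = k})) \<le> (10 * R) ^ 3" for k
  proof (cases "{v \<in> W. key v = k} = {}")
    case False
    then obtain v0 where v0: "v0 \<in> W" "key v0 = k" by auto
    \<comment> \<open>After scaling by K the angles differ by at most 1, the radii in the plane
      orthogonal to q by at most K w and the components along q by at most 2 K w, in total at most 4
      R.\<close>
    have dv: "norm (K *\<^sub>R v - K *\<^sub>R v0) \<le> 4 * R" if v: "v \<in> {v \<in> W. key v = k}" for v
    proof -
      have vW: "v \<in> W" using v by simp
      have "\<bar>K * Arg (z v) - K * Arg (z v0)\<bar> \<le> 1"
        using v v0 by (intro floor_close) (simp add: key_def)
      then have arg: "K * \<bar>Arg (z v) - Arg (z v0)\<bar> \<le> 1"
        using K by (simp add: abs_mult flip: right_diff_distrib)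
      have pol: "z y = complex_of_real (cmod (z y)) * cis (Arg (z y))" for y
        using rcis_cmod_Arg[of "z y"] by (simp add: rcis_def)
      have "z v - z v0 = complex_of_real (cmod (z v)) * (cis (Arg (z v)) - cis (Arg (z v0))) + complex_of_real (cmod (z v) - cmod (z v0)) * cis (Arg (z v0))"
        by (subst pol[of v], subst pol[of v0]) (simp add: algebra_simps)
      also have "cmod \<dots> \<le> cmod (z v) * cmod (cis (Arg (z v)) - cis (Arg (z v0))) + \<bar>cmod (z v) - cmod (z v0)\<bar>"
        by (rule order_trans[OF norm_triangle_ineq]) (simp add: norm_mult del: of_real_diff)
      also have "\<dots> \<le> 1 * \<bar>Arg (z v) - Arg (z v0)\<bar> + w"
      proof (intro add_mono mult_mono)
        show "cmod (cis (Arg (z v)) - cis (Arg (z v0))) \<le> \<bar>Arg (z v) - Arg (z v0)\<bar>"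
        proof -
          have "cis (Arg (z v)) - cis (Arg (z v0)) = cis (Arg (z v0)) * (cis (Arg (z v) - Arg (z v0)) - 1)" by (simp add: algebra_simps cis_mult)
          then have "cmod (cis (Arg (z v)) - cis (Arg (z v0))) = cmod (cis (Arg (z v) - Arg (z v0)) - 1)" by (simp add: norm_mult)
          also have "\<dots> \<le> \<bar>Arg (z v) - Arg (z v0)\<bar>" using iexp_approx1[of "Arg (z v) - Arg (z v0)" 0] by (simp add: cis_conv_exp)
          finally show ?thesis .
        qed
      qed (use cm2[OF vW] cm2[OF v0(1)] in auto)
      finally have zz: "cmod (z v - z v0) \<le> \<bar>Arg (z v) - Arg (z v0)\<bar> + w" by simp
      let ?y = "v - v0"
      have y: "?y = (?y \<bullet> q) *\<^sub>R q + ((?y \<bullet> e) *\<^sub>R e + (?y \<bullet> n) *\<^sub>R n)"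
        using orthonormal_frame(2)[OF fr, of ?y] by (simp only: add.assoc)
      have "norm ((?y \<bullet> e) *\<^sub>R e + (?y \<bullet> n) *\<^sub>R n) = cmod (z v - z v0)"
      proof -
        have ii: "e \<bullet> e = 1" "n \<bullet> n = 1" "n \<bullet> e = 0" using fr by (simp_all add: norm_eq_1 inner_commute)
        have "(norm ((?y \<bullet> e) *\<^sub>R e + (?y \<bullet> n) *\<^sub>R n))\<^sup>2 = (?y \<bullet> e)\<^sup>2 + (?y \<bullet> n)\<^sup>2"
          unfolding power2_norm_eq_inner by (simp add: inner_add_left inner_add_right ii fr(6) power2_eq_square)
        also have "\<dots> = (cmod (z v - z v0))\<^sup>2" by (simp add: z_def cmod_power2 inner_diff_left)
        finally show ?thesis by (rule power2_eq_imp_eq) simp_all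
      qed
      then have "norm ?y \<le> \<bar>?y \<bullet> q\<bar> + cmod (z v - z v0)"
        using norm_triangle_ineq[of "(?y \<bullet> q) *\<^sub>R q" "(?y \<bullet> e) *\<^sub>R e + (?y \<bullet> n) *\<^sub>R n"] y q by (metis norm_scaleR mult.right_neutral)
      moreover have "\<bar>?y \<bullet> q\<bar> \<le> 2 * w" using W(2)[OF vW] W(2)[OF v0(1)] unfolding inner_diff_left by linarith
      ultimately have "norm ?y \<le> \<bar>Arg (z v) - Arg (z v0)\<bar> + 3 * w" using zz by linarith
      then have "K * norm ?y \<le> K * \<bar>Arg (z v) - Arg (z v0)\<bar> + 3 * (K * w)"
        using mult_left_mono[of "norm ?y" "\<bar>Arg (z v) - Arg (z v0)\<bar> + 3 * w" K] K by (simp add: distrib_left)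
      then have "K * norm ?y \<le> 4 * R" using arg R by linarith
      then show ?thesis using K by (simp flip: scaleR_right_diff_distrib)
    qed
    have "real (card (?F ` {v \<in> W. key v = k})) \<le> (2 * (4 * R) + 2) ^ 3"
      by (rule card_floor3_ball(1)[where c = "K *\<^sub>R v0"]) (use R dv in auto)
    also have "\<dots> \<le> (10 * R) ^ 3" using R by (intro power_mono) auto
    finally show ?thesis .
  next
    case True
    show ?thesis unfolding True using R by simp
  qed
  have "?F ` W = (\<Union>k\<in>?I. ?F ` {v \<in> W. key v = k})"
  proof -
    have kI: "key v \<in> ?I" for v
    proof -
      have "- pi \<le> Arg (z v)" "Arg (z v) \<le> pi" using Arg_bounded[of "z v"] by auto
      then have "K * (- pi) \<le> K * Arg (z v)" "K * Arg (z v) \<le> K * pi" using K by (intro mult_left_mono; simp)+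
      then show ?thesis unfolding key_def by (auto intro!: floor_mono)
    qed
    have "W = (\<Union>k\<in>?I. {v \<in> W. key v = k})" using kI by blast
    then show ?thesis by (metis image_UN)
  qed
  then have "real (card (?F ` W)) \<le> (\<Sum>k\<in>?I. real (card (?F ` {v \<in> W. key v = k})))"
    using card_UN_le[of ?I "\<lambda>k. ?F ` {v \<in> W. key v = k}"] unfolding of_nat_sum[symmetric] of_nat_le_iff by simp
  also have "\<dots> \<le> (\<Sum>k\<in>?I. (10 * R) ^ 3)" by (intro sum_mono fib)
  also have "\<dots> = real (card ?I) * (10 * R) ^ 3" by (simp only: sum_constant)
  also have "\<dots> \<le> (9 * K) * (10 * R) ^ 3"
  proof (intro mult_right_mono)
    have "real (card ?I) \<le> 2 * (K * pi) + 2" using card_floor_le[of "K * pi"] K by simp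
    also have "\<dots> \<le> 9 * K"
    proof -
      have "pi \<le> 7 / 2" using pi_approx by simp
      then have "K * pi \<le> K * (7 / 2)" using K by (intro mult_left_mono) auto
      then show ?thesis using K by linarith
    qed
    finally show "real (card ?I) \<le> 9 * K" .
  qed (use R in simp)
  finally show ?thesis .
qed

section \<open>Energy on a frequency cap\<close>

text \<open>The data for one dyadic shell of outer radius \<rho>. B will be a small negative power
  of d and is the width beyond which all tails are negligible. The numbers b and J describe a tree
  of depth J whose finest cells have size about 1/\<rho>; b \<le> 4 B bounds the loss from one level
  of the tree, 2^J \<le> G the loss from halving at all levels. T bounds the expression under the
  supremum of the theorem, multiplied by the number of lines.\<close>

locale shell = bump_function +
  fixes \<beta> :: "real \<Rightarrow> real" and \<L> :: "(real^3) set set" and a v rep :: "(real^3) set \<Rightarrow> real^3" and V :: "(real^3) set"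
    and d B \<rho> G T \<epsilon>0 K1 Nc :: real and b J :: nat
  assumes \<beta>_measurable [measurable]: "\<beta> \<in> borel_measurable borel"
    and \<beta>: "\<And>t. 0 \<le> \<beta> t" "\<And>t. \<beta> t \<le> 1" "\<And>t. \<bar>t\<bar> > 14 \<Longrightarrow> \<beta> t = 0"
    and L: "finite \<L>" and ln: "\<And>l. l \<in> \<L> \<Longrightarrow> l = line_at (a l) (v l)" and v: "\<And>l. l \<in> \<L> \<Longrightarrow> norm (v l) = 1"
    and a: "\<And>l. l \<in> \<L> \<Longrightarrow> norm (a l) \<le> 1"
    and V: "finite V" "\<And>x. x \<in> V \<Longrightarrow> norm x = 1" "real (card V) \<le> Nc" "1 \<le> Nc"
    and rep: "\<And>l. l \<in> \<L> \<Longrightarrow> rep l \<in> V" "\<And>l. l \<in> \<L> \<Longrightarrow> norm (v l - rep l) \<le> 2 * d"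
    and d: "0 < d" "d < 1" and B: "1 \<le> B" and \<rho>: "1 \<le> \<rho>" "\<rho> * d \<le> 2 * B"
    and b: "0 < b" "0 < J" "\<rho> \<le> real b ^ J" "real b ^ J \<le> G * \<rho>" "real b \<le> 4 * B" and G: "2 ^ J \<le> G"
    and T: "\<And>u. d < u \<Longrightarrow> u < 1 \<Longrightarrow> min (sqrt Nc * d) u * u * real (M_lines \<L> d (d / u)) \<le> T"
    and tail: "\<And>l \<xi>. l \<in> \<L> \<Longrightarrow> B \<le> \<bar>\<xi> \<bullet> v l\<bar> \<Longrightarrow> cmod (line_fourier \<beta> (a l) (v l) \<xi>) \<le> \<epsilon>0"
    and K1: "exp (- B\<^sup>2 / 2) \<le> K1 * d ^ 6" "1 \<le> K1"
begin

text \<open>The 4 in the mesh gives three clean distances: at most b^-k / 2 inside a cell, at most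
  b^-k between neighbours, at least b^-k / 4 between cells that are not neighbours.\<close>

definition cl :: "nat \<Rightarrow> real^3 \<Rightarrow> int \<times> int \<times> int" where
  "cl k q = floor3 ((4 * real b ^ k) *\<^sub>R q)"

text \<open>The width for incidence. The 11 is a budget: after subtracting 4 B/\<rho> for replacing
  a direction by its representative and B/\<rho> for rounding the frequency direction, at least 2
  B/\<rho> must remain, see \<open>far_small\<close>.\<close>

definition W :: real where "W = 11 * B / \<rho>"

definition inc :: "real^3 \<Rightarrow> real^3 \<Rightarrow> bool" where
  "inc x q \<longleftrightarrow> \<bar>x \<bullet> q\<bar> \<le> W"

lemma G1: "1 \<le> G"
  using G one_le_power[of "2::real" J] by linarith

lemma W_pos: "W > 0" and W_ge: "1 / \<rho> \<le> W"
proof -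
  show "W > 0" using B \<rho> by (simp add: W_def)
  have "1 \<le> 11 * B" using B by linarith
  then show "1 / \<rho> \<le> W" unfolding W_def using \<rho> by (intro divide_right_mono) auto
qed

lemma b_pow_ge1: "1 \<le> real b ^ k"
  using b by simp

lemma cl_refine: "cl (Suc k) q = cl (Suc k) q' \<Longrightarrow> cl k q = cl k q'"
  unfolding cl_def using floor3_div[OF b(1), of "4 * real b ^ k"] by (simp add: mult.left_commute)

lemma cl_close: "cl k q = cl k q' \<Longrightarrow> norm (q - q') \<le> 1 / (2 * real b ^ k)"
proof -
  assume "cl k q = cl k q'"
  then have "norm ((4 * real b ^ k) *\<^sub>R q - (4 * real b ^ k) *\<^sub>R q') \<le> 2"
    unfolding cl_def by (rule floor3_eq_imp_close)
  then have "4 * real b ^ k * norm (q - q') \<le> 2" by (simp flip: scaleR_right_diff_distrib)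
  then show ?thesis using b by (simp add: field_simps)
qed

lemma cl_near: "near3 (cl k q) (cl k q') \<Longrightarrow> norm (q - q') \<le> 1 / real b ^ k"
proof -
  assume "near3 (cl k q) (cl k q')"
  then have "norm ((4 * real b ^ k) *\<^sub>R q - (4 * real b ^ k) *\<^sub>R q') \<le> 4"
    unfolding cl_def by (rule near3_imp_close)
  then have "4 * real b ^ k * norm (q - q') \<le> 4" by (simp flip: scaleR_right_diff_distrib)
  then show ?thesis using b by (simp add: field_simps)
qed

lemma cl_far: "\<not> near3 (cl k q) (cl k q') \<Longrightarrow> 1 / (4 * real b ^ k) \<le> norm (q - q')"
proof -
  assume "\<not> near3 (cl k q) (cl k q')"
  then have "1 \<le> norm ((4 * real b ^ k) *\<^sub>R q - (4 * real b ^ k) *\<^sub>R q')"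
    unfolding cl_def by (rule not_near3_imp_far)
  then have "1 \<le> 4 * real b ^ k * norm (q - q')" by (simp flip: scaleR_right_diff_distrib)
  then show ?thesis using b by (simp add: field_simps)
qed

definition U :: "nat \<Rightarrow> int \<times> int \<times> int \<Rightarrow> (real^3) set" where
  "U k c = {\<xi>. \<rho> / 2 < norm \<xi> \<and> norm \<xi> \<le> \<rho> \<and> cl k ((1 / norm \<xi>) *\<^sub>R \<xi>) = c}"

lemma U_measurable [measurable]: "U k c \<in> sets borel"
proof -
  have "Measurable.pred borel (\<lambda>\<xi>::real^3. \<lfloor>4 * real b ^ k * (1 / norm \<xi> * (\<xi> \<bullet> axis i 1))\<rfloor> = j)" for i j
    by measurable
  then have [measurable]: "Measurable.pred borel (\<lambda>\<xi>::real^3. \<lfloor>4 * real b ^ k * (1 / norm \<xi> * \<xi> $ i)\<rfloor> = j)" for i j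
    by (simp add: inner_axis)
  obtain c1 c2 c3 where c: "c = (c1, c2, c3)" by (cases c)
  have "U k c = {\<xi> \<in> space borel. \<rho> / 2 < norm \<xi> \<and> norm \<xi> \<le> \<rho> \<and> \<lfloor>4 * real b ^ k * (1 / norm \<xi> * \<xi> $ 1)\<rfloor> = c1
     \<and> \<lfloor>4 * real b ^ k * (1 / norm \<xi> * \<xi> $ 2)\<rfloor> = c2 \<and> \<lfloor>4 * real b ^ k * (1 / norm \<xi> * \<xi> $ 3)\<rfloor> = c3}"
    by (auto simp: U_def cl_def floor3_def c)
  also have "\<dots> \<in> sets borel" by measurable
  finally show ?thesis .
qed

text \<open>Over a cell of level k the shell has length \<rho> and width \<rho> / b^k; the axial and
  the transversal part contribute at most 1 each.\<close>

lemma U_axial: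
  assumes \<xi>: "\<xi> \<in> U k c" and \<omega>: "norm \<omega> = 1" "cl k \<omega> = c"
  shows "axial_form \<omega> (1 / \<rho>) (1 / (\<rho> / real b ^ k)) \<xi> \<le> 2"
proof -
  define y where "y = (1 / norm \<xi>) *\<^sub>R \<xi>"
  have n: "\<rho> / 2 < norm \<xi>" "norm \<xi> \<le> \<rho>" and c: "cl k y = cl k \<omega>" using \<xi> \<omega> by (auto simp: U_def y_def)
  have n0: "norm \<xi> > 0" using n \<rho> by linarith
  have y1: "norm y = 1" using n0 by (simp add: y_def)
  have xi: "\<xi> = norm \<xi> *\<^sub>R y" using n0 by (simp add: y_def)
  define c where "c = y \<bullet> \<omega>"
  have c1: "\<bar>c\<bar> \<le> 1" using Cauchy_Schwarz_ineq2[of y \<omega>] y1 \<omega> by (simp add: c_def)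
  have "(norm (y - \<omega>))\<^sup>2 = 2 - 2 * c"
    using y1 \<omega>(1) unfolding power2_norm_eq_inner norm_eq_1 by (simp add: inner_diff_left inner_diff_right c_def inner_commute[of \<omega> y])
  moreover have "1 - c\<^sup>2 \<le> 2 - 2 * c"
  proof -
    have "0 \<le> (1 - c)\<^sup>2" by simp
    then show ?thesis by (simp add: power2_eq_square algebra_simps)
  qed
  moreover have "(norm (y - \<omega>))\<^sup>2 \<le> (1 / real b ^ k)\<^sup>2"
  proof (intro power_mono)
    have "1 / (2 * real b ^ k) \<le> 1 / real b ^ k" using b by (intro divide_left_mono) auto
    then show "norm (y - \<omega>) \<le> 1 / real b ^ k" using cl_close[OF c] by linarith
  qed simp
  ultimately have c2: "1 - c\<^sup>2 \<le> (1 / real b ^ k)\<^sup>2" by linarith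
  have ax: "axial_form \<omega> (1 / \<rho>) (1 / (\<rho> / real b ^ k)) \<xi> = (norm \<xi> / \<rho>)\<^sup>2 * c\<^sup>2 + (norm \<xi> / \<rho>)\<^sup>2 * ((real b ^ k)\<^sup>2 * (1 - c\<^sup>2))"
  proof -
    have in0: "\<xi> \<bullet> \<omega> = norm \<xi> * c" by (subst xi) (simp add: c_def)
    show ?thesis unfolding axial_form_def in0 by (simp add: power_divide power_mult_distrib algebra_simps diff_divide_distrib)
  qed
  have q1: "(norm \<xi> / \<rho>)\<^sup>2 \<le> 1" using n \<rho> by (intro power_le_one) auto
  have "c\<^sup>2 \<le> 1" using c1 power_mono[of "\<bar>c\<bar>" 1 2] by simp
  then have t1: "(norm \<xi> / \<rho>)\<^sup>2 * c\<^sup>2 \<le> 1 * 1" using q1 by (intro mult_mono) auto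
  have "(real b ^ k)\<^sup>2 * (1 - c\<^sup>2) \<le> (real b ^ k)\<^sup>2 * (1 / real b ^ k)\<^sup>2" by (intro mult_left_mono c2) simp
  also have "\<dots> = 1" using b by (simp add: power_divide)
  finally have "(norm \<xi> / \<rho>)\<^sup>2 * ((real b ^ k)\<^sup>2 * (1 - c\<^sup>2)) \<le> 1 * 1"
    using q1 \<open>c\<^sup>2 \<le> 1\<close> by (intro mult_mono) auto
  then show ?thesis using t1 unfolding ax by linarith
qed

definition c0 :: real where "c0 = exp 1 * sqrt (2 * pi) ^ 3"

lemma c0_pos: "c0 > 0" by (simp add: c0_def)

text \<open>The energy per line over a cell of level n. The division by the minimum is arranged so
  that multiplication with the number of direction classes, which is bounded by the same minimum up
  to a factor, removes the dependence on the level, see \<open>mn_Ebd\<close>.\<close>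

definition Ebd :: "nat \<Rightarrow> real" where
  "Ebd n = 2 * 10 ^ 31 * c0 * K1 * B ^ 9 * G ^ 5 * \<rho> * T / (d\<^sup>2 * (\<rho> * d)\<^sup>2) / min (sqrt Nc) (G * \<rho> / real b ^ n)"

lemma T_nonneg: "0 \<le> T"
proof -
  have u: "d < (1 + d) / 2" "(1 + d) / 2 < 1" using d by auto
  have "0 \<le> min (sqrt Nc * d) ((1 + d) / 2) * ((1 + d) / 2) * real (M_lines \<L> d (d / ((1 + d) / 2)))"
    using d V(4) by (intro mult_nonneg_nonneg) auto
  then show ?thesis using T[OF u] by linarith
qed

text \<open>An application of \<open>local_energy\<close> with r = \<rho> and r' = \<rho> / b^n. The
  lines close to a given one fill a plank which, up to powers of B and G, has thickness 1/\<rho> and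
  width 1/r'. It is counted with boxes of sides d, d/u, 1 for u close to r' d. As 1/\<rho> may
  exceed d, the two thin coordinates of a line, offset and slope, cost (\<rho> d)^-2.\<close>

lemma block_energy:
  assumes n: "n \<le> J" and D: "D \<subseteq> \<L>" and \<omega>: "norm \<omega> = 1"
    and vk: "\<And>k. k \<in> D \<Longrightarrow> \<bar>v k \<bullet> \<omega>\<bar> \<le> 19 * B * G / real b ^ n"
    and v\<theta>: "\<And>k l. k \<in> D \<Longrightarrow> l \<in> D \<Longrightarrow> norm (v l - v k) \<le> 10 * B * real b ^ n / \<rho>"
    and v\<eta>: "\<And>k l. k \<in> D \<Longrightarrow> l \<in> D \<Longrightarrow> \<bar>(v l - v k) \<bullet> \<omega>\<bar> \<le> 19 * B / \<rho>"
  shows "(LINT \<xi>|lborel. indicator (U n (cl n \<omega>)) \<xi> * (cmod (\<Sum>l\<in>D. line_fourier \<beta> (a l) (v l) \<xi>))\<^sup>2)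
      \<le> Ebd n * real (card D)"
    and "integrable lborel (\<lambda>\<xi>. indicator (U n (cl n \<omega>)) \<xi> * (cmod (\<Sum>l\<in>D. line_fourier \<beta> (a l) (v l) \<xi>))\<^sup>2)"
proof -
  define bn where "bn = real b ^ n"
  have bn: "1 \<le> bn" "bn \<le> real b ^ J" using b_pow_ge1 n b by (auto simp: bn_def intro!: power_increasing)
  then have bnG: "bn \<le> G * \<rho>" using b by linarith
  define r' where "r' = \<rho> / bn"
  define x where "x = r' * d"
  \<comment> \<open>The natural choice is u = x, for which d/u = 1/r'. It is pushed into the open
    interval (d, 1) in which T is available; the facts below say that this costs at most 2 G in one
    direction and 4 B in the other.\<close>
  define uu where "uu = min (max x (2 * d)) ((1 + d) / 2)"
  define M where "M = real (M_lines \<L> d (d / uu))"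
  define \<eta> where "\<eta> = 190 * B\<^sup>2 * G / \<rho>"
  define \<theta> where "\<theta> = 10 * B / r'"
  have rp: "0 < \<rho>" using \<rho> by linarith
  have r': "0 < r'" "r' \<le> \<rho>" "1 / G \<le> r'"
    using bn rp bnG G1 by (auto simp: r'_def field_simps)
  have x0: "0 < x" "d \<le> G * x" "x \<le> 2 * B"
  proof -
    show "0 < x" using r' d by (simp add: x_def)
    have "1 \<le> G * r'" using r'(3) G1 by (simp add: field_simps)
    then show "d \<le> G * x" using mult_right_mono[of 1 "G * r'" d] d by (simp add: x_def mult.assoc)
    have "r' * d \<le> \<rho> * d" using r' d by (intro mult_right_mono) auto
    then show "x \<le> 2 * B" using \<rho> by (simp add: x_def)
  qed
  have uu: "d < uu" "uu < 1" "uu \<le> 2 * G * x" "x \<le> 4 * B * uu"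
  proof -
    show "d < uu" using d by (auto simp: uu_def)
    have "uu \<le> (1 + d) / 2" unfolding uu_def by (rule min.cobounded2)
    also have "(1 + d) / 2 < 1" using d by simp
    finally show "uu < 1" .
    have "x \<le> 2 * G * x" using G1 x0 by simp
    then show "uu \<le> 2 * G * x" using x0 by (simp add: uu_def min_le_iff_disj)
    show "x \<le> 4 * B * uu"
    proof (cases "uu = (1 + d) / 2")
      case True
      have "4 * B * (1 / 2) \<le> 4 * B * uu" using B d True by (intro mult_left_mono) auto
      then show ?thesis using x0 by linarith
    next
      case False
      then have "uu = max x (2 * d)" by (auto simp: uu_def min_def split: if_splits)
      then have "x \<le> uu" by simp
      also have "uu \<le> 4 * B * uu" using B \<open>d < uu\<close> d by simp
      finally show ?thesis .
    qed
  qed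
  have h: "0 < d" "d \<le> d / uu" "d / uu \<le> 1" using d uu by (auto simp: pos_le_divide_eq divide_le_eq)
  have M0: "0 \<le> M" by (simp add: M_def)
  have mainT: "min (sqrt Nc * d) uu * uu * M \<le> T" unfolding M_def by (rule T[OF uu(1,2)])
  have pos: "B / \<rho> \<le> \<eta>" "B / r' \<le> \<theta>" "19 * B * G / bn * \<theta> \<le> \<eta>" "19 * B / \<rho> \<le> \<eta>"
  proof -
    have "19 * B * 1 \<le> 190 * B * (B * G)" using B G1 by (intro mult_mono mult_ge1_I) auto
    then have *: "19 * B \<le> 190 * B\<^sup>2 * G" by (simp add: power2_eq_square mult.assoc)
    then show "19 * B / \<rho> \<le> \<eta>" unfolding \<eta>_def using rp by (intro divide_right_mono) auto
    then show "B / \<rho> \<le> \<eta>" using rp B by (simp add: field_simps)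
    show "B / r' \<le> \<theta>" using B r' by (simp add: \<theta>_def divide_right_mono)
    show "19 * B * G / bn * \<theta> \<le> \<eta>" using bn rp by (simp add: \<theta>_def \<eta>_def r'_def power2_eq_square mult_ac)
  qed
  have *: "10 * B * real b ^ n / \<rho> = \<theta>" using bn rp by (simp add: \<theta>_def r'_def bn_def)
  note le = local_energy[OF \<beta>_measurable \<beta> L D ln v a \<omega> vk[folded bn_def] r'(1,2) order_trans[OF zero_le_one B] pos(1,2,3) v\<theta>[unfolded *] order_trans[OF v\<eta> pos(4)] h U_measurable[of n "cl n \<omega>"]]
  have ax: "axial_form \<omega> (1 / \<rho>) (1 / r') \<xi> \<le> 2" if "\<xi> \<in> U n (cl n \<omega>)" for \<xi>
    using U_axial[OF that \<omega>] by (simp add: r'_def bn_def)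
  show "integrable lborel (\<lambda>\<xi>. indicator (U n (cl n \<omega>)) \<xi> * (cmod (\<Sum>l\<in>D. line_fourier \<beta> (a l) (v l) \<xi>))\<^sup>2)"
    by (rule le(2)) (use ax in auto)
  define Nr where "Nr = 125 * ((40000 * \<eta> / d + 2)\<^sup>2 * (40000 * \<theta> / (d / uu) + 2)\<^sup>2) * M"
  define Z where "Z = B ^ 6 * G ^ 4 / (\<rho> * d)\<^sup>2 * M"
  have rd: "0 < \<rho> * d" using rp d by simp
  have Z0: "0 \<le> Z" using B G1 M0 by (simp add: Z_def)
  have Nr: "Nr \<le> 8 * 10 ^ 27 * Z"
  proof -
    have "40000 * \<eta> / d + 2 \<le> 8000000 * B\<^sup>2 * G / (\<rho> * d)"
    proof -
      have "2 * (\<rho> * d) \<le> 4 * B" using \<rho> by linarith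
      also have "4 * B \<le> 4 * (B\<^sup>2 * G)"
        using mult_mono[of 1 B 1 G] mult_left_mono[of 1 "B * G" B] B G1 by (simp add: power2_eq_square mult.assoc)
      finally have "7600000 * (B\<^sup>2 * G) + 2 * (\<rho> * d) \<le> 8000000 * (B\<^sup>2 * G)"
        using zero_le_power2[of B] mult_nonneg_nonneg[of "B\<^sup>2" G] G1 by linarith
      then show ?thesis using rd rp d by (simp add: \<eta>_def field_simps)
    qed
    then have s1: "(40000 * \<eta> / d + 2)\<^sup>2 \<le> (8000000 * B\<^sup>2 * G / (\<rho> * d))\<^sup>2"
      using B G1 rp d by (intro power_mono) (auto simp: \<eta>_def intro!: add_nonneg_nonneg divide_nonneg_pos)
    have "40000 * \<theta> / (d / uu) = 400000 * B * (uu / x)" using r' d by (simp add: \<theta>_def x_def)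
    also have "\<dots> \<le> 400000 * B * (2 * G)" using uu x0 B by (intro mult_left_mono) (auto simp: pos_divide_le_eq)
    finally have "40000 * \<theta> / (d / uu) + 2 \<le> 1000000 * (B * G)"
      using mult_mono[of 1 B 1 G] B G1 by simp
    then have s2: "(40000 * \<theta> / (d / uu) + 2)\<^sup>2 \<le> (1000000 * (B * G))\<^sup>2"
      using B r' d uu by (intro power_mono) (auto simp: \<theta>_def intro!: add_nonneg_nonneg divide_nonneg_pos)
    have "Nr \<le> 125 * ((8000000 * B\<^sup>2 * G / (\<rho> * d))\<^sup>2 * (1000000 * (B * G))\<^sup>2) * M"
      unfolding Nr_def by (intro mult_right_mono mult_left_mono mult_mono s1 s2 M0) auto
    also have "\<dots> = 8 * 10 ^ 27 * Z"
      by (simp add: Z_def power_divide power_mult_distrib eval_nat_numeral)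
    finally show ?thesis .
  qed
  define ee where "ee = exp (- B\<^sup>2 / 2)"
  \<comment> \<open>The Gaussian tail. \<open>all_lines_count\<close> trades the number of lines for
    d^-4 M, so that two of the six powers of d in the tail bound remain. They suffice for comparison
    with the main term because \<rho> d and r' d are at most 2 B.\<close>
  have cD: "real (card D) * (28 * ee) \<le> 3 * 10 ^ 23 * K1 * (4 * (B / r') * Z)"
  proof -
    have "real (card D) \<le> real (card \<L>)" using D L by (simp add: card_mono)
    then have "real (card D) * d ^ 4 \<le> real (card \<L>) * d ^ 4" using d by (intro mult_right_mono) auto
    also have "\<dots> \<le> 125 * 80002 ^ 4 * M" unfolding M_def by (rule all_lines_count[OF L ln v a h])
    finally have 1: "(real (card D) * d ^ 4) * (28 * K1 * d\<^sup>2) \<le> (125 * 80002 ^ 4 * M) * (28 * K1 * d\<^sup>2)"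
      using K1 by (intro mult_right_mono) auto
    have "real (card D) * (28 * ee) \<le> real (card D) * (28 * (K1 * d ^ 6))"
      unfolding ee_def using K1 by (intro mult_left_mono) auto
    also have "\<dots> = (real (card D) * d ^ 4) * (28 * K1 * d\<^sup>2)" by (simp add: eval_nat_numeral)
    finally have 2: "real (card D) * (28 * ee) \<le> (125 * 80002 ^ 4 * 28) * K1 * (M * d\<^sup>2)" using 1 by (simp add: mult_ac)
    have "d\<^sup>2 \<le> 2 * (4 * (B / r') * (B ^ 6 * G ^ 4 / (\<rho> * d)\<^sup>2))"
    proof -
      have "(\<rho> * d)\<^sup>2 \<le> (2 * B)\<^sup>2" using \<rho> rd by (intro power_mono) auto
      then have "1 / (2 * B)\<^sup>2 \<le> 1 / (\<rho> * d)\<^sup>2" using rd rp d B by (intro divide_left_mono mult_pos_pos zero_less_power) auto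
      moreover have "B ^ 6 * 1 \<le> B ^ 6 * G ^ 4" using B G1 by (intro mult_left_mono) auto
      ultimately have i1: "B ^ 6 * (1 / (2 * B)\<^sup>2) \<le> B ^ 6 * G ^ 4 * (1 / (\<rho> * d)\<^sup>2)"
        using B G1 by (intro mult_mono) auto
      have "B ^ 6 * (1 / (2 * B)\<^sup>2) = B ^ 4 / 4" using B by (simp add: power_mult_distrib eval_nat_numeral)
      then have "1 / 4 \<le> B ^ 6 * G ^ 4 * (1 / (\<rho> * d)\<^sup>2)" using i1 one_le_power[OF B, of 4] by linarith
      then have i2: "1 / 4 \<le> B ^ 6 * G ^ 4 / (\<rho> * d)\<^sup>2" by simp
      have "d / 2 \<le> B / r'"
      proof -
        have "r' * d \<le> 2 * B" using x0 by (simp add: x_def)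
        then show ?thesis using r' by (simp add: field_simps)
      qed
      then have "4 * (d / 2) * (1 / 4) \<le> 4 * (B / r') * (B ^ 6 * G ^ 4 / (\<rho> * d)\<^sup>2)"
        using i2 d B r' by (intro mult_mono) auto
      moreover have "d\<^sup>2 \<le> d" using d by (simp add: power2_eq_square mult_left_le)
      ultimately show ?thesis by simp
    qed
    then have "M * d\<^sup>2 \<le> M * (2 * (4 * (B / r') * (B ^ 6 * G ^ 4 / (\<rho> * d)\<^sup>2)))" by (intro mult_left_mono M0)
    also have "\<dots> = 2 * (4 * (B / r') * Z)" by (simp add: Z_def)
    finally have "(125 * 80002 ^ 4 * 28) * K1 * (M * d\<^sup>2) \<le> (125 * 80002 ^ 4 * 28) * K1 * (2 * (4 * (B / r') * Z))"
      using K1 by (intro mult_left_mono) auto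
    also have "\<dots> = (125 * 80002 ^ 4 * 28 * 2) * (K1 * (4 * (B / r') * Z))" by simp
    also have "\<dots> \<le> (3 * 10 ^ 23) * (K1 * (4 * (B / r') * Z))"
      using K1 B r' Z0 by (intro mult_right_mono) auto
    finally show ?thesis using 2 by (simp only: mult.assoc)
  qed
  define q where "q = min (sqrt Nc) (G * \<rho> / bn)"
  have q: "0 < q" using V(4) G1 rp bn by (simp add: q_def)
  \<comment> \<open>Multiplication by d^2 turns q into the minimum of sqrt Nc d and x, up to G, and
    r' into x. Replacing x by \<open>uu\<close> costs 4 B in each of the two factors, after which
    the bound T applies.\<close>
  have qx: "q * (r' * M) \<le> G * (16 * B\<^sup>2) * T / d\<^sup>2"
  proof -
    have "q * d \<le> G * min (sqrt Nc * d) x"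
    proof -
      have "q * d \<le> sqrt Nc * d" using d by (simp add: q_def)
      also have "\<dots> \<le> G * (sqrt Nc * d)" using G1 V(4) d by simp
      finally have A: "q * d \<le> G * (sqrt Nc * d)" .
      have "q * d \<le> G * \<rho> / bn * d" using d by (intro mult_right_mono) (auto simp: q_def)
      also have "\<dots> = G * x" by (simp add: x_def r'_def)
      finally show ?thesis using A by (simp add: min_def)
    qed
    also have "min (sqrt Nc * d) x \<le> 4 * B * min (sqrt Nc * d) uu"
    proof -
      have "sqrt Nc * d \<le> 4 * B * (sqrt Nc * d)" using B V(4) d by simp
      then show ?thesis using uu(4) by (simp add: min_def)
    qed
    finally have 1: "q * d \<le> G * (4 * B * min (sqrt Nc * d) uu)" using G1 by (simp add: mult_left_mono)
    have "(q * d) * x * M \<le> (G * (4 * B * min (sqrt Nc * d) uu)) * (4 * B * uu) * M"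
    proof (intro mult_right_mono[OF _ M0] mult_mono[OF 1 uu(4)])
      show "0 \<le> G * (4 * B * min (sqrt Nc * d) uu)" using G1 B V(4) d uu by simp
    qed (use x0 in simp)
    also have "\<dots> = G * (16 * B\<^sup>2) * (min (sqrt Nc * d) uu * uu * M)" by (simp add: power2_eq_square)
    also have "\<dots> \<le> G * (16 * B\<^sup>2) * T" using mainT G1 by (intro mult_left_mono) auto
    finally have "(q * (r' * M)) * d\<^sup>2 \<le> G * (16 * B\<^sup>2) * T" by (simp add: x_def power2_eq_square mult_ac)
    then show ?thesis using d by (simp add: pos_le_divide_eq)
  qed
  have "(LINT \<xi>|lborel. indicator (U n (cl n \<omega>)) \<xi> * (cmod (\<Sum>l\<in>D. line_fourier \<beta> (a l) (v l) \<xi>))\<^sup>2)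
    \<le> exp 1 * (sqrt (2 * pi) ^ 3 * (\<rho> * r'\<^sup>2)) * (real (card D) * (28 * (4 * (B / r') * Nr + real (card D) * (28 * ee))))"
    unfolding Nr_def M_def ee_def by (rule le(1)) (use ax in auto)
  also have "\<dots> \<le> exp 1 * (sqrt (2 * pi) ^ 3 * (\<rho> * r'\<^sup>2)) * (real (card D) * (28 * (10 ^ 28 * K1 * (4 * (B / r') * Z))))"
  proof -
    have "4 * (B / r') * Nr \<le> 4 * (B / r') * (8 * 10 ^ 27 * Z)" using B r' by (intro mult_left_mono Nr) auto
    also have "\<dots> = 8 * 10 ^ 27 * (1 * (4 * (B / r') * Z))" by simp
    also have "\<dots> \<le> 8 * 10 ^ 27 * (K1 * (4 * (B / r') * Z))" using K1 B r' Z0 by (intro mult_left_mono mult_right_mono) auto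
    finally have N1: "4 * (B / r') * Nr \<le> 8 * 10 ^ 27 * (K1 * (4 * (B / r') * Z))" .
    have N2: "real (card D) * (28 * ee) \<le> 3 * 10 ^ 23 * (K1 * (4 * (B / r') * Z))" using cD by (simp only: mult.assoc)
    have "4 * (B / r') * Nr + real (card D) * (28 * ee) \<le> (8 * 10 ^ 27 + 3 * 10 ^ 23) * (K1 * (4 * (B / r') * Z))"
      using add_mono[OF N1 N2] by (simp only: distrib_right)
    also have "\<dots> \<le> 10 ^ 28 * (K1 * (4 * (B / r') * Z))" using K1 B r' Z0 by (intro mult_right_mono) auto
    finally have "4 * (B / r') * Nr + real (card D) * (28 * ee) \<le> 10 ^ 28 * K1 * (4 * (B / r') * Z)" by (simp add: mult.assoc)
    then show ?thesis using rp by (intro mult_left_mono) auto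
  qed
  also have "\<dots> = (112 * 10 ^ 28 * c0 * K1 * B ^ 7 * G ^ 4 * \<rho> / (\<rho> * d)\<^sup>2 * (r' * M)) * real (card D)"
    using r' by (simp add: c0_def Z_def power2_eq_square eval_nat_numeral)
  also have "\<dots> \<le> Ebd n * real (card D)"
  proof (rule mult_right_mono)
    have "112 * 10 ^ 28 * c0 * K1 * B ^ 7 * G ^ 4 * \<rho> / (\<rho> * d)\<^sup>2 * (r' * M) * q
      = 112 * 10 ^ 28 * c0 * K1 * B ^ 7 * G ^ 4 * \<rho> / (\<rho> * d)\<^sup>2 * (q * (r' * M))" by simp
    also have "\<dots> \<le> 112 * 10 ^ 28 * c0 * K1 * B ^ 7 * G ^ 4 * \<rho> / (\<rho> * d)\<^sup>2 * (G * (16 * B\<^sup>2) * T / d\<^sup>2)"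
      using c0_pos K1 B G1 rp by (intro mult_left_mono qx) auto
    also have "\<dots> = 1792 * 10 ^ 28 * (c0 * K1 * B ^ 9 * G ^ 5 * \<rho> * T / (d\<^sup>2 * (\<rho> * d)\<^sup>2))"
      by (simp add: eval_nat_numeral mult_ac)
    also have "\<dots> \<le> 2 * 10 ^ 31 * (c0 * K1 * B ^ 9 * G ^ 5 * \<rho> * T / (d\<^sup>2 * (\<rho> * d)\<^sup>2))"
      using c0_pos K1 B G1 rp T_nonneg by (intro mult_right_mono) auto
    also have "\<dots> = Ebd n * q"
      using q by (simp add: Ebd_def q_def[unfolded bn_def, symmetric])
    finally show "112 * 10 ^ 28 * c0 * K1 * B ^ 7 * G ^ 4 * \<rho> / (\<rho> * d)\<^sup>2 * (r' * M) \<le> Ebd n"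
      by (rule mult_right_le_imp_le) (rule q)
  qed simp
  finally show "(LINT \<xi>|lborel. indicator (U n (cl n \<omega>)) \<xi> * (cmod (\<Sum>l\<in>D. line_fourier \<beta> (a l) (v l) \<xi>))\<^sup>2)
      \<le> Ebd n * real (card D)" .
qed

end

section \<open>Directions near a family of frequency cells\<close>

context shell
begin

definition lf :: "(real^3) set \<Rightarrow> real^3 \<Rightarrow> complex" where "lf l = line_fourier \<beta> (a l) (v l)"

definition X :: "real^3 \<Rightarrow> complex" where "X \<xi> = (\<Sum>l\<in>\<L>. lf l \<xi>)"

lemma lf_measurable [measurable]: "lf l \<in> borel_measurable borel"
  by (simp add: lf_def line_fourier_measurable)

lemma X_measurable [measurable]: "X \<in> borel_measurable borel"
  unfolding X_def[abs_def] by measurable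

lemma X_bound: "cmod (X \<xi>) \<le> 28 * real (card \<L>)"
proof -
  have "cmod (X \<xi>) \<le> (\<Sum>l\<in>\<L>. 28)"
    unfolding X_def lf_def by (intro order_trans[OF norm_sum] sum_mono line_fourier_bound \<beta>) simp
  then show ?thesis by simp
qed

lemma BG1: "1 \<le> B * G" using mult_mono[of 1 B 1 G] B G1 by simp

definition Q :: real where "Q = 20000000 * (B * G) ^ 3"

lemma Q_pos: "0 < Q" using BG1 by (simp add: Q_def)

definition E' :: real where
  "E' = 2 * 10 ^ 31 * c0 * K1 * B ^ 9 * G ^ 5 * \<rho> * T / (d\<^sup>2 * (\<rho> * d)\<^sup>2)"

lemma E'_nonneg: "0 \<le> E'"
  using c0_pos K1 B G1 \<rho> T_nonneg by (simp add: E'_def)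

text \<open>31104 = 2 * 9 * 27 * 4^3, with 2 from splitting off the tail, 9 from
  \<open>Sig_card\<close>, 27 from \<open>members_count\<close> and 4^3 from b^3 \<le> (4 B)^3
  subcells. The second summand accounts for the lines not incident to the cap under
  consideration.\<close>

definition Kb :: real where
  "Kb = 31104 * (real J + 1)\<^sup>2 * (Q * E' * G * B ^ 3 * real (card \<L>))
    + 2 * (real (card \<L>) * \<epsilon>0)\<^sup>2 * measure lborel (cball 0 \<rho> :: (real^3) set)"

lemma Kb_nonneg: "0 \<le> Kb"
  using Q_pos E'_nonneg G1 B by (simp add: Kb_def)

lemma U_X_integrable: "integrable lborel (\<lambda>\<xi>. indicator (U k c) \<xi> * (cmod (X \<xi>))\<^sup>2)"
proof (rule integrable_bounded_support(1))
  show "norm (indicator (U k c) \<xi> * (cmod (X \<xi>))\<^sup>2) \<le> (28 * real (card \<L>))\<^sup>2" for \<xi>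
    using power_mono[OF X_bound[of \<xi>], of 2] by (simp add: indicator_def)
  show "indicator (U k c) \<xi> * (cmod (X \<xi>))\<^sup>2 = 0" if "norm \<xi> > \<rho>" for \<xi>
    using that by (simp add: U_def)
qed measurable

end

text \<open>S is an arbitrary family of caps in one cell of level 0, each given by a unit vector,
  with one vector per finest cell. It must be arbitrary because the exceptional caps form a new
  family with populations and types of their own. The common cell of level 0 makes all caps
  neighbours at the root and bounds their distances by 1.\<close>

locale shell_piece = shell +
  fixes S :: "(real^3) set"
  assumes fin_S: "finite S" and norm_S: "\<And>q. q \<in> S \<Longrightarrow> norm q = 1"
    and cl0_S: "\<And>q q'. q \<in> S \<Longrightarrow> q' \<in> S \<Longrightarrow> cl 0 q = cl 0 q'" and inj_S: "inj_on (cl J) S"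

sublocale shell_piece \<subseteq> incidence_tree S V inc cl near3 J
proof
  show "near3 (cl 0 q) (cl 0 q')" if "q \<in> S" "q' \<in> S" for q q'
    using cl0_S[OF that] near3_refl by simp
qed (use fin_S V(1) near3_refl card_near3 in \<open>auto intro: near3_sym cl_refine\<close>)

context shell_piece
begin

text \<open>Classes of diameter about b^(lam k) / \<rho>, the reciprocal of the width \<rho> /
  b^(lam k) of the frequency region over a cell of level \<open>lam k\<close>.\<close>

definition s :: "nat \<Rightarrow> real^3 \<Rightarrow> int \<times> int \<times> int" where
  "s k x = floor3 ((real b ^ (J - lam k)) *\<^sub>R x)"

lemma lam_le [simp]: "lam k \<le> J" by (simp add: lam_def)

lemma pow_lam: "real b ^ (J - lam k) * real b ^ lam k = real b ^ J"
  by (simp flip: power_add)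

lemma norm_diff_S: "q \<in> S \<Longrightarrow> q' \<in> S \<Longrightarrow> norm (q' - q) \<le> 1"
  using cl_close[OF cl0_S[of q' q]] by simp

text \<open>The radius 10 W / g from \<open>crossing_count\<close>, in units of the class size, is
  40 W b^J \<le> 440 B G: the powers of b combine to b^J, whatever k is. Thus separated caps share a
  number of classes bounded in terms of B G alone; 882 = 2 * 440 + 2.\<close>

lemma crossing:
  assumes q: "q \<in> S" "q' \<in> S" and far: "\<not> near3 (cl (Suc k) q) (cl (Suc k) q')" and k: "k < J"
  shows "real (card (s k ` {x \<in> V. inc x q \<and> inc x q'})) \<le> 2 * (882 * B * G) ^ 3"
proof -
  have g: "1 / (4 * real b ^ Suc k) \<le> norm (q' - q)" using cl_far[OF far] by (simp add: norm_minus_commute)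
  have l: "lam k = Suc k" using k by (simp add: lam_def)
  have rp: "0 < \<rho>" using \<rho> by linarith
  have bp: "0 < real b ^ n" for n using b by simp
  have "real (card (s k ` {x \<in> V. inc x q \<and> inc x q'}))
     \<le> 2 * (2 * (real b ^ (J - Suc k) * (10 * W / (1 / (4 * real b ^ Suc k)))) + 2) ^ 3"
    unfolding s_def l
    by (rule crossing_count[OF norm_S[OF q(1)] norm_S[OF q(2)] _ g norm_diff_S[OF q]])
      (use V(2) W_pos b(1) in \<open>auto simp: inc_def\<close>)
  also have "real b ^ (J - Suc k) * (10 * W / (1 / (4 * real b ^ Suc k))) = 40 * W * real b ^ J"
    using pow_lam[of k] unfolding l by (simp add: mult_ac)
  also have "2 * (2 * (40 * W * real b ^ J) + 2) ^ 3 \<le> 2 * (882 * B * G) ^ 3"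
  proof (intro mult_left_mono power_mono)
    have "40 * W * real b ^ J \<le> 40 * W * (G * \<rho>)" using W_pos b by (intro mult_left_mono) auto
    also have "\<dots> = 440 * (B * G)" using rp by (simp add: W_def)
    finally show "2 * (40 * W * real b ^ J) + 2 \<le> 882 * B * G"
      using mult_mono[of 1 B 1 G] B G1 by simp
    show "0 \<le> 2 * (40 * W * real b ^ J) + 2" using W_pos bp[of J] by simp
  qed simp
  finally show ?thesis .
qed

text \<open>The threshold for bad caps. Its square has the constant 1.6 * 10^11, just above the 27 *
  2 * 882^3 * 4 that \<open>card_Bad\<close> needs to make the bad caps of all levels together at
  most half of S.\<close>

definition \<Lambda> :: real where "\<Lambda> = 400000 * (B * G)\<^sup>2 * sqrt Nc"

definition Bad :: "(real^3) set" where "Bad = (\<Union>k<J. bad s \<Lambda> k)"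

lemma Bad_sub: "Bad \<subseteq> S" by (auto simp: Bad_def bad_def)

lemma card_Bad: "2 * card Bad \<le> card S"
proof -
  define M where "M = 2 * (882 * B * G) ^ 3"
  have M0: "0 < M" using B G1 by (simp add: M_def)
  have \<Lambda>2: "\<Lambda>\<^sup>2 = 160000000000 * (B * G) ^ 4 * Nc" using V(4) by (simp add: \<Lambda>_def power_mult_distrib)
  have "0 < (B * G) ^ 4" using BG1 by (intro zero_less_power) linarith
  then have L0: "0 < \<Lambda>\<^sup>2" unfolding \<Lambda>2 using V(4) by simp
  have key: "27 * M * 2 ^ (J + 2) * Nc \<le> \<Lambda>\<^sup>2"
  proof -
    have "27 * M * 2 ^ (J + 2) = (27 * 2 * 882 ^ 3 * 4) * ((B * G) ^ 3 * 2 ^ J)"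
      by (simp add: M_def power_mult_distrib)
    also have "\<dots> \<le> (27 * 2 * 882 ^ 3 * 4) * ((B * G) ^ 3 * (B * G))"
    proof (intro mult_left_mono)
      have "G \<le> B * G" using B G1 by simp
      then show "2 ^ J \<le> B * G" using G by linarith
    qed (use BG1 in auto)
    also have "\<dots> = (27 * 2 * 882 ^ 3 * 4) * (B * G) ^ 4" by (simp add: eval_nat_numeral)
    also have "\<dots> \<le> 160000000000 * (B * G) ^ 4" by (intro mult_right_mono) auto
    finally show ?thesis unfolding \<Lambda>2 using V(4) by (intro mult_right_mono) auto
  qed
  have each: "real (card (bad s \<Lambda> k)) * \<Lambda>\<^sup>2 \<le> 27 * M * 2 ^ (k + 1) * Nc * real (card S)" if k: "k < J" for k
  proof -
    have "real (card (bad s \<Lambda> k)) * \<Lambda>\<^sup>2 \<le> 27 * real (nat \<lfloor>M\<rfloor>) * 2 ^ (k + 1) * real (card V) * real (card S)"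
    proof (rule bad_card[OF k])
      show "0 \<le> \<Lambda>" using V(4) by (simp add: \<Lambda>_def)
      show "card (s k ` {x \<in> V. inc x q \<and> inc x q'}) \<le> nat \<lfloor>M\<rfloor>"
        if "q \<in> S" "q' \<in> S" "\<not> near3 (cl (Suc k) q) (cl (Suc k) q')" for q q'
        using crossing[OF that k] unfolding M_def[symmetric] by (simp add: le_nat_floor)
    qed
    also have "\<dots> \<le> 27 * M * 2 ^ (k + 1) * Nc * real (card S)"
      using M0 V by (intro mult_right_mono mult_mono) auto
    finally show ?thesis .
  qed
  have "real (card Bad) \<le> real (\<Sum>k<J. card (bad s \<Lambda> k))"
    unfolding Bad_def of_nat_le_iff by (rule card_UN_le) simp
  then have "real (card Bad) * \<Lambda>\<^sup>2 \<le> (\<Sum>k<J. real (card (bad s \<Lambda> k))) * \<Lambda>\<^sup>2" by (intro mult_right_mono) auto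
  also have "\<dots> = (\<Sum>k<J. real (card (bad s \<Lambda> k)) * \<Lambda>\<^sup>2)" by (rule sum_distrib_right)
  also have "\<dots> \<le> (\<Sum>k<J. 27 * M * 2 ^ (k + 1) * Nc * real (card S))" by (intro sum_mono each) auto
  also have "\<dots> = (27 * M * 2 * Nc * real (card S)) * (\<Sum>k<J. 2 ^ k)"
    by (subst sum_distrib_left) (simp add: mult_ac)
  also have "(\<Sum>k<J. 2 ^ k) = (2 ^ J - 1 :: real)" by (induction J) auto
  also have "(27 * M * 2 * Nc * real (card S)) * (2 ^ J - 1) \<le> (27 * M * 2 * Nc * real (card S)) * 2 ^ J"
    using M0 V(4) by (intro mult_left_mono) auto
  also have "\<dots> = (27 * M * 2 ^ (J + 2) * Nc) * (real (card S) / 2)" by simp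
  also have "\<dots> \<le> \<Lambda>\<^sup>2 * (real (card S) / 2)" by (intro mult_right_mono key) simp
  finally have "real (card Bad) \<le> real (card S) / 2" using L0 by (simp add: mult.commute)
  then show ?thesis by linarith
qed

definition mn :: "nat \<Rightarrow> real" where "mn k = min (sqrt Nc) (G * \<rho> / real b ^ lam k)"

lemma mn_pos: "0 < mn k"
proof -
  have "0 < real b ^ lam k" "0 < \<rho>" using b \<rho> by auto
  then show ?thesis using V(4) G1 by (simp add: mn_def)
qed

text \<open>Two bounds compete: the number of classes along a great circle, about b^(J - lam k), and
  the threshold \<Lambda>, which holds at good caps. For k = J no bad set is defined, but then the
  class mesh is 1 and the first bound is the constant Q.\<close>

lemma kappa_bound:
  assumes q: "q \<in> S - Bad" and k: "k \<le> J"
  shows "real (card (s k ` {x \<in> V. inc x q \<and> tp x q = k})) \<le> Q * mn k"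
proof -
  have gc: "real (card (s k ` {x \<in> V. inc x q \<and> tp x q = k})) \<le> Q * real b ^ (J - lam k)"
  proof -
    have "real (card (s k ` {x \<in> V. inc x q \<and> tp x q = k})) \<le> 9 * real b ^ (J - lam k) * (10 * (11 * (B * G))) ^ 3"
      unfolding s_def
    proof (rule great_circle_count)
      have "real b ^ (J - lam k) * W \<le> (G * \<rho>) * W"
      proof (intro mult_right_mono)
        have "real b ^ (J - lam k) \<le> real b ^ J" using b by (intro power_increasing) auto
        then show "real b ^ (J - lam k) \<le> G * \<rho>" using b by linarith
      qed (use W_pos in simp)
      also have "\<dots> = 11 * (B * G)" using \<rho> by (simp add: W_def)
      finally show "real b ^ (J - lam k) * W \<le> 11 * (B * G)" .
    qed (use q norm_S V b_pow_ge1 BG1 in \<open>auto simp: inc_def\<close>)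
    also have "\<dots> = 9 * 1331000 * (B * G) ^ 3 * real b ^ (J - lam k)" by (simp add: power_mult_distrib)
    also have "\<dots> \<le> Q * real b ^ (J - lam k)" unfolding Q_def using BG1 by (intro mult_right_mono) auto
    finally show ?thesis .
  qed
  have "real b ^ (J - lam k) \<le> G * \<rho> / real b ^ lam k"
    using pow_lam[of k] b by (simp add: pos_le_divide_eq)
  then have 1: "real (card (s k ` {x \<in> V. inc x q \<and> tp x q = k})) \<le> Q * (G * \<rho> / real b ^ lam k)"
    using gc Q_pos by (meson mult_left_mono less_imp_le order_trans)
  have 2: "real (card (s k ` {x \<in> V. inc x q \<and> tp x q = k})) \<le> Q * sqrt Nc"
  proof (cases "k = J")
    case True
    then have "J - lam k = 0" by (simp add: lam_def)
    then have "real (card (s k ` {x \<in> V. inc x q \<and> tp x q = k})) \<le> Q * 1" using gc by simp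
    also have "\<dots> \<le> Q * sqrt Nc" using Q_pos V(4) by (intro mult_left_mono) auto
    finally show ?thesis .
  next
    case False
    then have "real (card (s k ` {x \<in> V. inc x q \<and> tp x q = k})) \<le> \<Lambda>"
      using q k by (auto simp: Bad_def bad_def not_less)
    also have "\<Lambda> \<le> Q * sqrt Nc"
    proof -
      have "(B * G)\<^sup>2 * 1 \<le> (B * G)\<^sup>2 * (B * G)" using BG1 by (intro mult_left_mono) auto
      then have "400000 * (B * G)\<^sup>2 \<le> Q" using BG1 zero_le_power2[of "B * G"] unfolding Q_def power3_eq_cube power2_eq_square by linarith
      then show ?thesis unfolding \<Lambda>_def using V(4) by (intro mult_right_mono) auto
    qed
    finally show ?thesis .
  qed
  show ?thesis using 1 2 by (simp add: mn_def min_def)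
qed

section \<open>Refined direction classes and blocks of lines\<close>

definition om :: "nat \<Rightarrow> int \<times> int \<times> int \<Rightarrow> real^3" where
  "om k c = (SOME q. q \<in> S \<and> cl (lam k) q = c)"

lemma om: assumes "c \<in> cl (lam k) ` S" shows "om k c \<in> S" "cl (lam k) (om k c) = c"
proof -
  have "\<exists>q. q \<in> S \<and> cl (lam k) q = c" using assms by auto
  from someI_ex[OF this] show "om k c \<in> S" "cl (lam k) (om k c) = c" unfolding om_def by auto
qed

text \<open>The class is refined by the component along the centre of the cell, rounded to multiples
  of W. Directions of one unrefined class may differ by a multiple of b^(lam k) / \<rho> along the
  centre, while \<open>block_energy\<close> asks for 19 B/\<rho>.\<close>

definition s' :: "nat \<Rightarrow> int \<times> int \<times> int \<Rightarrow> real^3 \<Rightarrow> (int \<times> int \<times> int) \<times> int" where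
  "s' k c x = (s k x, \<lfloor>(x \<bullet> om k c) / W\<rfloor>)"

lemma s_close: "s k x = s k x' \<Longrightarrow> norm (x - x') \<le> 2 / real b ^ (J - lam k)"
proof -
  assume "s k x = s k x'"
  then have "norm ((real b ^ (J - lam k)) *\<^sub>R x - (real b ^ (J - lam k)) *\<^sub>R x') \<le> 2"
    unfolding s_def by (rule floor3_eq_imp_close)
  then have "real b ^ (J - lam k) * norm (x - x') \<le> 2" by (simp flip: scaleR_right_diff_distrib)
  then show ?thesis using b by (simp add: field_simps)
qed

definition Sig :: "nat \<Rightarrow> real^3 \<Rightarrow> ((int \<times> int \<times> int) \<times> int) set" where
  "Sig k q = s' k (cl (lam k) q) ` {x \<in> V. inc x q \<and> tp x q = k}"

lemma finite_Sig [simp]: "finite (Sig k q)" using V(1) by (simp add: Sig_def)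

text \<open>The refinement costs only a factor 9. Directions of one class that are incident to the
  same q differ by at most 3 W along the centre: W for each incidence and 1/b^J \<le> W for moving q
  to the centre. So their rounded components differ by at most 4.\<close>

lemma Sig_card:
  assumes q: "q \<in> S - Bad" and k: "k \<le> J"
  shows "real (card (Sig k q)) \<le> 9 * Q * mn k"
proof -
  define c where "c = cl (lam k) q"
  define w where "w = om k c"
  have w: "norm w = 1" "cl (lam k) w = cl (lam k) q" using om[of c k] q norm_S by (auto simp: w_def c_def)
  define Xq where "Xq = {x \<in> V. inc x q \<and> tp x q = k}"
  have dif: "\<bar>x \<bullet> w - x' \<bullet> w\<bar> \<le> 3 * W" if x: "x \<in> Xq" "x' \<in> Xq" "s k x = s k x'" for x x'
  proof -
    have "\<bar>(x - x') \<bullet> (w - q)\<bar> \<le> norm (x - x') * norm (w - q)" by (rule Cauchy_Schwarz_ineq2)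
    also have "\<dots> \<le> (2 / real b ^ (J - lam k)) * (1 / (2 * real b ^ lam k))"
      by (intro mult_mono s_close cl_close x w) auto
    also have "\<dots> = 1 / real b ^ J" using pow_lam[of k] by simp
    also have "\<dots> \<le> 1 / \<rho>" using b \<rho> by (intro divide_left_mono) auto
    finally have 1: "\<bar>(x - x') \<bullet> (w - q)\<bar> \<le> W" using W_ge by linarith
    have "x \<bullet> w - x' \<bullet> w = (x - x') \<bullet> (w - q) + x \<bullet> q - x' \<bullet> q" by (simp add: inner_diff_left inner_diff_right)
    moreover have "\<bar>x \<bullet> q\<bar> \<le> W" "\<bar>x' \<bullet> q\<bar> \<le> W" using x by (auto simp: Xq_def inc_def)
    ultimately show ?thesis using 1 by linarith
  qed
  have finX: "finite Xq" using V(1) by (simp add: Xq_def)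
  have "card (Sig k q) \<le> card (s k ` Xq) * 9"
  proof (rule card_le_fibres[where f = fst])
    show "fst ` Sig k q \<subseteq> s k ` Xq" by (auto simp: Sig_def s'_def Xq_def)
    show "card {y \<in> Sig k q. fst y = z} \<le> 9" if "z \<in> s k ` Xq" for z
    proof -
      from that obtain x0 where x0: "x0 \<in> Xq" "z = s k x0" by auto
      define i where "i = \<lfloor>(x0 \<bullet> w) / W\<rfloor>"
      have "{y \<in> Sig k q. fst y = z} \<subseteq> {z} \<times> {i - 4..i + 4}"
      proof
        fix y assume "y \<in> {y \<in> Sig k q. fst y = z}"
        then obtain x where x: "x \<in> Xq" "y = s' k c x" "s k x = z" by (auto simp: Sig_def Xq_def c_def s'_def)
        have "\<bar>(x \<bullet> w) / W - (x0 \<bullet> w) / W\<bar> \<le> 3"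
          using dif[OF x(1) x0(1)] x(3) x0(2) W_pos by (simp add: abs_divide pos_divide_le_eq flip: diff_divide_distrib)
        then have "\<lfloor>(x \<bullet> w) / W\<rfloor> \<in> {i - 4..i + 4}" unfolding i_def by simp linarith
        then show "y \<in> {z} \<times> {i - 4..i + 4}" using x by (simp add: s'_def w_def)
      qed
      from card_mono[OF _ this] show ?thesis by (simp add: card_cartesian_product)
    qed
  qed (use finX in auto)
  then have "real (card (Sig k q)) \<le> 9 * real (card (s k ` Xq))" by linarith
  also have "\<dots> \<le> 9 * (Q * mn k)" using kappa_bound[OF q k] by (intro mult_left_mono) (auto simp: Xq_def)
  finally show ?thesis by simp
qed

text \<open>A block depends on the cell c and not on a particular cap. It serves all caps of the
  cell at once, and its energy can be integrated over the whole region
  \<open>U (lam k) c\<close>.\<close>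

definition D :: "nat \<Rightarrow> int \<times> int \<times> int \<Rightarrow> (int \<times> int \<times> int) \<times> int \<Rightarrow> (real^3) set set" where
  "D k c \<sigma> = {l \<in> \<L>. rep l \<in> members k c \<and> s' k c (rep l) = \<sigma>}"

text \<open>The hypotheses of \<open>block_energy\<close> at the centre w of the cell. A member is
  incident to a cap which is only near at level k, whence the distance 1/b^k \<le> 4 B / b^(lam k).
  The number 19 is 4 + 4 + 11 twice: representative, displaced cap and W for a single line; two
  representatives and W for a pair.\<close>

lemma D_energy:
  assumes k: "k \<le> J" and c: "c \<in> cl (lam k) ` S"
  shows "(LINT \<xi>|lborel. indicator (U (lam k) c) \<xi> * (cmod (\<Sum>l\<in>D k c \<sigma>. lf l \<xi>))\<^sup>2)
      \<le> Ebd (lam k) * real (card (D k c \<sigma>))"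
    and "integrable lborel (\<lambda>\<xi>. indicator (U (lam k) c) \<xi> * (cmod (\<Sum>l\<in>D k c \<sigma>. lf l \<xi>))\<^sup>2)"
proof -
  define w where "w = om k c"
  have w: "w \<in> S" "norm w = 1" "cl (lam k) w = c" using om[OF c] norm_S by (auto simp: w_def)
  have rp: "0 < \<rho>" using \<rho> by linarith
  have bp: "0 < real b ^ n" for n using b by simp
  have d2: "2 * d \<le> 4 * B / \<rho>" using \<rho> rp by (simp add: field_simps)
  have lamG: "1 / \<rho> \<le> G / real b ^ lam k"
  proof -
    have "real b ^ lam k \<le> real b ^ J" using b by (intro power_increasing) auto
    then have "real b ^ lam k \<le> G * \<rho>" using b by linarith
    then show ?thesis using rp bp by (simp add: field_simps)
  qed
  have vk: "\<bar>v l \<bullet> w\<bar> \<le> 19 * B * G / real b ^ lam k" if l: "l \<in> D k c \<sigma>" for l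
  proof -
    have lm: "l \<in> \<L>" "rep l \<in> members k c" using l by (auto simp: D_def)
    obtain q q' where q: "q \<in> S" "q' \<in> S" "cl (lam k) q = c" "inc (rep l) q'" "near3 (cl k q) (cl k q')"
      by (rule members_near[OF lm(2) k])
    have "cl k w = cl k q" using cell_mono[of k "lam k" w q] k w q by (simp add: lam_def)
    then have "norm (w - q') \<le> 1 / real b ^ k" using q(5) by (intro cl_near) simp
    also have "\<dots> \<le> 4 * B / real b ^ lam k"
    proof (cases "k = J")
      case True
      then have "lam k = k" by (simp add: lam_def)
      then show ?thesis by (intro frac_le) (use B b in auto)
    next
      case False
      then have "lam k = Suc k" using k by (simp add: lam_def)
      then show ?thesis using b bp[of k] by (simp add: field_simps)
    qed
    also have "\<dots> \<le> 4 * B * G / real b ^ lam k" using B G1 bp by (intro divide_right_mono) auto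
    finally have 1: "norm (w - q') \<le> 4 * (B * G / real b ^ lam k)" by simp
    have "\<bar>rep l \<bullet> (w - q')\<bar> \<le> norm (rep l) * norm (w - q')" by (rule Cauchy_Schwarz_ineq2)
    then have 2: "\<bar>rep l \<bullet> (w - q')\<bar> \<le> 4 * (B * G / real b ^ lam k)" using 1 V(2)[OF rep(1)[OF lm(1)]] by simp
    have "\<bar>(v l - rep l) \<bullet> w\<bar> \<le> norm (v l - rep l) * norm w" by (rule Cauchy_Schwarz_ineq2)
    then have 3: "\<bar>(v l - rep l) \<bullet> w\<bar> \<le> 4 * (B / \<rho>)" using rep(2)[OF lm(1)] w d2 by simp
    have 4: "\<bar>rep l \<bullet> q'\<bar> \<le> 11 * (B / \<rho>)" using q by (simp add: inc_def W_def)
    have 5: "B / \<rho> \<le> B * G / real b ^ lam k" using mult_left_mono[OF lamG, of B] B by simp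
    have "v l \<bullet> w = (v l - rep l) \<bullet> w + rep l \<bullet> (w - q') + rep l \<bullet> q'"
      by (simp add: inner_diff_left inner_diff_right)
    then have "\<bar>v l \<bullet> w\<bar> \<le> 19 * (B * G / real b ^ lam k)" using 2 3 4 5 by linarith
    then show ?thesis by simp
  qed
  have pair: "norm (v l - v l') \<le> 10 * B * real b ^ lam k / \<rho> \<and> \<bar>(v l - v l') \<bullet> w\<bar> \<le> 19 * B / \<rho>"
    if l: "l' \<in> D k c \<sigma>" "l \<in> D k c \<sigma>" for l l'
  proof
    have lm: "l \<in> \<L>" "l' \<in> \<L>" and ss: "s' k c (rep l) = s' k c (rep l')" using l by (auto simp: D_def)
    have e: "norm (v l - rep l) \<le> 4 * B / \<rho>" "norm (v l' - rep l') \<le> 4 * B / \<rho>"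
      using rep(2)[OF lm(1)] rep(2)[OF lm(2)] d2 by linarith+
    have dec: "v l - v l' = (v l - rep l) - (v l' - rep l') + (rep l - rep l')" by simp
    have "norm (rep l - rep l') \<le> 2 / real b ^ (J - lam k)" using ss by (intro s_close) (simp add: s'_def)
    also have "\<dots> = 2 * real b ^ lam k / real b ^ J" unfolding pow_lam[of k, symmetric] using b by simp
    also have "\<dots> \<le> 2 * real b ^ lam k / \<rho>" using b rp by (intro divide_left_mono) auto
    finally have r1: "norm (rep l - rep l') \<le> 2 * real b ^ lam k / \<rho>" .
    have t: "norm (v l - v l') \<le> norm (v l - rep l) + norm (v l' - rep l') + norm (rep l - rep l')"
      unfolding dec by (intro order_trans[OF norm_triangle_ineq] add_right_mono norm_triangle_ineq4)
    have "norm (v l - v l') \<le> (8 * B + 2 * real b ^ lam k) / \<rho>"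
      using t e r1 by (simp add: add_divide_distrib)
    also have "\<dots> \<le> 10 * B * real b ^ lam k / \<rho>"
    proof (intro divide_right_mono)
      have "8 * B * 1 \<le> 8 * B * real b ^ lam k" "2 * real b ^ lam k * 1 \<le> 2 * real b ^ lam k * B"
        using B b_pow_ge1 by (intro mult_left_mono; simp)+
      then show "8 * B + 2 * real b ^ lam k \<le> 10 * B * real b ^ lam k" by (simp add: mult_ac)
    qed (use rp in simp)
    finally show "norm (v l - v l') \<le> 10 * B * real b ^ lam k / \<rho>" .
    have "\<bar>(rep l \<bullet> w) / W - (rep l' \<bullet> w) / W\<bar> \<le> 1"
      using ss by (intro floor_close) (simp add: s'_def w_def)
    then have 1: "\<bar>(rep l - rep l') \<bullet> w\<bar> \<le> W"
      using W_pos by (simp add: abs_divide pos_divide_le_eq inner_diff_left flip: diff_divide_distrib)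
    have 2: "\<bar>(v l - rep l) \<bullet> w\<bar> \<le> 4 * B / \<rho>" "\<bar>(v l' - rep l') \<bullet> w\<bar> \<le> 4 * B / \<rho>"
      using Cauchy_Schwarz_ineq2[of "v l - rep l" w] Cauchy_Schwarz_ineq2[of "v l' - rep l'" w] e w by auto
    have "(v l - v l') \<bullet> w = (v l - rep l) \<bullet> w - (v l' - rep l') \<bullet> w + (rep l - rep l') \<bullet> w"
      by (simp add: inner_diff_left)
    then show "\<bar>(v l - v l') \<bullet> w\<bar> \<le> 19 * B / \<rho>" using 1 2 unfolding W_def by linarith
  qed
  have sub: "D k c \<sigma> \<subseteq> \<L>" by (auto simp: D_def)
  note be = block_energy[OF lam_le[of k] sub w(2) vk conjunct1[OF pair] conjunct2[OF pair]]
  show "(LINT \<xi>|lborel. indicator (U (lam k) c) \<xi> * (cmod (\<Sum>l\<in>D k c \<sigma>. lf l \<xi>))\<^sup>2)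
      \<le> Ebd (lam k) * real (card (D k c \<sigma>))"
    using be(1) unfolding w(3) lf_def by simp
  show "integrable lborel (\<lambda>\<xi>. indicator (U (lam k) c) \<xi> * (cmod (\<Sum>l\<in>D k c \<sigma>. lf l \<xi>))\<^sup>2)"
    using be(2) unfolding w(3) lf_def by simp
qed

end

section \<open>Energy on a frequency shell\<close>

context shell_piece
begin

text \<open>If the representative misses the strip of width W, then \<xi> . v l has modulus at least
  (\<rho>/2) (2 B/\<rho>) = B everywhere over the cap, and \<open>tail\<close> applies.\<close>

lemma far_small:
  assumes q: "q \<in> S" and l: "l \<in> \<L>" and ni: "\<not> inc (rep l) q" and \<xi>: "\<xi> \<in> U J (cl J q)"
  shows "cmod (lf l \<xi>) \<le> \<epsilon>0"
  unfolding lf_def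
proof (rule tail[OF l])
  define y where "y = (1 / norm \<xi>) *\<^sub>R \<xi>"
  have n: "\<rho> / 2 < norm \<xi>" and c: "cl J y = cl J q" using \<xi> by (auto simp: U_def y_def)
  have rp: "0 < \<rho>" using \<rho> by linarith
  have n0: "norm \<xi> > 0" using n rp by linarith
  have y1: "norm y = 1" using n0 by (simp add: y_def)
  have d2: "2 * d \<le> 4 * (B / \<rho>)" using \<rho> rp by (simp add: field_simps)
  have "norm (y - q) \<le> 1 / (2 * real b ^ J)" by (rule cl_close[OF c])
  also have "\<dots> \<le> 1 / \<rho>" using b rp by (intro divide_left_mono) auto
  also have "\<dots> \<le> B / \<rho>" using B rp by (intro divide_right_mono) auto
  finally have yq: "norm (y - q) \<le> B / \<rho>" .
  have 1: "\<bar>rep l \<bullet> (y - q)\<bar> \<le> B / \<rho>"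
    using Cauchy_Schwarz_ineq2[of "rep l" "y - q"] yq V(2)[OF rep(1)[OF l]] by simp
  have 2: "\<bar>(v l - rep l) \<bullet> y\<bar> \<le> 4 * (B / \<rho>)"
    using Cauchy_Schwarz_ineq2[of "v l - rep l" y] y1 rep(2)[OF l] d2 by simp
  have 3: "11 * (B / \<rho>) < \<bar>rep l \<bullet> q\<bar>" using ni by (simp add: inc_def W_def)
  have "v l \<bullet> y = (v l - rep l) \<bullet> y + rep l \<bullet> (y - q) + rep l \<bullet> q"
    by (simp add: inner_diff_left inner_diff_right)
  then have "2 * (B / \<rho>) \<le> \<bar>v l \<bullet> y\<bar>" using 1 2 3 B rp divide_nonneg_pos[of B \<rho>] by linarith
  then have "\<rho> / 2 * (2 * (B / \<rho>)) \<le> norm \<xi> * \<bar>v l \<bullet> y\<bar>"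
    using n rp B by (intro mult_mono) auto
  also have "\<dots> = \<bar>\<xi> \<bullet> v l\<bar>" using n0 by (simp add: y_def abs_mult inner_commute)
  finally show "B \<le> \<bar>\<xi> \<bullet> v l\<bar>" using rp by simp
qed

text \<open>\<open>cov\<close> is the union of the complete blocks whose class occurs at q,
  including lines that are not incident to q themselves. By \<open>tp_cong\<close> these blocks are
  the fibres of g, hence disjoint, and every line left over is non-incident.\<close>

lemma decomposition:
  assumes q: "q \<in> S"
  obtains cov where "cov \<subseteq> \<L>" "\<And>l. l \<in> \<L> - cov \<Longrightarrow> \<not> inc (rep l) q"
    "\<And>\<xi>. (\<Sum>l\<in>cov. lf l \<xi>) = (\<Sum>k\<le>J. \<Sum>\<sigma>\<in>Sig k q. \<Sum>l\<in>D k (cl (lam k) q) \<sigma>. lf l \<xi>)"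
proof -
  define g where "g l = (tp (rep l) q, s' (tp (rep l) q) (cl (lam (tp (rep l) q)) q) (rep l))" for l
  define I where "I = Sigma {..J} (\<lambda>k. Sig k q)"
  define cov where "cov = {l \<in> \<L>. inc_set (rep l) \<noteq> {} \<and> g l \<in> I}"
  have finc: "finite cov" using L by (simp add: cov_def)
  have finI: "finite I" by (simp add: I_def)
  have fib: "{l \<in> cov. g l = (k, \<sigma>)} = D k (cl (lam k) q) \<sigma>" if i: "(k, \<sigma>) \<in> I" for k \<sigma>
  proof (intro set_eqI iffI)
    fix l assume "l \<in> {l \<in> cov. g l = (k, \<sigma>)}"
    then have "l \<in> \<L>" "inc_set (rep l) \<noteq> {}" "tp (rep l) q = k" "s' k (cl (lam k) q) (rep l) = \<sigma>"
      by (auto simp: cov_def g_def)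
    then show "l \<in> D k (cl (lam k) q) \<sigma>" using q rep(1) by (auto simp: D_def members_def)
  next
    fix l assume "l \<in> D k (cl (lam k) q) \<sigma>"
    then obtain q' where l: "l \<in> \<L>" "inc_set (rep l) \<noteq> {}" "s' k (cl (lam k) q) (rep l) = \<sigma>"
      and q': "cl (lam k) q' = cl (lam k) q" "tp (rep l) q' = k"
      by (auto simp: D_def members_def)
    have "tp (rep l) q = k" using tp_cong[of k q' q "rep l"] q' i by (simp add: I_def)
    then show "l \<in> {l \<in> cov. g l = (k, \<sigma>)}" using l i by (simp add: cov_def g_def)
  qed
  show ?thesis
  proof
    show "cov \<subseteq> \<L>" by (auto simp: cov_def)
    show "\<not> inc (rep l) q" if l: "l \<in> \<L> - cov" for l
    proof
      assume i: "inc (rep l) q"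
      have "inc_set (rep l) \<noteq> {}" using i q by (auto simp: inc_set_def)
      moreover have "g l \<in> I" using i rep(1) l tp_le by (auto simp: g_def I_def Sig_def)
      ultimately show False using l by (simp add: cov_def)
    qed
    show "(\<Sum>l\<in>cov. lf l \<xi>) = (\<Sum>k\<le>J. \<Sum>\<sigma>\<in>Sig k q. \<Sum>l\<in>D k (cl (lam k) q) \<sigma>. lf l \<xi>)" for \<xi>
    proof -
      have "(\<Sum>l\<in>cov. lf l \<xi>) = (\<Sum>i\<in>I. \<Sum>l\<in>{l \<in> cov. g l = i}. lf l \<xi>)"
        by (rule sum.group[symmetric, OF finc finI]) (auto simp: cov_def)
      also have "\<dots> = (\<Sum>(k, \<sigma>)\<in>I. \<Sum>l\<in>D k (cl (lam k) q) \<sigma>. lf l \<xi>)"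
        by (intro sum.cong refl) (auto simp: fib)
      also have "\<dots> = (\<Sum>k\<le>J. \<Sum>\<sigma>\<in>Sig k q. \<Sum>l\<in>D k (cl (lam k) q) \<sigma>. lf l \<xi>)"
        unfolding I_def by (intro sum.Sigma[symmetric]) auto
      finally show ?thesis .
    qed
  qed
qed

lemma cmod_sum_square:
  assumes "finite A"
  shows "(cmod (\<Sum>i\<in>A. f i))\<^sup>2 \<le> real (card A) * (\<Sum>i\<in>A. (cmod (f i))\<^sup>2)"
proof -
  have "(cmod (\<Sum>i\<in>A. f i))\<^sup>2 \<le> (\<Sum>i\<in>A. cmod (f i))\<^sup>2" by (intro power_mono norm_sum) simp
  also have "\<dots> \<le> (\<Sum>i\<in>A. (cmod (f i))\<^sup>2) * real (card A)"
    by (rule sum_squared_le_sum_of_squares)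
  finally show ?thesis by (simp add: mult.commute)
qed

definition h :: "nat \<Rightarrow> int \<times> int \<times> int \<Rightarrow> real^3 \<Rightarrow> real" where
  "h k c \<xi> = (\<Sum>\<sigma>\<in>s' k c ` V. (cmod (\<Sum>l\<in>D k c \<sigma>. lf l \<xi>))\<^sup>2)"

text \<open>Cauchy-Schwarz twice: over the J + 1 types and over the classes occurring at q, of which
  there are at most \<open>9 * Q * mn k\<close>. Afterwards the sum is extended to all classes, so
  that \<open>h\<close> depends on q only through its cell.\<close>

lemma pointwise:
  assumes q: "q \<in> S - Bad" and \<xi>: "\<xi> \<in> U J (cl J q)"
  shows "(cmod (X \<xi>))\<^sup>2 \<le> 2 * ((real J + 1) * (\<Sum>k\<le>J. 9 * Q * mn k * h k (cl (lam k) q) \<xi>))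
     + 2 * (real (card \<L>) * \<epsilon>0)\<^sup>2"
proof -
  obtain cov where cov: "cov \<subseteq> \<L>" "\<And>l. l \<in> \<L> - cov \<Longrightarrow> \<not> inc (rep l) q"
    and dec: "\<And>\<xi>. (\<Sum>l\<in>cov. lf l \<xi>) = (\<Sum>k\<le>J. \<Sum>\<sigma>\<in>Sig k q. \<Sum>l\<in>D k (cl (lam k) q) \<sigma>. lf l \<xi>)"
    using decomposition[of q] q by blast
  define Y where "Y = (\<Sum>l\<in>cov. lf l \<xi>)"
  define E where "E = (\<Sum>l\<in>\<L> - cov. lf l \<xi>)"
  have XE: "X \<xi> = Y + E"
    unfolding X_def Y_def E_def using sum.subset_diff[OF cov(1) L, of "\<lambda>l. lf l \<xi>"] by simp
  have "cmod E \<le> (\<Sum>l\<in>\<L> - cov. \<bar>\<epsilon>0\<bar>)"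
    unfolding E_def
  proof (intro order_trans[OF norm_sum] sum_mono)
    show "cmod (lf l \<xi>) \<le> \<bar>\<epsilon>0\<bar>" if l: "l \<in> \<L> - cov" for l
      using far_small[OF _ _ cov(2)[OF l] \<xi>] l q by fastforce
  qed
  also have "\<dots> \<le> real (card \<L>) * \<bar>\<epsilon>0\<bar>" using L by (simp add: mult_right_mono card_mono)
  finally have "(cmod E)\<^sup>2 \<le> (real (card \<L>) * \<bar>\<epsilon>0\<bar>)\<^sup>2" by (intro power_mono) auto
  then have E2: "(cmod E)\<^sup>2 \<le> (real (card \<L>) * \<epsilon>0)\<^sup>2" by (simp add: power_mult_distrib)
  have "(cmod Y)\<^sup>2 \<le> real (card {..J}) * (\<Sum>k\<le>J. (cmod (\<Sum>\<sigma>\<in>Sig k q. \<Sum>l\<in>D k (cl (lam k) q) \<sigma>. lf l \<xi>))\<^sup>2)"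
    unfolding Y_def dec by (rule cmod_sum_square) simp
  also have "\<dots> \<le> real (card {..J}) * (\<Sum>k\<le>J. 9 * Q * mn k * h k (cl (lam k) q) \<xi>)"
  proof (intro mult_left_mono sum_mono)
    fix k assume k: "k \<in> {..J}"
    have "(cmod (\<Sum>\<sigma>\<in>Sig k q. \<Sum>l\<in>D k (cl (lam k) q) \<sigma>. lf l \<xi>))\<^sup>2
      \<le> real (card (Sig k q)) * (\<Sum>\<sigma>\<in>Sig k q. (cmod (\<Sum>l\<in>D k (cl (lam k) q) \<sigma>. lf l \<xi>))\<^sup>2)"
      by (rule cmod_sum_square) simp
    also have "\<dots> \<le> (9 * Q * mn k) * h k (cl (lam k) q) \<xi>"
    proof (rule mult_mono)
      show "real (card (Sig k q)) \<le> 9 * Q * mn k" using Sig_card[OF q] k by simp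
      show "(\<Sum>\<sigma>\<in>Sig k q. (cmod (\<Sum>l\<in>D k (cl (lam k) q) \<sigma>. lf l \<xi>))\<^sup>2) \<le> h k (cl (lam k) q) \<xi>"
        unfolding h_def by (rule sum_mono2) (use V(1) in \<open>auto simp: Sig_def\<close>)
      show "0 \<le> 9 * Q * mn k" using Q_pos mn_pos[of k] by simp
    qed (simp add: sum_nonneg)
    finally show "(cmod (\<Sum>\<sigma>\<in>Sig k q. \<Sum>l\<in>D k (cl (lam k) q) \<sigma>. lf l \<xi>))\<^sup>2 \<le> 9 * Q * mn k * h k (cl (lam k) q) \<xi>" .
  qed simp
  finally have Y2: "(cmod Y)\<^sup>2 \<le> (real J + 1) * (\<Sum>k\<le>J. 9 * Q * mn k * h k (cl (lam k) q) \<xi>)" by (simp add: add.commute)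
  have "(cmod (X \<xi>))\<^sup>2 \<le> (cmod Y + cmod E)\<^sup>2" unfolding XE by (intro power_mono norm_triangle_ineq) simp
  also have "\<dots> \<le> 2 * (cmod Y)\<^sup>2 + 2 * (cmod E)\<^sup>2"
    using zero_le_power2[of "cmod Y - cmod E"] by (simp add: power2_sum power2_diff)
  finally show ?thesis using Y2 E2 by linarith
qed

lemma children:
  assumes k: "k \<le> J"
  shows "card (cl (lam k) ` {q \<in> S. cl k q = z}) \<le> b ^ 3"
proof (cases "k < J")
  case True
  then have l: "lam k = Suc k" by (simp add: lam_def)
  have fd: "cl k q = (\<lambda>(i, j, k). (i div int b, j div int b, k div int b)) (cl (Suc k) q)" for q
    unfolding cl_def using floor3_div[OF b(1), of "4 * real b ^ k" q] by (simp add: mult.left_commute)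
  have "cl (lam k) ` {q \<in> S. cl k q = z}
     \<subseteq> {c' \<in> cl (Suc k) ` S. (\<lambda>(i, j, k). (i div int b, j div int b, k div int b)) c' = z}"
    unfolding l
  proof (intro image_subsetI CollectI conjI)
    fix q assume q: "q \<in> {q \<in> S. cl k q = z}"
    then show "cl (Suc k) q \<in> cl (Suc k) ` S" by blast
    show "(\<lambda>(i, j, k). (i div int b, j div int b, k div int b)) (cl (Suc k) q) = z"
      unfolding fd[symmetric] using q by blast
  qed
  from card_mono[OF _ this] fin_S have "card (cl (lam k) ` {q \<in> S. cl k q = z})
     \<le> card {c' \<in> cl (Suc k) ` S. (\<lambda>(i, j, k). (i div int b, j div int b, k div int b)) c' = z}" by simp
  also have "\<dots> \<le> b ^ 3" by (rule card_children3[OF b(1)])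
  finally show ?thesis .
next
  case False
  then have "cl (lam k) ` {q \<in> S. cl k q = z} \<subseteq> {z}" using k by (auto simp: lam_def)
  from card_mono[OF _ this] have "card (cl (lam k) ` {q \<in> S. cl k q = z}) \<le> 1" by simp
  then show ?thesis using b(1) one_le_power[of b 3] by linarith
qed

text \<open>For a fixed cell the blocks partition the lines whose representative is a member of it,
  and \<open>members_count\<close> bounds the number of cells to which a representative
  belongs.\<close>

lemma total_card:
  assumes k: "k \<le> J"
  shows "(\<Sum>c\<in>cl (lam k) ` S. \<Sum>\<sigma>\<in>s' k c ` V. real (card (D k c \<sigma>))) \<le> real (card \<L>) * (27 * 2 ^ k * real b ^ 3)"
proof -
  have 1: "(\<Sum>\<sigma>\<in>s' k c ` V. card (D k c \<sigma>)) = card {l \<in> \<L>. rep l \<in> members k c}" for c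
  proof -
    have "(\<Sum>\<sigma>\<in>s' k c ` V. \<Sum>l\<in>{l \<in> {l \<in> \<L>. rep l \<in> members k c}. s' k c (rep l) = \<sigma>}. 1::nat)
      = (\<Sum>l\<in>{l \<in> \<L>. rep l \<in> members k c}. 1)"
      by (rule sum.group) (use L V(1) rep(1) in auto)
    then show ?thesis by (simp add: D_def)
  qed
  have "(\<Sum>c\<in>cl (lam k) ` S. card {l \<in> \<L>. rep l \<in> members k c})
      = (\<Sum>l\<in>\<L>. card {c \<in> cl (lam k) ` S. rep l \<in> members k c})"
    using sum.swap_restrict[OF finite_imageI[OF fin_S] L, of "\<lambda>_ _. 1::nat" "\<lambda>c l. rep l \<in> members k c" "cl (lam k)"] by simp
  also have "\<dots> \<le> (\<Sum>l\<in>\<L>. 27 * 2 ^ k * b ^ 3)"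
    by (intro sum_mono members_count rep k children[OF k])
  finally have "(\<Sum>c\<in>cl (lam k) ` S. card {l \<in> \<L>. rep l \<in> members k c}) \<le> card \<L> * (27 * 2 ^ k * b ^ 3)" by simp
  then have "real (\<Sum>c\<in>cl (lam k) ` S. card {l \<in> \<L>. rep l \<in> members k c}) \<le> real (card \<L> * (27 * 2 ^ k * b ^ 3))"
    unfolding of_nat_le_iff .
  then show ?thesis unfolding 1[symmetric] by simp
qed

lemma mn_Ebd: "mn k * Ebd (lam k) = E'"
proof -
  have "Ebd (lam k) = E' / mn k" by (simp only: Ebd_def E'_def mn_def)
  then show ?thesis using mn_pos[of k] by simp
qed

text \<open>The regions over distinct caps are disjoint by \<open>inj_S\<close>, so at each
  frequency at most one good cap contributes, and \<open>pointwise\<close> applies to it. The blocks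
  are then integrated over the larger cells of level \<open>lam k\<close>; there the number of
  classes times the energy per line gives E' for every k.\<close>

lemma piece: "(\<Sum>q\<in>S - Bad. LINT \<xi>|lborel. indicator (U J (cl J q)) \<xi> * (cmod (X \<xi>))\<^sup>2) \<le> Kb"
proof -
  let ?e = "\<lambda>k c \<sigma> \<xi>. indicator (U (lam k) c) \<xi> * (cmod (\<Sum>l\<in>D k c \<sigma>. lf l \<xi>))\<^sup>2 :: real"
  define m where "m = measure lborel (cball 0 \<rho> :: (real^3) set)"
  define e0 where "e0 = (real (card \<L>) * \<epsilon>0)\<^sup>2"
  define F where "F \<xi> = (\<Sum>q\<in>S - Bad. indicator (U J (cl J q)) \<xi> * (cmod (X \<xi>))\<^sup>2)" for \<xi>
  define H where "H \<xi> = 2 * ((real J + 1) * (\<Sum>k\<le>J. 9 * Q * mn k * (\<Sum>c\<in>cl (lam k) ` S. \<Sum>\<sigma>\<in>s' k c ` V. ?e k c \<sigma> \<xi>)))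
     + 2 * e0 * indicator (cball 0 \<rho>) \<xi>" for \<xi>
  define IH where "IH = 2 * ((real J + 1) * (\<Sum>k\<le>J. 9 * Q * mn k * (\<Sum>c\<in>cl (lam k) ` S. \<Sum>\<sigma>\<in>s' k c ` V. integral\<^sup>L lborel (?e k c \<sigma>))))
     + 2 * e0 * m"
  have hH: "has_bochner_integral lborel H IH"
    unfolding H_def IH_def m_def
  proof (intro has_bochner_integral_add has_bochner_integral_mult_right has_bochner_integral_sum has_bochner_integral_real_indicator emeasure_lborel_cball_finite)
    fix k c \<sigma> assume "k \<in> {..J}" "c \<in> cl (lam k) ` S"
    then show "has_bochner_integral lborel (?e k c \<sigma>) (integral\<^sup>L lborel (?e k c \<sigma>))"
      by (intro has_bochner_integral_integrable D_energy) auto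
  qed auto
  have intF: "integrable lborel F" unfolding F_def[abs_def] by (intro Bochner_Integration.integrable_sum U_X_integrable)
  have FH: "F \<xi> \<le> H \<xi>" for \<xi>
  proof (cases "\<exists>q\<in>S - Bad. \<xi> \<in> U J (cl J q)")
    case False
    then have "F \<xi> = 0" by (simp add: F_def)
    moreover have "0 \<le> H \<xi>" using Q_pos mn_pos
      unfolding H_def e0_def by (intro add_nonneg_nonneg mult_nonneg_nonneg sum_nonneg) (auto simp: less_imp_le)
    ultimately show ?thesis by simp
  next
    case True
    then obtain q where q: "q \<in> S - Bad" "\<xi> \<in> U J (cl J q)" by auto
    have other: "\<xi> \<notin> U J (cl J q')" if "q' \<in> S - Bad - {q}" for q'
      using q that inj_onD[OF inj_S, of q' q] by (auto simp: U_def)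
    have "F \<xi> = (cmod (X \<xi>))\<^sup>2"
      unfolding F_def using other q fin_S by (subst sum.remove[of _ q]) (auto intro!: sum.neutral)
    also have "\<dots> \<le> 2 * ((real J + 1) * (\<Sum>k\<le>J. 9 * Q * mn k * h k (cl (lam k) q) \<xi>)) + 2 * e0"
      unfolding e0_def by (rule pointwise[OF q])
    also have "\<dots> \<le> H \<xi>"
      unfolding H_def
    proof (intro add_mono mult_left_mono sum_mono)
      fix k assume k: "k \<in> {..J}"
      have "cl J ((1 / norm \<xi>) *\<^sub>R \<xi>) = cl J q" using q(2) by (simp add: U_def)
      then have "cl (lam k) ((1 / norm \<xi>) *\<^sub>R \<xi>) = cl (lam k) q" by (rule cell_mono[OF lam_le order_refl])
      then have "\<xi> \<in> U (lam k) (cl (lam k) q)" using q(2) by (simp add: U_def)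
      then have "h k (cl (lam k) q) \<xi> = (\<Sum>\<sigma>\<in>s' k (cl (lam k) q) ` V. ?e k (cl (lam k) q) \<sigma> \<xi>)" by (simp add: h_def)
      also have "\<dots> \<le> (\<Sum>c\<in>cl (lam k) ` S. \<Sum>\<sigma>\<in>s' k c ` V. ?e k c \<sigma> \<xi>)"
        using q fin_S by (intro member_le_sum[of "cl (lam k) q" _ "\<lambda>c. \<Sum>\<sigma>\<in>s' k c ` V. ?e k c \<sigma> \<xi>"]) (auto intro!: sum_nonneg)
      finally show "h k (cl (lam k) q) \<xi> \<le> (\<Sum>c\<in>cl (lam k) ` S. \<Sum>\<sigma>\<in>s' k c ` V. ?e k c \<sigma> \<xi>)" .
      show "0 \<le> 9 * Q * mn k" using Q_pos mn_pos[of k] by simp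
    next
      show "2 * e0 \<le> 2 * e0 * indicator (cball 0 \<rho>) \<xi>" using q(2) by (simp add: U_def)
    qed auto
    finally show ?thesis .
  qed
  have "(\<Sum>q\<in>S - Bad. LINT \<xi>|lborel. indicator (U J (cl J q)) \<xi> * (cmod (X \<xi>))\<^sup>2) = integral\<^sup>L lborel F"
    unfolding F_def[abs_def] by (rule Bochner_Integration.integral_sum[symmetric]) (rule U_X_integrable)
  also have "\<dots> \<le> integral\<^sup>L lborel H"
    by (rule integral_mono[OF intF integrable.intros[OF hH] FH])
  also have "\<dots> = IH" by (rule has_bochner_integral_integral_eq[OF hH])
  also have "IH \<le> 2 * ((real J + 1) * (\<Sum>k\<le>J. 15552 * (Q * E' * G * B ^ 3 * real (card \<L>)))) + 2 * e0 * m"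
    unfolding IH_def
  proof (intro add_right_mono mult_left_mono sum_mono)
    fix k assume k: "k \<in> {..J}"
    have "(\<Sum>c\<in>cl (lam k) ` S. \<Sum>\<sigma>\<in>s' k c ` V. integral\<^sup>L lborel (?e k c \<sigma>))
      \<le> (\<Sum>c\<in>cl (lam k) ` S. \<Sum>\<sigma>\<in>s' k c ` V. Ebd (lam k) * real (card (D k c \<sigma>)))"
      using k by (intro sum_mono D_energy(1)) auto
    also have "\<dots> = Ebd (lam k) * (\<Sum>c\<in>cl (lam k) ` S. \<Sum>\<sigma>\<in>s' k c ` V. real (card (D k c \<sigma>)))"
      by (simp add: sum_distrib_left)
    finally have 1: "(\<Sum>c\<in>cl (lam k) ` S. \<Sum>\<sigma>\<in>s' k c ` V. integral\<^sup>L lborel (?e k c \<sigma>))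
      \<le> Ebd (lam k) * (\<Sum>c\<in>cl (lam k) ` S. \<Sum>\<sigma>\<in>s' k c ` V. real (card (D k c \<sigma>)))" .
    have "9 * Q * mn k * (\<Sum>c\<in>cl (lam k) ` S. \<Sum>\<sigma>\<in>s' k c ` V. integral\<^sup>L lborel (?e k c \<sigma>))
       \<le> 9 * Q * mn k * (Ebd (lam k) * (\<Sum>c\<in>cl (lam k) ` S. \<Sum>\<sigma>\<in>s' k c ` V. real (card (D k c \<sigma>))))"
      using Q_pos mn_pos[of k] by (intro mult_left_mono 1) auto
    also have "\<dots> = 9 * Q * (mn k * Ebd (lam k)) * (\<Sum>c\<in>cl (lam k) ` S. \<Sum>\<sigma>\<in>s' k c ` V. real (card (D k c \<sigma>)))"
      by (simp only: mult.assoc)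
    also have "\<dots> \<le> 9 * Q * E' * (real (card \<L>) * (27 * G * (4 * B) ^ 3))"
      unfolding mn_Ebd
    proof (rule mult_left_mono)
      have "2 ^ k \<le> (2 ^ J :: real)" using k by (intro power_increasing) auto
      then have "2 ^ k \<le> G" using G by linarith
      then have "27 * 2 ^ k * real b ^ 3 \<le> 27 * G * (4 * B) ^ 3"
        using G b B G1 by (intro mult_mono power_mono) auto
      then have tc: "real (card \<L>) * (27 * 2 ^ k * real b ^ 3) \<le> real (card \<L>) * (27 * G * (4 * B) ^ 3)"
        by (intro mult_left_mono) auto
      show "(\<Sum>c\<in>cl (lam k) ` S. \<Sum>\<sigma>\<in>s' k c ` V. real (card (D k c \<sigma>))) \<le> real (card \<L>) * (27 * G * (4 * B) ^ 3)"
        by (rule order_trans[OF total_card tc]) (use k in simp)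
      show "0 \<le> 9 * Q * E'" using Q_pos E'_nonneg by simp
    qed
    also have "\<dots> = 15552 * (Q * E' * G * B ^ 3 * real (card \<L>))" by (simp add: power_mult_distrib)
    finally show "9 * Q * mn k * (\<Sum>c\<in>cl (lam k) ` S. \<Sum>\<sigma>\<in>s' k c ` V. integral\<^sup>L lborel (?e k c \<sigma>))
      \<le> 15552 * (Q * E' * G * B ^ 3 * real (card \<L>))" .
  qed auto
  also have "\<dots> = Kb" by (simp add: Kb_def e0_def m_def power2_eq_square algebra_simps)
  finally show ?thesis .
qed

end

context shell
begin

text \<open>One unit vector is taken from each finest cell meeting the sphere. Their number is at
  most (8 b^J + 2)^3 \<le> (10 G \<rho>)^3, which the n halvings exhaust. The factor 1000 is the
  bound (8 + 2)^3 for the cells of level 0.\<close>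

lemma shell_total:
  assumes n: "(10 * G * \<rho>) ^ 3 < 2 ^ n"
  shows "(LINT \<xi>|lborel. indicator {\<xi>. \<rho> / 2 < norm \<xi> \<and> norm \<xi> \<le> \<rho>} \<xi> * (cmod (X \<xi>))\<^sup>2) \<le> 1000 * real n * Kb"
proof -
  have fc: "real (card (cl k ` sphere 0 1)) \<le> (2 * (4 * real b ^ k) + 2) ^ 3" "finite (cl k ` sphere 0 1)" for k
    unfolding cl_def[abs_def] using card_floor3_ball[of "4 * real b ^ k" "sphere 0 1" "\<lambda>q. (4 * real b ^ k) *\<^sub>R q" 0] by simp_all
  obtain S where S: "S \<subseteq> sphere 0 1" "inj_on (cl J) S" "cl J ` S = cl J ` sphere 0 1"
    using subset_image_inj[of "cl J ` sphere 0 1" "cl J" "sphere 0 1"] by auto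
  have finS: "finite S" using finite_imageD[OF _ S(2)] S(3) fc(2) by simp
  have "real (card S) = real (card (cl J ` sphere 0 1))" using card_image[OF S(2)] S(3) by simp
  also have "\<dots> \<le> (2 * (4 * real b ^ J) + 2) ^ 3" by (rule fc)
  also have "\<dots> \<le> (10 * G * \<rho>) ^ 3"  
  proof (intro power_mono)
    have "10 * (G * \<rho>) = 10 * G * \<rho>" by simp
    then show "2 * (4 * real b ^ J) + 2 \<le> 10 * G * \<rho>" using b(4) b_pow_ge1[of J] by linarith
  qed simp
  also have "\<dots> < 2 ^ n" by (rule n)
  finally have cS: "card S < 2 ^ n" by (simp flip: of_nat_less_iff)
  define f where "f q = (LINT \<xi>|lborel. indicator (U J (cl J q)) \<xi> * (cmod (X \<xi>))\<^sup>2)" for q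
  have ind: "indicator {\<xi>. \<rho> / 2 < norm \<xi> \<and> norm \<xi> \<le> \<rho>} \<xi> = (\<Sum>q\<in>S. indicator (U J (cl J q)) \<xi> :: real)" for \<xi>
  proof (cases "\<rho> / 2 < norm \<xi> \<and> norm \<xi> \<le> \<rho>")
    case False
    then have "\<xi> \<notin> U J c" for c by (auto simp: U_def)
    then have "(\<Sum>q\<in>S. indicator (U J (cl J q)) \<xi> :: real) = 0" by simp
    moreover have "indicator {\<xi>. \<rho> / 2 < norm \<xi> \<and> norm \<xi> \<le> \<rho>} \<xi> = (0 :: real)"
      unfolding indicator_def using False by auto
    ultimately show ?thesis by simp
  next
    case True
    then have "\<xi> \<noteq> 0" using \<rho> by auto
    then have "cl J ((1 / norm \<xi>) *\<^sub>R \<xi>) \<in> cl J ` S" unfolding S(3) by (intro imageI) simp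
    then obtain q where q: "q \<in> S" "cl J ((1 / norm \<xi>) *\<^sub>R \<xi>) = cl J q" by auto
    have other: "\<xi> \<notin> U J (cl J q')" if "q' \<in> S - {q}" for q'
      using q that inj_onD[OF S(2), of q' q] by (auto simp: U_def)
    have "(\<Sum>q\<in>S. indicator (U J (cl J q)) \<xi> :: real) = 1"
      using other q finS True by (subst sum.remove[of _ q]) (auto simp: U_def intro!: sum.neutral)
    then show ?thesis using True by simp
  qed
  have group: "(\<Sum>q\<in>{q \<in> S. cl 0 q = z}. f q) \<le> real n * Kb" for z
  proof (rule halving_sum_le)
    show "finite {q \<in> S. cl 0 q = z}" using finS by simp
    show "card {q \<in> S. cl 0 q = z} < 2 ^ n" using card_mono[OF finS, of "{q \<in> S. cl 0 q = z}"] cS by simp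
    fix S' assume S': "S' \<subseteq> {q \<in> S. cl 0 q = z}"
    interpret shell_piece chi \<beta> \<L> a v rep V d B \<rho> G T \<epsilon>0 K1 Nc b J S'
    proof unfold_locales
      show "finite S'" using S' finS finite_subset by fastforce
      show "inj_on (cl J) S'" using S' S(2) inj_on_subset by blast
    qed (use S' S(1) in auto)
    show "\<exists>Bad\<subseteq>S'. 2 * card Bad \<le> card S' \<and> (\<Sum>q\<in>S' - Bad. f q) \<le> Kb"
      unfolding f_def using Bad_sub card_Bad piece by blast
  qed (rule Kb_nonneg)
  have z: "real (card (cl 0 ` S)) \<le> 1000"
  proof -
    have "card (cl 0 ` S) \<le> card (cl 0 ` sphere 0 1)" using S(1) fc(2) by (intro card_mono image_mono) auto
    then show ?thesis using fc(1)[of 0] by simp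
  qed
  have "(LINT \<xi>|lborel. indicator {\<xi>. \<rho> / 2 < norm \<xi> \<and> norm \<xi> \<le> \<rho>} \<xi> * (cmod (X \<xi>))\<^sup>2)
      = (LINT \<xi>|lborel. (\<Sum>q\<in>S. indicator (U J (cl J q)) \<xi> * (cmod (X \<xi>))\<^sup>2))"
    by (simp only: ind sum_distrib_right)
  also have "\<dots> = (\<Sum>q\<in>S. f q)" unfolding f_def by (rule Bochner_Integration.integral_sum) (rule U_X_integrable)
  also have "\<dots> = (\<Sum>z\<in>cl 0 ` S. \<Sum>q\<in>{q \<in> S. cl 0 q = z}. f q)"
    by (rule sum.group[symmetric]) (use finS in auto)
  also have "\<dots> \<le> (\<Sum>z\<in>cl 0 ` S. real n * Kb)" by (intro sum_mono group)
  also have "\<dots> = real (card (cl 0 ` S)) * (real n * Kb)" by simp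
  also have "\<dots> \<le> 1000 * (real n * Kb)" using z Kb_nonneg by (intro mult_right_mono) auto
  finally show ?thesis by simp
qed

end

section \<open>Energy over all frequencies\<close>

lemma dyadic_scale:
  fixes x :: real
  obtains i :: nat where "x \<le> 2 ^ i" "i = 0 \<or> 2 ^ i < 2 * x"
proof -
  define i where "i = (LEAST i. x \<le> 2 ^ i)"
  have "\<exists>i. x \<le> 2 ^ i" using real_arch_pow[of 2 x] by (auto intro: less_imp_le)
  then have 1: "x \<le> 2 ^ i" unfolding i_def by (rule LeastI_ex)
  have 2: "2 ^ i < 2 * x" if "i \<noteq> 0"
  proof -
    from that obtain j where j: "i = Suc j" by (cases i) auto
    have "\<not> x \<le> 2 ^ j" using not_less_Least[of j "\<lambda>i. x \<le> 2 ^ i"] j unfolding i_def by simp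
    then show ?thesis by (simp add: j)
  qed
  show ?thesis by (rule that[OF 1]) (use 2 in blast)
qed

lemma measure_cball3: "r \<ge> 0 \<Longrightarrow> measure lborel (cball 0 r :: (real^3) set) = unit_ball_vol 3 * r ^ 3"
  using content_cball[of r "0 :: real^3"] by (simp add: measure_def)

text \<open>A dyadic step function, the sum of 16^-i times the indicator of the ball of radius 2^i.
  The integrals are proportional to 16^-i 8^i = 2^-i and hence summable, while the ball just
  containing x contributes |x|^-4 up to the factor 16.\<close>

lemma decay_majorant:
  obtains g :: "real^3 \<Rightarrow> real" where "integrable lborel g" "\<And>x. 0 \<le> g x"
    "\<And>x. 1 \<le> norm x \<Longrightarrow> 1 / (16 * norm x ^ 4) \<le> g x"
proof -
  define f :: "nat \<Rightarrow> real^3 \<Rightarrow> real" where "f i x = (1 / 16) ^ i * indicator (cball 0 (2 ^ i)) x" for i x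
  define g where "g x = (\<Sum>i. f i x)" for x
  have f0: "0 \<le> f i x" for i x by (simp add: f_def)
  have sf: "summable (\<lambda>i. f i x)" for x
    by (rule summable_comparison_test'[of "\<lambda>i. (1 / 16) ^ i" 0]) (auto simp: f_def indicator_def intro: summable_geometric)
  have fi: "integrable lborel (f i)" for i
    unfolding f_def[abs_def] by (intro integrable_mult_right integrable_real_indicator emeasure_lborel_cball_finite) auto
  have "(LINT x|lborel. norm (f i x)) = unit_ball_vol 3 * (1 / 2) ^ i" for i
  proof -
    have "(LINT x|lborel. norm (f i x)) = (1 / 16) ^ i * measure lborel (cball 0 (2 ^ i) :: (real^3) set)"
      by (simp add: f_def abs_mult)
    also have "\<dots> = unit_ball_vol 3 * ((1 / 16) ^ i * (2 ^ i) ^ 3)" by (simp add: measure_cball3)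
    also have "(2 ^ i) ^ 3 = ((2::real) ^ 3) ^ i" by (simp only: power_mult[symmetric] mult.commute)
    also have "(1 / 16) ^ i * ((2::real) ^ 3) ^ i = (1 / 2) ^ i" by (simp flip: power_mult_distrib)
    finally show ?thesis .
  qed
  then have si: "summable (\<lambda>i. LINT x|lborel. norm (f i x))" by (simp add: summable_mult summable_geometric)
  have "integrable lborel g"
    unfolding g_def[abs_def] using sf f0 by (intro integrable_suminf fi si) auto
  moreover have "0 \<le> g x" for x unfolding g_def by (intro suminf_nonneg sf f0)
  moreover have "1 / (16 * norm x ^ 4) \<le> g x" if x: "1 \<le> norm x" for x
  proof -
    obtain i where i: "norm x \<le> 2 ^ i" "i = 0 \<or> 2 ^ i < 2 * norm x" by (rule dyadic_scale)
    have "2 ^ i \<le> 2 * norm x" using i x by auto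
    then have "(2 ^ i) ^ 4 \<le> (2 * norm x) ^ 4" by (intro power_mono) auto
    moreover have "(2 ^ i) ^ 4 = ((2::real) ^ 4) ^ i" by (simp only: power_mult[symmetric] mult.commute)
    ultimately have le: "16 ^ i \<le> 16 * norm x ^ 4" by (simp add: power_mult_distrib)
    have "1 / (16 * norm x ^ 4) \<le> 1 / 16 ^ i" using x by (intro divide_left_mono le) (auto intro!: mult_pos_pos zero_less_power)
    also have "\<dots> = f i x" using i by (simp add: f_def power_divide)
    also have "\<dots> \<le> g x" unfolding g_def using sum_le_suminf[OF sf, of "{i}" x] f0 by simp
    finally show ?thesis .
  qed
  ultimately show ?thesis using that by blast
qed

context bump_function
begin

text \<open>Cauchy-Schwarz in space between the point mass and the sum of the line waves;
  \<open>plancherel_le\<close> takes the latter to the frequency side. 5832 = 729 * 8 comes from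
  \<open>point_mass_square\<close>.\<close>

lemma incidence_gap:
  fixes a v :: "(real^3) set \<Rightarrow> real^3"
  assumes P: "finite P" "\<And>p. p \<in> P \<Longrightarrow> norm p \<le> 2" and L: "finite \<L>"
    and ln: "\<And>l. l \<in> \<L> \<Longrightarrow> l = line_at (a l) (v l)" and v: "\<And>l. l \<in> \<L> \<Longrightarrow> norm (v l) = 1"
    and a: "\<And>l. l \<in> \<L> \<Longrightarrow> norm (a l) \<le> 1" and d: "0 < d" "d < 1"
    and [measurable]: "\<beta> \<in> borel_measurable borel"
    and \<beta>: "\<And>t. 0 \<le> \<beta> t" "\<And>t. \<beta> t \<le> 1" "\<And>t. \<bar>t\<bar> > 14 \<Longrightarrow> \<beta> t = 0" "\<And>t. \<bar>t\<bar> \<le> 10 \<Longrightarrow> \<beta> t = 1"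
    and H: "integrable lborel H" "\<And>\<xi>. (cmod (phihat d \<xi> * (\<Sum>l\<in>\<L>. line_fourier \<beta> (a l) (v l) \<xi>)))\<^sup>2 \<le> H \<xi>"
  shows "\<bar>normalized_incidences chi d P \<L> - normalized_incidences chi (2 * d) P \<L>\<bar>\<^sup>2
    \<le> 5832 * unit_ball_vol 3 / d ^ 3 * (real (M_points P d) / real (card P)) * (integral\<^sup>L lborel H / (real (card \<L>))\<^sup>2)"
proof -
  define G where "G y = (\<Sum>l\<in>\<L>. line_wave \<beta> d (a l) (v l) y)" for y
  have i\<beta>: "integrable lborel \<beta>"
    by (rule integrable_bounded_support(1)[of _ 1 14]) (use \<beta> in auto)
  note reg = line_wave_regular[OF d v a \<open>\<beta> \<in> borel_measurable borel\<close> \<beta>(1-3)]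
  have Gc: "continuous_on UNIV G" unfolding G_def[abs_def] by (intro continuous_on_sum reg(1))
  then have [measurable]: "G \<in> borel_measurable borel" by (rule borel_measurable_continuous_onI)
  define K where "K = (\<Sum>l\<in>\<L>. 8 / d ^ 3 * 28)"
  have K0: "0 \<le> K" using d by (simp add: K_def)
  have Gb: "\<bar>G y\<bar> \<le> K" for y unfolding G_def K_def by (intro order_trans[OF sum_abs] sum_mono reg(2))
  have Gs: "G y = 0" if "norm y > 20" for y unfolding G_def by (intro sum.neutral ballI reg(3) that)
  have iG: "integrable lborel (\<lambda>y. (G y)\<^sup>2)"
  proof (rule integrable_bounded_support(1))
    show "norm ((G y)\<^sup>2) \<le> K\<^sup>2" for y using power_mono[OF Gb[of y], of 2] by simp
    show "(G y)\<^sup>2 = 0" if "norm y > 20" for y using Gs[OF that] by simp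
  qed measurable
  have Gh: "(LINT y|lborel. complex_of_real (G y) * cis (\<xi> \<bullet> y)) = phihat d \<xi> * (\<Sum>l\<in>\<L>. line_fourier \<beta> (a l) (v l) \<xi>)" for \<xi>
  proof -
    have "(LINT y|lborel. complex_of_real (G y) * cis (\<xi> \<bullet> y))
      = (LINT y|lborel. (\<Sum>l\<in>\<L>. complex_of_real (line_wave \<beta> d (a l) (v l) y) * cis (\<xi> \<bullet> y)))"
      by (simp add: G_def sum_distrib_right)
    also have "\<dots> = (\<Sum>l\<in>\<L>. LINT y|lborel. complex_of_real (line_wave \<beta> d (a l) (v l) y) * cis (\<xi> \<bullet> y))"
    proof (rule Bochner_Integration.integral_sum)
      fix l
      have i: "integrable lborel (line_wave \<beta> d (a l) (v l))" by (rule line_wave_fourier(2)[OF d(1) _ i\<beta>]) measurable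
      show "integrable lborel (\<lambda>y. complex_of_real (line_wave \<beta> d (a l) (v l) y) * cis (\<xi> \<bullet> y))"
        by (rule Bochner_Integration.integrable_bound[OF i]) (use borel_measurable_integrable[OF i] in \<open>auto simp: norm_mult\<close>)
    qed
    also have "\<dots> = (\<Sum>l\<in>\<L>. phihat d \<xi> * line_fourier \<beta> (a l) (v l) \<xi>)"
      by (intro sum.cong refl line_wave_fourier(1)[OF d(1) _ i\<beta>]) measurable
    finally show ?thesis by (simp add: sum_distrib_left)
  qed
  have G2: "(LINT y|lborel. (G y)\<^sup>2) \<le> integral\<^sup>L lborel H"
  proof -
    have H0: "0 \<le> H \<xi>" for \<xi> using H(2)[of \<xi>] zero_le_power2 order_trans by blast
    have "(LINT y|lborel. (G y)\<^sup>2) \<le> integral\<^sup>L lborel H / (2 * pi) ^ DIM(real^3)"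
      by (rule plancherel_le[OF Gc Gb Gs H(1)]) (use H(2) in \<open>simp_all add: Gh\<close>)
    also have "\<dots> \<le> integral\<^sup>L lborel H / 1"
      using H0 pi_ge_two by (intro divide_left_mono Bochner_Integration.integral_nonneg one_le_power) auto
    finally show ?thesis by simp
  qed
  define PM where "PM = point_mass P d"
  have iterm: "integrable lborel (\<lambda>y. dilate chi d (y - p) * line_wave \<beta> d (a l) (v l) y)" if "p \<in> P" "l \<in> \<L>" for p l
    by (rule eta_line_diff(2)[OF d v[OF that(2)] a[OF that(2)] P(2)[OF that(1)] _ i\<beta> \<beta>(4)]) measurable
  have PG: "(\<lambda>y. PM y * G y) = (\<lambda>y. \<Sum>p\<in>P. \<Sum>l\<in>\<L>. dilate chi d (y - p) * line_wave \<beta> d (a l) (v l) y)"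
    by (simp add: PM_def point_mass_def G_def sum_product)
  have iPG: "integrable lborel (\<lambda>y. PM y * G y)"
    unfolding PG by (intro Bochner_Integration.integrable_sum iterm)
  have diff: "(\<Sum>p\<in>P. \<Sum>l\<in>\<L>. LINT x|arc_length l. eta chi d (x - p)) - (\<Sum>p\<in>P. \<Sum>l\<in>\<L>. LINT x|arc_length l. eta chi (2 * d) (x - p))
    = (LINT y|lborel. PM y * G y)"
  proof -
    have "(LINT y|lborel. PM y * G y) = (\<Sum>p\<in>P. \<Sum>l\<in>\<L>. LINT y|lborel. dilate chi d (y - p) * line_wave \<beta> d (a l) (v l) y)"
      unfolding PG by (subst Bochner_Integration.integral_sum)
        (auto intro!: Bochner_Integration.integrable_sum iterm sum.cong Bochner_Integration.integral_sum)
    also have "\<dots> = (\<Sum>p\<in>P. \<Sum>l\<in>\<L>. (LINT x|arc_length l. eta chi d (x - p)) - (LINT x|arc_length l. eta chi (2 * d) (x - p)))"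
    proof (intro sum.cong refl)
      fix p l assume pl: "p \<in> P" "l \<in> \<L>"
      show "(LINT y|lborel. dilate chi d (y - p) * line_wave \<beta> d (a l) (v l) y)
        = (LINT x|arc_length l. eta chi d (x - p)) - (LINT x|arc_length l. eta chi (2 * d) (x - p))"
        using eta_line_diff(1)[OF d v[OF pl(2)] a[OF pl(2)] P(2)[OF pl(1)] \<open>\<beta> \<in> borel_measurable borel\<close> i\<beta> \<beta>(4)]
        unfolding ln[OF pl(2), symmetric] by simp
    qed
    finally show ?thesis by (simp add: sum_subtractf)
  qed
  have nd: "normalized_incidences chi d P \<L> - normalized_incidences chi (2 * d) P \<L>
    = (LINT y|lborel. PM y * G y) / (real (card P) * real (card \<L>))"
    unfolding diff[symmetric] normalized_incidences_def incidences_def using d by (simp add: diff_divide_distrib mult.assoc)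
  have "(LINT y|lborel. PM y * G y)\<^sup>2 \<le> (LINT y|lborel. (PM y)\<^sup>2) * (LINT y|lborel. (G y)\<^sup>2)"
    by (rule integral_Cauchy_Schwarz[OF _ iG iPG]) (unfold PM_def, rule point_mass_square(1)[OF P(1) d(1)])
  also have "\<dots> \<le> (5832 * unit_ball_vol 3 / d ^ 3 * real (card P) * real (M_points P d)) * integral\<^sup>L lborel H"
    using point_mass_square(2)[OF P(1) d(1)] d
    by (intro mult_mono G2) (auto simp: PM_def)
  finally have CS: "(LINT y|lborel. PM y * G y)\<^sup>2 \<le> (5832 * unit_ball_vol 3 / d ^ 3 * real (card P) * real (M_points P d)) * integral\<^sup>L lborel H" .
  have "\<bar>normalized_incidences chi d P \<L> - normalized_incidences chi (2 * d) P \<L>\<bar>\<^sup>2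
    = (LINT y|lborel. PM y * G y)\<^sup>2 / (real (card P) * real (card \<L>))\<^sup>2" by (simp add: nd power_divide)
  also have "\<dots> \<le> (5832 * unit_ball_vol 3 / d ^ 3 * real (card P) * real (M_points P d)) * integral\<^sup>L lborel H / (real (card P) * real (card \<L>))\<^sup>2"
    by (intro divide_right_mono CS) simp
  \<comment> \<open>For \<open>card P = 0\<close> both sides are 0, by the convention for division
    by zero.\<close>
  also have "\<dots> = 5832 * unit_ball_vol 3 / d ^ 3 * (real (M_points P d) / real (card P)) * (integral\<^sup>L lborel H / (real (card \<L>))\<^sup>2)"
    by (cases "card P = 0") (simp_all add: power2_eq_square mult_ac)
  finally show ?thesis .
qed

end

text \<open>Everything in \<open>shell\<close> that does not depend on the radius;
  \<open>branching\<close> supplies a tree for each admissible radius. The decay order m is such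
  that frequencies beyond B/d become negligible.\<close>

locale line_energy = bump_function +
  fixes \<beta> :: "real \<Rightarrow> real" and \<L> :: "(real^3) set set" and a v rep :: "(real^3) set \<Rightarrow> real^3" and V :: "(real^3) set"
    and d B G T \<epsilon>0 K1 K2 Nc Cp :: real and J m n :: nat and g :: "real^3 \<Rightarrow> real"
  assumes \<beta>_measurable [measurable]: "\<beta> \<in> borel_measurable borel"
    and \<beta>: "\<And>t. 0 \<le> \<beta> t" "\<And>t. \<beta> t \<le> 1" "\<And>t. \<bar>t\<bar> > 14 \<Longrightarrow> \<beta> t = 0"
    and L: "finite \<L>" and ln: "\<And>l. l \<in> \<L> \<Longrightarrow> l = line_at (a l) (v l)" and v: "\<And>l. l \<in> \<L> \<Longrightarrow> norm (v l) = 1"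
    and a: "\<And>l. l \<in> \<L> \<Longrightarrow> norm (a l) \<le> 1"
    and V: "finite V" "\<And>x. x \<in> V \<Longrightarrow> norm x = 1" "real (card V) \<le> Nc" "1 \<le> Nc"
    and rep: "\<And>l. l \<in> \<L> \<Longrightarrow> rep l \<in> V" "\<And>l. l \<in> \<L> \<Longrightarrow> norm (v l - rep l) \<le> 2 * d"
    and d: "0 < d" "d < 1" and B: "1 \<le> B" and J: "0 < J" and G: "2 ^ J \<le> G"
    and branching: "\<And>\<rho>. 1 \<le> \<rho> \<Longrightarrow> \<rho> * d \<le> 2 * B \<Longrightarrow> \<exists>b::nat. 0 < b \<and> \<rho> \<le> real b ^ J \<and> real b ^ J \<le> G * \<rho> \<and> real b \<le> 4 * B"
    and T: "\<And>u. d < u \<Longrightarrow> u < 1 \<Longrightarrow> min (sqrt Nc * d) u * u * real (M_lines \<L> d (d / u)) \<le> T"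
    and tail: "\<And>l \<xi>. l \<in> \<L> \<Longrightarrow> B \<le> \<bar>\<xi> \<bullet> v l\<bar> \<Longrightarrow> cmod (line_fourier \<beta> (a l) (v l) \<xi>) \<le> \<epsilon>0"
    and \<epsilon>0: "\<epsilon>0\<^sup>2 \<le> K2 * d ^ 5"
    and K1: "exp (- B\<^sup>2 / 2) \<le> K1 * d ^ 6" "1 \<le> K1"
    and n: "(20 * G * B / d) ^ 3 < 2 ^ n"
    and Cp: "0 \<le> Cp" "\<And>\<xi>. cmod (phihat d \<xi>) \<le> Cp * (d * norm \<xi>)"
      "\<And>\<xi>. cmod (phihat d \<xi>) * (1 + d * norm \<xi>) ^ (m + 2) \<le> Cp"
    and m: "1 \<le> B ^ (2 * m) * d ^ 5"
    and g: "integrable lborel g" "\<And>x. 0 \<le> g x" "\<And>x. 1 \<le> norm x \<Longrightarrow> 1 / (16 * norm x ^ 4) \<le> g x"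
begin

definition Y :: "real^3 \<Rightarrow> complex" where "Y \<xi> = (\<Sum>l\<in>\<L>. line_fourier \<beta> (a l) (v l) \<xi>)"

definition sh :: "real \<Rightarrow> (real^3) set" where "sh \<rho> = {\<xi>. \<rho> / 2 < norm \<xi> \<and> norm \<xi> \<le> \<rho>}"

definition c5 :: real where "c5 = 250 * 80002 ^ 4"

definition A1 :: real where "A1 = 31104 * (real J + 1)\<^sup>2 * (8 * 10 ^ 38) * (exp 1 * sqrt (2 * pi) ^ 3) * K1 * G ^ 9"
definition A2 :: real where "A2 = 64 * unit_ball_vol 3 * c5 * K2"

text \<open>The size of the line energy up to constants and powers of B and n. By
  \<open>card_square\<close>, errors proportional to d^2 times the squared number of lines are below
  it.\<close>

definition R :: real where "R = real (card \<L>) * T / d ^ 3"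

lemma G1: "1 \<le> G"
  using G one_le_power[of "2::real" J] by linarith

lemma K2_nonneg: "0 \<le> K2"
proof -
  have "0 \<le> K2 * d ^ 5" using \<epsilon>0 zero_le_power2[of \<epsilon>0] by linarith
  then show ?thesis using d by (simp add: zero_le_mult_iff)
qed

text \<open>T cannot be too small. At u = (1 + d)/2 the minimum is at least d and u is at least 1/2,
  so d M \<le> 2 T, and \<open>all_lines_count\<close> bounds M from below.\<close>

lemma card_T: "real (card \<L>) * d ^ 5 \<le> c5 * T" and T_nonneg: "0 \<le> T"
proof -
  define u where "u = (1 + d) / 2"
  have u: "d < u" "u < 1" "1 / 2 \<le> u" using d by (auto simp: u_def)
  define M where "M = real (M_lines \<L> d (d / u))"
  have M0: "0 \<le> M" by (simp add: M_def)
  have "1 * d \<le> sqrt Nc * d" using d V(4) by (intro mult_right_mono) auto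
  then have "d * (1 / 2) * M \<le> min (sqrt Nc * d) u * u * M"
    using u d M0 by (intro mult_right_mono mult_mono) auto
  also have "\<dots> \<le> T" unfolding M_def by (rule T[OF u(1,2)])
  finally have 1: "d * M \<le> 2 * T" by simp
  have "0 \<le> d * M" using d M0 by simp
  then show "0 \<le> T" using 1 by linarith
  have h: "0 < d" "d \<le> d / u" "d / u \<le> 1" using d u by (auto simp: pos_le_divide_eq divide_le_eq)
  have "real (card \<L>) * d ^ 4 \<le> 125 * 80002 ^ 4 * M" unfolding M_def by (rule all_lines_count[OF L ln v a h])
  then have "d * (real (card \<L>) * d ^ 4) \<le> d * (125 * 80002 ^ 4 * M)" using d by (intro mult_left_mono) auto
  also have "\<dots> = 125 * 80002 ^ 4 * (d * M)" by simp
  also have "\<dots> \<le> 125 * 80002 ^ 4 * (2 * T)" by (intro mult_left_mono 1) simp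
  finally show "real (card \<L>) * d ^ 5 \<le> c5 * T" by (simp add: c5_def eval_nat_numeral mult_ac)
qed

lemma R_nonneg: "0 \<le> R" using T_nonneg d by (simp add: R_def)

lemma card_square: "(real (card \<L>))\<^sup>2 * d\<^sup>2 \<le> c5 * R"
proof -
  have "real (card \<L>) * (real (card \<L>) * d ^ 5) \<le> real (card \<L>) * (c5 * T)" by (intro mult_left_mono card_T) simp
  then have "((real (card \<L>))\<^sup>2 * d\<^sup>2) * d ^ 3 \<le> c5 * (real (card \<L>) * T)" by (simp add: eval_nat_numeral mult_ac)
  then show ?thesis using d by (simp add: R_def pos_le_divide_eq)
qed

lemma Y_measurable [measurable]: "Y \<in> borel_measurable borel"
  unfolding Y_def[abs_def] using line_fourier_measurable[OF \<beta>_measurable] by measurable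

lemma Y_bound: "cmod (Y \<xi>) \<le> 28 * real (card \<L>)"
proof -
  have "cmod (Y \<xi>) \<le> (\<Sum>l\<in>\<L>. 28)"
    unfolding Y_def by (intro order_trans[OF norm_sum] sum_mono line_fourier_bound \<beta>) simp
  then show ?thesis by simp
qed

lemma sh_integrable: "integrable lborel (\<lambda>\<xi>. indicator (sh \<rho>) \<xi> * (cmod (Y \<xi>))\<^sup>2)"
proof (rule integrable_bounded_support(1))
  show "norm (indicator (sh \<rho>) \<xi> * (cmod (Y \<xi>))\<^sup>2) \<le> (28 * real (card \<L>))\<^sup>2" for \<xi>
    using power_mono[OF Y_bound[of \<xi>], of 2] by (simp add: indicator_def)
  show "indicator (sh \<rho>) \<xi> * (cmod (Y \<xi>))\<^sup>2 = 0" if "norm \<xi> > \<rho>" for \<xi>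
    using that by (simp add: sh_def)
  show "(\<lambda>\<xi>. indicator (sh \<rho>) \<xi> * (cmod (Y \<xi>))\<^sup>2) \<in> borel_measurable borel"
    unfolding sh_def by measurable
qed

text \<open>The factor (\<rho> d)^2, which the majorant takes from the linear bound on
  \<open>phihat\<close>, cancels (\<rho> d)^-2 in E'. The remaining \<rho> \<le> 2 B/d turns d^-2
  into d^-3. The power B^16 has 3 factors from Q, 10 from E' and \<rho>, 3 from the
  subcells.\<close>

lemma shell_bound:
  assumes \<rho>: "1 \<le> \<rho>" "\<rho> * d \<le> 2 * B"
  shows "(\<rho> * d)\<^sup>2 * (LINT \<xi>|lborel. indicator (sh \<rho>) \<xi> * (cmod (Y \<xi>))\<^sup>2) \<le> 1000 * real n * ((A1 + A2) * B ^ 16 * R)"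
proof -
  obtain b :: nat where b: "0 < b" "\<rho> \<le> real b ^ J" "real b ^ J \<le> G * \<rho>" "real b \<le> 4 * B" using branching[OF \<rho>] by blast
  interpret S: shell chi \<beta> \<L> a v rep V d B \<rho> G T \<epsilon>0 K1 Nc b J
    by unfold_locales (fact \<beta>_measurable \<beta> L ln v a V rep d B \<rho> b J G T tail K1)+
  have rp: "0 < \<rho>" "0 < \<rho> * d" using \<rho> d by auto
  have \<rho>B: "\<rho> \<le> 2 * B / d" using \<rho> d by (simp add: pos_le_divide_eq)
  have n': "(10 * G * \<rho>) ^ 3 < 2 ^ n"
  proof -
    have "10 * G * \<rho> \<le> 10 * G * (2 * B / d)" using G1 by (intro mult_left_mono \<rho>B) auto
    then have "(10 * G * \<rho>) ^ 3 \<le> (20 * G * B / d) ^ 3" using G1 rp by (intro power_mono) auto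
    then show ?thesis using n by linarith
  qed
  have st: "(LINT \<xi>|lborel. indicator (sh \<rho>) \<xi> * (cmod (Y \<xi>))\<^sup>2) \<le> 1000 * real n * S.Kb"
    using S.shell_total[OF n'] unfolding S.X_def S.lf_def Y_def sh_def .
  have main: "(\<rho> * d)\<^sup>2 * (31104 * (real J + 1)\<^sup>2 * (S.Q * S.E' * G * B ^ 3 * real (card \<L>))) \<le> A1 * B ^ 16 * R"
  proof -
    define c where "c = exp 1 * sqrt (2 * pi) ^ 3"
    have c0: "0 < c" by (simp add: c_def)
    have "(\<rho> * d)\<^sup>2 * S.E' = 2 * 10 ^ 31 * c * K1 * B ^ 9 * G ^ 5 * T / d\<^sup>2 * \<rho>"
      using rp by (simp add: S.E'_def S.c0_def c_def)
    also have "\<dots> \<le> 2 * 10 ^ 31 * c * K1 * B ^ 9 * G ^ 5 * T / d\<^sup>2 * (2 * B / d)"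
      using c0 K1 B G1 T_nonneg d by (intro mult_left_mono \<rho>B) auto
    also have "\<dots> = 4 * 10 ^ 31 * c * K1 * B ^ 10 * G ^ 5 * (T / d ^ 3)" by (simp add: eval_nat_numeral mult_ac)
    finally have E: "(\<rho> * d)\<^sup>2 * S.E' \<le> 4 * 10 ^ 31 * c * K1 * B ^ 10 * G ^ 5 * (T / d ^ 3)" .
    have "(\<rho> * d)\<^sup>2 * (31104 * (real J + 1)\<^sup>2 * (S.Q * S.E' * G * B ^ 3 * real (card \<L>)))
      = 31104 * (real J + 1)\<^sup>2 * S.Q * G * B ^ 3 * real (card \<L>) * ((\<rho> * d)\<^sup>2 * S.E')" by (simp add: mult_ac)
    also have "\<dots> \<le> 31104 * (real J + 1)\<^sup>2 * S.Q * G * B ^ 3 * real (card \<L>) * (4 * 10 ^ 31 * c * K1 * B ^ 10 * G ^ 5 * (T / d ^ 3))"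
      using S.Q_pos G1 B by (intro mult_left_mono E) auto
    also have "\<dots> = A1 * B ^ 16 * R"
      by (simp add: A1_def R_def S.Q_def c_def power_mult_distrib eval_nat_numeral mult_ac)
    finally show ?thesis .
  qed
  have err: "(\<rho> * d)\<^sup>2 * (2 * (real (card \<L>) * \<epsilon>0)\<^sup>2 * measure lborel (cball 0 \<rho> :: (real^3) set)) \<le> A2 * B ^ 16 * R"
  proof -
    have "(\<rho> * d)\<^sup>2 * (2 * (real (card \<L>) * \<epsilon>0)\<^sup>2 * measure lborel (cball 0 \<rho> :: (real^3) set))
      = 2 * unit_ball_vol 3 / d ^ 3 * ((real (card \<L>))\<^sup>2 * \<epsilon>0\<^sup>2) * (\<rho> * d) ^ 5"
      using rp d by (simp add: measure_cball3 power_mult_distrib eval_nat_numeral)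
    also have "\<dots> \<le> 2 * unit_ball_vol 3 / d ^ 3 * ((real (card \<L>))\<^sup>2 * (K2 * d ^ 5)) * (2 * B) ^ 5"
    proof (rule mult_mono)
      show "(\<rho> * d) ^ 5 \<le> (2 * B) ^ 5" using \<rho> rp by (intro power_mono) auto
      have qq: "(real (card \<L>))\<^sup>2 * \<epsilon>0\<^sup>2 \<le> (real (card \<L>))\<^sup>2 * (K2 * d ^ 5)" by (intro mult_left_mono \<epsilon>0) simp
      show "2 * unit_ball_vol 3 / d ^ 3 * ((real (card \<L>))\<^sup>2 * \<epsilon>0\<^sup>2) \<le> 2 * unit_ball_vol 3 / d ^ 3 * ((real (card \<L>))\<^sup>2 * (K2 * d ^ 5))"
        by (rule mult_left_mono[OF qq]) (use d in simp)
    qed (use d K2_nonneg rp in auto)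
    also have "\<dots> = 64 * unit_ball_vol 3 * K2 * B ^ 5 * ((real (card \<L>))\<^sup>2 * d\<^sup>2)"
      using d by (simp add: power_mult_distrib eval_nat_numeral)
    also have "\<dots> \<le> 64 * unit_ball_vol 3 * K2 * B ^ 16 * (c5 * R)"
    proof (intro mult_mono[OF _ card_square] mult_left_mono power_increasing)
      show "0 \<le> 64 * unit_ball_vol 3 * K2 * B ^ 16" using K2_nonneg B by simp
    qed (use K2_nonneg B in auto)
    finally show ?thesis by (simp add: A2_def mult_ac)
  qed
  have "(\<rho> * d)\<^sup>2 * (LINT \<xi>|lborel. indicator (sh \<rho>) \<xi> * (cmod (Y \<xi>))\<^sup>2) \<le> (\<rho> * d)\<^sup>2 * (1000 * real n * S.Kb)"
    by (intro mult_left_mono st) simp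
  also have "\<dots> = 1000 * real n * ((\<rho> * d)\<^sup>2 * S.Kb)" by simp
  also have "\<dots> \<le> 1000 * real n * ((A1 + A2) * B ^ 16 * R)"
    using main err by (intro mult_left_mono) (simp_all add: S.Kb_def distrib_left distrib_right)
  finally show ?thesis .
qed

definition A3 :: real where
  "A3 = Cp\<^sup>2 * (784 * unit_ball_vol 3 * c5 + 1000 * (A1 + A2) + 12544 * c5 * integral\<^sup>L lborel g)"

text \<open>Three ranges of frequency: the unit ball, where \<open>phihat\<close> is at most Cp d;
  dyadic shells up to a radius comparable to B/d; and the rest. There r = d |\<xi>| exceeds B, so
  r^(-2m) \<le> d^5, and the remaining r^-4 integrates to a constant times d^-3, which leaves
  d^2.\<close>

lemma majorant:
  obtains H where "integrable lborel H" "\<And>\<xi>. (cmod (phihat d \<xi> * Y \<xi>))\<^sup>2 \<le> H \<xi>"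
    "integral\<^sup>L lborel H \<le> A3 * (real n)\<^sup>2 * B ^ 16 * R"
proof -
  obtain N where N: "B / d \<le> 2 ^ N" "N = 0 \<or> 2 ^ N < 2 * (B / d)" by (rule dyadic_scale)
  have Bd: "1 < B / d" using B d by (simp add: less_divide_eq)
  have N2: "2 ^ N * d \<le> 2 * B" 
  proof -
    have "2 ^ N \<le> 2 * (B / d)" using N(2) Bd by auto
    then show ?thesis using d by (simp add: pos_le_divide_eq)
  qed
  have nN: "N \<le> n" "1 \<le> n"
  proof -
    have 1: "2 * (B / d) \<le> 20 * G * B / d" using G1 Bd mult_right_mono[of 1 G "B / d"] by simp
    then have "20 * G * B / d \<le> (20 * G * B / d) ^ 3" using Bd power_increasing[of 1 3 "20 * G * B / d"] by simp
    then have 2: "2 * (B / d) < 2 ^ n" using 1 n by linarith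
    have "2 ^ N < 2 * (B / d)" using N(2) Bd by auto
    then have "2 ^ N < (2::real) ^ n" using 2 by linarith
    then show "N \<le> n" by simp
    show "1 \<le> n" using 2 Bd by (cases n) auto
  qed
  define c where "c = real (card \<L>)"
  define Ig where "Ig = integral\<^sup>L lborel g"
  have Ig0: "0 \<le> Ig" unfolding Ig_def by (intro Bochner_Integration.integral_nonneg g)
  define hi where "hi = 16 * (28 * c * Cp)\<^sup>2 / B ^ (2 * m)"
  have hi0: "0 \<le> hi" using B by (simp add: hi_def)
  define f where "f i \<xi> = indicator (sh (2 ^ i)) \<xi> * (cmod (Y \<xi>))\<^sup>2" for i :: nat and \<xi>
  have f0: "0 \<le> f i \<xi>" for i \<xi> by (simp add: f_def)
  define H where "H \<xi> = (28 * c * Cp * d)\<^sup>2 * indicator (cball 0 1) \<xi> + (\<Sum>i=1..N. (Cp * (d * 2 ^ i))\<^sup>2 * f i \<xi>) + hi * g (d *\<^sub>R \<xi>)" for \<xi>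
  have ig: "integrable lborel (\<lambda>\<xi>. g (d *\<^sub>R \<xi>))" and Ig: "(LINT \<xi>|lborel. g (d *\<^sub>R \<xi>)) = Ig / d ^ 3"
    using lborel_integral_affine(1)[of g d 0] lborel_integral_affine(2)[of g d 0] g(1) d by (simp_all add: Ig_def)
  have hH: "has_bochner_integral lborel H ((28 * c * Cp * d)\<^sup>2 * measure lborel (cball 0 1 :: (real^3) set)
      + (\<Sum>i=1..N. (Cp * (d * 2 ^ i))\<^sup>2 * integral\<^sup>L lborel (f i)) + hi * (Ig / d ^ 3))"
    unfolding H_def
  proof (intro has_bochner_integral_add has_bochner_integral_mult_right has_bochner_integral_sum has_bochner_integral_real_indicator
       emeasure_lborel_cball_finite)
    show "has_bochner_integral lborel (f i) (integral\<^sup>L lborel (f i))" for i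
      unfolding f_def by (intro has_bochner_integral_integrable sh_integrable)
    show "has_bochner_integral lborel (\<lambda>\<xi>. g (d *\<^sub>R \<xi>)) (Ig / d ^ 3)"
      using has_bochner_integral_integrable[OF ig] unfolding Ig .
  qed auto
  have phY: "(cmod (phihat d \<xi> * Y \<xi>))\<^sup>2 \<le> (q * (28 * c))\<^sup>2" if "cmod (phihat d \<xi>) \<le> q" for q \<xi>
    unfolding norm_mult c_def by (intro power_mono mult_mono that Y_bound) (use that norm_ge_zero order_trans in \<open>auto intro: order_trans[OF norm_ge_zero]\<close>)
  have le: "(cmod (phihat d \<xi> * Y \<xi>))\<^sup>2 \<le> H \<xi>" for \<xi>
  proof -
    have nn: "0 \<le> (28 * c * Cp * d)\<^sup>2 * indicator (cball 0 1) \<xi>" "0 \<le> hi * g (d *\<^sub>R \<xi>)"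
      "0 \<le> (\<Sum>i=1..N. (Cp * (d * 2 ^ i))\<^sup>2 * f i \<xi>)"
      using hi0 g(2) f0 by (auto intro!: sum_nonneg)
    consider "norm \<xi> \<le> 1" | "1 < norm \<xi>" "norm \<xi> \<le> 2 ^ N" | "2 ^ N < norm \<xi>" by linarith
    then show ?thesis
    proof cases
      case 1
      have "cmod (phihat d \<xi>) \<le> Cp * (d * 1)"
        using Cp(1) d 1 by (intro order_trans[OF Cp(2)] mult_left_mono) auto
      from phY[OF this] have "(cmod (phihat d \<xi> * Y \<xi>))\<^sup>2 \<le> (28 * c * Cp * d)\<^sup>2 * indicator (cball 0 1) \<xi>"
        using 1 by (simp add: mult_ac)
      then show ?thesis using nn unfolding H_def by linarith
    next
      case 2
      obtain i where i: "norm \<xi> \<le> 2 ^ i" "i = 0 \<or> 2 ^ i < 2 * norm \<xi>" by (rule dyadic_scale)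
      have i0: "i \<noteq> 0" using 2(1) i(1) by (metis power_0 not_less)
      have "(2::real) ^ i < 2 ^ Suc N" using i i0 2 by simp
      then have iN: "i \<in> {1..N}" using i0 by (simp del: power_Suc)
      have "cmod (phihat d \<xi>) \<le> Cp * (d * 2 ^ i)"
        using Cp(1) d i by (intro order_trans[OF Cp(2)] mult_left_mono) auto
      then have "(cmod (phihat d \<xi>) * cmod (Y \<xi>))\<^sup>2 \<le> (Cp * (d * 2 ^ i) * cmod (Y \<xi>))\<^sup>2"
        by (intro power_mono mult_right_mono) auto
      also have "\<dots> = (Cp * (d * 2 ^ i))\<^sup>2 * f i \<xi>" using i i0 by (simp add: f_def sh_def power_mult_distrib)
      also have "\<dots> \<le> (\<Sum>i=1..N. (Cp * (d * 2 ^ i))\<^sup>2 * f i \<xi>)"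
        by (rule member_le_sum[OF iN]) (auto simp: f0)
      finally show ?thesis using nn unfolding H_def norm_mult by linarith
    next
      case 3
      define r where "r = d * norm \<xi>"
      have "B / d < norm \<xi>" using 3 N(1) by linarith
      then have rB: "B < r" using d by (simp add: r_def divide_less_eq mult.commute)
      then have r1: "1 \<le> r" using B by linarith
      have "cmod (phihat d \<xi>) * r ^ (m + 2) \<le> cmod (phihat d \<xi>) * (1 + r) ^ (m + 2)"
        using r1 by (intro mult_left_mono power_mono) auto
      also have "\<dots> \<le> Cp" using Cp(3)[of \<xi>] by (simp only: r_def)
      finally have "cmod (phihat d \<xi>) \<le> Cp / r ^ (m + 2)" using r1 by (subst pos_le_divide_eq) auto
      from phY[OF this] have "(cmod (phihat d \<xi> * Y \<xi>))\<^sup>2 \<le> (28 * c * Cp)\<^sup>2 / (r ^ (m + 2))\<^sup>2"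
        by (simp add: power_divide power_mult_distrib mult_ac)
      also have "(r ^ (m + 2))\<^sup>2 = r ^ (2 * m) * r ^ 4"
      proof -
        have "(m + 2) * 2 = 2 * m + 4" by simp
        then show ?thesis by (simp only: power_mult[symmetric] power_add[symmetric])
      qed
      also have "(28 * c * Cp)\<^sup>2 / (r ^ (2 * m) * r ^ 4) \<le> (28 * c * Cp)\<^sup>2 / (B ^ (2 * m) * r ^ 4)"
        using B rB r1 by (intro divide_left_mono mult_right_mono power_mono mult_pos_pos zero_less_power) auto
      also have "\<dots> = hi * (1 / (16 * r ^ 4))" by (simp add: hi_def)
      also have "\<dots> \<le> hi * g (d *\<^sub>R \<xi>)"
        using g(3)[of "d *\<^sub>R \<xi>"] r1 d hi0 by (intro mult_left_mono) (auto simp: r_def)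
      finally show ?thesis using nn unfolding H_def by linarith
    qed
  qed
  have cs: "c\<^sup>2 * d\<^sup>2 \<le> c5 * R" unfolding c_def by (rule card_square)
  have s1: "(28 * c * Cp * d)\<^sup>2 * measure lborel (cball 0 1 :: (real^3) set) \<le> Cp\<^sup>2 * (784 * unit_ball_vol 3 * c5) * R"
  proof -
    have "(28 * c * Cp * d)\<^sup>2 * measure lborel (cball 0 1 :: (real^3) set) = Cp\<^sup>2 * 784 * unit_ball_vol 3 * (c\<^sup>2 * d\<^sup>2)"
      by (simp add: measure_cball3 power_mult_distrib)
    also have "\<dots> \<le> Cp\<^sup>2 * 784 * unit_ball_vol 3 * (c5 * R)" by (intro mult_left_mono cs) simp
    finally show ?thesis by (simp add: mult_ac)
  qed
  have s2: "(\<Sum>i=1..N. (Cp * (d * 2 ^ i))\<^sup>2 * integral\<^sup>L lborel (f i)) \<le> Cp\<^sup>2 * (1000 * (A1 + A2)) * ((real n)\<^sup>2 * B ^ 16 * R)"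
  proof -
    have b0: "0 \<le> (A1 + A2) * B ^ 16 * R"
      using K1 G1 K2_nonneg B R_nonneg by (auto simp: A1_def A2_def c5_def intro!: mult_nonneg_nonneg add_nonneg_nonneg)
    have "(\<Sum>i=1..N. (Cp * (d * 2 ^ i))\<^sup>2 * integral\<^sup>L lborel (f i)) \<le> (\<Sum>i=1..N. Cp\<^sup>2 * (1000 * real n * ((A1 + A2) * B ^ 16 * R)))"
    proof (rule sum_mono)
      fix i assume i: "i \<in> {1..N}"
      have "2 ^ i * d \<le> 2 ^ N * d" using i d by (intro mult_right_mono power_increasing) auto
      then have "(2 ^ i * d)\<^sup>2 * integral\<^sup>L lborel (f i) \<le> 1000 * real n * ((A1 + A2) * B ^ 16 * R)"
        unfolding f_def[abs_def] using N2 by (intro shell_bound) auto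
      then have "Cp\<^sup>2 * ((2 ^ i * d)\<^sup>2 * integral\<^sup>L lborel (f i)) \<le> Cp\<^sup>2 * (1000 * real n * ((A1 + A2) * B ^ 16 * R))"
        by (intro mult_left_mono) auto
      then show "(Cp * (d * 2 ^ i))\<^sup>2 * integral\<^sup>L lborel (f i) \<le> Cp\<^sup>2 * (1000 * real n * ((A1 + A2) * B ^ 16 * R))"
        by (simp add: power_mult_distrib mult_ac)
    qed
    also have "\<dots> = real N * (Cp\<^sup>2 * (1000 * real n * ((A1 + A2) * B ^ 16 * R)))" by simp
    also have "\<dots> \<le> real n * (Cp\<^sup>2 * (1000 * real n * ((A1 + A2) * B ^ 16 * R)))"
      using nN(1) mult_nonneg_nonneg[OF zero_le_power2[of Cp] mult_nonneg_nonneg[OF _ b0, of "1000 * real n"]]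
      by (intro mult_right_mono) auto
    finally show ?thesis by (simp only: power2_eq_square mult_ac)
  qed
  have s3: "hi * (Ig / d ^ 3) \<le> Cp\<^sup>2 * (12544 * c5 * Ig) * R"
  proof -
    have "1 / B ^ (2 * m) \<le> d ^ 5" using m B by (simp add: divide_le_eq mult.commute)
    then have "16 * (28 * c * Cp)\<^sup>2 * (1 / B ^ (2 * m)) * (Ig / d ^ 3) \<le> 16 * (28 * c * Cp)\<^sup>2 * d ^ 5 * (Ig / d ^ 3)"
      using Ig0 d by (intro mult_right_mono mult_left_mono) auto
    also have "\<dots> = Cp\<^sup>2 * 12544 * Ig * (c\<^sup>2 * d\<^sup>2)" using d by (simp add: power_mult_distrib eval_nat_numeral)
    also have "\<dots> \<le> Cp\<^sup>2 * 12544 * Ig * (c5 * R)" using Ig0 by (intro mult_left_mono cs) simp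
    finally show ?thesis by (simp add: hi_def mult_ac)
  qed
  have big: "R \<le> (real n)\<^sup>2 * B ^ 16 * R"
  proof -
    have "1 * 1 \<le> (real n)\<^sup>2 * B ^ 16" using nN B by (intro mult_mono one_le_power) auto
    from mult_right_mono[OF this R_nonneg] show ?thesis by simp
  qed
  have t1: "Cp\<^sup>2 * (784 * unit_ball_vol 3 * c5) * R \<le> Cp\<^sup>2 * (784 * unit_ball_vol 3 * c5) * ((real n)\<^sup>2 * B ^ 16 * R)"
    by (intro mult_left_mono big) (simp add: c5_def)
  have t3: "Cp\<^sup>2 * (12544 * c5 * Ig) * R \<le> Cp\<^sup>2 * (12544 * c5 * Ig) * ((real n)\<^sup>2 * B ^ 16 * R)"
    using Ig0 by (intro mult_left_mono big) (simp add: c5_def)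
  have "integral\<^sup>L lborel H \<le> Cp\<^sup>2 * (784 * unit_ball_vol 3 * c5) * ((real n)\<^sup>2 * B ^ 16 * R)
    + Cp\<^sup>2 * (1000 * (A1 + A2)) * ((real n)\<^sup>2 * B ^ 16 * R) + Cp\<^sup>2 * (12544 * c5 * Ig) * ((real n)\<^sup>2 * B ^ 16 * R)"
    unfolding has_bochner_integral_integral_eq[OF hH] using s1 s2 s3 t1 t3 by linarith
  also have "\<dots> = A3 * (real n)\<^sup>2 * B ^ 16 * R" by (simp add: A3_def Ig_def algebra_simps)
  finally show ?thesis using that integrable.intros[OF hH] le by blast
qed

end

section \<open>Choice of the parameters\<close>

lemma less_power_two:
  fixes x :: real
  assumes x: "1 \<le> x"
  obtains n :: nat where "x < 2 ^ n" "real n \<le> 2 * ln x + 1"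
proof -
  define n where "n = nat \<lfloor>log 2 x\<rfloor> + 1"
  have l0: "0 \<le> log 2 x" using x by simp
  have n: "log 2 x < real n" "real n \<le> log 2 x + 1" using l0 unfolding n_def by linarith+
  have "x < 2 powr real n" using n(1) x by (subst (asm) log_less_iff) auto
  then have 1: "x < 2 ^ n" by (simp add: powr_realpow)
  have "(1::real) / 2 \<le> ln 2" using ln_2_less_1 ln_one_minus_pos_lower_bound[of "1 / 2"] exp_le ln2_ge_two_thirds by linarith
  then have "ln x / ln 2 \<le> ln x / (1 / 2)" using x by (intro divide_left_mono) auto
  then have "log 2 x \<le> 2 * ln x" by (simp add: log_def)
  then show ?thesis using that[OF 1] n(2) by linarith
qed

text \<open>The inverse of (1 + y/k)^k \<le> exp y. With y = B^2 / 2 it makes the Gaussian tail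
  smaller than any prescribed power of d.\<close>

lemma exp_minus_le_power:
  assumes y: "0 < y" and k: "0 < k"
  shows "exp (- y) \<le> (real k / y) ^ k"
proof -
  have "(y / real k) ^ k \<le> (1 + y / real k) ^ k" using y by (intro power_mono) auto
  also have "\<dots> \<le> exp y" using y k by (intro exp_ge_one_plus_x_over_n_power_n) auto
  finally have "inverse (exp y) \<le> inverse ((y / real k) ^ k)"
    using y k by (intro le_imp_inverse_le) auto
  then show ?thesis using y k by (simp add: exp_minus power_divide inverse_eq_divide)
qed

text \<open>The sphere is totally bounded, so finite covers exist and the \<open>LEAST\<close> in
  \<open>covering_number\<close> is attained.\<close>

lemma covering_attained:
  fixes A :: "(real^3) set"
  assumes A: "A \<subseteq> sphere 0 1" and d: "0 < d"
  obtains C where "finite C" "card C = covering_number d A" "A \<subseteq> (\<Union>c\<in>C. cball c d)"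
proof -
  obtain k where k: "finite k" "sphere (0 :: real^3) 1 \<subseteq> (\<Union>x\<in>k. ball x d)"
    using compact_sphere[of "0 :: real^3" 1] d unfolding compact_eq_totally_bounded by blast
  have "A \<subseteq> (\<Union>x\<in>k. cball x d)"
  proof
    fix x assume "x \<in> A"
    then obtain c where "c \<in> k" "x \<in> ball c d" using A k(2) by blast
    then show "x \<in> (\<Union>x\<in>k. cball x d)" by (auto intro!: bexI[of _ c])
  qed
  then have "\<exists>n C. finite C \<and> card C = n \<and> A \<subseteq> (\<Union>c\<in>C. cball c d)" using k by blast
  then have "\<exists>C. finite C \<and> card C = covering_number d A \<and> A \<subseteq> (\<Union>c\<in>C. cball c d)"
    unfolding covering_number_def by (rule LeastI_ex)
  then show ?thesis using that by blast
qed

text \<open>The centres of an optimal cover need not be unit vectors. A centre in use has a unit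
  vector within distance d; replacing the centre by it doubles the radius.\<close>

lemma unit_representatives:
  fixes v :: "'l \<Rightarrow> real^3"
  assumes A: "A \<subseteq> sphere 0 1" and d: "0 < d" and v: "\<And>l. l \<in> L \<Longrightarrow> v l \<in> A"
  obtains V rep where "finite V" "\<And>x. x \<in> V \<Longrightarrow> norm x = 1" "card V \<le> covering_number d A"
    "\<And>l. l \<in> L \<Longrightarrow> rep l \<in> V" "\<And>l. l \<in> L \<Longrightarrow> norm (v l - rep l) \<le> 2 * d"
proof -
  obtain C where C: "finite C" "card C = covering_number d A" "A \<subseteq> (\<Union>c\<in>C. cball c d)"
    by (rule covering_attained[OF A d])
  define C' where "C' = {c \<in> C. \<exists>x. norm x = 1 \<and> dist c x \<le> d}"
  obtain r where r: "\<And>c. c \<in> C' \<Longrightarrow> norm (r c) = 1 \<and> dist c (r c) \<le> d"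
    using bchoice[of C' "\<lambda>c x. norm x = 1 \<and> dist c x \<le> d"] by (auto simp: C'_def)
  have "\<exists>c. c \<in> C' \<and> dist c (v l) \<le> d" if "l \<in> L" for l
  proof -
    from that have vA: "v l \<in> A" by (rule v)
    then obtain c where "c \<in> C" "dist c (v l) \<le> d" using C(3) by auto
    moreover have "norm (v l) = 1" using vA A by auto
    ultimately show ?thesis by (auto simp: C'_def)
  qed
  then obtain f where f: "\<And>l. l \<in> L \<Longrightarrow> f l \<in> C' \<and> dist (f l) (v l) \<le> d" by metis
  show ?thesis
  proof
    show "finite (r ` C')" using C by (simp add: C'_def)
    have "card (r ` C') \<le> card C'" using C by (intro card_image_le) (simp add: C'_def)
    also have "\<dots> \<le> card C" using C by (intro card_mono) (auto simp: C'_def)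
    finally show "card (r ` C') \<le> covering_number d A" using C by simp
    show "norm x = 1" if "x \<in> r ` C'" for x using that r by auto
    show "r (f l) \<in> r ` C'" if "l \<in> L" for l using f[OF that] by simp
    show "norm (v l - r (f l)) \<le> 2 * d" if "l \<in> L" for l
    proof -
      have "dist (v l) (r (f l)) \<le> dist (f l) (v l) + dist (f l) (r (f l))" by (rule dist_triangle3)
      then show ?thesis using f[OF that] r[of "f l"] unfolding dist_norm by simp
    qed
  qed
qed

lemma lines_parametrized:
  assumes "L \<subseteq> lines_meeting_unit_ball"
  obtains a v where "\<And>l. l \<in> L \<Longrightarrow> l = line_at (a l) (v l)" "\<And>l. l \<in> L \<Longrightarrow> norm (v l) = 1" "\<And>l. l \<in> L \<Longrightarrow> norm (a l) \<le> 1"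
proof -
  have "\<exists>p. l = line_at (fst p) (snd p) \<and> norm (snd p) = 1 \<and> norm (fst p) \<le> 1" if l: "l \<in> L" for l
  proof -
    have "l \<in> lines" and meet: "l \<inter> cball 0 1 \<noteq> {}" using l assms by (auto simp: lines_meeting_unit_ball_def)
    then obtain a v where "l = line_at a v" "norm v = 1" unfolding lines_def by blast
    note av = this meet
    then obtain t where t: "norm (a + t *\<^sub>R v) \<le> 1" by (auto simp: line_at_def)
    have "line_at (a + t *\<^sub>R v) v = line_at a v"
    proof -
      have e: "a + t *\<^sub>R v + s *\<^sub>R v = a + (t + s) *\<^sub>R v" "a + s *\<^sub>R v = a + t *\<^sub>R v + (s - t) *\<^sub>R v" for s
        by (simp_all add: scaleR_add_left scaleR_diff_left)
      show ?thesis
        unfolding line_at_def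
        by (intro equalityI image_subsetI; rule range_eqI; rule e)
    qed
    then show ?thesis using av t by (intro exI[of _ "(a + t *\<^sub>R v, v)"]) simp
  qed
  then obtain p where "\<And>l. l \<in> L \<Longrightarrow> l = line_at (fst (p l)) (snd (p l)) \<and> norm (snd (p l)) = 1 \<and> norm (fst (p l)) \<le> 1"
    using bchoice[of L "\<lambda>l p. l = line_at (fst p) (snd p) \<and> norm (snd p) = 1 \<and> norm (fst p) \<le> 1"] by blast
  then show ?thesis using that[of "\<lambda>l. fst (p l)" "\<lambda>l. snd (p l)"] by blast
qed

context bump_function
begin

lemma incidence_gap_bound:
  assumes \<epsilon>: "\<epsilon> > 0"
  shows "\<exists>C::real. \<forall>P L \<delta>. finite P \<longrightarrow> P \<subseteq> {x. \<forall>i. - 1 \<le> x $ i \<and> x $ i \<le> 1} \<longrightarrow>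
    finite L \<longrightarrow> L \<subseteq> lines_meeting_unit_ball \<longrightarrow> 0 < \<delta> \<longrightarrow> \<delta> < 1 \<longrightarrow>
    \<bar>normalized_incidences chi \<delta> P L - normalized_incidences chi (2 * \<delta>) P L\<bar>\<^sup>2
    \<le> C * \<delta> powr (- 6 - \<epsilon>) * (real (M_points P \<delta>) / real (card P)) *
       (SUP u\<in>{\<delta><..<1}.
          min (sqrt (real (covering_number \<delta> (directions L))) * \<delta>) u * u *
          (real (M_lines L \<delta> (\<delta> / u)) / real (card L)))"
proof -
  \<comment> \<open>18 = 16 + 2: the energy carries B^16, and n^2 is at most (\<kappa> B)^2.\<close>
  define e where "e = \<epsilon> / 18"
  have e: "0 < e" using \<epsilon> by (simp add: e_def)
  have up: "\<exists>j::nat. t \<le> e * real j" for t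
  proof -
    obtain j :: nat where "t / e \<le> real j" using real_arch_simple by blast
    then show ?thesis using e by (auto simp: pos_divide_le_eq mult.commute)
  qed
  obtain j m k where j: "1 \<le> e * real j" and m: "5 \<le> e * real m" and k: "6 \<le> e * real k" using up by metis
  have kp: "0 < k" using k by (cases k) auto
  \<comment> \<open>One more than j: if the J-th root of \<rho> exceeded 2 B, then \<rho> d would
    exceed 2 B B^j d \<ge> 2 B. So the root, rounded up, serves as branching number b \<le> 4
    B.\<close>
  define J where "J = Suc j"
  define G where "G = (2::real) ^ J"
  define K1 where "K1 = (2 * real k) ^ k"
  have K1: "1 \<le> K1" unfolding K1_def using kp by (intro one_le_power) simp
  have G1: "1 \<le> G" by (simp add: G_def)
  obtain \<beta> :: "real \<Rightarrow> real" where \<beta>m: "\<beta> \<in> borel_measurable borel"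
    and \<beta>: "\<And>t. 0 \<le> \<beta> t" "\<And>t. \<beta> t \<le> 1" "\<And>t. \<bar>t\<bar> > 14 \<Longrightarrow> \<beta> t = 0" "\<And>t. \<bar>t\<bar> \<le> 10 \<Longrightarrow> \<beta> t = 1"
    and \<beta>d: "\<And>m. \<exists>C\<ge>0. \<forall>s. cmod (LINT t|lborel. complex_of_real (\<beta> t) * cis (s * t)) * \<bar>s\<bar> ^ m \<le> C"
    using line_cutoff by blast
  obtain Cm where Cm: "Cm \<ge> 0" "\<And>s. cmod (LINT t|lborel. complex_of_real (\<beta> t) * cis (s * t)) * \<bar>s\<bar> ^ m \<le> Cm"
    using \<beta>d[of m] by blast
  obtain Cp where Cp: "Cp \<ge> 0" "\<And>d \<xi>. d > 0 \<Longrightarrow> cmod (phihat d \<xi>) \<le> Cp * (d * norm \<xi>)"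
      "\<And>d \<xi>. d > 0 \<Longrightarrow> cmod (phihat d \<xi>) * (1 + d * norm \<xi>) ^ (m + 2) \<le> Cp"
    using phihat_bounds[of "m + 2"] by blast
  obtain g :: "real^3 \<Rightarrow> real" where g: "integrable lborel g" "\<And>x. 0 \<le> g x"
    "\<And>x. 1 \<le> norm x \<Longrightarrow> 1 / (16 * norm x ^ 4) \<le> g x" by (rule decay_majorant) blast
  define \<kappa> where "\<kappa> = 6 * (ln (20 * G) + 1 + 1 / e) + 1"
  \<comment> \<open>The constants c5 and A repeat \<open>c5\<close> and \<open>A3\<close> of
    \<open>line_energy\<close> with K2 replaced by the square of Cm. They are fixed before P, L and
    d, so that the final constant does not depend on these.\<close>
  define c5 :: real where "c5 = 250 * 80002 ^ 4"
  define A where "A = Cp\<^sup>2 * (784 * unit_ball_vol 3 * c5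
    + 1000 * (31104 * (real J + 1)\<^sup>2 * (8 * 10 ^ 38) * (exp 1 * sqrt (2 * pi) ^ 3) * K1 * G ^ 9 + 64 * unit_ball_vol 3 * c5 * Cm\<^sup>2)
    + 12544 * c5 * integral\<^sup>L lborel g)"
  have A0: "0 \<le> A"
    using K1 G1 g(2) unfolding A_def c5_def
    by (intro mult_nonneg_nonneg add_nonneg_nonneg Bochner_Integration.integral_nonneg) auto
  show ?thesis
  proof (intro exI[of _ "5832 * unit_ball_vol 3 * (A * \<kappa>\<^sup>2)"] allI impI)
    fix P :: "(real^3) set" and L :: "(real^3) set set" and d :: real
    assume P: "finite P" "P \<subseteq> {x. \<forall>i. - 1 \<le> x $ i \<and> x $ i \<le> 1}" and L: "finite L" "L \<subseteq> lines_meeting_unit_ball"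
      and d: "0 < d" "d < 1"
    define Nc where "Nc = real (covering_number d (directions L))"
    define F where "F u = min (sqrt Nc * d) u * u * (real (M_lines L d (d / u)) / real (card L))" for u
    define S where "S = (SUP u\<in>{d<..<1}. F u)"
    have ne: "{d<..<1} \<noteq> {}" using d by simp
    have goal: "\<bar>normalized_incidences chi d P L - normalized_incidences chi (2 * d) P L\<bar>\<^sup>2
      \<le> 5832 * unit_ball_vol 3 * (A * \<kappa>\<^sup>2) * d powr (- 6 - \<epsilon>) * (real (M_points P d) / real (card P)) * S"
    proof (cases "L = {}")
      case True
      \<comment> \<open>Without lines every term under the supremum is 0, again by division by zero,
        and so is the left-hand side.\<close>
      have "S = 0" unfolding S_def F_def True using cSUP_const[OF ne, of "0::real"] by simp
      then show ?thesis using True by (simp add: normalized_incidences_def incidences_def)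
    next
      case False
      define c where "c = real (card L)"
      have c: "1 \<le> c" using False L by (simp add: c_def Suc_leI card_gt_0_iff)
      obtain a v where ln: "\<And>l. l \<in> L \<Longrightarrow> l = line_at (a l) (v l)" and v: "\<And>l. l \<in> L \<Longrightarrow> norm (v l) = 1"
        and a: "\<And>l. l \<in> L \<Longrightarrow> norm (a l) \<le> 1"
        using lines_parametrized[OF L(2)] by blast
      have dir: "directions L \<subseteq> sphere 0 1" by (auto simp: directions_def)
      have vd: "v l \<in> directions L" if "l \<in> L" for l
      proof -
        have "line_at (a l) (v l) \<in> L" using that by (simp add: ln[OF that, symmetric])
        then show ?thesis using v[OF that] by (auto simp: directions_def)
      qed
      obtain V rep where V: "finite V" "\<And>x. x \<in> V \<Longrightarrow> norm x = 1" "card V \<le> covering_number d (directions L)"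
        and rep: "\<And>l. l \<in> L \<Longrightarrow> rep l \<in> V" "\<And>l. l \<in> L \<Longrightarrow> norm (v l - rep l) \<le> 2 * d"
        by (rule unit_representatives[OF dir d(1) vd]) blast+
      have VN: "real (card V) \<le> Nc" using V(3) by (simp add: Nc_def)
      have N1: "1 \<le> Nc"
      proof -
        have "V \<noteq> {}" using False rep(1) by auto
        then have "1 \<le> card V" using V(1) by (simp add: Suc_leI card_gt_0_iff)
        then show ?thesis using VN by linarith
      qed
      define B where "B = d powr (- e)"
      have pw: "1 \<le> B ^ i * d ^ i'" if "real i' \<le> e * real i" for i i'
      proof -
        have "B ^ i * d ^ i' = d powr (- e * real i) * d powr real i'"
          unfolding B_def using d by (simp add: powr_power powr_realpow mult.commute)
        also have "\<dots> = d powr (real i' - e * real i)" by (simp flip: powr_add)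
        also have "\<dots> \<ge> d powr 0" using that d by (intro powr_mono') auto
        finally show ?thesis using d by simp
      qed
      have B: "1 \<le> B" using pw[of 0 1] e by simp
      have K1d: "exp (- B\<^sup>2 / 2) \<le> K1 * d ^ 6"
      proof -
        have "exp (- (B\<^sup>2 / 2)) \<le> (real k / (B\<^sup>2 / 2)) ^ k" using B kp by (intro exp_minus_le_power) auto
        also have "real k / (B\<^sup>2 / 2) = 2 * real k / B\<^sup>2" by simp
        also have "(2 * real k / B\<^sup>2) ^ k = K1 / B ^ (2 * k)" by (simp only: K1_def power_divide power_mult)
        also have "\<dots> \<le> K1 * d ^ 6"
        proof -
          have "6 \<le> e * real (2 * k)" using k e by simp
          then have "1 \<le> B ^ (2 * k) * d ^ 6" using pw[of 6 "2 * k"] by simp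
          from mult_left_mono[OF this, of K1] show ?thesis using B K1 by (simp add: pos_divide_le_eq mult_ac)
        qed
        finally show ?thesis by simp
      qed
      have m5: "1 \<le> B ^ (2 * m) * d ^ 5"
      proof -
        have "5 \<le> e * real (2 * m)" using m e by simp
        then show ?thesis using pw[of 5 "2 * m"] by simp
      qed
      have branching: "\<exists>b::nat. 0 < b \<and> \<rho> \<le> real b ^ J \<and> real b ^ J \<le> G * \<rho> \<and> real b \<le> 4 * B"
        if \<rho>: "1 \<le> \<rho>" "\<rho> * d \<le> 2 * B" for \<rho>
      proof -
        define r where "r = root J \<rho>"
        have r: "1 \<le> r" "r ^ J = \<rho>" 
        proof -
          show "1 \<le> r" using \<rho> by (simp add: r_def J_def)
          show "r ^ J = \<rho>" unfolding r_def using \<rho> by (intro real_root_pow_pos2) (auto simp: J_def)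
        qed
        define b where "b = nat \<lceil>r\<rceil>"
        have b: "r \<le> real b" "real b \<le> 2 * r" using r unfolding b_def by linarith+
        have "r \<le> 2 * B"
        proof (rule ccontr)
          assume "\<not> r \<le> 2 * B"
          then have "(2 * B) ^ J < r ^ J" using B by (intro power_strict_mono) (auto simp: J_def)
          then have "2 * B * (2 * B) ^ j < \<rho>" unfolding r(2) by (simp add: J_def)
          moreover have "2 * B * B ^ j \<le> 2 * B * (2 * B) ^ j" using B by (intro mult_left_mono power_mono) auto
          ultimately have "2 * B * B ^ j * d < \<rho> * d" using d by (intro mult_strict_right_mono) linarith+
          moreover have "2 * B * 1 \<le> 2 * B * (B ^ j * d)" using pw[of 1 j] j B by (intro mult_left_mono) auto
          ultimately show False using \<rho> by (simp add: mult.assoc)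
        qed
        then have "real b \<le> 4 * B" using b by linarith
        moreover have "\<rho> \<le> real b ^ J" unfolding r(2)[symmetric] using b r by (intro power_mono) auto
        moreover have "real b ^ J \<le> (2 * r) ^ J" using b by (intro power_mono) auto
        then have "real b ^ J \<le> G * \<rho>" by (simp add: power_mult_distrib r(2) G_def)
        moreover have "0 < b" using b r by (cases b) auto
        ultimately show ?thesis by blast
      qed
      have Bd: "1 \<le> B / d" using B d by (simp add: pos_le_divide_eq)
      have x1: "1 \<le> 20 * G * B / d" using mult_mono[of 1 "20 * G" 1 "B / d"] G1 Bd by simp
      obtain n where n: "(20 * G * B / d) ^ 3 < 2 ^ n" "real n \<le> 2 * ln ((20 * G * B / d) ^ 3) + 1"
        by (rule less_power_two[OF one_le_power[OF x1]])
      have nk: "real n \<le> \<kappa> * B"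
      proof -
        have lB: "ln B = - e * ln d" using d by (simp add: B_def ln_powr)
        have lB': "ln B \<le> B" using ln_le_minus_one[of B] B by linarith
        have "- ln d = ln B / e" using lB e by simp
        also have "\<dots> \<le> B / e" using lB' e by (intro divide_right_mono) auto
        finally have ld: "- ln d \<le> B / e" .
        have lG: "0 \<le> ln (20 * G)" using G1 by (intro ln_ge_zero) simp
        have "ln ((20 * G * B / d) ^ 3) = 3 * (ln (20 * G) + ln B - ln d)"
          using G1 B d by (simp add: ln_realpow ln_div ln_mult)
        then have n2: "real n \<le> 2 * (3 * (ln (20 * G) + ln B - ln d)) + 1" using n(2) by (simp only:)
        have "ln (20 * G) + ln B - ln d \<le> ln (20 * G) + B + B / e"
          using add_mono[OF add_mono[OF order_refl[of "ln (20 * G)"] lB'] ld] by simp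
        then have "2 * (3 * (ln (20 * G) + ln B - ln d)) + 1 \<le> 2 * (3 * (ln (20 * G) + B + B / e)) + 1"
          by (intro add_right_mono mult_left_mono) auto
        with n2 have "real n \<le> 2 * (3 * (ln (20 * G) + B + B / e)) + 1" by (rule order_trans)
        then have "real n \<le> 6 * (ln (20 * G) + B + B / e) + 1" by simp
        also have "\<dots> \<le> 6 * (ln (20 * G) * B + B + B / e) + B"
          using mult_left_mono[OF B lG] B by simp
        also have "\<dots> = \<kappa> * B" by (simp add: \<kappa>_def algebra_simps)
        finally show ?thesis .
      qed
      \<comment> \<open>A supremum of reals is an upper bound only for a set bounded above; here
        \<open>M_lines\<close> is at most the number of lines and u is below 1.\<close>
      have F_le: "F u \<le> S" if u: "u \<in> {d<..<1}" for u
        unfolding S_def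
      proof (rule cSUP_upper[OF u])
        show "bdd_above (F ` {d<..<1})"
        proof (rule bdd_aboveI2)
          fix u assume u: "u \<in> {d<..<1}"
          have "real (M_lines L d (d / u)) / real (card L) \<le> 1"
            using M_lines_le[OF L(1)] c by (simp add: c_def divide_le_eq)
          then have "F u \<le> (sqrt Nc * d) * 1 * 1"
            unfolding F_def using u d N1 by (intro mult_mono mult_nonneg_nonneg) auto
          then show "F u \<le> sqrt Nc * d" by simp
        qed
      qed
      define T where "T = c * S"
      have T: "min (sqrt Nc * d) u * u * real (M_lines L d (d / u)) \<le> T" if "d < u" "u < 1" for u
      proof -
        have "min (sqrt Nc * d) u * u * real (M_lines L d (d / u)) = c * F u" using c by (simp add: F_def c_def)
        also have "\<dots> \<le> T" unfolding T_def using that c by (intro mult_left_mono F_le) auto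
        finally show ?thesis .
      qed
      define \<epsilon>0 where "\<epsilon>0 = Cm / B ^ m"
      have tail: "cmod (line_fourier \<beta> (a l) (v l) \<xi>) \<le> \<epsilon>0" if "l \<in> L" "B \<le> \<bar>\<xi> \<bullet> v l\<bar>" for l \<xi>
      proof -
        let ?I = "cmod (LINT t|lborel. complex_of_real (\<beta> t) * cis ((\<xi> \<bullet> v l) * t))"
        have "?I * B ^ m \<le> ?I * \<bar>\<xi> \<bullet> v l\<bar> ^ m" using that B by (intro mult_left_mono power_mono) auto
        also have "\<dots> \<le> Cm" by (rule Cm(2))
        finally show ?thesis unfolding line_fourier_cmod \<epsilon>0_def using B by (subst pos_le_divide_eq) auto
      qed
      have e02: "\<epsilon>0\<^sup>2 \<le> Cm\<^sup>2 * d ^ 5"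
      proof -
        have "\<epsilon>0\<^sup>2 = Cm\<^sup>2 / B ^ (2 * m)" by (simp only: \<epsilon>0_def power_divide power_even_eq)
        also have "\<dots> \<le> Cm\<^sup>2 * d ^ 5"
          using mult_left_mono[OF m5, of "Cm\<^sup>2"] B by (simp add: pos_divide_le_eq mult_ac)
        finally show ?thesis .
      qed
      have J0: "0 < J" and GJ: "2 ^ J \<le> G" by (simp_all add: J_def G_def)
      interpret E: line_energy chi \<beta> L a v rep V d B G T \<epsilon>0 K1 "Cm\<^sup>2" Nc Cp J m n g
        by unfold_locales
          (fact \<beta>m \<beta> L(1) ln v a V(1,2) VN N1 rep d B J0 GJ branching T tail e02 K1d K1 n(1) Cp(1) Cp(2,3)[OF d(1)] m5 g)+
      have A3: "E.A3 = A" unfolding E.A3_def E.A1_def E.A2_def E.c5_def A_def c5_def by simp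
      obtain H where H: "integrable lborel H" "\<And>\<xi>. (cmod (phihat d \<xi> * E.Y \<xi>))\<^sup>2 \<le> H \<xi>"
        "integral\<^sup>L lborel H \<le> A * (real n)\<^sup>2 * B ^ 16 * E.R"
        using E.majorant unfolding A3 by blast
      have P2: "norm p \<le> 2" if "p \<in> P" for p
        using norm_le_coords[of p 1] P(2) that by (force simp: abs_le_iff)
      have gap: "\<bar>normalized_incidences chi d P L - normalized_incidences chi (2 * d) P L\<bar>\<^sup>2
        \<le> 5832 * unit_ball_vol 3 / d ^ 3 * (real (M_points P d) / real (card P)) * (integral\<^sup>L lborel H / c\<^sup>2)"
        unfolding c_def by (rule incidence_gap[OF P(1) P2 L(1) ln v a d \<beta>m \<beta> H(1) H(2)[unfolded E.Y_def]])
      have S0: "0 \<le> S" using E.T_nonneg c by (simp add: T_def zero_le_mult_iff)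
      have "A * (real n)\<^sup>2 * B ^ 16 * E.R \<le> A * (\<kappa> * B)\<^sup>2 * B ^ 16 * E.R"
        using nk A0 B E.R_nonneg by (intro mult_right_mono mult_left_mono power_mono) auto
      also have "\<dots> = A * \<kappa>\<^sup>2 * B ^ 18 * (c * T / d ^ 3)" by (simp add: E.R_def c_def power_mult_distrib eval_nat_numeral mult_ac)
      also have "B ^ 18 = d powr (- \<epsilon>)" unfolding B_def e_def using d by (simp add: powr_power)
      finally have "integral\<^sup>L lborel H / c\<^sup>2 \<le> A * \<kappa>\<^sup>2 * d powr (- \<epsilon>) * (c * T / d ^ 3) / c\<^sup>2"
        using H(3) by (intro divide_right_mono) auto
      also have "\<dots> = A * \<kappa>\<^sup>2 * d powr (- \<epsilon>) * (S / d ^ 3)" using c by (simp add: T_def power2_eq_square)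
      finally have "5832 * unit_ball_vol 3 / d ^ 3 * (real (M_points P d) / real (card P)) * (integral\<^sup>L lborel H / c\<^sup>2)
        \<le> 5832 * unit_ball_vol 3 / d ^ 3 * (real (M_points P d) / real (card P)) * (A * \<kappa>\<^sup>2 * d powr (- \<epsilon>) * (S / d ^ 3))"
        using d by (intro mult_left_mono) auto
      also have "\<dots> = 5832 * unit_ball_vol 3 * (A * \<kappa>\<^sup>2) * (d powr (- \<epsilon>) / d ^ 6) * (real (M_points P d) / real (card P)) * S"
        by (simp add: eval_nat_numeral mult_ac)
      also have "d powr (- \<epsilon>) / d ^ 6 = d powr (- 6 - \<epsilon>)"
      proof -
        have "d powr (- 6 - \<epsilon>) = d powr (- \<epsilon> - real 6)" by (rule arg_cong[where f = "(powr) d"]) simp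
        also have "\<dots> = d powr (- \<epsilon>) / d powr real 6" by (rule powr_diff)
        also have "d powr real 6 = d ^ 6" using d by (rule_tac powr_realpow) simp
        finally show ?thesis by simp
      qed
      finally show ?thesis using gap by linarith
    qed
    show "\<bar>normalized_incidences chi d P L - normalized_incidences chi (2 * d) P L\<bar>\<^sup>2
      \<le> 5832 * unit_ball_vol 3 * (A * \<kappa>\<^sup>2) * d powr (- 6 - \<epsilon>) * (real (M_points P d) / real (card P)) *
       (SUP u\<in>{d<..<1}. min (sqrt (real (covering_number d (directions L))) * d) u * u *
          (real (M_lines L d (d / u)) / real (card L)))"
      using goal unfolding S_def F_def Nc_def .
  qed
qed

end

theorem theorem4p3:
  fixes chi :: "real^3 \<Rightarrow> real" and \<epsilon> :: real
  assumes "bump chi" and "\<epsilon> > 0"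
  shows "\<exists>C::real. \<forall>(P :: (real^3) set) (L :: (real^3) set set) (\<delta>::real).
    finite P \<longrightarrow> P \<subseteq> {x. \<forall>i. - 1 \<le> x $ i \<and> x $ i \<le> 1} \<longrightarrow>
    finite L \<longrightarrow> L \<subseteq> lines_meeting_unit_ball \<longrightarrow>
    0 < \<delta> \<longrightarrow> \<delta> < 1 \<longrightarrow>
    \<bar>normalized_incidences chi \<delta> P L - normalized_incidences chi (2 * \<delta>) P L\<bar>\<^sup>2
    \<le> C * \<delta> powr (- 6 - \<epsilon>) * (real (M_points P \<delta>) / real (card P)) *
       (SUP u\<in>{\<delta><..<1}.
          min (sqrt (real (covering_number \<delta> (directions L))) * \<delta>) u * u *
          (real (M_lines L \<delta> (\<delta> / u)) / real (card L)))"
proof -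
  interpret bump_function chi by unfold_locales (rule assms(1))
  show ?thesis by (rule incidence_gap_bound[OF assms(2)])
qed

end
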